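(* Let $N\in\{1,2,3\}$, let $\Omega\subset\mathbb{R}^N$ be a bounded domain, let $\lambda_1,\lambda_2,\mu_1,\mu_2$ be positive constants and let $\beta\in\mathbb{R}$ satisfy $\beta>-\sqrt{\mu_1\mu_2}$. There exists a positive constant $\Lambda=\Lambda(\lambda_1,\lambda_2,\mu_1,\mu_2,\beta,S_4)$, depending only on the listed quantities, such that for all $f,g\in L^{4/3}(\Omega)$, both nonzero, with $\max\{\|f\|_{4/3},\|g\|_{4/3}\}<\Lambda$, the system $$\begin{cases}-\Delta u+\lambda_1u=\mu_1u^3+\beta uv^2+f(x), & x\in\Omega,\\ -\Delta v+\lambda_2v=\mu_2v^3+\beta u^2v+g(x), & x\in\Omega,\\ u=v=0, & x\in\partial\Omega,\end{cases}$$ has two (distinct) nontrivial solutions. Furthermore, if in addition $f$ and $g$ are both positive, then the system has one positive ground state solution and one positive bound state solution, and these two solutions are distinct.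
   Context: $\|\cdot\|_p$ is the norm of $L^p(\Omega)$. $S_4$ is the best Sobolev constant of the embedding $H_0^1(\Omega)\hookrightarrow L^4(\Omega)$, i.e. the smallest constant with $\|u\|_4\le S_4\left(\int_\Omega|\nabla u|^2\right)^{1/2}$ for all $u\in H_0^1(\Omega)$. Let $H=H_0^1(\Omega)\times H_0^1(\Omega)$ with norm $\|(u,v)\|=\left(\int_\Omega(|\nabla u|^2+\lambda_1u^2)+\int_\Omega(|\nabla v|^2+\lambda_2v^2)\right)^{1/2}$. A (weak) solution of the system is $(u,v)\in H$ such that for all $(\varphi,\psi)\in H$, $$\int_\Omega\big(\nabla u\nabla\varphi+\nabla v\nabla\psi+\lambda_1u\varphi+\lambda_2v\psi-\mu_1u^3\varphi-\mu_2v^3\psi-\beta uv^2\varphi-\beta u^2v\psi-f\varphi-g\psi\big)dx=0;$$ equivalently, a critical point of the $C^1$ energy functional $J:H\to\mathbb{R}$, $$J(u,v)=\frac12\|(u,v)\|^2-\frac14\Big(\mu_1\|u\|_4^4+\mu_2\|v\|_4^4+2\beta\int_\Omega u^2v^2\Big)-\int_\Omega(fu+gv).$$ A solution $(u,v)$ is nontrivial if both components are nonzero. A function is called positive if it is nonnegative (a.e.) and nonzero. A positive ground state solution is a solution which has the least energy $J$ among all nonzero solutions and whose two components are both positive. A bound state solution is a solution of finite energy; it is positive if both of its components are positive. *)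

theory Defs
  imports "HOL-Analysis.Analysis"
begin

(* Functions on Omega are represented by total functions on the ambient space; only their values
   on Omega matter, and elements of function spaces are identified up to equality a.e. on Omega. *)

definition Lp :: "real \<Rightarrow> 'a::euclidean_space set \<Rightarrow> ('a \<Rightarrow> 'b::euclidean_space) set" where
  "Lp p \<Omega> = {u \<in> borel_measurable (lebesgue_on \<Omega>).
     integrable (lebesgue_on \<Omega>) (\<lambda>x. norm (u x) powr p)}"

definition Lp_norm :: "real \<Rightarrow> 'a::euclidean_space set \<Rightarrow> ('a \<Rightarrow> 'b::euclidean_space) \<Rightarrow> real" where
  "Lp_norm p \<Omega> u = (LINT x|lebesgue_on \<Omega>. norm (u x) powr p) powr (1 / p)"

definition nonzero_on :: "'a::euclidean_space set \<Rightarrow> ('a \<Rightarrow> real) \<Rightarrow> bool" where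
  "nonzero_on \<Omega> u \<longleftrightarrow> \<not> (AE x in lebesgue_on \<Omega>. u x = 0)"

definition positive_on :: "'a::euclidean_space set \<Rightarrow> ('a \<Rightarrow> real) \<Rightarrow> bool" where
  "positive_on \<Omega> u \<longleftrightarrow> (AE x in lebesgue_on \<Omega>. 0 \<le> u x) \<and> nonzero_on \<Omega> u"

definition domain_set :: "'a::euclidean_space set \<Rightarrow> bool" where
  "domain_set \<Omega> \<longleftrightarrow> open \<Omega> \<and> connected \<Omega> \<and> \<Omega> \<noteq> {}"

primrec Ck :: "nat \<Rightarrow> ('a::euclidean_space \<Rightarrow> real) \<Rightarrow> bool" where
  "Ck 0 f \<longleftrightarrow> continuous_on UNIV f"
| "Ck (Suc k) f \<longleftrightarrow> (\<forall>x. f differentiable (at x)) \<and>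
     (\<forall>b\<in>Basis. Ck k (\<lambda>x. frechet_derivative f (at x) b))"

definition test_functions :: "'a::euclidean_space set \<Rightarrow> ('a \<Rightarrow> real) set" where
  "test_functions \<Omega> = {\<phi>. (\<forall>k. Ck k \<phi>) \<and>
     compact (closure {x. \<phi> x \<noteq> 0}) \<and> closure {x. \<phi> x \<noteq> 0} \<subseteq> \<Omega>}"

definition L1_loc :: "'a::euclidean_space set \<Rightarrow> ('a \<Rightarrow> 'b::euclidean_space) set" where
  "L1_loc \<Omega> = {u. \<forall>K. compact K \<and> K \<subseteq> \<Omega> \<longrightarrow> integrable (lebesgue_on K) u}"

definition is_weak_grad ::
  "'a::euclidean_space set \<Rightarrow> ('a \<Rightarrow> real) \<Rightarrow> ('a \<Rightarrow> 'a) \<Rightarrow> bool" where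
  "is_weak_grad \<Omega> u w \<longleftrightarrow> u \<in> L1_loc \<Omega> \<and> w \<in> L1_loc \<Omega> \<and>
     (\<forall>\<phi>\<in>test_functions \<Omega>. \<forall>b\<in>Basis.
        (LINT x|lebesgue_on \<Omega>. u x * frechet_derivative \<phi> (at x) b)
        = - (LINT x|lebesgue_on \<Omega>. (w x \<bullet> b) * \<phi> x))"

(* A weak gradient is unique up to equality a.e. on Omega, so the choice does not affect integrals. *)
definition weak_grad :: "'a::euclidean_space set \<Rightarrow> ('a \<Rightarrow> real) \<Rightarrow> 'a \<Rightarrow> 'a" where
  "weak_grad \<Omega> u = (SOME w. is_weak_grad \<Omega> u w)"

definition H1 :: "'a::euclidean_space set \<Rightarrow> ('a \<Rightarrow> real) set" where
  "H1 \<Omega> = {u \<in> Lp 2 \<Omega>. \<exists>w\<in>Lp 2 \<Omega>. is_weak_grad \<Omega> u w}"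

definition H1_norm :: "'a::euclidean_space set \<Rightarrow> ('a \<Rightarrow> real) \<Rightarrow> real" where
  "H1_norm \<Omega> u = sqrt ((LINT x|lebesgue_on \<Omega>. (u x)\<^sup>2)
     + (LINT x|lebesgue_on \<Omega>. (norm (weak_grad \<Omega> u x))\<^sup>2))"

definition H10 :: "'a::euclidean_space set \<Rightarrow> ('a \<Rightarrow> real) set" where
  "H10 \<Omega> = {u \<in> H1 \<Omega>. \<forall>\<epsilon>>0. \<exists>\<phi>\<in>test_functions \<Omega>. H1_norm \<Omega> (\<lambda>x. u x - \<phi> x) < \<epsilon>}"

(* Membership in L^4 is required explicitly because Lp_norm is 0 when the integral diverges. *)
definition S4 :: "'a::euclidean_space set \<Rightarrow> real" where
  "S4 \<Omega> = (LEAST C. \<forall>u\<in>H10 \<Omega>. u \<in> Lp 4 \<Omega> \<and>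
     Lp_norm 4 \<Omega> u \<le> C * sqrt (LINT x|lebesgue_on \<Omega>. (norm (weak_grad \<Omega> u x))\<^sup>2))"

definition H_norm :: "'a::euclidean_space set \<Rightarrow> real \<Rightarrow> real \<Rightarrow> ('a \<Rightarrow> real) \<Rightarrow> ('a \<Rightarrow> real) \<Rightarrow> real"
  where
  "H_norm \<Omega> lam1 lam2 u v = sqrt (
     (LINT x|lebesgue_on \<Omega>. (norm (weak_grad \<Omega> u x))\<^sup>2 + lam1 * (u x)\<^sup>2) +
     (LINT x|lebesgue_on \<Omega>. (norm (weak_grad \<Omega> v x))\<^sup>2 + lam2 * (v x)\<^sup>2))"

definition energy ::
  "'a::euclidean_space set \<Rightarrow> real \<Rightarrow> real \<Rightarrow> real \<Rightarrow> real \<Rightarrow> real \<Rightarrow> ('a \<Rightarrow> real) \<Rightarrow> ('a \<Rightarrow> real)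
   \<Rightarrow> ('a \<Rightarrow> real) \<Rightarrow> ('a \<Rightarrow> real) \<Rightarrow> real" where
  "energy \<Omega> lam1 lam2 \<mu>1 \<mu>2 \<beta> f g u v =
     1/2 * (H_norm \<Omega> lam1 lam2 u v)\<^sup>2
     - 1/4 * (\<mu>1 * Lp_norm 4 \<Omega> u ^ 4 + \<mu>2 * Lp_norm 4 \<Omega> v ^ 4
              + 2 * \<beta> * (LINT x|lebesgue_on \<Omega>. (u x)\<^sup>2 * (v x)\<^sup>2))
     - (LINT x|lebesgue_on \<Omega>. f x * u x + g x * v x)"

(* The Bochner integral of a non-integrable function is 0, so finiteness of the energy is expressed
   by requiring that every integral occurring in it converges. *)
definition finite_energy ::
  "'a::euclidean_space set \<Rightarrow> ('a \<Rightarrow> real) \<Rightarrow> ('a \<Rightarrow> real)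
   \<Rightarrow> ('a \<Rightarrow> real) \<Rightarrow> ('a \<Rightarrow> real) \<Rightarrow> bool" where
  "finite_energy \<Omega> f g u v \<longleftrightarrow>
     u \<in> Lp 2 \<Omega> \<and> v \<in> Lp 2 \<Omega> \<and> weak_grad \<Omega> u \<in> Lp 2 \<Omega> \<and> weak_grad \<Omega> v \<in> Lp 2 \<Omega> \<and>
     u \<in> Lp 4 \<Omega> \<and> v \<in> Lp 4 \<Omega> \<and>
     integrable (lebesgue_on \<Omega>) (\<lambda>x. (u x)\<^sup>2 * (v x)\<^sup>2) \<and>
     integrable (lebesgue_on \<Omega>) (\<lambda>x. f x * u x + g x * v x)"

definition weak_solution ::
  "'a::euclidean_space set \<Rightarrow> real \<Rightarrow> real \<Rightarrow> real \<Rightarrow> real \<Rightarrow> real \<Rightarrow> ('a \<Rightarrow> real) \<Rightarrow> ('a \<Rightarrow> real)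
   \<Rightarrow> ('a \<Rightarrow> real) \<Rightarrow> ('a \<Rightarrow> real) \<Rightarrow> bool" where
  "weak_solution \<Omega> lam1 lam2 \<mu>1 \<mu>2 \<beta> f g u v \<longleftrightarrow>
     u \<in> H10 \<Omega> \<and> v \<in> H10 \<Omega> \<and>
     (\<forall>\<phi>\<in>H10 \<Omega>. \<forall>\<psi>\<in>H10 \<Omega>.
        (LINT x|lebesgue_on \<Omega>.
           weak_grad \<Omega> u x \<bullet> weak_grad \<Omega> \<phi> x + weak_grad \<Omega> v x \<bullet> weak_grad \<Omega> \<psi> x
           + lam1 * u x * \<phi> x + lam2 * v x * \<psi> x
           - \<mu>1 * u x ^ 3 * \<phi> x - \<mu>2 * v x ^ 3 * \<psi> x
           - \<beta> * u x * (v x)\<^sup>2 * \<phi> x - \<beta> * (u x)\<^sup>2 * v x * \<psi> x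
           - f x * \<phi> x - g x * \<psi> x) = 0)"

definition nontrivial_solution ::
  "'a::euclidean_space set \<Rightarrow> real \<Rightarrow> real \<Rightarrow> real \<Rightarrow> real \<Rightarrow> real \<Rightarrow> ('a \<Rightarrow> real) \<Rightarrow> ('a \<Rightarrow> real)
   \<Rightarrow> ('a \<Rightarrow> real) \<Rightarrow> ('a \<Rightarrow> real) \<Rightarrow> bool" where
  "nontrivial_solution \<Omega> lam1 lam2 \<mu>1 \<mu>2 \<beta> f g u v \<longleftrightarrow>
     weak_solution \<Omega> lam1 lam2 \<mu>1 \<mu>2 \<beta> f g u v \<and> nonzero_on \<Omega> u \<and> nonzero_on \<Omega> v"

definition positive_ground_state ::
  "'a::euclidean_space set \<Rightarrow> real \<Rightarrow> real \<Rightarrow> real \<Rightarrow> real \<Rightarrow> real \<Rightarrow> ('a \<Rightarrow> real) \<Rightarrow> ('a \<Rightarrow> real)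
   \<Rightarrow> ('a \<Rightarrow> real) \<Rightarrow> ('a \<Rightarrow> real) \<Rightarrow> bool" where
  "positive_ground_state \<Omega> lam1 lam2 \<mu>1 \<mu>2 \<beta> f g u v \<longleftrightarrow>
     weak_solution \<Omega> lam1 lam2 \<mu>1 \<mu>2 \<beta> f g u v \<and>
     (\<forall>u' v'. weak_solution \<Omega> lam1 lam2 \<mu>1 \<mu>2 \<beta> f g u' v' \<and> (nonzero_on \<Omega> u' \<or> nonzero_on \<Omega> v')
        \<longrightarrow> energy \<Omega> lam1 lam2 \<mu>1 \<mu>2 \<beta> f g u v \<le> energy \<Omega> lam1 lam2 \<mu>1 \<mu>2 \<beta> f g u' v') \<and>
     positive_on \<Omega> u \<and> positive_on \<Omega> v"

definition positive_bound_state ::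
  "'a::euclidean_space set \<Rightarrow> real \<Rightarrow> real \<Rightarrow> real \<Rightarrow> real \<Rightarrow> real \<Rightarrow> ('a \<Rightarrow> real) \<Rightarrow> ('a \<Rightarrow> real)
   \<Rightarrow> ('a \<Rightarrow> real) \<Rightarrow> ('a \<Rightarrow> real) \<Rightarrow> bool" where
  "positive_bound_state \<Omega> lam1 lam2 \<mu>1 \<mu>2 \<beta> f g u v \<longleftrightarrow>
     weak_solution \<Omega> lam1 lam2 \<mu>1 \<mu>2 \<beta> f g u v \<and> finite_energy \<Omega> f g u v \<and>
     positive_on \<Omega> u \<and> positive_on \<Omega> v"

definition distinct_pairs ::
  "'a::euclidean_space set \<Rightarrow> ('a \<Rightarrow> real) \<Rightarrow> ('a \<Rightarrow> real) \<Rightarrow> ('a \<Rightarrow> real) \<Rightarrow> ('a \<Rightarrow> real) \<Rightarrow> bool"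
  where
  "distinct_pairs \<Omega> u\<^sub>1 v\<^sub>1 u\<^sub>2 v\<^sub>2 \<longleftrightarrow>
     \<not> (AE x in lebesgue_on \<Omega>. u\<^sub>1 x = u\<^sub>2 x \<and> v\<^sub>1 x = v\<^sub>2 x)"

(* The existence claim for all data (f, g) below the threshold L. It is named, and polymorphic in the
   ambient space, because a threshold independent of the dimension has to be quantified before
   the dimension, and the dimension is a type. *)
definition solvable_below ::
  "real \<Rightarrow> 'a::euclidean_space set \<Rightarrow> real \<Rightarrow> real \<Rightarrow> real \<Rightarrow> real \<Rightarrow> real \<Rightarrow> bool" where
  "solvable_below L \<Omega> lam1 lam2 \<mu>1 \<mu>2 \<beta> \<longleftrightarrow>
     (\<forall>f\<in>Lp (4/3) \<Omega>. \<forall>g\<in>Lp (4/3) \<Omega>.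
        nonzero_on \<Omega> f \<and> nonzero_on \<Omega> g \<and>
        max (Lp_norm (4/3) \<Omega> f) (Lp_norm (4/3) \<Omega> g) < L \<longrightarrow>
        (\<exists>u\<^sub>1 v\<^sub>1 u\<^sub>2 v\<^sub>2.
           nontrivial_solution \<Omega> lam1 lam2 \<mu>1 \<mu>2 \<beta> f g u\<^sub>1 v\<^sub>1 \<and>
           nontrivial_solution \<Omega> lam1 lam2 \<mu>1 \<mu>2 \<beta> f g u\<^sub>2 v\<^sub>2 \<and>
           distinct_pairs \<Omega> u\<^sub>1 v\<^sub>1 u\<^sub>2 v\<^sub>2) \<and>
        (positive_on \<Omega> f \<and> positive_on \<Omega> g \<longrightarrow>
          (\<exists>u\<^sub>1 v\<^sub>1 u\<^sub>2 v\<^sub>2.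
             positive_ground_state \<Omega> lam1 lam2 \<mu>1 \<mu>2 \<beta> f g u\<^sub>1 v\<^sub>1 \<and>
             positive_bound_state \<Omega> lam1 lam2 \<mu>1 \<mu>2 \<beta> f g u\<^sub>2 v\<^sub>2 \<and>
             distinct_pairs \<Omega> u\<^sub>1 v\<^sub>1 u\<^sub>2 v\<^sub>2)))"

end

theory Submission
  imports Defs "HOL-Computational_Algebra.Polynomial" "HOL-Complex_Analysis.Great_Picard"
begin

text \<open>Write the energy as \<open>J(w) = B(w, w)/2 - Q(w)/4 - F(w)\<close> with \<open>B\<close> the inner product of \<open>H\<close>, \<open>Q \<ge> 0\<close>
  the quartic form (nonnegative because \<open>\<beta> > -sqrt (\<mu>1 \<mu>2)\<close>) and \<open>F\<close> the linear term. Let \<open>\<rho>\<close> be such that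
  \<open>Q(w) \<le> B(w, w)\<^sup>2 / (3 \<rho>\<^sup>2)\<close>; the threshold makes \<open>|F(w)| \<le> \<rho>/8 sqrt (B(w, w))\<close>. The first solution
  minimises \<open>J\<close> over the ball of radius \<open>\<rho>\<close>, on whose boundary \<open>J\<close> is too large for a minimum. The second one
  minimises \<open>E = B/4 - 3/4 F\<close>, which is \<open>J\<close> on the Nehari set \<open>B = Q + F\<close>, over the weakly closed set
  \<open>B \<le> Q + F, Q \<ge> \<rho>\<^sup>2 / 2\<close>, which lies outside that ball. Shrinking a critical point
  that lies outside the ball to the sphere of radius \<open>\<rho>\<close> decreases \<open>J\<close>, so the first solution is a ground state. If \<open>f, g\<close> are positive, passing to absolute values
  preserves both minimising properties. Neither component of a solution vanishes since \<open>f\<close> and \<open>g\<close> do not.\<close>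

subsection \<open>Two critical points of an abstract quartic functional\<close>

text \<open>Two obstacles shape the argument: elements of \<open>H\<close> are functions without a
  quotient, so weak limits are not at hand, and the Nehari set is neither convex nor weakly closed.
  Midpoints deal with both. The parallelogram identity makes \<open>B\<close> drop at a midpoint by
  a quarter of its value on the difference, while \<open>Q_compact\<close> makes the change of
  \<open>Q\<close> negligible along a subsequence; two late terms of a minimising sequence that
  stayed apart would thus have too good a midpoint. Relaxing \<open>B = Q + F\<close> to
  \<open>B \<le> Q + F\<close> lets such midpoints stay in the set. The relaxation is undone through
  the identity \<open>J = E + (B - Q - F) / 4\<close>. The factor 3 in \<open>Q_bd\<close> makes
  \<open>Q\<close> at most \<open>\<rho>\<^sup>2 / 3\<close> on the ball, below the bound
  \<open>\<rho>\<^sup>2 / 2\<close> of the second problem. The factor 8 in \<open>F_bd\<close> makes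
  the linear term at most \<open>B / 8\<close> outside the ball, so there
  \<open>B \<le> Q + F\<close> forces \<open>Q \<ge> 7/8 B\<close>. The lower bound on
  \<open>Q\<close> is therefore strict and contributes no multiplier. The analytic half of the proof
  supplies \<open>Q_compact\<close>, which is where dimension at most 3 enters.\<close>

text \<open>Elements of \<open>H\<close> are function pairs, not equivalence classes, so the vector space axioms are replaced by
  the behaviour of \<open>lin a w b z\<close>, read as \<open>a w + b z\<close>, under the forms.\<close>

locale quartic_problem =
  fixes H :: "'v set" and lin :: "real \<Rightarrow> 'v \<Rightarrow> real \<Rightarrow> 'v \<Rightarrow> 'v"
    and B :: "'v \<Rightarrow> 'v \<Rightarrow> real" and Q F :: "'v \<Rightarrow> real" and DQ :: "'v \<Rightarrow> 'v \<Rightarrow> real" and \<rho> :: real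
  assumes H_pos: "\<exists>w\<in>H. 0 < Q w"
    and lin_H: "w \<in> H \<Longrightarrow> z \<in> H \<Longrightarrow> lin a w b z \<in> H"
    and lin_comm: "lin a w b z = lin b z a w"
    and B_sym: "w \<in> H \<Longrightarrow> z \<in> H \<Longrightarrow> B w z = B z w"
    and B_lin: "w \<in> H \<Longrightarrow> z \<in> H \<Longrightarrow> y \<in> H \<Longrightarrow> B (lin a w b z) y = a * B w y + b * B z y"
    and B_nonneg: "w \<in> H \<Longrightarrow> 0 \<le> B w w"
    and F_lin: "w \<in> H \<Longrightarrow> z \<in> H \<Longrightarrow> F (lin a w b z) = a * F w + b * F z"
    and rho_pos: "0 < \<rho>"
    and F_bd: "w \<in> H \<Longrightarrow> \<bar>F w\<bar> \<le> \<rho> / 8 * sqrt (B w w)"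
    and Q_nonneg: "w \<in> H \<Longrightarrow> 0 \<le> Q w"
    and Q_bd: "w \<in> H \<Longrightarrow> Q w \<le> (B w w)\<^sup>2 / (3 * \<rho>\<^sup>2)"
    and Q_scale: "w \<in> H \<Longrightarrow> Q (lin s w 0 w) = s ^ 4 * Q w"
    and DQ_self: "w \<in> H \<Longrightarrow> DQ w w = 4 * Q w"
    and DQ_lin: "w \<in> H \<Longrightarrow> \<phi> \<in> H \<Longrightarrow> \<psi> \<in> H \<Longrightarrow> DQ w (lin a \<phi> b \<psi>) = a * DQ w \<phi> + b * DQ w \<psi>"
    and Q_exp: "w \<in> H \<Longrightarrow> \<phi> \<in> H \<Longrightarrow>
       \<exists>K. \<forall>s. \<bar>s\<bar> \<le> 1 \<longrightarrow> \<bar>Q (lin 1 w s \<phi>) - Q w - s * DQ w \<phi>\<bar> \<le> K * s\<^sup>2"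
    and Q_compact: "(\<And>n. x n \<in> H) \<Longrightarrow> (\<And>n. B (x n) (x n) \<le> M) \<Longrightarrow>
       \<exists>r::nat\<Rightarrow>nat. strict_mono r \<and> (\<forall>e>0. \<exists>N. \<forall>n\<ge>N. \<forall>m\<ge>N.
          \<bar>Q (lin (1/2) (x (r n)) (1/2) (x (r m))) - Q (x (r n))\<bar> < e)"
    and Q_cont: "(\<And>n. x n \<in> H) \<Longrightarrow> w \<in> H \<Longrightarrow>
       (\<lambda>n. B (lin 1 (x n) (-1) w) (lin 1 (x n) (-1) w)) \<longlonglongrightarrow> 0 \<Longrightarrow> (\<lambda>n. Q (x n)) \<longlonglongrightarrow> Q w"
    and complete: "(\<And>n. x n \<in> H) \<Longrightarrow>
       \<forall>e>0. \<exists>N. \<forall>n\<ge>N. \<forall>m\<ge>N. B (lin 1 (x n) (-1) (x m)) (lin 1 (x n) (-1) (x m)) < e \<Longrightarrow>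
       \<exists>w\<in>H. (\<lambda>n. B (lin 1 (x n) (-1) w) (lin 1 (x n) (-1) w)) \<longlonglongrightarrow> 0"
begin

definition "J w = B w w / 2 - Q w / 4 - F w"

definition "E w = B w w / 4 - 3/4 * F w"

definition "ball0 = {w \<in> H. B w w \<le> \<rho>\<^sup>2}"

text \<open>Zero satisfies the first inequality; the lower bound on \<open>Q\<close> removes it
  together with the whole ball, on which \<open>Q_bd\<close> gives
  \<open>Q \<le> \<rho>\<^sup>2 / 3\<close>.\<close>

definition "A = {w \<in> H. B w w \<le> Q w + F w \<and> \<rho>\<^sup>2 / 2 \<le> Q w}"

definition "critical w \<longleftrightarrow> w \<in> H \<and> (\<forall>\<phi>\<in>H. B w \<phi> - DQ w \<phi> / 4 - F \<phi> = 0)"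

section \<open>Cauchy-Schwarz and convergence for the abstract form\<close>

lemma B_lin2:
  assumes "w \<in> H" "z \<in> H"
  shows "B (lin a w b z) (lin a w b z) = a\<^sup>2 * B w w + 2 * a * b * B w z + b\<^sup>2 * B z z"
proof -
  have "B (lin a w b z) (lin a w b z) = a * B (lin a w b z) w + b * B (lin a w b z) z"
    using assms lin_H B_lin B_sym by (metis (no_types, lifting))
  also have "\<dots> = a\<^sup>2 * B w w + 2 * a * b * B w z + b\<^sup>2 * B z z"
    using assms B_lin B_sym[of z w] by (simp add: power2_eq_square algebra_simps)
  finally show ?thesis .
qed

text \<open>The form is only semidefinite: in the application a pair that vanishes almost everywhere
  need not be the zero pair. The discriminant argument therefore splits on
  \<open>B z z = 0\<close>.\<close>

lemma B_CS:
  assumes "w \<in> H" "z \<in> H"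
  shows "\<bar>B w z\<bar> \<le> sqrt (B w w) * sqrt (B z z)"
proof -
  have *: "0 \<le> B w w - 2 * t * B w z + t\<^sup>2 * B z z" for t
    using B_nonneg[OF lin_H[OF assms, of 1 "-t"]] B_lin2[OF assms, of 1 "-t"] by simp
  have "(B w z)\<^sup>2 \<le> B w w * B z z"
  proof (cases "B z z = 0")
    case True
    have "B w z = 0"
    proof (rule ccontr)
      assume "B w z \<noteq> 0"
      then show False
        \<comment> \<open>With this value of \<open>t\<close> the nonnegative expression equals
          -1.\<close>
        using *[of "(B w w + 1) / (2 * B w z)"] True by simp
    qed
    then show ?thesis using True by simp
  next
    case False
    then have p: "0 < B z z" using B_nonneg[OF assms(2)] by simp
    have "0 \<le> B w w - (B w z)\<^sup>2 / B z z"
      \<comment> \<open>The minimiser of the quadratic in \<open>t\<close>.\<close>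
      using *[of "B w z / B z z"] p by (simp add: power2_eq_square field_simps)
    then show ?thesis using p by (simp add: field_simps)
  qed
  then show ?thesis
    using real_le_rsqrt[of "\<bar>B w z\<bar>" "B w w * B z z"] by (simp add: real_sqrt_mult)
qed

lemma conv_imp:
  assumes "\<And>n. x n \<in> H" "w \<in> H" "(\<lambda>n. B (lin 1 (x n) (-1) w) (lin 1 (x n) (-1) w)) \<longlonglongrightarrow> 0"
  shows "(\<lambda>n. B (x n) (x n)) \<longlonglongrightarrow> B w w" "(\<lambda>n. F (x n)) \<longlonglongrightarrow> F w"
proof -
  let ?d = "\<lambda>n. lin 1 (x n) (-1) w"
  have dH: "?d n \<in> H" for n using assms lin_H by blast
  have s: "(\<lambda>n. sqrt (B (?d n) (?d n))) \<longlonglongrightarrow> 0"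
    using tendsto_real_sqrt[OF assms(3)] by simp
  have 1: "(\<lambda>n. B (?d n) w) \<longlonglongrightarrow> 0"
  proof (rule Lim_null_comparison)
    show "\<forall>\<^sub>F n in sequentially. norm (B (?d n) w) \<le> sqrt (B (?d n) (?d n)) * sqrt (B w w)"
      using B_CS[OF dH assms(2)] by simp
    show "(\<lambda>n. sqrt (B (?d n) (?d n)) * sqrt (B w w)) \<longlonglongrightarrow> 0"
      using tendsto_mult_right[OF s, of "sqrt (B w w)"] by simp
  qed
  have "B (x n) (x n) = B (?d n) (?d n) + 2 * B (?d n) w + B w w" for n
    using B_lin2[OF assms(1,2), of 1 n "-1"] B_lin[OF assms(1,2,2), of 1 n "-1"] by simp
  then show "(\<lambda>n. B (x n) (x n)) \<longlonglongrightarrow> B w w"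
    using tendsto_add[OF tendsto_add[OF assms(3) tendsto_mult_left[OF 1, of 2]] tendsto_const[of "B w w"]] by simp
  have "(\<lambda>n. F (x n) - F w) \<longlonglongrightarrow> 0"
  proof (rule Lim_null_comparison)
    show "\<forall>\<^sub>F n in sequentially. norm (F (x n) - F w) \<le> \<rho> / 8 * sqrt (B (?d n) (?d n))"
      using F_bd[OF dH] F_lin[OF assms(1,2), of 1 _ "-1"] by simp
    show "(\<lambda>n. \<rho> / 8 * sqrt (B (?d n) (?d n))) \<longlonglongrightarrow> 0"
      using tendsto_mult_left[OF s, of "\<rho> / 8"] by simp
  qed
  then show "(\<lambda>n. F (x n)) \<longlonglongrightarrow> F w" by (simp add: LIM_zero_iff)
qed

text \<open>Convexity turns \<open>\<Phi>(w) + \<Phi>(z) - 2 \<Phi>((w + z)/2)\<close> into a bound on \<open>w - z\<close>, so minimising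
  sequences are Cauchy and no weak compactness is needed.\<close>

lemma minimiser_exists:
  fixes \<Phi> :: "'v \<Rightarrow> real"
  assumes SH: "S \<subseteq> H" and ne: "S \<noteq> {}"
    and below: "\<And>w. w \<in> S \<Longrightarrow> m \<le> \<Phi> w"
    and coercive: "\<And>K. \<exists>M. \<forall>w\<in>S. \<Phi> w \<le> K \<longrightarrow> B w w \<le> M"
    and mid: "\<And>\<epsilon>::real. \<epsilon> > 0 \<Longrightarrow> \<exists>\<eta>>0. \<forall>e. \<forall>w\<in>S. \<forall>z\<in>S. \<Phi> w < e + \<eta> \<longrightarrow> \<Phi> z < e + \<eta> \<longrightarrow>
        \<bar>Q (lin (1/2) w (1/2) z) - Q w\<bar> < \<eta> \<longrightarrow> \<bar>Q (lin (1/2) w (1/2) z) - Q z\<bar> < \<eta> \<longrightarrow>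
        \<epsilon> \<le> B (lin 1 w (-1) z) (lin 1 w (-1) z) \<longrightarrow>
        lin (1/2) w (1/2) z \<in> S \<and> \<Phi> (lin (1/2) w (1/2) z) < e"
    and closed: "\<And>x w. (\<And>n. x n \<in> S) \<Longrightarrow> w \<in> H \<Longrightarrow>
        (\<lambda>n. B (lin 1 (x n) (-1) w) (lin 1 (x n) (-1) w)) \<longlonglongrightarrow> 0 \<Longrightarrow> w \<in> S \<and> (\<lambda>n. \<Phi> (x n)) \<longlonglongrightarrow> \<Phi> w"
  shows "\<exists>w\<in>S. \<forall>z\<in>S. \<Phi> w \<le> \<Phi> z"
proof -
  define e where "e = Inf (\<Phi> ` S)"
  have bdd: "bdd_below (\<Phi> ` S)" using below by (auto intro!: bdd_belowI[of _ m])
  have e_le: "e \<le> \<Phi> w" if "w \<in> S" for w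
    unfolding e_def using that bdd by (auto intro: cInf_lower)
  have "\<exists>w\<in>S. \<Phi> w < e + 1 / Suc n" for n
  proof -
    have "Inf (\<Phi> ` S) < e + 1 / Suc n" by (simp add: e_def)
    then show ?thesis using ne cInf_lessD[of "\<Phi> ` S" "e + 1 / Suc n"] by auto
  qed
  then obtain x where x: "\<And>n. x n \<in> S" "\<And>n. \<Phi> (x n) < e + 1 / Suc n" by metis
  have "\<Phi> (x n) \<le> e + 1" for n
    using x(2)[of n] by (smt (verit) divide_le_eq_1_pos of_nat_0_less_iff of_nat_Suc of_nat_0_le_iff zero_less_Suc)
  moreover obtain M where "\<forall>w\<in>S. \<Phi> w \<le> e + 1 \<longrightarrow> B w w \<le> M" using coercive by blast
  ultimately have M: "B (x n) (x n) \<le> M" for n using x(1) by blast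
  have xH: "x n \<in> H" for n using x(1) SH by blast
  \<comment> \<open>Along this subsequence \<open>Q\<close> at the midpoint of two late terms is
    close to \<open>Q\<close> at one end; the other end is covered by exchanging the indices and
    \<open>lin_comm\<close>.\<close>
  obtain r :: "nat \<Rightarrow> nat" where r: "strict_mono r"
    "\<And>\<eta>. \<eta> > 0 \<Longrightarrow> \<exists>N. \<forall>n\<ge>N. \<forall>m\<ge>N. \<bar>Q (lin (1/2) (x (r n)) (1/2) (x (r m))) - Q (x (r n))\<bar> < \<eta>"
    using Q_compact[of x M, OF xH M] by meson
  have lim: "(\<lambda>n. e + 1 / Suc n) \<longlonglongrightarrow> e"
    using tendsto_add[OF tendsto_const LIMSEQ_Suc[OF lim_1_over_n]] by simp
  \<comment> \<open>If late terms stayed \<epsilon> apart, \<open>mid\<close> would yield an element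
    of \<open>S\<close> with value below the infimum \<open>e\<close>.\<close>
  have cauchy: "\<forall>\<epsilon>>0. \<exists>N. \<forall>n\<ge>N. \<forall>m\<ge>N.
      B (lin 1 (x (r n)) (-1) (x (r m))) (lin 1 (x (r n)) (-1) (x (r m))) < \<epsilon>"
  proof (intro allI impI)
    fix \<epsilon> :: real assume "\<epsilon> > 0"
    then obtain \<eta> where \<eta>: "\<eta> > 0" "\<And>e w z. w\<in>S \<Longrightarrow> z\<in>S \<Longrightarrow> \<Phi> w < e + \<eta> \<Longrightarrow> \<Phi> z < e + \<eta> \<Longrightarrow>
        \<bar>Q (lin (1/2) w (1/2) z) - Q w\<bar> < \<eta> \<Longrightarrow> \<bar>Q (lin (1/2) w (1/2) z) - Q z\<bar> < \<eta> \<Longrightarrow>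
        \<epsilon> \<le> B (lin 1 w (-1) z) (lin 1 w (-1) z) \<Longrightarrow>
        lin (1/2) w (1/2) z \<in> S \<and> \<Phi> (lin (1/2) w (1/2) z) < e"
      using mid by meson
    obtain N1 where N1: "\<And>n m. n\<ge>N1 \<Longrightarrow> m\<ge>N1 \<Longrightarrow> \<bar>Q (lin (1/2) (x (r n)) (1/2) (x (r m))) - Q (x (r n))\<bar> < \<eta>"
      using r(2)[OF \<eta>(1)] by blast
    have "\<forall>\<^sub>F n in sequentially. e + 1 / Suc n < e + \<eta>"
      using order_tendstoD(2)[OF lim, of "e + \<eta>"] \<eta>(1) by simp
    then obtain N2 where N2: "\<And>n. n \<ge> N2 \<Longrightarrow> e + 1 / Suc n < e + \<eta>"
      unfolding eventually_sequentially by blast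
    have N2': "\<Phi> (x (r n)) < e + \<eta>" if "n \<ge> N2" for n
      using x(2)[of "r n"] N2[of "r n"] seq_suble[OF r(1), of n] that by force
    show "\<exists>N. \<forall>n\<ge>N. \<forall>m\<ge>N. B (lin 1 (x (r n)) (-1) (x (r m))) (lin 1 (x (r n)) (-1) (x (r m))) < \<epsilon>"
    proof (intro exI[of _ "max N1 N2"] allI impI)
      fix n m assume nm: "max N1 N2 \<le> n" "max N1 N2 \<le> m"
      show "B (lin 1 (x (r n)) (-1) (x (r m))) (lin 1 (x (r n)) (-1) (x (r m))) < \<epsilon>"
      proof (rule ccontr)
        assume "\<not> ?thesis"
        then have "lin (1/2) (x (r n)) (1/2) (x (r m)) \<in> S \<and> \<Phi> (lin (1/2) (x (r n)) (1/2) (x (r m))) < e"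
          using nm N1[of n m] N1[of m n] lin_comm[of "1/2" "x (r m)" "1/2" "x (r n)"] N2'[of n] N2'[of m]
          by (intro \<eta>(2) x(1)) auto
        then show False using e_le by fastforce
      qed
    qed
  qed
  obtain w where w: "w \<in> H"
    "(\<lambda>n. B (lin 1 (x (r n)) (-1) w) (lin 1 (x (r n)) (-1) w)) \<longlonglongrightarrow> 0"
    using complete[of "\<lambda>n. x (r n)", OF xH cauchy] by blast
  have wS: "w \<in> S" and lw: "(\<lambda>n. \<Phi> (x (r n))) \<longlonglongrightarrow> \<Phi> w"
    using closed[of "\<lambda>n. x (r n)", OF x(1) w] by auto
  have "(\<lambda>n. e + 1 / Suc (r n)) \<longlonglongrightarrow> e"
    using LIMSEQ_subseq_LIMSEQ[OF lim r(1)] by (simp add: o_def)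
  then have "\<Phi> w \<le> e"
    by (rule LIMSEQ_le[OF lw]) (use x(2) less_imp_le in blast)
  then show ?thesis using wS e_le order_trans by blast
qed

text \<open>Dividing a one-sided first-order expansion by its step \<open>s\<close> leaves the
  derivative \<open>a\<close> and a remainder \<open>s * b\<close>; this extracts the sign of the
  derivative.\<close>

lemma real_nonneg_of_small:
  fixes a b s0 :: real
  assumes "0 < s0" "\<And>s. 0 < s \<Longrightarrow> s < s0 \<Longrightarrow> 0 \<le> a + s * b"
  shows "0 \<le> a"
proof (rule ccontr)
  assume "\<not> 0 \<le> a"
  \<comment> \<open>Small enough that \<open>s * b\<close> is at most \<open>- a / 2\<close>; the
    summand 1 avoids division by zero.\<close>
  define s where "s = min (s0 / 2) (- a / (2 * (\<bar>b\<bar> + 1)))"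
  have "0 < - a / (2 * (\<bar>b\<bar> + 1))" using \<open>\<not> 0 \<le> a\<close> by (intro divide_pos_pos) auto
  then have s: "0 < s" "s < s0" using assms(1) by (auto simp: s_def)
  have "s * b \<le> s * (\<bar>b\<bar> + 1)" using s by (intro mult_left_mono) auto
  also have "\<dots> \<le> (- a / (2 * (\<bar>b\<bar> + 1))) * (\<bar>b\<bar> + 1)"
    by (intro mult_right_mono) (auto simp: s_def)
  also have "\<dots> = - a / 2" by (simp add: field_simps add_eq_0_iff)
  finally show False using assms(2)[OF s] \<open>\<not> 0 \<le> a\<close> by simp
qed

section \<open>First solution: minimisation of \<open>J\<close> over the ball\<close>

lemma J_minimiser_ball: "\<exists>w\<in>ball0. \<forall>z\<in>ball0. J w \<le> J z"
proof (rule minimiser_exists)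
  show "ball0 \<subseteq> H" by (auto simp: ball0_def)
  obtain w where w: "w \<in> H" using H_pos by blast
  \<comment> \<open>There is no zero vector in the locale; \<open>lin 0 w 0 w\<close> stands in for
    it.\<close>
  have "lin 0 w 0 w \<in> ball0"
    using lin_H[OF w w] B_lin2[OF w w, of 0 0] rho_pos by (simp add: ball0_def)
  then show "ball0 \<noteq> {}" by blast
next
  fix w assume "w \<in> ball0"
  then have w: "w \<in> H" "B w w \<le> \<rho>\<^sup>2" "0 \<le> B w w" using B_nonneg by (auto simp: ball0_def)
  have "sqrt (B w w) \<le> \<rho>" using w rho_pos real_le_lsqrt by auto
  then have "F w \<le> \<rho> / 8 * \<rho>" using F_bd[OF w(1)] rho_pos
    by (smt (verit, best) divide_pos_pos mult_left_mono)
  moreover have "Q w \<le> (\<rho>\<^sup>2)\<^sup>2 / (3 * \<rho>\<^sup>2)"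
    using Q_bd[OF w(1)] power_mono[OF w(2,3), of 2]
    by (smt (verit, best) divide_right_mono zero_le_power2)
  ultimately show "- (\<rho>\<^sup>2)\<^sup>2 / (3 * \<rho>\<^sup>2) / 4 - \<rho> / 8 * \<rho> \<le> J w"
    using w by (simp add: J_def)
next
  show "\<exists>M. \<forall>w\<in>ball0. J w \<le> K \<longrightarrow> B w w \<le> M" for K
    by (rule exI[of _ "\<rho>\<^sup>2"]) (auto simp: ball0_def)
next
  fix \<epsilon> :: real assume "\<epsilon> > 0"
  show "\<exists>\<eta>>0. \<forall>e. \<forall>w\<in>ball0. \<forall>z\<in>ball0. J w < e + \<eta> \<longrightarrow> J z < e + \<eta> \<longrightarrow>
        \<bar>Q (lin (1/2) w (1/2) z) - Q w\<bar> < \<eta> \<longrightarrow> \<bar>Q (lin (1/2) w (1/2) z) - Q z\<bar> < \<eta> \<longrightarrow>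
        \<epsilon> \<le> B (lin 1 w (-1) z) (lin 1 w (-1) z) \<longrightarrow>
        lin (1/2) w (1/2) z \<in> ball0 \<and> J (lin (1/2) w (1/2) z) < e"
  \<comment> \<open>At the midpoint the quadratic part of \<open>J\<close> gains \<epsilon>/8, while
    the slack \<eta> and the change of \<open>Q\<close> cost less than \<eta> + \<eta>/4. With
    \<eta> = \<epsilon>/16 the gain wins.\<close>
  proof (intro exI[of _ "\<epsilon> / 16"] conjI allI ballI impI)
    fix e w z
    assume h: "w \<in> ball0" "z \<in> ball0" "J w < e + \<epsilon> / 16" "J z < e + \<epsilon> / 16"
        "\<bar>Q (lin (1/2) w (1/2) z) - Q w\<bar> < \<epsilon> / 16" "\<bar>Q (lin (1/2) w (1/2) z) - Q z\<bar> < \<epsilon> / 16"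
        "\<epsilon> \<le> B (lin 1 w (-1) z) (lin 1 w (-1) z)"
    have H: "w \<in> H" "z \<in> H" using h by (auto simp: ball0_def)
    have *: "B (lin (1/2) w (1/2) z) (lin (1/2) w (1/2) z) =
        B w w / 2 + B z z / 2 - B (lin 1 w (-1) z) (lin 1 w (-1) z) / 4"
      using B_lin2[OF H, of "1/2" "1/2"] B_lin2[OF H, of 1 "-1"] by (simp add: power2_eq_square field_simps)
    have Fm: "F (lin (1/2) w (1/2) z) = F w / 2 + F z / 2" using F_lin[OF H, of "1/2" "1/2"] by simp
    have ab: "Q w - Q (lin (1/2) w (1/2) z) < \<epsilon> / 16" "Q z - Q (lin (1/2) w (1/2) z) < \<epsilon> / 16"
      using h(5,6) by linarith+
    show "lin (1/2) w (1/2) z \<in> ball0"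
      using h(1,2,7) \<open>\<epsilon> > 0\<close> * lin_H[OF H] by (auto simp: ball0_def)
    show "J (lin (1/2) w (1/2) z) < e"
      using h(3,4,7) ab \<open>\<epsilon> > 0\<close> unfolding J_def * Fm by argo
  qed (use \<open>\<epsilon> > 0\<close> in auto)
next
  fix x w assume x: "\<And>n. x n \<in> ball0" and w: "w \<in> H"
    and l: "(\<lambda>n. B (lin 1 (x n) (-1) w) (lin 1 (x n) (-1) w)) \<longlonglongrightarrow> 0"
  have xH: "x n \<in> H" "B (x n) (x n) \<le> \<rho>\<^sup>2" for n using x by (auto simp: ball0_def)
  have "B w w \<le> \<rho>\<^sup>2"
    by (rule LIMSEQ_le_const2[OF conv_imp(1)[OF xH(1) w l]]) (use xH(2) in auto)
  moreover have "(\<lambda>n. J (x n)) \<longlonglongrightarrow> J w"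
    unfolding J_def by (intro tendsto_intros conv_imp Q_cont xH w l) auto
  ultimately show "w \<in> ball0 \<and> (\<lambda>n. J (x n)) \<longlonglongrightarrow> J w" using w by (simp add: ball0_def)
qed

text \<open>On the sphere \<open>B w w = \<rho>\<^sup>2\<close> the value of \<open>J\<close> is at
  least \<open>(1/2 - 1/12 - 1/8) * \<rho>\<^sup>2\<close>, which is positive, whereas zero gives 0.
  A minimiser is therefore interior and can be varied in every direction.\<close>

lemma ball_minimiser_critical:
  assumes w: "w \<in> ball0" and min: "\<And>z. z \<in> ball0 \<Longrightarrow> J w \<le> J z"
  shows "critical w" "B w w < \<rho>\<^sup>2"
proof -
  have wH: "w \<in> H" and wb: "B w w \<le> \<rho>\<^sup>2" using w by (auto simp: ball0_def)
  let ?o = "lin 0 w 0 w"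
  have "?o \<in> ball0" "J ?o = 0"
    using lin_H[OF wH wH] B_lin2[OF wH wH, of 0 0] Q_scale[OF wH, of 0] F_lin[OF wH wH, of 0 0]
    by (auto simp: ball0_def J_def)
  then have J0: "J w \<le> 0" using min by fastforce
  show less: "B w w < \<rho>\<^sup>2"
  proof (rule ccontr)
    assume "\<not> ?thesis"
    then have b: "B w w = \<rho>\<^sup>2" using wb by simp
    have "F w \<le> \<rho> / 8 * \<rho>" using F_bd[OF wH] rho_pos b by simp
    moreover have "Q w \<le> \<rho> * \<rho> / 3" using Q_bd[OF wH] rho_pos b by (simp add: power2_eq_square)
    moreover have "0 < \<rho> * \<rho>" using rho_pos by simp
    ultimately have "0 < J w" unfolding J_def b by (simp add: power2_eq_square)
    then show False using J0 by simp
  qed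
  have ge: "0 \<le> B w \<phi> - DQ w \<phi> / 4 - F \<phi>" if \<phi>: "\<phi> \<in> H" for \<phi>
  proof -
    obtain K where K: "\<And>s. \<bar>s\<bar> \<le> 1 \<Longrightarrow> \<bar>Q (lin 1 w s \<phi>) - Q w - s * DQ w \<phi>\<bar> \<le> K * s\<^sup>2"
      using Q_exp[OF wH \<phi>] by blast
    have "((\<lambda>s. B w w + 2 * s * B w \<phi> + s\<^sup>2 * B \<phi> \<phi>) \<longlongrightarrow> B w w + 2 * 0 * B w \<phi> + 0\<^sup>2 * B \<phi> \<phi>) (at_right 0)"
      by (intro tendsto_intros)
    then have "\<forall>\<^sub>F s in at_right 0. B w w + 2 * s * B w \<phi> + s\<^sup>2 * B \<phi> \<phi> < \<rho>\<^sup>2"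
      using less by (intro order_tendstoD(2)) auto
    then obtain s1 where s1: "0 < s1" "\<And>s. 0 < s \<Longrightarrow> s < s1 \<Longrightarrow> B w w + 2 * s * B w \<phi> + s\<^sup>2 * B \<phi> \<phi> < \<rho>\<^sup>2"
      unfolding eventually_at_right_field by auto
    show ?thesis
    proof (rule real_nonneg_of_small[of "min s1 1" _ "B \<phi> \<phi> / 2 + K / 4"])
      show "0 < min s1 1" using s1 by simp
      fix s :: real assume s: "0 < s" "s < min s1 1"
      have 1: "B (lin 1 w s \<phi>) (lin 1 w s \<phi>) = B w w + 2 * s * B w \<phi> + s\<^sup>2 * B \<phi> \<phi>"
        using B_lin2[OF wH \<phi>, of 1 s] by simp
      have "lin 1 w s \<phi> \<in> ball0" using s1(2)[of s] s 1 lin_H[OF wH \<phi>] by (simp add: ball0_def)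
      then have "J w \<le> J (lin 1 w s \<phi>)" by (rule min)
      then have "0 \<le> s * B w \<phi> + s\<^sup>2 * B \<phi> \<phi> / 2 - (Q (lin 1 w s \<phi>) - Q w) / 4 - s * F \<phi>"
        unfolding J_def 1 using F_lin[OF wH \<phi>, of 1 s] by (simp add: field_simps)
      also have "\<dots> \<le> s * B w \<phi> + s\<^sup>2 * B \<phi> \<phi> / 2 - (s * DQ w \<phi> - K * s\<^sup>2) / 4 - s * F \<phi>"
        using K[of s] s by (simp add: abs_if split: if_splits)
      also have "\<dots> = s * (B w \<phi> - DQ w \<phi> / 4 - F \<phi> + s * (B \<phi> \<phi> / 2 + K / 4))"
        by (simp add: power2_eq_square field_simps)
      finally show "0 \<le> B w \<phi> - DQ w \<phi> / 4 - F \<phi> + s * (B \<phi> \<phi> / 2 + K / 4)"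
        using s by (simp add: zero_le_mult_iff)
    qed
  qed
  have "B w \<phi> - DQ w \<phi> / 4 - F \<phi> = 0" if \<phi>: "\<phi> \<in> H" for \<phi>
  proof -
    \<comment> \<open>The one-sided inequality applied to the opposite direction gives
      equality.\<close>
    have m: "lin (-1) \<phi> 0 \<phi> \<in> H" using lin_H \<phi> by blast
    have "B w (lin (-1) \<phi> 0 \<phi>) = - B w \<phi>"
      using B_sym[OF wH m] B_lin[OF \<phi> \<phi> wH, of "-1" 0] B_sym[OF wH \<phi>] by simp
    then show ?thesis
      using ge[OF \<phi>] ge[OF m] DQ_lin[OF wH \<phi> \<phi>, of "-1" 0] F_lin[OF \<phi> \<phi>, of "-1" 0] by simp
  qed
  then show "critical w" unfolding critical_def using wH by blast
qed

section \<open>Second solution: minimisation of \<open>E\<close> over \<open>A\<close>\<close>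

lemma A_facts:
  assumes "w \<in> A"
  shows "w \<in> H" "\<rho>\<^sup>2 < B w w" "\<bar>F w\<bar> \<le> B w w / 8" "7/8 * B w w \<le> Q w"
proof -
  show H: "w \<in> H" using assms by (simp add: A_def)
  have r2: "0 < \<rho>\<^sup>2" using rho_pos by simp
  \<comment> \<open>The lower bound on \<open>Q\<close> from \<open>A\<close> and the upper bound
    \<open>Q_bd\<close> meet here and push \<open>B w w\<close> beyond the ball.\<close>
  have "\<rho>\<^sup>2 / 2 \<le> (B w w)\<^sup>2 / (3 * \<rho>\<^sup>2)" using assms Q_bd[OF H] by (auto simp: A_def)
  then have "3/2 * (\<rho>\<^sup>2)\<^sup>2 \<le> (B w w)\<^sup>2" using r2 by (simp add: field_simps power2_eq_square)
  then have "(\<rho>\<^sup>2)\<^sup>2 < (B w w)\<^sup>2" using zero_less_power[OF r2, of 2] by linarith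
  then show gt: "\<rho>\<^sup>2 < B w w" using B_nonneg[OF H] by (rule power_less_imp_less_base)
  \<comment> \<open>Outside the ball the factor \<rho> in \<open>F_bd\<close> is at most
    \<open>sqrt (B w w)\<close>, so the linear term becomes an eighth of the quadratic one.\<close>
  have "\<rho> \<le> sqrt (B w w)" using gt rho_pos by (simp add: real_le_rsqrt)
  then have "\<rho> * sqrt (B w w) \<le> sqrt (B w w) * sqrt (B w w)" using B_nonneg[OF H] by (intro mult_right_mono) auto
  then show F: "\<bar>F w\<bar> \<le> B w w / 8" using F_bd[OF H] B_nonneg[OF H] by simp
  show "7/8 * B w w \<le> Q w" using assms F by (auto simp: A_def)
qed

text \<open>Far out on a ray through a point with positive \<open>Q\<close> the quartic term
  dominates the quadratic and the linear one.\<close>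

lemma A_nonempty: "A \<noteq> {}"
proof -
  obtain w where w: "w \<in> H" "0 < Q w" using H_pos by blast
  \<comment> \<open>\<open>X\<close> collects all that \<open>Q\<close> has to beat. The factor
    \<open>s\<close> defined from it satisfies \<open>1 \<le> s\<close> and
    \<open>X \<le> s\<^sup>2 * Q w\<close>, hence
    \<open>s\<^sup>2 * X \<le> s ^ 4 * Q w\<close>.\<close>
  define X where "X = B w w + \<bar>F w\<bar> + \<rho>\<^sup>2"
  have X: "0 \<le> X" using B_nonneg[OF w(1)] by (simp add: X_def)
  define s where "s = 1 + X / Q w"
  have s1: "1 \<le> s" using X w by (simp add: s_def)
  have "X \<le> s * Q w" using w by (simp add: s_def field_simps)
  also have "\<dots> \<le> s\<^sup>2 * Q w" using s1 w self_le_power[of s 2] by (intro mult_right_mono) auto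
  finally have *: "X \<le> s\<^sup>2 * Q w" .
  have s2: "1 \<le> s\<^sup>2" "s \<le> s\<^sup>2" using s1 self_le_power[of s 2] by auto
  have "s\<^sup>2 * X \<le> s\<^sup>2 * (s\<^sup>2 * Q w)" using * by (intro mult_left_mono) auto
  then have q: "s\<^sup>2 * X \<le> s ^ 4 * Q w" by (simp add: power2_eq_square power4_eq_xxxx algebra_simps)
  have "s * \<bar>F w\<bar> \<le> s\<^sup>2 * \<bar>F w\<bar>" using s2 by (intro mult_right_mono) auto
  moreover have "- (s * F w) \<le> s * \<bar>F w\<bar>" using s1 by (simp add: abs_if)
  moreover have "0 \<le> s\<^sup>2 * \<rho>\<^sup>2" by simp
  ultimately have 1: "s\<^sup>2 * B w w \<le> s ^ 4 * Q w + s * F w"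
    using q unfolding X_def distrib_left by linarith
  have "\<rho>\<^sup>2 / 2 \<le> X" using B_nonneg[OF w(1)] by (simp add: X_def)
  also have "\<dots> \<le> s\<^sup>2 * X" using X s2 mult_right_mono[of 1 "s\<^sup>2" X] by simp
  finally have 2: "\<rho>\<^sup>2 / 2 \<le> s ^ 4 * Q w" using q by simp
  have "lin s w 0 w \<in> A"
    using 1 2 lin_H[OF w(1) w(1)] B_lin2[OF w(1) w(1), of s 0] Q_scale[OF w(1)] F_lin[OF w(1) w(1), of s 0]
    by (simp add: A_def)
  then show ?thesis by blast
qed

lemma E_minimiser_A: "\<exists>w\<in>A. \<forall>z\<in>A. E w \<le> E z"
proof (rule minimiser_exists)
  show "A \<subseteq> H" by (auto simp: A_def)
  show "A \<noteq> {}" by (rule A_nonempty)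
  \<comment> \<open>The constant is 1/4 - 3/4 * 1/8 = 5/32.\<close>
  have coer: "5/32 * B w w \<le> E w" if "w \<in> A" for w
    using A_facts(3)[OF that] by (simp add: E_def abs_if split: if_splits)
  show "0 \<le> E w" if "w \<in> A" for w
    using coer[OF that] B_nonneg[OF A_facts(1)[OF that]] by simp
  show "\<exists>M. \<forall>w\<in>A. E w \<le> K \<longrightarrow> B w w \<le> M" for K
    using coer by (intro exI[of _ "32/5 * K"]) fastforce
next
  fix \<epsilon> :: real assume "\<epsilon> > 0"
  \<comment> \<open>The midpoint gains at least \<epsilon>/16 in \<open>E\<close>, which absorbs a
    slack \<eta> of that size. On \<open>A\<close> one has \<open>Q > 7/8 * \<rho>\<^sup>2\<close>,
    so a loss below \<open>\<rho>\<^sup>2 / 4\<close> leaves \<open>Q\<close> above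
    \<open>\<rho>\<^sup>2 / 2\<close>.\<close>
  define \<eta> where "\<eta> = min (\<epsilon> / 16) (\<rho>\<^sup>2 / 4)"
  have \<eta>: "0 < \<eta>" "\<eta> \<le> \<epsilon> / 16" "\<eta> \<le> \<rho>\<^sup>2 / 4" using \<open>\<epsilon> > 0\<close> rho_pos by (auto simp: \<eta>_def)
  show "\<exists>\<eta>>0. \<forall>e. \<forall>w\<in>A. \<forall>z\<in>A. E w < e + \<eta> \<longrightarrow> E z < e + \<eta> \<longrightarrow>
        \<bar>Q (lin (1/2) w (1/2) z) - Q w\<bar> < \<eta> \<longrightarrow> \<bar>Q (lin (1/2) w (1/2) z) - Q z\<bar> < \<eta> \<longrightarrow>
        \<epsilon> \<le> B (lin 1 w (-1) z) (lin 1 w (-1) z) \<longrightarrow>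
        lin (1/2) w (1/2) z \<in> A \<and> E (lin (1/2) w (1/2) z) < e"
  proof (intro exI[of _ \<eta>] conjI allI ballI impI)
    fix e w z
    assume h: "w \<in> A" "z \<in> A" "E w < e + \<eta>" "E z < e + \<eta>"
        "\<bar>Q (lin (1/2) w (1/2) z) - Q w\<bar> < \<eta>" "\<bar>Q (lin (1/2) w (1/2) z) - Q z\<bar> < \<eta>"
        "\<epsilon> \<le> B (lin 1 w (-1) z) (lin 1 w (-1) z)"
    note H = A_facts(1)[OF h(1)] A_facts(1)[OF h(2)]
    have *: "B (lin (1/2) w (1/2) z) (lin (1/2) w (1/2) z) =
        B w w / 2 + B z z / 2 - B (lin 1 w (-1) z) (lin 1 w (-1) z) / 4"
      using B_lin2[OF H, of "1/2" "1/2"] B_lin2[OF H, of 1 "-1"] by (simp add: power2_eq_square field_simps)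
    have Fm: "F (lin (1/2) w (1/2) z) = F w / 2 + F z / 2" using F_lin[OF H, of "1/2" "1/2"] by simp
    have ab: "Q w - Q (lin (1/2) w (1/2) z) < \<eta>" "Q z - Q (lin (1/2) w (1/2) z) < \<eta>"
      using h(5,6) by linarith+
    have "B w w \<le> Q w + F w" "B z z \<le> Q z + F z" using h(1,2) by (auto simp: A_def)
    then have "B (lin (1/2) w (1/2) z) (lin (1/2) w (1/2) z) \<le> Q (lin (1/2) w (1/2) z) + F (lin (1/2) w (1/2) z)"
      unfolding * Fm using h(7) \<eta> ab by argo
    moreover have "\<rho>\<^sup>2 / 2 \<le> Q (lin (1/2) w (1/2) z)"
      using ab A_facts(2,4)[OF h(1)] \<eta> by linarith
    ultimately show "lin (1/2) w (1/2) z \<in> A" using lin_H[OF H] by (simp add: A_def)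
    show "E (lin (1/2) w (1/2) z) < e"
      using h(3,4,7) \<eta> unfolding E_def * Fm by argo
  qed (use \<eta> in auto)
next
  fix x w assume x: "\<And>n. x n \<in> A" and w: "w \<in> H"
    and l: "(\<lambda>n. B (lin 1 (x n) (-1) w) (lin 1 (x n) (-1) w)) \<longlonglongrightarrow> 0"
  have xH: "x n \<in> H" "B (x n) (x n) \<le> Q (x n) + F (x n)" "\<rho>\<^sup>2 / 2 \<le> Q (x n)" for n using x by (auto simp: A_def)
  note c = conv_imp[OF xH(1) w l] Q_cont[OF xH(1) w l]
  have "B w w \<le> Q w + F w"
    by (rule LIMSEQ_le[OF c(1) tendsto_add[OF c(3,2)]]) (use xH in auto)
  moreover have "\<rho>\<^sup>2 / 2 \<le> Q w" by (rule LIMSEQ_le_const[OF c(3)]) (use xH in auto)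
  moreover have "(\<lambda>n. E (x n)) \<longlonglongrightarrow> E w"
    unfolding E_def by (intro tendsto_intros c) auto
  ultimately show "w \<in> A \<and> (\<lambda>n. E (x n)) \<longlonglongrightarrow> E w" using w by (simp add: A_def)
qed

text \<open>By \<open>dir\<close> the constraint \<open>B - Q - F \<le> 0\<close> is slack at
  \<open>w\<close> or has negative derivative along \<phi>, and the lower bound on \<open>Q\<close>
  is strict at \<open>w\<close>. Small steps along \<phi> hence stay in \<open>A\<close>, where
  \<open>E\<close> cannot decrease to first order.\<close>

lemma A_minimiser_descent:
  assumes w: "w \<in> A" and min: "\<And>z. z \<in> A \<Longrightarrow> E w \<le> E z" and \<phi>: "\<phi> \<in> H"
    and dir: "B w w < Q w + F w \<or> 2 * B w \<phi> - DQ w \<phi> - F \<phi> < 0"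
  shows "0 \<le> B w \<phi> / 2 - 3/4 * F \<phi>"
proof -
  note wH = A_facts(1)[OF w]
  obtain K where K: "\<And>s. \<bar>s\<bar> \<le> 1 \<Longrightarrow> \<bar>Q (lin 1 w s \<phi>) - Q w - s * DQ w \<phi>\<bar> \<le> K * s\<^sup>2"
    using Q_exp[OF wH \<phi>] by blast
  define G where "G = B w w - Q w - F w"
  define G' where "G' = 2 * B w \<phi> - DQ w \<phi> - F \<phi>"
  have G: "G \<le> 0" "G < 0 \<or> G' < 0" using w dir by (auto simp: A_def G_def G'_def)
  \<comment> \<open>The expression bounds \<open>B - Q - F\<close> at
    \<open>lin 1 w s \<phi>\<close> from above, \<open>K\<close> being the second-order error of
    \<open>Q\<close>.\<close>
  have "\<forall>\<^sub>F s in at_right 0. G + s * (G' + s * (B \<phi> \<phi> + K)) \<le> 0"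
  proof (cases "G < 0")
    case True
    have "((\<lambda>s. G + s * (G' + s * (B \<phi> \<phi> + K))) \<longlongrightarrow> G + 0 * (G' + 0 * (B \<phi> \<phi> + K))) (at_right 0)"
      by (intro tendsto_intros)
    then have "\<forall>\<^sub>F s in at_right 0. G + s * (G' + s * (B \<phi> \<phi> + K)) < 0"
      using True by (intro order_tendstoD(2)) auto
    then show ?thesis by eventually_elim simp
  next
    case False
    then have "G' < 0" using G by simp
    have "((\<lambda>s. G' + s * (B \<phi> \<phi> + K)) \<longlongrightarrow> G' + 0 * (B \<phi> \<phi> + K)) (at_right 0)"
      by (intro tendsto_intros)
    then have "\<forall>\<^sub>F s in at_right 0. G' + s * (B \<phi> \<phi> + K) < 0"
      using \<open>G' < 0\<close> by (intro order_tendstoD(2)) auto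
    moreover have "\<forall>\<^sub>F s in at_right (0::real). 0 < s" by (simp add: eventually_at_right_less)
    ultimately show ?thesis
      by eventually_elim (use G in \<open>smt (verit) mult_pos_neg\<close>)
  qed
  moreover have "\<forall>\<^sub>F s in at_right 0. \<rho>\<^sup>2 / 2 < Q w + s * DQ w \<phi> - K * s\<^sup>2"
  proof (rule order_tendstoD(1))
    show "((\<lambda>s. Q w + s * DQ w \<phi> - K * s\<^sup>2) \<longlongrightarrow> Q w + 0 * DQ w \<phi> - K * 0\<^sup>2) (at_right 0)"
      by (intro tendsto_intros)
    show "\<rho>\<^sup>2 / 2 < Q w + 0 * DQ w \<phi> - K * 0\<^sup>2"
    proof -
      have "\<rho>\<^sup>2 / 2 < Q w" using A_facts(2,4)[OF w] zero_less_power[OF rho_pos, of 2] by linarith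
      then show ?thesis by simp
    qed
  qed
  ultimately have "\<forall>\<^sub>F s in at_right 0. G + s * (G' + s * (B \<phi> \<phi> + K)) \<le> 0 \<and> \<rho>\<^sup>2 / 2 < Q w + s * DQ w \<phi> - K * s\<^sup>2"
    by eventually_elim simp
  then obtain s1 where s1: "0 < s1" "\<And>s. 0 < s \<Longrightarrow> s < s1 \<Longrightarrow>
      G + s * (G' + s * (B \<phi> \<phi> + K)) \<le> 0 \<and> \<rho>\<^sup>2 / 2 < Q w + s * DQ w \<phi> - K * s\<^sup>2"
    unfolding eventually_at_right_field by auto
  show ?thesis
  proof (rule real_nonneg_of_small[of "min s1 1" _ "B \<phi> \<phi> / 4"])
    show "0 < min s1 1" using s1 by simp
    fix s :: real assume s: "0 < s" "s < min s1 1"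
    have 1: "B (lin 1 w s \<phi>) (lin 1 w s \<phi>) = B w w + 2 * s * B w \<phi> + s\<^sup>2 * B \<phi> \<phi>"
      using B_lin2[OF wH \<phi>, of 1 s] by simp
    have Fs: "F (lin 1 w s \<phi>) = F w + s * F \<phi>" using F_lin[OF wH \<phi>, of 1 s] by simp
    have Qs: "Q w + s * DQ w \<phi> - K * s\<^sup>2 \<le> Q (lin 1 w s \<phi>)"
      using K[of s] s by (simp add: abs_if split: if_splits)
    have "B (lin 1 w s \<phi>) (lin 1 w s \<phi>) - F (lin 1 w s \<phi>) - (Q w + s * DQ w \<phi> - K * s\<^sup>2)
        = G + s * (G' + s * (B \<phi> \<phi> + K))"
      unfolding 1 Fs G_def G'_def by (simp add: power2_eq_square algebra_simps)
    then have "lin 1 w s \<phi> \<in> A" using s1(2)[of s] s Qs lin_H[OF wH \<phi>] by (simp add: A_def)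
    then have "E w \<le> E (lin 1 w s \<phi>)" by (rule min)
    then have "0 \<le> s * (B w \<phi> / 2 - 3/4 * F \<phi> + s * (B \<phi> \<phi> / 4))"
      unfolding E_def 1 Fs by (simp add: power2_eq_square algebra_simps)
    then show "0 \<le> B w \<phi> / 2 - 3/4 * F \<phi> + s * (B \<phi> \<phi> / 4)"
      using s by (simp add: zero_le_mult_iff)
  qed
qed

text \<open>Differentiating \<open>J = E + (B - Q - F) / 4\<close> shows that
  \<open>L - G' / 4\<close> is the derivative of \<open>E\<close>. On the Nehari set
  \<open>L w = 0\<close> while \<open>G' w < 0\<close>, so a multiple of \<open>w\<close> adjusts
  \<open>G'\<close> at will without changing \<open>L\<close>. This takes the place of a Lagrange
  multiplier.\<close>

lemma A_minimiser_critical: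
  assumes w: "w \<in> A" and min: "\<And>z. z \<in> A \<Longrightarrow> E w \<le> E z"
  shows "critical w"
proof -
  note wH = A_facts(1)[OF w]
  have desc: "0 \<le> B w \<phi> / 2 - 3/4 * F \<phi>"
    if "\<phi> \<in> H" "B w w < Q w + F w \<or> 2 * B w \<phi> - DQ w \<phi> - F \<phi> < 0" for \<phi>
    using A_minimiser_descent[OF w _ that] min by blast
  have Bsc: "B w (lin a \<phi> b \<psi>) = a * B w \<phi> + b * B w \<psi>" if "\<phi> \<in> H" "\<psi> \<in> H" for a b \<phi> \<psi>
    using B_sym[OF wH lin_H[OF that]] B_lin[OF that wH] B_sym[OF wH] that by simp
  have Bpos: "0 < B w w" using A_facts(2)[OF w] zero_le_power2[of \<rho>] by linarith
  \<comment> \<open>With a slack constraint the direction \<open>-w\<close> would be admissible, but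
    the derivative of \<open>E\<close> along \<open>w\<close> is at least (1/2 - 3/32)
    \<open>B w w\<close>, so \<open>E\<close> would decrease.\<close>
  have G0: "B w w = Q w + F w"
  proof (rule ccontr)
    assume "\<not> ?thesis"
    then have "B w w < Q w + F w" using w by (auto simp: A_def)
    then have "0 \<le> B w (lin (-1) w 0 w) / 2 - 3/4 * F (lin (-1) w 0 w)"
      using desc[OF lin_H[OF wH wH]] by blast
    then show False
      using Bsc[OF wH wH] F_lin[OF wH wH] A_facts(3)[OF w] Bpos by (simp add: abs_if split: if_splits)
  qed
  define L where "L \<phi> = B w \<phi> - DQ w \<phi> / 4 - F \<phi>" for \<phi>
  define G' where "G' \<phi> = 2 * B w \<phi> - DQ w \<phi> - F \<phi>" for \<phi>
  have L_lin: "L (lin a \<phi> b \<psi>) = a * L \<phi> + b * L \<psi>" "G' (lin a \<phi> b \<psi>) = a * G' \<phi> + b * G' \<psi>"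
    if "\<phi> \<in> H" "\<psi> \<in> H" for a b \<phi> \<psi>
    using Bsc[OF that] DQ_lin[OF wH that] F_lin[OF that] by (simp_all add: L_def G'_def field_simps)
  have Lw: "L w = 0" using G0 DQ_self[OF wH] by (simp add: L_def)
  \<comment> \<open>Here \<open>G' w = 2 * B w w - 4 * Q w - F w\<close>, at most (2 - 7/2 + 1/8)
    \<open>B w w\<close>.\<close>
  have G'w: "G' w < 0" using G0 DQ_self[OF wH] A_facts(3,4)[OF w] Bpos by (simp add: G'_def)
  have ge: "0 \<le> L \<phi>" if \<phi>: "\<phi> \<in> H" for \<phi>
  proof (rule field_le_epsilon)
    fix e :: real assume "0 < e"
    \<comment> \<open>Chosen so that \<open>G'\<close> of the corrected direction is
      \<open>-e\<close>, which makes it admissible; the resulting error in \<open>L\<close> is only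
      \<open>e / 4\<close>.\<close>
    define c where "c = (- e - G' \<phi>) / G' w"
    let ?\<psi> = "lin 1 \<phi> c w"
    have g: "G' ?\<psi> = - e" using L_lin(2)[OF \<phi> wH] G'w by (simp add: c_def)
    have "0 \<le> B w ?\<psi> / 2 - 3/4 * F ?\<psi>"
      using desc[OF lin_H[OF \<phi> wH]] g \<open>0 < e\<close> unfolding G'_def by (metis neg_less_0_iff_less)
    also have "\<dots> = L ?\<psi> - G' ?\<psi> / 4" by (simp add: L_def G'_def field_simps)
    also have "\<dots> \<le> L \<phi> + e" unfolding g using L_lin(1)[OF \<phi> wH] Lw \<open>0 < e\<close> by simp
    finally show "0 \<le> L \<phi> + e" .
  qed
  have "L \<phi> = 0" if \<phi>: "\<phi> \<in> H" for \<phi>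
    using ge[OF \<phi>] ge[OF lin_H[OF \<phi> \<phi>, of "-1" 0]] L_lin(1)[OF \<phi> \<phi>] by simp
  then show ?thesis using wH by (simp add: critical_def L_def)
qed

text \<open>For critical \<open>v\<close> the relation \<open>F v = B v v - Q v\<close> makes the
  difference of \<open>J\<close> at \<open>v\<close> and at its multiple by \<open>t\<close> factor
  as \<open>(1 - t)\<^sup>2 * (Q v * (3 + 2 * t + t\<^sup>2) / 4 - B v v / 2)\<close>. Outside the
  ball \<open>Q v \<ge> 7/8 * B v v\<close>, and 3/4 * 7/8 exceeds 1/2.\<close>

lemma ball_minimiser_ground:
  assumes min: "\<And>z. z \<in> ball0 \<Longrightarrow> J w \<le> J z" and v: "critical v"
  shows "J w \<le> J v"
proof (cases "B v v \<le> \<rho>\<^sup>2")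
  case True
  then show ?thesis using v min by (simp add: critical_def ball0_def)
next
  case False
  have vH: "v \<in> H" using v by (simp add: critical_def)
  have G0: "F v = B v v - Q v" using v DQ_self[OF vH] by (auto simp: critical_def)
  define r where "r = sqrt (B v v)"
  have r: "\<rho> < r" "r\<^sup>2 = B v v" using False rho_pos B_nonneg[OF vH] by (auto simp: r_def intro: real_less_rsqrt)
  define t where "t = \<rho> / r"
  have t: "0 < t" "t < 1" "t\<^sup>2 * B v v = \<rho>\<^sup>2"
    using r rho_pos by (auto simp: t_def power2_eq_square simp flip: r(2))
  let ?z = "lin t v 0 v"
  have Bz: "B ?z ?z = t\<^sup>2 * B v v" and Fz: "F ?z = t * F v"
    using B_lin2[OF vH vH] F_lin[OF vH vH] by auto
  have "?z \<in> ball0" using Bz t lin_H[OF vH vH] by (simp add: ball0_def)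
  then have "J w \<le> J ?z" by (rule min)
  also have "\<dots> \<le> J v"
  proof -
    have "\<rho> * r \<le> r * r" using r rho_pos by (intro mult_right_mono) auto
    then have "F v \<le> B v v / 8" using F_bd[OF vH] r by (simp add: r_def power2_eq_square)
    then have q: "7/8 * B v v \<le> Q v" using G0 by simp
    have "7/8 * B v v * 3 \<le> Q v * (3 + 2 * t + t\<^sup>2)"
      using q t B_nonneg[OF vH] Q_nonneg[OF vH] by (intro mult_mono) auto
    then have "0 \<le> (1 - t)\<^sup>2 * (Q v * (3 + 2 * t + t\<^sup>2) / 4 - B v v / 2)"
      using B_nonneg[OF vH] by (intro mult_nonneg_nonneg) auto
    also have "\<dots> = J v - J ?z"
      unfolding J_def Bz Fz Q_scale[OF vH] G0
      by (simp add: power2_eq_square power4_eq_xxxx field_simps)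
    finally show ?thesis by simp
  qed
  finally show ?thesis .
qed

text \<open>The map \<open>p\<close> will be the identity for general data and the passage to
  absolute values for positive data. Its assumptions make it preserve \<open>ball0\<close> and
  \<open>A\<close> without raising \<open>J\<close> or \<open>E\<close>, so it sends minimisers to
  minimisers. The two bounds on \<open>B\<close> will tell the solutions apart.\<close>

theorem two_critical_points:
  assumes p: "\<And>w. w \<in> H \<Longrightarrow> p w \<in> H \<and> B (p w) (p w) \<le> B w w \<and> Q (p w) = Q w \<and> F w \<le> F (p w)"
  shows "\<exists>w\<^sub>1\<in>H. \<exists>w\<^sub>2\<in>H. critical (p w\<^sub>1) \<and> critical (p w\<^sub>2) \<and>
    B (p w\<^sub>1) (p w\<^sub>1) < \<rho>\<^sup>2 \<and> \<rho>\<^sup>2 < B (p w\<^sub>2) (p w\<^sub>2) \<and> (\<forall>w. critical w \<longrightarrow> J (p w\<^sub>1) \<le> J w)"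
proof -
  obtain w1 where w1: "w1 \<in> ball0" "\<And>z. z \<in> ball0 \<Longrightarrow> J w1 \<le> J z" using J_minimiser_ball by blast
  have 1: "w1 \<in> H" using w1 by (simp add: ball0_def)
  have p1: "p w1 \<in> ball0" using p[OF 1] w1 by (auto simp: ball0_def)
  have "J (p w1) \<le> J w1" using p[OF 1] by (simp add: J_def)
  then have m1: "J (p w1) \<le> J z" if "z \<in> ball0" for z using w1(2)[OF that] by simp
  obtain w2 where w2: "w2 \<in> A" "\<And>z. z \<in> A \<Longrightarrow> E w2 \<le> E z" using E_minimiser_A by blast
  have 2: "w2 \<in> H" using w2 by (simp add: A_def)
  have p2: "p w2 \<in> A" using p[OF 2] w2 by (auto simp: A_def)
  have "E (p w2) \<le> E w2" using p[OF 2] by (simp add: E_def)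
  then have m2: "E (p w2) \<le> E z" if "z \<in> A" for z using w2(2)[OF that] by simp
  show ?thesis
    using ball_minimiser_critical[OF p1 m1] A_minimiser_critical[OF p2 m2] A_facts(2)[OF p2]
      ball_minimiser_ground[OF m1] 1 2 by blast
qed

end

subsection \<open>Functions of class \<open>C\<^sup>k\<close>\<close>

lemma Ck_SucI:
  assumes "\<And>x. (f has_derivative D x) (at x)" "\<And>b. b \<in> Basis \<Longrightarrow> Ck k (\<lambda>x. D x b)"
  shows "Ck (Suc k) f"
proof -
  have "frechet_derivative f (at x) = D x" for x
    using frechet_derivative_at[OF assms(1)] by simp
  then show ?thesis using assms by (auto simp: differentiable_def)
qed

lemma Ck_Suc_has_derivative:
  "Ck (Suc k) f \<Longrightarrow> (f has_derivative frechet_derivative f (at x)) (at x)"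
  by (simp add: frechet_derivative_works)

lemma Ck_Suc_deriv: "Ck (Suc k) f \<Longrightarrow> b \<in> Basis \<Longrightarrow> Ck k (\<lambda>x. frechet_derivative f (at x) b)"
  by simp

lemma Ck_continuous: "Ck k f \<Longrightarrow> continuous_on UNIV f"
  by (cases k) (auto simp: continuous_on_eq_continuous_within differentiable_imp_continuous_within)

lemma Ck_measurable:
  assumes "Ck k f"
  shows "f \<in> borel_measurable lebesgue"
proof -
  have "f \<in> borel_measurable borel" by (rule borel_measurable_continuous_onI[OF Ck_continuous[OF assms]])
  then have "f \<in> borel_measurable lborel" by simp
  then show ?thesis by (rule measurable_completion)
qed

text \<open>From here on the recursive clause is accessed only through \<open>Ck_SucI\<close>,
  \<open>Ck_Suc_has_derivative\<close> and \<open>Ck_Suc_deriv\<close>, which keeps the inductions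
  free of unfolded derivatives.\<close>

declare Ck.simps(2) [simp del]

lemma Ck_lower: "Ck (Suc k) f \<Longrightarrow> Ck k f"
proof (induction k arbitrary: f)
  case 0
  then show ?case using Ck_continuous[of "Suc 0" f] by simp
next
  case (Suc k)
  show ?case
    by (rule Ck_SucI[OF Ck_Suc_has_derivative[OF Suc.prems] Suc.IH[OF Ck_Suc_deriv[OF Suc.prems]]])
qed

lemma Ck_const: "Ck k (\<lambda>x. c)"
proof (induction k arbitrary: c)
  case (Suc k)
  then show ?case by (intro Ck_SucI[where D = "\<lambda>x h. 0"]) (auto intro: derivative_eq_intros)
qed simp

lemma Ck_add: "Ck k f \<Longrightarrow> Ck k g \<Longrightarrow> Ck k (\<lambda>x. f x + g x)"
proof (induction k arbitrary: f g)
  case 0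
  then show ?case by (auto intro: continuous_intros)
next
  case (Suc k)
  show ?case
    by (rule Ck_SucI[OF has_derivative_add[OF Suc.prems[THEN Ck_Suc_has_derivative]]])
      (intro Suc.IH Suc.prems[THEN Ck_Suc_deriv])
qed

lemma Ck_mult: "Ck k f \<Longrightarrow> Ck k g \<Longrightarrow> Ck k (\<lambda>x. f x * g x)"
proof (induction k arbitrary: f g)
  case 0
  then show ?case by (auto intro: continuous_intros)
next
  case (Suc k)
  show ?case
    by (rule Ck_SucI[OF has_derivative_mult[OF Suc.prems[THEN Ck_Suc_has_derivative]]])
      (intro Ck_add Suc.IH Suc.prems[THEN Ck_Suc_deriv] Suc.prems[THEN Ck_lower])
qed

lemma Ck_lincomb: "Ck k f \<Longrightarrow> Ck k g \<Longrightarrow> Ck k (\<lambda>x. a * f x + b * g x)"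
  by (intro Ck_add Ck_mult Ck_const)

lemma Ck_power: "Ck k f \<Longrightarrow> Ck k (\<lambda>x. f x ^ n)"
  by (induction n) (auto intro: Ck_const Ck_mult)

lemma Ck_prod: "(\<And>i. i \<in> I \<Longrightarrow> Ck k (f i)) \<Longrightarrow> Ck k (\<lambda>x. \<Prod>i\<in>I. f i x)"
  by (induction I rule: infinite_finite_induct) (auto intro: Ck_const Ck_mult)

text \<open>The exponent is generalised because differentiation lowers it by one; a positive base
  keeps negative exponents regular. The square root in \<open>smooth_abs\<close> is an
  instance.\<close>

lemma Ck_powr:
  assumes "Ck k h" "\<And>x. 0 < h x"
  shows "Ck k (\<lambda>x. h x powr p)"
  using assms(1)
proof (induction k arbitrary: p)
  case 0
  have "h x \<noteq> 0" for x using assms(2)[of x] by simp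
  then show ?case using 0 by (auto intro!: continuous_intros)
next
  case (Suc k)
  show ?case
  proof (rule Ck_SucI[where D = "\<lambda>x y. frechet_derivative h (at x) y * (p * h x powr (p - 1))"])
    show "((\<lambda>x. h x powr p) has_derivative (\<lambda>y. frechet_derivative h (at x) y * (p * h x powr (p - 1)))) (at x)" for x
      by (rule DERIV_compose_FDERIV[OF _ Ck_Suc_has_derivative[OF Suc.prems]])
        (rule has_real_derivative_powr[OF assms(2)])
    show "Ck k (\<lambda>x. frechet_derivative h (at x) b * (p * h x powr (p - 1)))" if "b \<in> Basis" for b
      by (intro Ck_mult Ck_const Suc.IH Ck_lower[OF Suc.prems] Ck_Suc_deriv[OF Suc.prems that])
  qed
qed

section \<open>Construction and algebra of test functions\<close>

lemma test_functionsI: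
  assumes "\<And>k. Ck k \<phi>" "{x. \<phi> x \<noteq> 0} \<subseteq> K" "compact K" "K \<subseteq> \<Omega>"
  shows "\<phi> \<in> test_functions \<Omega>"
proof -
  have "closure {x. \<phi> x \<noteq> 0} \<subseteq> K" using assms(2,3) by (simp add: closure_minimal compact_imp_closed)
  moreover have "compact (closure {x. \<phi> x \<noteq> 0})"
    using assms(2,3) bounded_subset compact_imp_bounded compact_closure by blast
  ultimately show ?thesis using assms by (auto simp: test_functions_def)
qed

lemma test_functionsD:
  assumes "\<phi> \<in> test_functions \<Omega>"
  shows "Ck k \<phi>" "compact (closure {x. \<phi> x \<noteq> 0})" "closure {x. \<phi> x \<noteq> 0} \<subseteq> \<Omega>"
  using assms by (auto simp: test_functions_def)

lemma test_functions_lincomb: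
  assumes "\<phi> \<in> test_functions \<Omega>" "\<psi> \<in> test_functions \<Omega>"
  shows "(\<lambda>x. a * \<phi> x + b * \<psi> x) \<in> test_functions \<Omega>"
proof (rule test_functionsI)
  show "{x. a * \<phi> x + b * \<psi> x \<noteq> 0} \<subseteq> closure {x. \<phi> x \<noteq> 0} \<union> closure {x. \<psi> x \<noteq> 0}"
    by (rule subset_trans[OF _ Un_mono[OF closure_subset closure_subset]]) auto
  show "Ck k (\<lambda>x. a * \<phi> x + b * \<psi> x)" for k
    by (intro Ck_lincomb test_functionsD(1)[OF assms(1)] test_functionsD(1)[OF assms(2)])
  show "compact (closure {x. \<phi> x \<noteq> 0} \<union> closure {x. \<psi> x \<noteq> 0})"
    by (intro compact_Un test_functionsD(2)[OF assms(1)] test_functionsD(2)[OF assms(2)])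
  show "closure {x. \<phi> x \<noteq> 0} \<union> closure {x. \<psi> x \<noteq> 0} \<subseteq> \<Omega>"
    by (intro Un_least test_functionsD(3)[OF assms(1)] test_functionsD(3)[OF assms(2)])
qed

lemma test_functions_mult:
  assumes "\<phi> \<in> test_functions \<Omega>" "\<psi> \<in> test_functions \<Omega>"
  shows "(\<lambda>x. \<phi> x * \<psi> x) \<in> test_functions \<Omega>"
proof (rule test_functionsI)
  show "{x. \<phi> x * \<psi> x \<noteq> 0} \<subseteq> closure {x. \<phi> x \<noteq> 0}"
    by (rule subset_trans[OF _ closure_subset]) auto
  show "Ck k (\<lambda>x. \<phi> x * \<psi> x)" for k
    by (intro Ck_mult test_functionsD(1)[OF assms(1)] test_functionsD(1)[OF assms(2)])
qed (use test_functionsD[OF assms(1)] in auto)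

subsection \<open>Smooth approximation of box indicators\<close>

text \<open>Functions p(1/t) exp(-1/t), extended by 0, are closed under differentiation. With the
  polynomial as a parameter the smoothness of exp(-1/t) follows by one induction.\<close>

definition flat_exp :: "real poly \<Rightarrow> real \<Rightarrow> real" where
  "flat_exp p t = (if t \<le> 0 then 0 else poly p (1 / t) * exp (- (1 / t)))"

lemma poly_exp_tendsto_0: "((\<lambda>y. poly p y * exp (- y)) \<longlongrightarrow> (0::real)) at_top"
proof -
  have "((\<lambda>y. \<Sum>i\<le>degree p. coeff p i * (y ^ i / exp y)) \<longlongrightarrow> (\<Sum>i\<le>degree p. coeff p i * 0)) at_top"
    by (intro tendsto_intros tendsto_power_div_exp_0)
  moreover have "(\<lambda>y. \<Sum>i\<le>degree p. coeff p i * (y ^ i / exp y)) = (\<lambda>y. poly p y * exp (- y))"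
    by (auto simp: poly_altdef sum_distrib_right exp_minus divide_inverse mult.assoc)
  ultimately show ?thesis by simp
qed

text \<open>For y = 1/t the derivative of y is -y^2, so p(y) exp(-y) becomes y^2 (p - p')(y)
  exp(-y); the factor \<open>[:0, 0, 1:]\<close> is y^2. At 0 the right difference quotient is y
  p(y) exp(-y), which tends to 0.\<close>

lemma flat_exp_deriv:
  "(flat_exp p has_real_derivative flat_exp ([:0, 0, 1:] * (p - pderiv p)) t) (at t)"
proof -
  let ?q = "[:0, 0, 1:] * (p - pderiv p)"
  consider "t < 0" | "t > 0" | "t = 0" by linarith
  then show ?thesis
  proof cases
    case 1
    have "(flat_exp p has_real_derivative 0) (at t)"
      by (rule has_field_derivative_transform_within_open[where S = "{..<0}" and f = "\<lambda>_. 0"])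
        (use 1 in \<open>auto simp: flat_exp_def\<close>)
    then show ?thesis using 1 by (simp add: flat_exp_def)
  next
    case 2
    have "((\<lambda>t. poly p (1 / t) * exp (- (1 / t))) has_real_derivative
        (poly (pderiv p) (1 / t) * (- (1 / t\<^sup>2))) * exp (- (1 / t)) + exp (- (1 / t)) * (1 / t\<^sup>2) * poly p (1 / t)) (at t)"
    proof (rule DERIV_mult[THEN DERIV_cong])
      have d: "((\<lambda>t. 1 / t) has_real_derivative - (1 / t\<^sup>2)) (at t)"
        using 2 by (auto intro!: derivative_eq_intros simp: power2_eq_square)
      show "((\<lambda>t. poly p (1 / t)) has_real_derivative poly (pderiv p) (1 / t) * - (1 / t\<^sup>2)) (at t)"
        by (rule DERIV_chain2[OF poly_DERIV d])
      show "((\<lambda>t. exp (- (1 / t))) has_real_derivative exp (- (1 / t)) * (1 / t\<^sup>2)) (at t)"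
        using DERIV_chain2[OF DERIV_exp DERIV_minus[OF d]] by simp
    qed simp
    moreover have "(poly (pderiv p) (1 / t) * (- (1 / t\<^sup>2))) * exp (- (1 / t)) + exp (- (1 / t)) * (1 / t\<^sup>2) * poly p (1 / t)
        = flat_exp ?q t"
      using 2 by (simp add: flat_exp_def power2_eq_square field_simps)
    ultimately have "((\<lambda>t. poly p (1 / t) * exp (- (1 / t))) has_real_derivative flat_exp ?q t) (at t)" by simp
    then show ?thesis
      by (rule has_field_derivative_transform_within_open[where S = "{0<..}"])
        (use 2 in \<open>auto simp: flat_exp_def\<close>)
  next
    case 3
    have "((\<lambda>h. flat_exp p h / h) \<longlongrightarrow> 0) (at_right 0)"
    proof -
      \<comment> \<open>\<open>pCons 0 p\<close> is \<open>p\<close> times its variable and absorbs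
        the division by \<open>h\<close>.\<close>
      have "((\<lambda>h. poly (pCons 0 p) (inverse h) * exp (- inverse h)) \<longlongrightarrow> (0::real)) (at_right 0)"
        by (rule filterlim_compose[OF poly_exp_tendsto_0 filterlim_inverse_at_top_right])
      moreover have "\<forall>\<^sub>F h in at_right 0. poly (pCons 0 p) (inverse h) * exp (- inverse h) = flat_exp p h / h"
        using eventually_at_right_less[of 0] by eventually_elim (simp add: flat_exp_def divide_inverse)
      ultimately show ?thesis by (rule Lim_transform_eventually)
    qed
    moreover have "((\<lambda>h. flat_exp p h / h) \<longlongrightarrow> 0) (at_left 0)"
      by (rule Lim_transform_eventually[OF tendsto_const])
        (simp add: eventually_at_left_field flat_exp_def exI[of _ "-1"])
    ultimately have "((\<lambda>h. flat_exp p h / h) \<longlongrightarrow> 0) (at 0)" by (simp add: filterlim_split_at)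
    then show ?thesis using 3 by (simp add: DERIV_def flat_exp_def)
  qed
qed

lemma Ck_flat_exp: "Ck k (\<lambda>x::'a::euclidean_space. flat_exp p (c * (x \<bullet> b) + d))"
proof (induction k arbitrary: p)
  case 0
  have "continuous_on UNIV (flat_exp p)"
    by (meson DERIV_isCont continuous_at_imp_continuous_on flat_exp_deriv)
  then show ?case
    by (auto intro!: continuous_on_compose2[of UNIV "flat_exp p"] continuous_intros)
next
  case (Suc k)
  show ?case
  proof (rule Ck_SucI)
    show "((\<lambda>x. flat_exp p (c * (x \<bullet> b) + d)) has_derivative
       (\<lambda>h. (c * (h \<bullet> b)) * flat_exp ([:0, 0, 1:] * (p - pderiv p)) (c * (x \<bullet> b) + d))) (at x)" for x :: 'a
      by (rule DERIV_compose_FDERIV[OF flat_exp_deriv]) (auto intro!: derivative_eq_intros)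
    show "Ck k (\<lambda>x. (c * (b' \<bullet> b)) * flat_exp ([:0, 0, 1:] * (p - pderiv p)) (c * (x \<bullet> b) + d))" for b' :: 'a
      by (intro Ck_mult Ck_const Suc.IH)
  qed
qed

text \<open>Positive exactly on the open box. The arguments have the shape
  \<open>c * (x \<bullet> b) + d\<close> expected by \<open>Ck_flat_exp\<close>.\<close>

definition bump :: "'a::euclidean_space \<Rightarrow> 'a \<Rightarrow> 'a \<Rightarrow> real" where
  "bump a c x = (\<Prod>b\<in>Basis. flat_exp 1 (1 * (x \<bullet> b) + - (a \<bullet> b)) * flat_exp 1 ((-1) * (x \<bullet> b) + c \<bullet> b))"

lemma Ck_bump: "Ck k (bump a c)"
  unfolding bump_def by (intro Ck_prod Ck_mult Ck_flat_exp)

lemma bump_nonneg: "0 \<le> bump a c x" and bump_le_1: "bump a c x \<le> 1"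
proof -
  have *: "0 \<le> flat_exp 1 t" "flat_exp 1 t \<le> 1" for t by (auto simp: flat_exp_def)
  show "0 \<le> bump a c x" unfolding bump_def by (intro prod_nonneg ballI mult_nonneg_nonneg *)
  show "bump a c x \<le> 1" unfolding bump_def
    by (intro prod_le_1 conjI mult_nonneg_nonneg mult_le_one *)
qed

lemma bump_pos: "x \<in> box a c \<Longrightarrow> 0 < bump a c x"
  unfolding bump_def by (intro prod_pos) (auto simp: mem_box flat_exp_def)

lemma bump_zero: "x \<notin> box a c \<Longrightarrow> bump a c x = 0"
  by (auto simp: bump_def mem_box flat_exp_def not_less)

text \<open>Powers of \<open>1 - bump\<close> tend to 0 inside the box and stay 1 outside. This
  approximates the indicator smoothly without convolution, and all approximants live in the same
  box.\<close>

definition box_approx :: "'a::euclidean_space \<Rightarrow> 'a \<Rightarrow> nat \<Rightarrow> 'a \<Rightarrow> real" where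
  "box_approx a c n x = 1 - (1 - bump a c x) ^ n"

lemma box_approx_zero: "x \<notin> box a c \<Longrightarrow> box_approx a c n x = 0"
  by (simp add: box_approx_def bump_zero)

lemma box_approx_bound: "\<bar>box_approx a c n x\<bar> \<le> 1"
  using bump_nonneg[of a c x] bump_le_1[of a c x] power_le_one[of "1 - bump a c x" n]
    zero_le_power[of "1 - bump a c x" n] by (simp add: box_approx_def abs_if)

lemma box_approx_tendsto: "(\<lambda>n. box_approx a c n x) \<longlonglongrightarrow> indicator (box a c) x"
proof (cases "x \<in> box a c")
  case True
  then have "(\<lambda>n. (1 - bump a c x) ^ n) \<longlonglongrightarrow> 0"
    using bump_pos[of x a c] bump_le_1[of a c x] by (intro LIMSEQ_realpow_zero) auto
  from tendsto_diff[OF tendsto_const[of 1] this] show ?thesis using True by (simp add: box_approx_def)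
qed (simp add: box_approx_zero)

lemma Ck_box_approx: "Ck k (box_approx a c n)"
proof -
  have "Ck k (\<lambda>x. 1 * 1 + (-1) * (1 * 1 + (-1) * bump a c x) ^ n)"
    by (intro Ck_lincomb Ck_const Ck_power Ck_bump)
  then show ?thesis by (simp add: box_approx_def[abs_def])
qed

lemma box_approx_test_function:
  assumes "cbox a c \<subseteq> \<Omega>"
  shows "box_approx a c n \<in> test_functions \<Omega>"
  by (rule test_functionsI[OF Ck_box_approx _ compact_cbox assms])
    (use box_approx_zero box_subset_cbox in blast)

text \<open>Lebesgue differentiation: outside a negligible set the value at a point is the limit of
  averages over small boxes with that point as a corner, and those averages vanish. Countably many
  boxes cover the open set.\<close>

lemma AE_lebesgue_zero_if_box_integrals_zero:
  fixes w :: "'a::euclidean_space \<Rightarrow> real"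
  assumes "open \<Omega>"
    and int: "\<And>a c. cbox a c \<subseteq> \<Omega> \<Longrightarrow> w integrable_on cbox a c"
    and zero: "\<And>a c. cbox a c \<subseteq> \<Omega> \<Longrightarrow> integral (cbox a c) w = 0"
  shows "AE x in lebesgue_on \<Omega>. w x = 0"
proof -
  obtain \<D> where D: "countable \<D>" "\<D> \<subseteq> Pow \<Omega>" "\<And>X. X \<in> \<D> \<Longrightarrow> \<exists>a b. X = cbox a b"
    "\<Union>\<D> = \<Omega>"
    using open_countable_Union_open_cbox[OF assms(1)] by blast
  have neg: "negligible {x \<in> X. w x \<noteq> 0}" if XD: "X \<in> \<D>" for X
  proof -
    obtain a c where X: "X = cbox a c" using D(3)[OF XD] by blast
    then have sub: "cbox a c \<subseteq> \<Omega>" using D(2) XD by auto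
    \<comment> \<open>The differentiation theorem asks for integrability on every box, hence the
      truncation.\<close>
    let ?f = "\<lambda>x. if x \<in> cbox a c then w x else 0"
    have "?f integrable_on cbox u v" for u v by (rule integrable_altD(1)[OF int[OF sub]])
    then obtain N where N: "negligible N" "\<And>x e. \<lbrakk>x \<notin> N; 0 < e\<rbrakk> \<Longrightarrow> \<exists>d>0. \<forall>h. 0 < h \<and> h < d \<longrightarrow>
        norm (integral (cbox x (x + h *\<^sub>R One)) ?f /\<^sub>R h ^ DIM('a) - ?f x) < e"
      by (rule integrable_ccontinuous_explicit) blast
    have "w x = 0" if x: "x \<in> box a c" "x \<notin> N" for x
    proof (rule ccontr)
      assume "w x \<noteq> 0"
      then obtain d where d: "d > 0" "\<And>h. 0 < h \<Longrightarrow> h < d \<Longrightarrow>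
          norm (integral (cbox x (x + h *\<^sub>R One)) ?f /\<^sub>R h ^ DIM('a) - ?f x) < \<bar>w x\<bar>"
        using N(2)[OF x(2), of "\<bar>w x\<bar>"] by auto
      obtain r where r: "r > 0" "\<And>y. dist y x < r \<Longrightarrow> y \<in> box a c"
        using open_box[of a c] x(1) unfolding open_dist by metis
      \<comment> \<open>The first bound comes from differentiation, the second keeps the box inside:
        the norm of \<open>One\<close> is at most the dimension.\<close>
      define h where "h = min (d / 2) (r / (2 * real DIM('a)))"
      have h: "0 < h" "h < d" using d r by (auto simp: h_def)
      have "norm (h *\<^sub>R (One::'a)) < r"
      proof -
        have "norm (One::'a) \<le> real DIM('a)"
          using norm_sum[of "\<lambda>b::'a. b" Basis] by simp
        then have "norm (h *\<^sub>R (One::'a)) \<le> h * real DIM('a)" using h by (auto intro: mult_left_mono)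
        also have "\<dots> \<le> (r / (2 * real DIM('a))) * real DIM('a)"
          by (intro mult_right_mono) (auto simp: h_def)
        also have "\<dots> < r" using r by simp
        finally show ?thesis .
      qed
      then have "x + h *\<^sub>R One \<in> cbox a c" using r(2)[of "x + h *\<^sub>R One"] box_subset_cbox
        by (auto simp: dist_norm)
      then have c: "cbox x (x + h *\<^sub>R One) \<subseteq> cbox a c"
        using x(1) box_subset_cbox by (intro subset_box_imp) (auto simp: mem_box intro: less_imp_le)
      have "integral (cbox x (x + h *\<^sub>R One)) ?f = integral (cbox x (x + h *\<^sub>R One)) w"
        by (rule Henstock_Kurzweil_Integration.integral_cong) (use c in auto)
      also have "\<dots> = 0" using c sub by (intro zero) auto
      finally show False using d(2)[OF h] subsetD[OF box_subset_cbox x(1)] by simp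
    qed
    then have "{x \<in> X. w x \<noteq> 0} \<subseteq> N \<union> (cbox a c - box a c)" using X by auto
    then show ?thesis using N(1) negligible_frontier_interval negligible_Un negligible_subset by blast
  qed
  have "{x \<in> \<Omega>. w x \<noteq> 0} = (\<Union>X\<in>\<D>. {x \<in> X. w x \<noteq> 0})" using D(4) by auto
  then have "negligible {x \<in> \<Omega>. w x \<noteq> 0}" using neg D(1) by (auto intro!: negligible_countable_Union)
  then have "{x \<in> \<Omega>. w x \<noteq> 0} \<in> null_sets lebesgue" by (simp add: negligible_iff_null_sets)
  then have "AE x in lebesgue. x \<in> \<Omega> \<longrightarrow> w x = 0" by (rule AE_I') auto
  then show ?thesis using \<open>open \<Omega>\<close> by (simp add: AE_restrict_space_iff)
qed

lemma integrable_lebesgue_on_compact_support: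
  fixes w :: "'a::euclidean_space \<Rightarrow> 'b::euclidean_space"
  assumes "w \<in> L1_loc \<Omega>" "compact K" "K \<subseteq> \<Omega>"
  shows "integrable lebesgue (\<lambda>x. indicator K x *\<^sub>R w x)"
proof -
  have "K \<in> sets lebesgue" using assms(2) by (simp add: lmeasurable_compact fmeasurableD)
  then show ?thesis using assms integrable_restrict_space[of K lebesgue w] by (auto simp: L1_loc_def)
qed

text \<open>Testing with \<open>box_approx\<close> and dominated convergence show that the integral
  over every closed box in the domain vanishes. This is the source of the uniqueness of weak
  gradients and of the nonvanishing of both solution components.\<close>

lemma L1_loc_AE_zero:
  fixes w :: "'a::euclidean_space \<Rightarrow> real"
  assumes \<Omega>: "open \<Omega>" and w: "w \<in> L1_loc \<Omega>"
    and test: "\<And>\<phi>. \<phi> \<in> test_functions \<Omega> \<Longrightarrow> (LINT x|lebesgue_on \<Omega>. w x * \<phi> x) = 0"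
  shows "AE x in lebesgue_on \<Omega>. w x = 0"
proof (rule AE_lebesgue_zero_if_box_integrals_zero[OF \<Omega>])
  fix a c assume sub: "cbox a c \<subseteq> \<Omega>"
  have wi: "integrable (lebesgue_on (cbox a c)) w" using w sub compact_cbox by (auto simp: L1_loc_def)
  then show "w integrable_on cbox a c" by (intro integrable_on_lebesgue_on) auto
  have \<Omega>m: "\<Omega> \<in> sets lebesgue" using \<Omega> by auto
  define v where "v x = indicator (cbox a c) x * w x" for x
  have vi: "integrable lebesgue v"
    using integrable_lebesgue_on_compact_support[OF w compact_cbox sub] by (simp add: v_def[abs_def])
  have 0: "(LINT x|lebesgue. v x * box_approx a c n x) = 0" for n
  proof -
    have "(LINT x|lebesgue_on \<Omega>. w x * box_approx a c n x) = (LINT x|lebesgue. indicator \<Omega> x *\<^sub>R (w x * box_approx a c n x))"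
      using \<Omega>m by (intro integral_restrict_space) auto
    also have "\<dots> = (LINT x|lebesgue. v x * box_approx a c n x)"
    proof (rule Bochner_Integration.integral_cong)
      fix x
      show "indicator \<Omega> x *\<^sub>R (w x * box_approx a c n x) = v x * box_approx a c n x"
        using box_approx_zero[of x a c n] box_subset_cbox[of a c] sub
        by (cases "x \<in> box a c") (auto simp: v_def indicator_def)
    qed auto
    finally show ?thesis using test[OF box_approx_test_function[OF sub]] by simp
  qed
  have "(\<lambda>n. LINT x|lebesgue. v x * box_approx a c n x) \<longlonglongrightarrow> (LINT x|lebesgue. v x * indicator (box a c) x)"
  proof (rule integral_dominated_convergence[where w = "\<lambda>x. \<bar>v x\<bar>"])
    show "(\<lambda>x. v x * indicator (box a c) x) \<in> borel_measurable lebesgue"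
      using vi by (intro borel_measurable_times borel_measurable_indicator) auto
    have "box_approx a c n \<in> borel_measurable lebesgue" for n
      by (rule Ck_measurable[OF Ck_box_approx])
    then show "(\<lambda>x. v x * box_approx a c n x) \<in> borel_measurable lebesgue" for n
      using vi by (intro borel_measurable_times) auto
    show "AE x in lebesgue. norm (v x * box_approx a c n x) \<le> \<bar>v x\<bar>" for n
      using box_approx_bound[of a c n] by (auto simp: abs_mult intro!: mult_left_le)
  qed (use vi in \<open>auto intro!: tendsto_intros box_approx_tendsto\<close>)
  then have "(LINT x|lebesgue. v x * indicator (box a c) x) = 0" using 0 by (simp add: LIMSEQ_const_iff)
  \<comment> \<open>The open and the closed box differ by a negligible frontier.\<close>
  moreover have "(LINT x|lebesgue. v x * indicator (box a c) x) = (LINT x|lebesgue. v x)"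
  proof (rule integral_cong_AE)
    have "AE x in lebesgue. x \<notin> cbox a c - box a c"
      using negligible_frontier_interval[of a c] by (intro AE_not_in) (simp add: negligible_iff_null_sets)
    then show "AE x in lebesgue. v x * indicator (box a c) x = v x"
      by eventually_elim (auto simp: v_def indicator_def)
  qed (use vi in \<open>auto intro!: borel_measurable_times borel_measurable_indicator\<close>)
  moreover have "(LINT x|lebesgue. v x) = (LINT x|lebesgue_on (cbox a c). w x)"
    by (subst integral_restrict_space) (auto simp: v_def[abs_def])
  ultimately show "integral (cbox a c) w = 0"
    using lebesgue_integral_eq_integral[OF wi] by simp
qed

subsection \<open>Spaces of functions with integrable even powers\<close>

text \<open>The applications use the even exponents 2 and 4; natural powers give access to the
  convexity of even powers and to plain algebra. \<open>Lp2_iff\<close> and \<open>Lp4_iff\<close>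
  make the link to \<open>Lp\<close>.\<close>

definition pint :: "nat \<Rightarrow> 'x measure \<Rightarrow> ('x \<Rightarrow> 'b::euclidean_space) \<Rightarrow> bool" where
  "pint p M f \<longleftrightarrow> f \<in> borel_measurable M \<and> integrable M (\<lambda>x. norm (f x) ^ p)"

definition pnorm :: "nat \<Rightarrow> 'x measure \<Rightarrow> ('x \<Rightarrow> 'b::euclidean_space) \<Rightarrow> real" where
  "pnorm p M f = root p (LINT x|M. norm (f x) ^ p)"

lemma pint_measurable: "pint p M f \<Longrightarrow> f \<in> borel_measurable M"
  by (simp add: pint_def)

lemma pint_integrable: "pint p M f \<Longrightarrow> integrable M (\<lambda>x. norm (f x) ^ p)"
  by (simp add: pint_def)

lemma pnorm_nonneg: "0 \<le> pnorm p M f"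
  by (cases "p = 0") (auto simp: pnorm_def)

lemma pnorm_power: "0 < p \<Longrightarrow> pnorm p M f ^ p = (LINT x|M. norm (f x) ^ p)"
  by (simp add: pnorm_def)

lemma pnorm_le: "0 < p \<Longrightarrow> 0 \<le> C \<Longrightarrow> (LINT x|M. norm (f x) ^ p) \<le> C ^ p \<Longrightarrow> pnorm p M f \<le> C"
  using real_root_le_mono[of p "LINT x|M. norm (f x) ^ p" "C ^ p"] by (simp add: pnorm_def real_root_power_cancel)

lemma pint_cong_AE:
  assumes "f \<in> borel_measurable M" "g \<in> borel_measurable M" "AE x in M. f x = g x"
  shows "pint p M f = pint p M g" "pnorm p M f = pnorm p M g"
proof -
  have "AE x in M. norm (f x) ^ p = norm (g x) ^ p" using assms(3) by eventually_elim simp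
  then show "pint p M f = pint p M g" "pnorm p M f = pnorm p M g"
    using integrable_cong_AE[of "\<lambda>x. norm (f x) ^ p" M "\<lambda>x. norm (g x) ^ p"]
      integral_cong_AE[of "\<lambda>x. norm (f x) ^ p" M "\<lambda>x. norm (g x) ^ p"] assms(1,2)
    by (auto simp: pint_def pnorm_def)
qed

lemma pint_scale:
  assumes "pint p M f"
  shows "pint p M (\<lambda>x. c *\<^sub>R f x)"
  using assms by (auto simp: pint_def power_mult_distrib)

lemma pnorm_scale: "0 < p \<Longrightarrow> pnorm p M (\<lambda>x. c *\<^sub>R f x) = \<bar>c\<bar> * pnorm p M f"
  by (simp add: pnorm_def power_mult_distrib real_root_mult real_root_power_cancel)

text \<open>Convexity of the even power at the points s/a and t/b with weights a/(a+b) and b/(a+b).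
  Integrated with \<open>a\<close> and \<open>b\<close> just above two norms it becomes Minkowski's
  inequality.\<close>

lemma power_mean_split:
  fixes s t a b :: real
  assumes "even p" "0 \<le> s" "0 \<le> t" "0 < a" "0 < b"
  shows "(s + t) ^ p \<le> (a + b) ^ p * (a / (a + b) * (s / a) ^ p + b / (a + b) * (t / b) ^ p)"
proof -
  have cv: "(u * x + v * y) ^ p \<le> u * x ^ p + v * y ^ p" if "0 \<le> u" "0 \<le> v" "u + v = 1" for u v x y :: real
    using convex_power_even[OF assms(1)] that unfolding convex_on_def by simp
  have "(a / (a + b)) *\<^sub>R (s / a) + (b / (a + b)) *\<^sub>R (t / b) = (s + t) / (a + b)"
    using assms by (simp add: add_divide_distrib)
  moreover have "((a / (a + b)) *\<^sub>R (s / a) + (b / (a + b)) *\<^sub>R (t / b)) ^ p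
      \<le> a / (a + b) * (s / a) ^ p + b / (a + b) * (t / b) ^ p"
    using cv[of "a / (a + b)" "b / (a + b)" "s / a" "t / b"] assms by (simp add: add_divide_distrib[symmetric])
  ultimately have "((s + t) / (a + b)) ^ p \<le> a / (a + b) * (s / a) ^ p + b / (a + b) * (t / b) ^ p" by simp
  then have "(a + b) ^ p * ((s + t) / (a + b)) ^ p \<le> (a + b) ^ p * (a / (a + b) * (s / a) ^ p + b / (a + b) * (t / b) ^ p)"
    using assms by (intro mult_left_mono) auto
  moreover have "(a + b) ^ p * ((s + t) / (a + b)) ^ p = (s + t) ^ p"
    using assms by (simp add: power_divide)
  ultimately show ?thesis by simp
qed

lemma pint_add:
  assumes p: "even p" "0 < p" and f: "pint p M f" and g: "pint p M g"
  shows "pint p M (\<lambda>x. f x + g x)" "pnorm p M (\<lambda>x. f x + g x) \<le> pnorm p M f + pnorm p M g"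
proof -
  note m = pint_measurable[OF f] pint_measurable[OF g]
  note i = pint_integrable[OF f] pint_integrable[OF g]
  have pw: "norm (f x + g x) ^ p \<le> (a + b) ^ p * (a / (a + b) * (norm (f x) / a) ^ p + b / (a + b) * (norm (g x) / b) ^ p)"
    if "0 < a" "0 < b" for a b x
    using power_mono[OF norm_triangle_ineq[of "f x" "g x"], of p]
      power_mean_split[OF p(1), of "norm (f x)" "norm (g x)" a b] that by fastforce
  have bi: "integrable M (\<lambda>x. (a + b) ^ p * (a / (a + b) * (norm (f x) / a) ^ p + b / (a + b) * (norm (g x) / b) ^ p))"
    for a b :: real
    using i by (auto simp: power_divide)
  show 1: "pint p M (\<lambda>x. f x + g x)"
    unfolding pint_def
  proof
    show "integrable M (\<lambda>x. norm (f x + g x) ^ p)"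
      by (rule Bochner_Integration.integrable_bound[OF bi[of 1 1]]) (use pw[of 1 1] m in \<open>auto simp: abs_le_iff\<close>)
  qed (use m in auto)
  \<comment> \<open>Strict upper bounds replace the norms so that nothing is divided by a norm equal
    to 0; the slack is removed at the end.\<close>
  have *: "pnorm p M (\<lambda>x. f x + g x) \<le> a + b" if a: "pnorm p M f < a" and b: "pnorm p M g < b" for a b
  proof (rule pnorm_le[OF p(2)])
    have ab: "0 < a" "0 < b" using a b pnorm_nonneg[of p M f] pnorm_nonneg[of p M g] by auto
    then show "0 \<le> a + b" by simp
    have fa: "(LINT x|M. norm (f x) ^ p) / a ^ p \<le> 1" "(LINT x|M. norm (g x) ^ p) / b ^ p \<le> 1"
      using pnorm_power[OF p(2), of M f] pnorm_power[OF p(2), of M g] ab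
        power_mono[OF less_imp_le[OF a] pnorm_nonneg, of p] power_mono[OF less_imp_le[OF b] pnorm_nonneg, of p] by auto
    have "(LINT x|M. norm (f x + g x) ^ p)
      \<le> (LINT x|M. (a + b) ^ p * (a / (a + b) * (norm (f x) / a) ^ p + b / (a + b) * (norm (g x) / b) ^ p))"
      using pw[OF ab] by (intro integral_mono bi pint_integrable[OF 1]) auto
    also have "\<dots> = (a + b) ^ p * (a / (a + b) * ((LINT x|M. norm (f x) ^ p) / a ^ p)
        + b / (a + b) * ((LINT x|M. norm (g x) ^ p) / b ^ p))"
      using i by (simp add: power_divide)
    also have "\<dots> \<le> (a + b) ^ p * (a / (a + b) * 1 + b / (a + b) * 1)"
      using ab fa by (intro mult_left_mono add_mono) auto
    also have "\<dots> = (a + b) ^ p" using ab by (simp add: add_divide_distrib[symmetric])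
    finally show "(LINT x|M. norm (f x + g x) ^ p) \<le> (a + b) ^ p" .
  qed
  show "pnorm p M (\<lambda>x. f x + g x) \<le> pnorm p M f + pnorm p M g"
  proof (rule field_le_epsilon)
    fix e :: real assume "0 < e"
    then show "pnorm p M (\<lambda>x. f x + g x) \<le> pnorm p M f + pnorm p M g + e"
      using *[of "pnorm p M f + e / 2" "pnorm p M g + e / 2"] by simp
  qed
qed

lemma pint_diff:
  assumes p: "even p" "0 < p" and f: "pint p M f" and g: "pint p M g"
  shows "pint p M (\<lambda>x. f x - g x)" "pnorm p M (\<lambda>x. f x - g x) \<le> pnorm p M f + pnorm p M g"
  using pint_add[OF p f pint_scale[OF g, of "-1"]] pnorm_scale[OF p(2), of M "-1" g] by auto

lemma pnorm_minus_commute: "pnorm p M (\<lambda>x. f x - g x) = pnorm p M (\<lambda>x. g x - f x)"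
  by (simp add: pnorm_def norm_minus_commute)

lemma pnorm_triangle:
  assumes p: "even p" "0 < p" and f: "pint p M f" and g: "pint p M g" and h: "pint p M h"
  shows "pnorm p M (\<lambda>x. f x - h x) \<le> pnorm p M (\<lambda>x. f x - g x) + pnorm p M (\<lambda>x. g x - h x)"
  using pint_add(2)[OF p pint_diff(1)[OF p f g] pint_diff(1)[OF p g h]] by simp

lemma pnorm_triangle_rev:
  assumes p: "even p" "0 < p" and f: "pint p M f" and g: "pint p M g"
  shows "\<bar>pnorm p M f - pnorm p M g\<bar> \<le> pnorm p M (\<lambda>x. f x - g x)"
  using pint_add(2)[OF p pint_diff(1)[OF p f g] g] pint_add(2)[OF p pint_diff(1)[OF p g f] f]
    pnorm_minus_commute[of p M f g] by simp

lemma pnorm_zero_AE: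
  assumes p: "0 < p" and f: "pint p M f" and "pnorm p M f = 0"
  shows "AE x in M. f x = 0"
proof -
  have "(LINT x|M. norm (f x) ^ p) = 0" using assms pnorm_power[OF p, of M f] by (simp add: zero_power)
  then have "AE x in M. norm (f x) ^ p = 0"
    using integral_nonneg_eq_0_iff_AE[OF pint_integrable[OF f]] by simp
  then show ?thesis by eventually_elim (use p in simp)
qed

text \<open>Fatou's lemma for the powers of the norms. It supplies integrability for limits that are
  known only almost everywhere.\<close>

lemma pnorm_fatou:
  assumes p: "0 < p" and f: "f \<in> borel_measurable M" and s: "\<And>n. pint p M (s n)"
    and lim: "AE x in M. (\<lambda>n. s n x) \<longlonglongrightarrow> f x" and C: "\<And>n. pnorm p M (s n) \<le> C"
  shows "pint p M f" "pnorm p M f \<le> C"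
proof -
  have C0: "0 \<le> C" using C[of 0] pnorm_nonneg[of p M "s 0"] by simp
  have *: "(\<integral>\<^sup>+x. ennreal (norm (s n x) ^ p) \<partial>M) \<le> ennreal (C ^ p)" for n
  proof -
    have "(\<integral>\<^sup>+x. ennreal (norm (s n x) ^ p) \<partial>M) = ennreal (pnorm p M (s n) ^ p)"
      unfolding pnorm_power[OF p] by (intro nn_integral_eq_integral pint_integrable[OF s]) auto
    also have "\<dots> \<le> ennreal (C ^ p)" by (intro ennreal_leI power_mono C pnorm_nonneg)
    finally show ?thesis .
  qed
  have "(\<integral>\<^sup>+x. ennreal (norm (f x) ^ p) \<partial>M) = (\<integral>\<^sup>+x. liminf (\<lambda>n. ennreal (norm (s n x) ^ p)) \<partial>M)"
  proof (rule nn_integral_cong_AE)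
    show "AE x in M. ennreal (norm (f x) ^ p) = liminf (\<lambda>n. ennreal (norm (s n x) ^ p))"
      using lim
    proof eventually_elim
      case (elim x)
      then have "(\<lambda>n. ennreal (norm (s n x) ^ p)) \<longlonglongrightarrow> ennreal (norm (f x) ^ p)"
        by (intro tendsto_ennrealI tendsto_intros)
      then show ?case by (rule lim_imp_Liminf[OF trivial_limit_sequentially, symmetric])
    qed
  qed
  also have "\<dots> \<le> liminf (\<lambda>n. \<integral>\<^sup>+x. ennreal (norm (s n x) ^ p) \<partial>M)"
    using pint_measurable[OF s] by (intro nn_integral_liminf) auto
  also have "\<dots> \<le> ennreal (C ^ p)"
    by (rule order_trans[OF Liminf_le_Limsup Limsup_bounded]) (simp_all add: *)
  finally have le: "(\<integral>\<^sup>+x. ennreal (norm (f x) ^ p) \<partial>M) \<le> ennreal (C ^ p)" .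
  show pf: "pint p M f"
    unfolding pint_def integrable_iff_bounded using f le by (auto simp: top.extremum_strict le_less_trans)
  have "ennreal (LINT x|M. norm (f x) ^ p) \<le> ennreal (C ^ p)"
    using le nn_integral_eq_integral[OF pint_integrable[OF pf]] by simp
  then show "pnorm p M f \<le> C" using C0 by (intro pnorm_le p) (auto simp: ennreal_le_iff)
qed

text \<open>The Riesz-Fischer argument: if the increments d_k of a subsequence have norm below
  (1/4)^k, the sum of the terms (2^k |d_k|)^p has finite integral, so almost everywhere the
  increments decay like (1/2)^k.\<close>

lemma pint_complete:
  fixes s :: "nat \<Rightarrow> 'x \<Rightarrow> 'b::euclidean_space"
  assumes p: "even p" "0 < p" and s: "\<And>n. pint p M (s n)"
    and cauchy: "\<And>e. e > 0 \<Longrightarrow> \<exists>N. \<forall>n\<ge>N. \<forall>m\<ge>N. pnorm p M (\<lambda>x. s n x - s m x) < e"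
  shows "\<exists>f r. strict_mono r \<and> pint p M f \<and> (AE x in M. (\<lambda>n. s (r n) x) \<longlonglongrightarrow> f x) \<and>
    (\<lambda>n. pnorm p M (\<lambda>x. s n x - f x)) \<longlonglongrightarrow> 0"
proof -
  have "\<exists>N. \<forall>n\<ge>N. \<forall>m\<ge>N. pnorm p M (\<lambda>x. s n x - s m x) < (1/4) ^ k" for k :: nat
    by (rule cauchy) simp
  then obtain N where N: "\<And>k n m. n \<ge> N k \<Longrightarrow> m \<ge> N k \<Longrightarrow> pnorm p M (\<lambda>x. s n x - s m x) < (1/4) ^ k"
    by metis
  \<comment> \<open>The sum puts \<open>r k\<close> above \<open>N k\<close>, the summand
    \<open>k\<close> makes \<open>r\<close> strictly increasing.\<close>
  define r where "r k = (\<Sum>i\<le>k. N i) + k" for k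
  have r: "strict_mono r" by (intro strict_monoI_Suc) (simp add: r_def)
  have rN: "N k \<le> r k" for k
    using member_le_sum[of k "{..k}" N] by (simp add: r_def)
  define d where "d k x = s (r (Suc k)) x - s (r k) x" for k x
  have dp: "pint p M (d k)" for k unfolding d_def by (rule pint_diff(1)[OF p s s])
  have dn: "pnorm p M (d k) < (1/4) ^ k" for k
    unfolding d_def using rN[of k] strict_monoD[OF r, of k "Suc k"] by (intro N) auto
  define T where "T x = (\<Sum>k. ennreal ((2 ^ k * norm (d k x)) ^ p))" for x
  have Tm: "T \<in> borel_measurable M"
    unfolding T_def using pint_measurable[OF dp] by measurable
  have "(\<integral>\<^sup>+x. T x \<partial>M) = (\<Sum>k. \<integral>\<^sup>+x. ennreal ((2 ^ k * norm (d k x)) ^ p) \<partial>M)"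
    unfolding T_def using pint_measurable[OF dp] by (intro nn_integral_suminf) measurable
  also have "\<dots> \<le> (\<Sum>k. ennreal ((1/2) ^ k))"
  proof (intro suminf_le allI)
    fix k
    have "(\<integral>\<^sup>+x. ennreal ((2 ^ k * norm (d k x)) ^ p) \<partial>M) = ennreal (LINT x|M. (2 ^ k * norm (d k x)) ^ p)"
      using pint_integrable[OF dp[of k]] by (intro nn_integral_eq_integral) (auto simp: power_mult_distrib)
    also have "(LINT x|M. (2 ^ k * norm (d k x)) ^ p) = (2 ^ k * pnorm p M (d k)) ^ p"
      using pnorm_power[OF p(2), of M "d k"] by (simp add: power_mult_distrib)
    also have "\<dots> \<le> (2 ^ k * (1/4) ^ k) ^ p"
      using dn[of k] pnorm_nonneg[of p M "d k"] by (intro power_mono mult_left_mono) auto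
    also have "\<dots> = ((1/2) ^ k) ^ p" by (simp add: power_mult_distrib[symmetric])
    also have "\<dots> \<le> ((1/2) ^ k) ^ 1" using p by (intro power_decreasing) (auto simp: power_le_one)
    finally show "(\<integral>\<^sup>+x. ennreal ((2 ^ k * norm (d k x)) ^ p) \<partial>M) \<le> ennreal ((1/2) ^ k)"
      by (simp add: ennreal_leI)
  qed auto
  also have "\<dots> = ennreal (\<Sum>k. (1/2) ^ k)" by (intro suminf_ennreal2) (auto simp: summable_geometric)
  finally have "(\<integral>\<^sup>+x. T x \<partial>M) \<noteq> \<infinity>" by (auto simp: top_unique)
  then have Tfin: "AE x in M. T x \<noteq> \<infinity>" by (rule nn_integral_PInf_AE[OF Tm])
  have conv: "AE x in M. convergent (\<lambda>n. s (r n) x)"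
    using Tfin
  proof eventually_elim
    case (elim x)
    define C where "C = enn2real (T x)"
    have C: "T x = ennreal C"
      unfolding C_def by (rule ennreal_enn2real[symmetric]) (use elim in \<open>simp only: less_top infinity_ennreal_def\<close>)
    have C0: "0 \<le> C" unfolding C_def by (rule enn2real_nonneg)
    have "norm (d k x) \<le> (C + 1) * (1/2) ^ k" for k
    proof -
      have "(\<Sum>j\<in>{k}. ennreal ((2 ^ j * norm (d j x)) ^ p)) \<le> T x"
        unfolding T_def by (rule sum_le_suminf[OF summableI]) simp_all
      then have "ennreal ((2 ^ k * norm (d k x)) ^ p) \<le> T x"
        by (simp only: sum.insert sum.empty finite.emptyI empty_iff not_False_eq_True add_0_right)
      then have le: "(2 ^ k * norm (d k x)) ^ p \<le> C" unfolding C using C0 by (simp only: ennreal_le_iff)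
      \<comment> \<open>A number above 1 is bounded by its \<open>p\<close>-th power and hence by
        \<open>C\<close>.\<close>
      have "2 ^ k * norm (d k x) \<le> C + 1"
      proof (cases "2 ^ k * norm (d k x) \<le> 1")
        case True
        then show ?thesis using C0 by linarith
      next
        case False
        then show ?thesis using le self_le_power[of "2 ^ k * norm (d k x)" p] p by auto
      qed
      then show ?thesis by (simp add: power_one_over field_simps)
    qed
    then have dle: "\<And>k. norm (d k x) \<le> (C + 1) * (1/2) ^ k" .
    have "summable (\<lambda>k. (C + 1) * (1/2 :: real) ^ k)" by (intro summable_mult summable_geometric) simp
    then have "summable (\<lambda>k. d k x)" by (rule summable_comparison_test') (rule dle)
    then have "convergent (\<lambda>n. \<Sum>k<n. d k x)" by (simp add: summable_iff_convergent)
    then have "convergent (\<lambda>n. s (r 0) x + (\<Sum>k<n. d k x))" by (intro convergent_add convergent_const)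
    moreover have "(\<lambda>n. s (r 0) x + (\<Sum>k<n. d k x)) = (\<lambda>n. s (r n) x)"
      unfolding d_def using sum_lessThan_telescope[of "\<lambda>k. s (r k) x"] by simp
    ultimately show ?case by simp
  qed
  define f where "f x = lim (\<lambda>n. s (r n) x)" for x
  have fm: "f \<in> borel_measurable M"
    unfolding f_def using pint_measurable[OF s] by measurable
  have lim: "AE x in M. (\<lambda>n. s (r n) x) \<longlonglongrightarrow> f x"
    using conv by eventually_elim (simp add: f_def convergent_LIMSEQ_iff)
  \<comment> \<open>Fatou along the subsequence turns the Cauchy estimate into a bound on the
    distance to the limit.\<close>
  have est: "pint p M (\<lambda>x. s n x - f x) \<and> pnorm p M (\<lambda>x. s n x - f x) \<le> (1/4) ^ k" if n: "N k \<le> n" for n k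
  proof -
    define s' where "s' j x = s n x - s (r (j + k)) x" for j x
    have 1: "pint p M (s' j)" for j unfolding s'_def by (rule pint_diff(1)[OF p s s])
    have 2: "AE x in M. (\<lambda>j. s' j x) \<longlonglongrightarrow> s n x - f x"
      using lim
    proof eventually_elim
      case (elim x)
      from tendsto_diff[OF tendsto_const LIMSEQ_ignore_initial_segment[OF this, of k]]
      show ?case by (simp add: s'_def)
    qed
    have "N k \<le> r (j + k)" for j
      using rN[of k] strict_mono_leD[OF r, of k "j + k"] by simp
    then have 3: "pnorm p M (s' j) \<le> (1/4) ^ k" for j
      unfolding s'_def using N[OF n, of "r (j + k)"] by (simp add: less_imp_le)
    have 4: "(\<lambda>x. s n x - f x) \<in> borel_measurable M" using fm pint_measurable[OF s] by measurable
    show ?thesis using pnorm_fatou[OF p(2) 4 1 2 3] by blast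
  qed
  have "pint p M (\<lambda>x. s (N 0) x - (s (N 0) x - f x))"
    by (rule pint_diff(1)[OF p s]) (use est[of 0 "N 0"] in simp)
  then have fp: "pint p M f" by simp
  have "(\<lambda>n. pnorm p M (\<lambda>x. s n x - f x)) \<longlonglongrightarrow> 0"
  proof (rule LIMSEQ_I)
    fix e :: real assume "0 < e"
    then obtain k where k: "(1/4 :: real) ^ k < e" using real_arch_pow_inv[of e "1/4"] by auto
    show "\<exists>no. \<forall>n\<ge>no. norm (pnorm p M (\<lambda>x. s n x - f x) - 0) < e"
    proof (intro exI[of _ "N k"] allI impI)
      fix n assume "N k \<le> n"
      then show "norm (pnorm p M (\<lambda>x. s n x - f x) - 0) < e"
        using est[of k n] k pnorm_nonneg[of p M "\<lambda>x. s n x - f x"] by simp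
    qed
  qed
  then show ?thesis using r fp lim by blast
qed

text \<open>Completeness yields a limit \<open>g\<close> together with an almost everywhere
  convergent subsequence; uniqueness of norm limits identifies \<open>g\<close> with
  \<open>f\<close>.\<close>

lemma pnorm_tendsto_AE_subseq:
  fixes s :: "nat \<Rightarrow> 'x \<Rightarrow> 'b::euclidean_space"
  assumes p: "even p" "0 < p" and s: "\<And>n. pint p M (s n)" and f: "pint p M f"
    and lim: "(\<lambda>n. pnorm p M (\<lambda>x. s n x - f x)) \<longlonglongrightarrow> 0"
  shows "\<exists>r. strict_mono r \<and> (AE x in M. (\<lambda>n. s (r n) x) \<longlonglongrightarrow> f x)"
proof -
  have "\<exists>N. \<forall>n\<ge>N. \<forall>m\<ge>N. pnorm p M (\<lambda>x. s n x - s m x) < e" if "e > 0" for e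
  proof -
    have "\<forall>\<^sub>F n in sequentially. pnorm p M (\<lambda>x. s n x - f x) < e / 2"
      by (rule order_tendstoD(2)[OF lim]) (use \<open>e > 0\<close> in simp)
    then obtain N where N: "\<And>n. n \<ge> N \<Longrightarrow> pnorm p M (\<lambda>x. s n x - f x) < e / 2"
      by (auto simp: eventually_sequentially)
    show ?thesis
    proof (intro exI[of _ N] allI impI)
      fix n m assume "N \<le> n" "N \<le> m"
      then show "pnorm p M (\<lambda>x. s n x - s m x) < e"
        using pnorm_triangle[OF p s f s, of n m] N[of n] N[of m] pnorm_minus_commute[of p M f "s m"] by simp
    qed
  qed
  from pint_complete[of p M s, OF p s this] obtain g r where g: "strict_mono r" "pint p M g"
    "AE x in M. (\<lambda>n. s (r n) x) \<longlonglongrightarrow> g x" "(\<lambda>n. pnorm p M (\<lambda>x. s n x - g x)) \<longlonglongrightarrow> 0" by blast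
  have "pnorm p M (\<lambda>x. g x - f x) \<le> 0"
  proof (rule LIMSEQ_le_const[OF tendsto_add_zero[OF g(4) lim]])
    show "\<exists>N. \<forall>n\<ge>N. pnorm p M (\<lambda>x. g x - f x) \<le> pnorm p M (\<lambda>x. s n x - g x) + pnorm p M (\<lambda>x. s n x - f x)"
      using pnorm_triangle[OF p g(2) s f] pnorm_minus_commute[of p M g] by simp
  qed
  then have "AE x in M. g x - f x = 0"
    using pnorm_nonneg[of p M "\<lambda>x. g x - f x"] by (intro pnorm_zero_AE[OF p(2) pint_diff(1)[OF p g(2) f]]) simp
  with g(3) have "AE x in M. (\<lambda>n. s (r n) x) \<longlonglongrightarrow> f x" by eventually_elim simp
  then show ?thesis using g(1) by blast
qed

text \<open>Cauchy-Schwarz from st \<le> (s^2 + t^2)/2, scaled by numbers \<open>a\<close>,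
  \<open>b\<close> above the two norms that finally decrease to them.\<close>

lemma pint2_inner:
  fixes f g :: "'x \<Rightarrow> 'b::euclidean_space"
  assumes f: "pint 2 M f" and g: "pint 2 M g"
  shows "integrable M (\<lambda>x. f x \<bullet> g x)" "\<bar>LINT x|M. f x \<bullet> g x\<bar> \<le> pnorm 2 M f * pnorm 2 M g"
proof -
  note i = pint_integrable[OF f] pint_integrable[OF g]
  have pw: "\<bar>f x \<bullet> g x\<bar> \<le> a * b * ((norm (f x))\<^sup>2 / a\<^sup>2 + (norm (g x))\<^sup>2 / b\<^sup>2) / 2" if "0 < a" "0 < b" for a b x
  proof -
    have "\<bar>f x \<bullet> g x\<bar> \<le> a * b * ((norm (f x) / a) * (norm (g x) / b))"
      using Cauchy_Schwarz_ineq2[of "f x" "g x"] that by simp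
    also have "\<dots> \<le> a * b * (((norm (f x) / a)\<^sup>2 + (norm (g x) / b)\<^sup>2) / 2)"
      using that sum_squares_bound[of "norm (f x) / a" "norm (g x) / b"]
      by (intro mult_left_mono) (auto simp: ac_simps)
    finally show ?thesis by (simp add: power_divide)
  qed
  have bi: "integrable M (\<lambda>x. a * b * ((norm (f x))\<^sup>2 / a\<^sup>2 + (norm (g x))\<^sup>2 / b\<^sup>2) / 2)" for a b :: real
    using i by auto
  show 1: "integrable M (\<lambda>x. f x \<bullet> g x)"
    by (rule Bochner_Integration.integrable_bound[OF bi[of 1 1]])
      (use pw[of 1 1] pint_measurable[OF f] pint_measurable[OF g] in \<open>auto simp: abs_le_iff\<close>)
  have *: "\<bar>LINT x|M. f x \<bullet> g x\<bar> \<le> a * b" if a: "pnorm 2 M f < a" and b: "pnorm 2 M g < b" for a b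
  proof -
    have ab: "0 < a" "0 < b" using a b pnorm_nonneg[of 2 M f] pnorm_nonneg[of 2 M g] by auto
    have fa: "(LINT x|M. (norm (f x))\<^sup>2) / a\<^sup>2 \<le> 1" "(LINT x|M. (norm (g x))\<^sup>2) / b\<^sup>2 \<le> 1"
      using pnorm_power[of 2 M f] pnorm_power[of 2 M g] ab
        power_mono[OF less_imp_le[OF a] pnorm_nonneg, of 2] power_mono[OF less_imp_le[OF b] pnorm_nonneg, of 2] by auto
    have "\<bar>LINT x|M. f x \<bullet> g x\<bar> \<le> (LINT x|M. \<bar>f x \<bullet> g x\<bar>)" by (rule integral_abs_bound)
    also have "\<dots> \<le> (LINT x|M. a * b * ((norm (f x))\<^sup>2 / a\<^sup>2 + (norm (g x))\<^sup>2 / b\<^sup>2) / 2)"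
      using pw[OF ab] 1 bi by (intro integral_mono) auto
    also have "\<dots> = a * b * ((LINT x|M. (norm (f x))\<^sup>2) / a\<^sup>2 + (LINT x|M. (norm (g x))\<^sup>2) / b\<^sup>2) / 2"
      using i by simp
    also have "\<dots> \<le> a * b * (1 + 1) / 2"
      using ab fa by (intro divide_right_mono mult_left_mono add_mono) auto
    finally show ?thesis by simp
  qed
  have "((\<lambda>e. (pnorm 2 M f + e) * (pnorm 2 M g + e)) \<longlongrightarrow> (pnorm 2 M f + 0) * (pnorm 2 M g + 0)) (at_right 0)"
    by (intro tendsto_intros)
  then show "\<bar>LINT x|M. f x \<bullet> g x\<bar> \<le> pnorm 2 M f * pnorm 2 M g"
    by (intro tendsto_lowerbound[where F = "at_right 0"])
      (auto intro!: * eventually_mono[OF eventually_at_right_less[of 0]])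
qed

subsection \<open>Test functions\<close>

definition tgrad :: "('a::euclidean_space \<Rightarrow> real) \<Rightarrow> 'a \<Rightarrow> 'a" where
  "tgrad \<phi> x = (\<Sum>b\<in>Basis. frechet_derivative \<phi> (at x) b *\<^sub>R b)"

lemma tgrad_derivative:
  assumes "\<phi> \<in> test_functions \<Omega>"
  shows "(\<phi> has_derivative (\<lambda>h. tgrad \<phi> x \<bullet> h)) (at x)"
proof -
  have d: "(\<phi> has_derivative frechet_derivative \<phi> (at x)) (at x)"
    by (rule Ck_Suc_has_derivative[OF test_functionsD(1)[OF assms, of "Suc 0"]])
  interpret linear "frechet_derivative \<phi> (at x)" by (rule has_derivative_linear[OF d])
  have "frechet_derivative \<phi> (at x) h = tgrad \<phi> x \<bullet> h" for h
  proof -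
    have "frechet_derivative \<phi> (at x) h = frechet_derivative \<phi> (at x) (\<Sum>b\<in>Basis. (h \<bullet> b) *\<^sub>R b)"
      by (simp add: euclidean_representation)
    also have "\<dots> = (\<Sum>b\<in>Basis. (h \<bullet> b) * frechet_derivative \<phi> (at x) b)"
      by (simp add: sum scale)
    also have "\<dots> = tgrad \<phi> x \<bullet> h"
      unfolding tgrad_def inner_sum_left by (rule sum.cong) (auto simp: inner_commute mult.commute)
    finally show ?thesis .
  qed
  then have "frechet_derivative \<phi> (at x) = (\<lambda>h. tgrad \<phi> x \<bullet> h)" by blast
  then show ?thesis using d by simp
qed

lemma frechet_eq_tgrad:
  "\<phi> \<in> test_functions \<Omega> \<Longrightarrow> frechet_derivative \<phi> (at x) = (\<lambda>h. tgrad \<phi> x \<bullet> h)"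
  using frechet_derivative_at[OF tgrad_derivative] by metis

lemma tgrad_unique:
  assumes "\<phi> \<in> test_functions \<Omega>" "(\<phi> has_derivative (\<lambda>h. v \<bullet> h)) (at x)"
  shows "tgrad \<phi> x = v"
proof -
  have "(\<lambda>h. tgrad \<phi> x \<bullet> h) = (\<lambda>h. v \<bullet> h)"
    by (rule has_derivative_unique[OF tgrad_derivative[OF assms(1)] assms(2)])
  then have "\<forall>h. tgrad \<phi> x \<bullet> h = v \<bullet> h" by (rule fun_cong[THEN allI])
  then show ?thesis by (simp add: vector_eq_rdot)
qed

lemma tgrad_lincomb:
  assumes "\<phi> \<in> test_functions \<Omega>" "\<psi> \<in> test_functions \<Omega>"
  shows "tgrad (\<lambda>x. a * \<phi> x + b * \<psi> x) x = a *\<^sub>R tgrad \<phi> x + b *\<^sub>R tgrad \<psi> x"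
  by (rule tgrad_unique[OF test_functions_lincomb[OF assms]])
    (auto intro!: derivative_eq_intros tgrad_derivative[OF assms(1)] tgrad_derivative[OF assms(2)]
      simp: inner_add_left)

lemma tgrad_mult:
  assumes "\<phi> \<in> test_functions \<Omega>" "\<psi> \<in> test_functions \<Omega>"
  shows "tgrad (\<lambda>x. \<phi> x * \<psi> x) x = \<phi> x *\<^sub>R tgrad \<psi> x + \<psi> x *\<^sub>R tgrad \<phi> x"
  by (rule tgrad_unique[OF test_functions_mult[OF assms]])
    (auto intro!: derivative_eq_intros tgrad_derivative[OF assms(1)] tgrad_derivative[OF assms(2)]
      simp: inner_add_left)

lemma test_continuous: "\<phi> \<in> test_functions \<Omega> \<Longrightarrow> continuous_on UNIV \<phi>"
  using Ck_continuous[OF test_functionsD(1)] .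

lemma tgrad_continuous:
  assumes "\<phi> \<in> test_functions \<Omega>"
  shows "continuous_on UNIV (tgrad \<phi>)"
  unfolding tgrad_def
  by (intro continuous_on_sum continuous_on_scaleR continuous_on_const
      Ck_continuous[OF Ck_Suc_deriv[OF test_functionsD(1)[OF assms, of "Suc 0"]]])

lemma tgrad_zero_outside:
  assumes "\<phi> \<in> test_functions \<Omega>" "x \<notin> closure {x. \<phi> x \<noteq> 0}"
  shows "tgrad \<phi> x = 0"
proof (rule tgrad_unique[OF assms(1)])
  have "(\<phi> has_derivative (\<lambda>h. 0)) (at x)"
  proof (rule has_derivative_transform_within_open[where f = "\<lambda>_. 0"])
    show "open (- closure {x. \<phi> x \<noteq> 0})" by (rule open_Compl[OF closed_closure])
    show "x \<in> - closure {x. \<phi> x \<noteq> 0}" using assms(2) by simp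
    show "0 = \<phi> y" if "y \<in> - closure {x. \<phi> x \<noteq> 0}" for y
    proof (rule ccontr)
      assume "0 \<noteq> \<phi> y"
      then have "y \<in> {x. \<phi> x \<noteq> 0}" by simp
      then show False using that closure_subset[of "{x. \<phi> x \<noteq> 0}"] by blast
    qed
  qed simp
  then show "(\<phi> has_derivative (\<bullet>) 0) (at x)"
    by (rule has_derivative_eq_rhs) (simp add: fun_eq_iff)
qed

lemma test_zero_outside:
  assumes "\<phi> \<in> test_functions \<Omega>" "x \<notin> \<Omega>"
  shows "\<phi> x = 0" "tgrad \<phi> x = 0"
proof -
  have n: "x \<notin> closure {x. \<phi> x \<noteq> 0}" using test_functionsD(3)[OF assms(1)] assms(2) by blast
  then have "x \<notin> {x. \<phi> x \<noteq> 0}" using closure_subset[of "{x. \<phi> x \<noteq> 0}"] by blast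
  then show "\<phi> x = 0" by simp
  show "tgrad \<phi> x = 0" by (rule tgrad_zero_outside[OF assms(1) n])
qed

lemma continuous_bounded_of_compact_support:
  fixes g :: "'a::euclidean_space \<Rightarrow> 'b::real_normed_vector"
  assumes "compact K" "continuous_on UNIV g" "\<And>x. x \<notin> K \<Longrightarrow> g x = 0"
  shows "\<exists>L\<ge>0. \<forall>x. norm (g x) \<le> L"
proof -
  have "bounded (g ` K)"
    using assms(1,2) compact_continuous_image continuous_on_subset compact_imp_bounded by (metis subset_UNIV)
  then obtain L where L: "\<And>x. x \<in> K \<Longrightarrow> norm (g x) \<le> L" unfolding bounded_iff by blast
  have "norm (g x) \<le> max L 0" for x
    using L[of x] assms(3)[of x] by (cases "x \<in> K") auto
  then show ?thesis by (intro exI[of _ "max L 0"]) auto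
qed

lemma test_bounded:
  fixes \<phi> :: "'a::euclidean_space \<Rightarrow> real"
  assumes "\<phi> \<in> test_functions \<Omega>"
  shows "\<exists>L\<ge>0. \<forall>x. \<bar>\<phi> x\<bar> \<le> L \<and> norm (tgrad \<phi> x) \<le> L"
proof -
  let ?K = "closure {x. \<phi> x \<noteq> 0}"
  have z: "\<phi> x = 0" if "x \<notin> ?K" for x
    using subsetD[OF closure_subset[of "{x. \<phi> x \<noteq> 0}"], of x] that by auto
  have "\<exists>L\<ge>0. \<forall>x. norm (\<phi> x) \<le> L"
    by (rule continuous_bounded_of_compact_support[OF test_functionsD(2)[OF assms] test_continuous[OF assms] z])
  then obtain L1 where L1: "\<And>x. norm (\<phi> x) \<le> L1" by blast
  have "\<exists>L\<ge>0. \<forall>x. norm (tgrad \<phi> x) \<le> L"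
    by (rule continuous_bounded_of_compact_support[OF test_functionsD(2)[OF assms] tgrad_continuous[OF assms]
        tgrad_zero_outside[OF assms]])
  then obtain L2 where L2: "\<And>x. norm (tgrad \<phi> x) \<le> L2" by blast
  show ?thesis
  proof (intro exI[of _ "max 0 (max L1 L2)"] conjI allI)
    fix x
    show "\<bar>\<phi> x\<bar> \<le> max 0 (max L1 L2)" "norm (tgrad \<phi> x) \<le> max 0 (max L1 L2)"
      using L1[of x] L2[of x] by auto
  qed simp
qed

lemma test_support_radius:
  fixes \<phi> :: "'a::euclidean_space \<Rightarrow> real"
  assumes "\<phi> \<in> test_functions \<Omega>"
  shows "\<exists>R>0. \<forall>x. R \<le> norm x \<longrightarrow> \<phi> x = 0 \<and> tgrad \<phi> x = 0"
proof -
  let ?K = "closure {x. \<phi> x \<noteq> 0}"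
  obtain R where R: "R > 0" "\<forall>x\<in>?K. norm x < R"
    using compact_imp_bounded[OF test_functionsD(2)[OF assms]] unfolding bounded_pos_less by auto
  show ?thesis
  proof (intro exI[of _ R] conjI allI impI)
    fix x :: 'a assume "R \<le> norm x"
    then have n: "x \<notin> ?K" using R(2) by force
    show "tgrad \<phi> x = 0" by (rule tgrad_zero_outside[OF assms n])
    show "\<phi> x = 0" using subsetD[OF closure_subset[of "{x. \<phi> x \<noteq> 0}"], of x] n by auto
  qed (rule R(1))
qed

lemma test_measurable:
  assumes "\<phi> \<in> test_functions \<Omega>"
  shows "\<phi> \<in> borel_measurable borel" "tgrad \<phi> \<in> borel_measurable borel"
  using borel_measurable_continuous_onI[OF test_continuous[OF assms]]
    borel_measurable_continuous_onI[OF tgrad_continuous[OF assms]] by auto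

lemma integrable_bounded_support:
  fixes g :: "'a::euclidean_space \<Rightarrow> 'b::{banach, second_countable_topology}"
  assumes "g \<in> borel_measurable borel" "\<And>x. norm (g x) \<le> L" "\<And>x. R \<le> norm x \<Longrightarrow> g x = 0"
  shows "integrable lborel g"
proof (rule Bochner_Integration.integrable_bound[where f = "\<lambda>x. L * indicator (cball 0 R) x"])
  show "integrable lborel (\<lambda>x. L * indicator (cball (0::'a) R) x)"
    using emeasure_lborel_cball_finite[of "0::'a" R] by (intro integrable_mult_right integrable_real_indicator) auto
  show "AE x in lborel. norm (g x) \<le> norm (L * indicator (cball 0 R) x)"
  proof (rule AE_I2)
    fix x :: 'a
    have "0 \<le> L" using assms(2)[of x] norm_ge_zero order_trans by blast
    then show "norm (g x) \<le> norm (L * indicator (cball 0 R) x)"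
      using assms(2)[of x] assms(3)[of x] by (cases "norm x \<le> R") (auto simp: indicator_def)
  qed
qed (use assms(1) in simp)

section \<open>Translations and difference quotients\<close>

lemma lborel_integral_shift:
  fixes g :: "'a::euclidean_space \<Rightarrow> real"
  assumes "g \<in> borel_measurable borel"
  shows "(LINT x|lborel. g (x + c)) = (LINT x|lborel. g x)"
proof -
  have "(LINT x|lborel. g x) = (LINT x|distr lborel borel ((+) c). g x)" by (simp add: lborel_distr_plus)
  also have "\<dots> = (LINT x|lborel. g (c + x))" using assms by (intro integral_distr) auto
  finally show ?thesis by (simp add: add.commute)
qed

lemma nn_integral_lborel_shift:
  fixes g :: "'a::euclidean_space \<Rightarrow> ennreal"
  assumes "g \<in> borel_measurable borel"
  shows "(\<integral>\<^sup>+x. g (x + c) \<partial>lborel) = (\<integral>\<^sup>+x. g x \<partial>lborel)"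
proof -
  have "(\<integral>\<^sup>+x. g x \<partial>lborel) = (\<integral>\<^sup>+x. g x \<partial>distr lborel borel ((+) c))" by (simp add: lborel_distr_plus)
  also have "\<dots> = (\<integral>\<^sup>+x. g (c + x) \<partial>lborel)" using assms by (intro nn_integral_distr) auto
  finally show ?thesis by (simp add: add.commute)
qed

text \<open>A general \<open>F\<close> serves two uses: the identity for integration by parts and
  the square for the translation estimate. The quotients are bounded by a Lipschitz constant times
  \<open>norm h\<close> and vanish outside one ball, which \<open>F 0 = 0\<close> passes on to the
  integrand; dominated convergence applies.\<close>

lemma difference_quotient_limit:
  fixes F :: "real \<Rightarrow> real"
  assumes \<phi>: "\<phi> \<in> test_functions \<Omega>" and F: "continuous_on UNIV F" "F 0 = 0"
  shows "(\<lambda>n. LINT x|lborel. F (real (Suc n) * (\<phi> (x + (1 / real (Suc n)) *\<^sub>R h) - \<phi> x)))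
     \<longlonglongrightarrow> (LINT x|lborel. F (tgrad \<phi> x \<bullet> h))"
proof -
  obtain L where L: "L \<ge> 0" "\<And>x. norm (tgrad \<phi> x) \<le> L" using test_bounded[OF \<phi>] by blast
  obtain R where R: "R > 0" "\<And>x. R \<le> norm x \<Longrightarrow> \<phi> x = 0" using test_support_radius[OF \<phi>] by blast
  define D where "D n x = real (Suc n) * (\<phi> (x + (1 / real (Suc n)) *\<^sub>R h) - \<phi> x)" for n x
  have Db: "\<bar>D n x\<bar> \<le> L * norm h" for n x
  proof -
    have "norm (\<phi> (x + (1 / real (Suc n)) *\<^sub>R h) - \<phi> x) \<le> L * norm ((x + (1 / real (Suc n)) *\<^sub>R h) - x)"
    proof (rule differentiable_bound[of UNIV \<phi> "\<lambda>x h. tgrad \<phi> x \<bullet> h"])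
      show "onorm (\<lambda>h. tgrad \<phi> y \<bullet> h) \<le> L" for y
      proof (rule onorm_le)
        show "norm (tgrad \<phi> y \<bullet> k) \<le> L * norm k" for k
          using Cauchy_Schwarz_ineq2[of "tgrad \<phi> y" k] mult_right_mono[OF L(2)[of y] norm_ge_zero[of k]] by simp
      qed
    qed (use tgrad_derivative[OF \<phi>] in auto)
    then have "\<bar>\<phi> (x + (1 / real (Suc n)) *\<^sub>R h) - \<phi> x\<bar> \<le> L * ((1 / real (Suc n)) * norm h)" by simp
    then have "real (Suc n) * \<bar>\<phi> (x + (1 / real (Suc n)) *\<^sub>R h) - \<phi> x\<bar> \<le> real (Suc n) * (L * ((1 / real (Suc n)) * norm h))"
      by (intro mult_left_mono) auto
    then show ?thesis by (simp add: D_def abs_mult del: of_nat_Suc)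
  qed
  \<comment> \<open>All steps have length at most \<open>norm h\<close>, so one radius works for
    every \<open>n\<close>.\<close>
  have Dz: "D n x = 0" if "R + norm h \<le> norm x" for n x
  proof -
    have "norm ((1 / real (Suc n)) *\<^sub>R h) \<le> 1 * norm h"
      unfolding norm_scaleR by (intro mult_right_mono) auto
    then have "R \<le> norm (x + (1 / real (Suc n)) *\<^sub>R h)"
      using that norm_triangle_ineq2[of x "- ((1 / real (Suc n)) *\<^sub>R h)"] by simp
    moreover have "R \<le> norm x" using that norm_ge_zero[of h] by linarith
    ultimately show ?thesis by (simp add: D_def R(2))
  qed
  have Dl: "(\<lambda>n. D n x) \<longlonglongrightarrow> tgrad \<phi> x \<bullet> h" for x
  proof -
    have "((\<lambda>t. \<phi> (x + t *\<^sub>R h)) has_derivative (\<lambda>t. tgrad \<phi> x \<bullet> (t *\<^sub>R h))) (at 0)"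
    proof (rule has_derivative_compose[where g = \<phi>])
      show "((\<lambda>t. x + t *\<^sub>R h) has_derivative (\<lambda>t. t *\<^sub>R h)) (at 0)"
        by (auto intro!: derivative_eq_intros)
      show "(\<phi> has_derivative (\<lambda>h. tgrad \<phi> x \<bullet> h)) (at (x + 0 *\<^sub>R h))"
        using tgrad_derivative[OF \<phi>] by simp
    qed
    then have "((\<lambda>t. \<phi> (x + t *\<^sub>R h)) has_real_derivative (tgrad \<phi> x \<bullet> h)) (at 0)"
      by (simp add: has_field_derivative_def mult.commute[of _ "tgrad \<phi> x \<bullet> h"])
    then have "((\<lambda>t. (\<phi> (x + t *\<^sub>R h) - \<phi> x) / t) \<longlongrightarrow> tgrad \<phi> x \<bullet> h) (at 0)"
      by (simp add: DERIV_def)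
    moreover have "filterlim (\<lambda>n. 1 / real (Suc n)) (at 0) sequentially"
      using LIMSEQ_Suc[OF lim_1_over_n[where 'a = real]] by (simp add: filterlim_at)
    ultimately have "(\<lambda>n. (\<phi> (x + (1 / real (Suc n)) *\<^sub>R h) - \<phi> x) / (1 / real (Suc n))) \<longlonglongrightarrow> tgrad \<phi> x \<bullet> h"
      by (rule filterlim_compose)
    then show ?thesis by (simp add: D_def mult.commute del: of_nat_Suc)
  qed
  have "bounded (F ` cball 0 (L * norm h))"
    using F(1) compact_continuous_image[of "cball 0 (L * norm h)" F] continuous_on_subset compact_imp_bounded
    by (metis compact_cball subset_UNIV)
  then obtain C where "\<forall>x\<in>cball 0 (L * norm h). \<bar>F x\<bar> \<le> C"
    unfolding bounded_iff by auto
  then have C: "\<bar>F y\<bar> \<le> C" if "\<bar>y\<bar> \<le> L * norm h" for y using that by simp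
  have C0: "0 \<le> C" using C[of 0] L(1) by auto
  have [measurable]: "F \<in> borel_measurable borel" by (rule borel_measurable_continuous_onI[OF F(1)])
  note [measurable] = test_measurable[OF \<phi>]
  have "(\<lambda>n. LINT x|lborel. F (D n x)) \<longlonglongrightarrow> (LINT x|lborel. F (tgrad \<phi> x \<bullet> h))"
  proof (rule integral_dominated_convergence[where w = "\<lambda>x. C * indicator (cball 0 (R + norm h)) x"])
    show "integrable lborel (\<lambda>x. C * indicator (cball (0::'a) (R + norm h)) x)"
      using emeasure_lborel_cball_finite[of "0::'a" "R + norm h"]
      by (intro integrable_mult_right integrable_real_indicator) auto
    show "AE x in lborel. (\<lambda>n. F (D n x)) \<longlonglongrightarrow> F (tgrad \<phi> x \<bullet> h)"
    proof (rule AE_I2)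
      fix x
      have "isCont F (tgrad \<phi> x \<bullet> h)" using F(1) by (simp add: continuous_on_eq_continuous_at)
      then show "(\<lambda>n. F (D n x)) \<longlonglongrightarrow> F (tgrad \<phi> x \<bullet> h)" by (rule isCont_tendsto_compose) (rule Dl)
    qed
    show "AE x in lborel. norm (F (D n x)) \<le> C * indicator (cball 0 (R + norm h)) x" for n
    proof (rule AE_I2)
      fix x
      show "norm (F (D n x)) \<le> C * indicator (cball 0 (R + norm h)) x"
        using C[OF Db[of n x]] Dz[of x n] F(2) C0 by (cases "norm x \<le> R + norm h") (auto simp: indicator_def)
    qed
  qed (auto simp: D_def)
  then show ?thesis by (simp add: D_def)
qed

lemma test_integrable:
  assumes "\<phi> \<in> test_functions \<Omega>"
  shows "integrable lborel \<phi>"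
proof -
  obtain L where L: "\<And>x. \<bar>\<phi> x\<bar> \<le> L" using test_bounded[OF assms] by blast
  obtain R where R: "\<And>x. R \<le> norm x \<Longrightarrow> \<phi> x = 0" using test_support_radius[OF assms] by blast
  show ?thesis by (rule integrable_bounded_support[OF test_measurable(1)[OF assms]]) (use L R in auto)
qed

text \<open>Translation invariance makes the integral of each difference quotient 0, and the limit
  is the integral of the derivative. This stands in for the divergence theorem.\<close>

lemma integral_tgrad_zero:
  assumes \<phi>: "\<phi> \<in> test_functions \<Omega>"
  shows "(LINT x|lborel. tgrad \<phi> x \<bullet> h) = 0"
proof -
  note i = test_integrable[OF \<phi>]
  have sh: "integrable lborel (\<lambda>x. \<phi> (x + c))" for c
  proof -
    have "integrable (distr lborel borel ((+) c)) \<phi>" using i by (simp add: lborel_distr_plus)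
    then have "integrable lborel (\<lambda>x. \<phi> (c + x))"
      using test_measurable(1)[OF \<phi>] by (subst (asm) integrable_distr_eq) auto
    then show ?thesis by (simp add: add.commute)
  qed
  have "(LINT x|lborel. real (Suc n) * (\<phi> (x + (1 / real (Suc n)) *\<^sub>R h) - \<phi> x)) = 0" for n
    using i sh lborel_integral_shift[OF test_measurable(1)[OF \<phi>]] by simp
  then have "(\<lambda>n. 0) \<longlonglongrightarrow> (LINT x|lborel. tgrad \<phi> x \<bullet> h)"
    using difference_quotient_limit[OF \<phi>, of "\<lambda>y. y" h] by simp
  then show ?thesis by (simp add: LIMSEQ_const_iff)
qed

text \<open>Splitting \<open>h\<close> into m equal steps, Cauchy-Schwarz for sums and translation
  invariance give D(h) \<le> m^2 D(h/m). As m grows, the right-hand side tends to the integral of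
  the squared directional derivative.\<close>

lemma translation_estimate:
  assumes \<phi>: "\<phi> \<in> test_functions \<Omega>"
  shows "(LINT x|lborel. (\<phi> (x + h) - \<phi> x)\<^sup>2) \<le> (norm h)\<^sup>2 * (LINT x|lborel. (norm (tgrad \<phi> x))\<^sup>2)"
proof -
  obtain L where L: "L \<ge> 0" "\<And>x. \<bar>\<phi> x\<bar> \<le> L \<and> norm (tgrad \<phi> x) \<le> L" using test_bounded[OF \<phi>] by blast
  obtain R where R: "R > 0" "\<And>x. R \<le> norm x \<Longrightarrow> \<phi> x = 0 \<and> tgrad \<phi> x = 0"
    using test_support_radius[OF \<phi>] by blast
  note [measurable] = test_measurable[OF \<phi>]
  have int: "integrable lborel (\<lambda>x. (\<phi> (x + c) - \<phi> (x + d))\<^sup>2)" for c d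
  proof (rule integrable_bounded_support[where L = "(2 * L)\<^sup>2" and R = "R + norm c + norm d"])
    fix x
    have "\<bar>\<phi> (x + c) - \<phi> (x + d)\<bar> \<le> 2 * L" using L(2)[of "x + c"] L(2)[of "x + d"] by linarith
    then show "norm ((\<phi> (x + c) - \<phi> (x + d))\<^sup>2) \<le> (2 * L)\<^sup>2" using power_mono[of _ "2 * L" 2] by fastforce
    show "(\<phi> (x + c) - \<phi> (x + d))\<^sup>2 = 0" if "R + norm c + norm d \<le> norm x"
    proof -
      have "norm x - norm c \<le> norm (x + c)" "norm x - norm d \<le> norm (x + d)"
        using norm_triangle_ineq2[of x "- c"] norm_triangle_ineq2[of x "- d"] by auto
      then have "R \<le> norm (x + c)" "R \<le> norm (x + d)"
        using that norm_ge_zero[of c] norm_ge_zero[of d] by linarith+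
      then show ?thesis using R(2) by simp
    qed
  qed measurable
  define D where "D k = (LINT x|lborel. (\<phi> (x + k) - \<phi> x)\<^sup>2)" for k
  have D_le: "D h \<le> (real (Suc n))\<^sup>2 * D ((1 / real (Suc n)) *\<^sub>R h)" for n
  proof -
    let ?m = "Suc n"
    define k where "k = (1 / real ?m) *\<^sub>R h"
    have hk: "h = real ?m *\<^sub>R k" by (simp add: k_def del: of_nat_Suc)
    have pw: "(\<phi> (x + h) - \<phi> x)\<^sup>2 \<le> real ?m * (\<Sum>i<?m. (\<phi> (x + real (Suc i) *\<^sub>R k) - \<phi> (x + real i *\<^sub>R k))\<^sup>2)" for x
    proof -
      have "\<phi> (x + h) - \<phi> x = (\<Sum>i<?m. \<phi> (x + real (Suc i) *\<^sub>R k) - \<phi> (x + real i *\<^sub>R k))"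
        using sum_lessThan_telescope[of "\<lambda>i. \<phi> (x + real i *\<^sub>R k)" ?m] hk by simp
      then show ?thesis
        using sum_squared_le_sum_of_squares[of "\<lambda>i. \<phi> (x + real (Suc i) *\<^sub>R k) - \<phi> (x + real i *\<^sub>R k)" "{..<?m}"]
        by (simp add: mult.commute)
    qed
    have "D h \<le> (LINT x|lborel. real ?m * (\<Sum>i<?m. (\<phi> (x + real (Suc i) *\<^sub>R k) - \<phi> (x + real i *\<^sub>R k))\<^sup>2))"
      unfolding D_def
    proof (rule integral_mono)
      show "integrable lborel (\<lambda>x. (\<phi> (x + h) - \<phi> x)\<^sup>2)" using int[of h 0] by simp
      show "integrable lborel (\<lambda>x. real ?m * (\<Sum>i<?m. (\<phi> (x + real (Suc i) *\<^sub>R k) - \<phi> (x + real i *\<^sub>R k))\<^sup>2))"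
        by (intro integrable_mult_right Bochner_Integration.integrable_sum int)
    qed (rule pw)
    also have "\<dots> = real ?m * (\<Sum>i<?m. LINT x|lborel. (\<phi> (x + real (Suc i) *\<^sub>R k) - \<phi> (x + real i *\<^sub>R k))\<^sup>2)"
      by (subst integral_mult_right_zero, subst Bochner_Integration.integral_sum) (auto intro: int simp del: of_nat_Suc)
    also have "\<dots> = real ?m * (\<Sum>i<?m. D k)"
    proof (intro arg_cong[where f = "(*) (real ?m)"] sum.cong refl)
      fix i
      have "(LINT x|lborel. (\<phi> ((x + real i *\<^sub>R k) + k) - \<phi> (x + real i *\<^sub>R k))\<^sup>2) = D k"
        unfolding D_def by (rule lborel_integral_shift[where g = "\<lambda>x. (\<phi> (x + k) - \<phi> x)\<^sup>2"]) measurable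
      then show "(LINT x|lborel. (\<phi> (x + real (Suc i) *\<^sub>R k) - \<phi> (x + real i *\<^sub>R k))\<^sup>2) = D k"
        by (simp add: scaleR_add_left add_ac)
    qed
    also have "\<dots> = (real ?m)\<^sup>2 * D k" by (simp add: power2_eq_square)
    finally show ?thesis unfolding k_def .
  qed
  have "(\<lambda>n. LINT x|lborel. (real (Suc n) * (\<phi> (x + (1 / real (Suc n)) *\<^sub>R h) - \<phi> x))\<^sup>2)
      \<longlonglongrightarrow> (LINT x|lborel. (tgrad \<phi> x \<bullet> h)\<^sup>2)"
    by (rule difference_quotient_limit[OF \<phi>]) (auto intro!: continuous_intros)
  moreover have "(LINT x|lborel. (real (Suc n) * (\<phi> (x + (1 / real (Suc n)) *\<^sub>R h) - \<phi> x))\<^sup>2)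
      = (real (Suc n))\<^sup>2 * D ((1 / real (Suc n)) *\<^sub>R h)" for n
    by (simp add: D_def power_mult_distrib del: of_nat_Suc)
  ultimately have "(\<lambda>n. (real (Suc n))\<^sup>2 * D ((1 / real (Suc n)) *\<^sub>R h)) \<longlonglongrightarrow> (LINT x|lborel. (tgrad \<phi> x \<bullet> h)\<^sup>2)"
    by simp
  then have "D h \<le> (LINT x|lborel. (tgrad \<phi> x \<bullet> h)\<^sup>2)"
    by (rule LIMSEQ_le_const) (use D_le in blast)
  also have "\<dots> \<le> (LINT x|lborel. (norm h)\<^sup>2 * (norm (tgrad \<phi> x))\<^sup>2)"
  proof (rule integral_mono)
    have cs: "\<bar>tgrad \<phi> x \<bullet> h\<bar> \<le> norm h * norm (tgrad \<phi> x)" for x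
      using Cauchy_Schwarz_ineq2[of "tgrad \<phi> x" h] by (simp add: mult.commute)
    show pw: "(tgrad \<phi> x \<bullet> h)\<^sup>2 \<le> (norm h)\<^sup>2 * (norm (tgrad \<phi> x))\<^sup>2" for x
      using power_mono[OF cs[of x], of 2] by (simp add: power_mult_distrib)
    have b: "(norm (tgrad \<phi> x))\<^sup>2 \<le> L\<^sup>2" for x using L(2)[of x] by (intro power_mono) auto
    show "integrable lborel (\<lambda>x. (norm h)\<^sup>2 * (norm (tgrad \<phi> x))\<^sup>2)"
      by (intro integrable_mult_right integrable_bounded_support[where L = "L\<^sup>2" and R = R]) (use R b in auto)
    show "integrable lborel (\<lambda>x. (tgrad \<phi> x \<bullet> h)\<^sup>2)"
    proof (rule integrable_bounded_support[where L = "(norm h)\<^sup>2 * L\<^sup>2" and R = R])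
      show "norm ((tgrad \<phi> x \<bullet> h)\<^sup>2) \<le> (norm h)\<^sup>2 * L\<^sup>2" for x
        using order_trans[OF pw[of x] mult_left_mono[OF b[of x], of "(norm h)\<^sup>2"]] by simp
    qed (use R in auto)
  qed
  finally show ?thesis by (simp add: D_def)
qed

text \<open>A shift of length 2 R moves the support off itself, so the translation difference
  carries twice the squared norm of \<phi>. The translation estimate bounds it by 4 R^2 times the
  squared norm of the gradient.\<close>

lemma test_poincare:
  fixes \<phi> :: "'a::euclidean_space \<Rightarrow> real"
  assumes \<phi>: "\<phi> \<in> test_functions \<Omega>" and R: "0 < R" "\<Omega> \<subseteq> ball 0 R"
  shows "(LINT x|lborel. (\<phi> x)\<^sup>2) \<le> 2 * R\<^sup>2 * (LINT x|lborel. (norm (tgrad \<phi> x))\<^sup>2)"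
proof -
  obtain b :: 'a where b: "b \<in> Basis" using nonempty_Basis by blast
  define h where "h = (2 * R) *\<^sub>R b"
  have nh: "norm h = 2 * R" using b R by (simp add: h_def)
  note [measurable] = test_measurable[OF \<phi>]
  obtain L where L: "\<And>x. \<bar>\<phi> x\<bar> \<le> L" using test_bounded[OF \<phi>] by blast
  have z: "\<phi> x = 0" if "R \<le> norm x" for x
  proof (rule test_zero_outside(1)[OF \<phi>])
    show "x \<notin> \<Omega>" using R(2) that by (force simp: subset_iff)
  qed
  have i: "integrable lborel (\<lambda>x. (\<phi> x)\<^sup>2)"
    by (rule integrable_bounded_support[where L = "L\<^sup>2" and R = R])
      (use L z power_mono[OF L abs_ge_zero, where n = 2] in auto)
  have ih: "integrable lborel (\<lambda>x. (\<phi> (x + h))\<^sup>2)"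
  proof -
    have "integrable (distr lborel borel ((+) h)) (\<lambda>x. (\<phi> x)\<^sup>2)" using i by (simp add: lborel_distr_plus)
    then have "integrable lborel (\<lambda>x. (\<phi> (h + x))\<^sup>2)"
      by (subst (asm) integrable_distr_eq) auto
    then show ?thesis by (simp add: add.commute)
  qed
  have "(\<phi> (x + h) - \<phi> x)\<^sup>2 = (\<phi> (x + h))\<^sup>2 + (\<phi> x)\<^sup>2" for x
  proof -
    \<comment> \<open>Two points at distance 2 R cannot both lie in the open ball of radius
      R.\<close>
    have "norm (x + h) \<ge> R \<or> norm x \<ge> R"
      using norm_triangle_ineq4[of "x + h" x] nh by auto
    then have "\<phi> (x + h) * \<phi> x = 0" using z by auto
    then show ?thesis by (simp add: power2_diff)
  qed
  then have "(LINT x|lborel. (\<phi> (x + h) - \<phi> x)\<^sup>2) = (LINT x|lborel. (\<phi> (x + h))\<^sup>2) + (LINT x|lborel. (\<phi> x)\<^sup>2)"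
    using i ih by simp
  also have "(LINT x|lborel. (\<phi> (x + h))\<^sup>2) = (LINT x|lborel. (\<phi> x)\<^sup>2)"
    by (rule lborel_integral_shift[where g = "\<lambda>x. (\<phi> x)\<^sup>2"]) measurable
  finally show ?thesis using translation_estimate[OF \<phi>, of h] nh by (simp add: power_mult_distrib)
qed

subsection \<open>Averages over dyadic cubes\<close>

text \<open>Half-open dyadic cubes of side (1/2)^k as classes of an equivalence relation: they
  partition the space exactly, and the symmetry of the relation is what Fubini arguments
  exploit.\<close>

definition same_cube :: "nat \<Rightarrow> 'a::euclidean_space \<Rightarrow> 'a \<Rightarrow> bool" where
  "same_cube k x y \<longleftrightarrow> (\<forall>b\<in>Basis. \<lfloor>2 ^ k * (x \<bullet> b)\<rfloor> = \<lfloor>2 ^ k * (y \<bullet> b)\<rfloor>)"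

text \<open>Conditional expectation on the dyadic grid; the prefactor is the reciprocal volume of a
  cube.\<close>

definition cavg :: "nat \<Rightarrow> ('a::euclidean_space \<Rightarrow> real) \<Rightarrow> 'a \<Rightarrow> real" where
  "cavg k f x = (2 ^ k) ^ DIM('a) * (LINT y|lborel. indicator {y. same_cube k x y} y * f y)"

lemma same_cube_refl: "same_cube k x x"
  and same_cube_sym: "same_cube k x y \<Longrightarrow> same_cube k y x"
  by (auto simp: same_cube_def)

lemma cube_eq: "same_cube k x y \<Longrightarrow> {z. same_cube k x z} = {z. same_cube k y z}"
  by (auto simp: same_cube_def)

lemma cavg_same_cube: "same_cube k x y \<Longrightarrow> cavg k f x = cavg k f y"
  by (simp add: cavg_def cube_eq)

text \<open>The grids are nested: halving a number divides its floor by 2 as an integer.\<close>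

lemma same_cube_Suc: "same_cube (Suc k) x y \<Longrightarrow> same_cube k x y"
proof -
  have *: "\<lfloor>2 ^ k * t\<rfloor> = \<lfloor>2 ^ Suc k * t\<rfloor> div 2" for t :: real
    using floor_divide_real_eq_div[of 2 "2 ^ Suc k * t"] by simp
  show "same_cube (Suc k) x y \<Longrightarrow> same_cube k x y"
    unfolding same_cube_def * by metis
qed

definition cube_lo :: "nat \<Rightarrow> 'a::euclidean_space \<Rightarrow> 'a" where
  "cube_lo k x = (\<Sum>b\<in>Basis. (real_of_int \<lfloor>2 ^ k * (x \<bullet> b)\<rfloor> / 2 ^ k) *\<^sub>R b)"

definition cube_hi :: "nat \<Rightarrow> 'a::euclidean_space \<Rightarrow> 'a" where
  "cube_hi k x = cube_lo k x + (1 / 2 ^ k) *\<^sub>R One"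

lemma cube_lo_inner: "b \<in> Basis \<Longrightarrow> cube_lo k x \<bullet> b = real_of_int \<lfloor>2 ^ k * (x \<bullet> b)\<rfloor> / 2 ^ k"
  by (simp add: cube_lo_def)

lemma cube_hi_inner: "b \<in> Basis \<Longrightarrow> cube_hi k x \<bullet> b = (real_of_int \<lfloor>2 ^ k * (x \<bullet> b)\<rfloor> + 1) / 2 ^ k"
  by (simp add: cube_hi_def cube_lo_inner inner_add_left add_divide_distrib)

lemma same_cube_iff:
  "same_cube k x y \<longleftrightarrow> (\<forall>b\<in>Basis. cube_lo k x \<bullet> b \<le> y \<bullet> b \<and> y \<bullet> b < cube_hi k x \<bullet> b)"
proof -
  have "\<lfloor>2 ^ k * (x \<bullet> b)\<rfloor> = \<lfloor>2 ^ k * (y \<bullet> b)\<rfloor> \<longleftrightarrow> cube_lo k x \<bullet> b \<le> y \<bullet> b \<and> y \<bullet> b < cube_hi k x \<bullet> b"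
    if "b \<in> Basis" for b
    unfolding cube_lo_inner[OF that] cube_hi_inner[OF that]
    using floor_eq_iff[of "2 ^ k * (y \<bullet> b)" "\<lfloor>2 ^ k * (x \<bullet> b)\<rfloor>"] by (auto simp: field_simps)
  then show ?thesis unfolding same_cube_def by blast
qed

lemma box_subset_cube: "box (cube_lo k x) (cube_hi k x) \<subseteq> {y. same_cube k x y}"
  by (auto simp: same_cube_iff mem_box less_imp_le)

lemma cube_subset_cbox: "{y. same_cube k x y} \<subseteq> cbox (cube_lo k x) (cube_hi k x)"
  by (auto simp: same_cube_iff mem_box less_imp_le)

lemma same_cube_measurable: "{(x, y). same_cube k x (y::'a::euclidean_space)} \<in> sets (borel \<Otimes>\<^sub>M borel)"
proof -
  have "Measurable.pred (borel \<Otimes>\<^sub>M borel) (\<lambda>p::'a \<times> 'a. \<forall>b\<in>Basis. \<lfloor>2 ^ k * (fst p \<bullet> b)\<rfloor> = \<lfloor>2 ^ k * (snd p \<bullet> b)\<rfloor>)"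
    by measurable
  then show ?thesis
    by (simp add: pred_def same_cube_def case_prod_beta' space_pair_measure)
qed

lemma cube_measurable: "{y. same_cube k x (y::'a::euclidean_space)} \<in> sets borel"
proof -
  have "Measurable.pred borel (\<lambda>y::'a. \<forall>b\<in>Basis. \<lfloor>2 ^ k * (x \<bullet> b)\<rfloor> = \<lfloor>2 ^ k * (y \<bullet> b)\<rfloor>)"
    by measurable
  then show ?thesis by (simp add: pred_def same_cube_def)
qed

lemma emeasure_cube:
  "emeasure lborel {y. same_cube k x (y::'a::euclidean_space)} = ennreal ((1 / 2 ^ k) ^ DIM('a))"
proof -
  have le: "cube_lo k x \<bullet> b \<le> cube_hi k x \<bullet> b" if "b \<in> Basis" for b
    using that by (simp add: cube_lo_inner cube_hi_inner divide_right_mono)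
  have p: "(\<Prod>b\<in>Basis. (cube_hi k x - cube_lo k x) \<bullet> b) = (1 / 2 ^ k) ^ DIM('a)"
    by (simp add: cube_hi_def)
  have "emeasure lborel (box (cube_lo k x) (cube_hi k x)) \<le> emeasure lborel {y. same_cube k x y}"
    using box_subset_cube cube_measurable by (intro emeasure_mono) auto
  moreover have "emeasure lborel {y. same_cube k x y} \<le> emeasure lborel (cbox (cube_lo k x) (cube_hi k x))"
    using cube_subset_cbox by (intro emeasure_mono) auto
  moreover have "emeasure lborel (box (cube_lo k x) (cube_hi k x)) = ennreal ((1 / 2 ^ k) ^ DIM('a))"
    by (subst emeasure_lborel_box[OF le]) (simp_all only: p)
  moreover have "emeasure lborel (cbox (cube_lo k x) (cube_hi k x)) = ennreal ((1 / 2 ^ k) ^ DIM('a))"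
    by (subst emeasure_lborel_cbox[OF le]) (simp_all only: p)
  ultimately show ?thesis by simp
qed

lemma measure_cube: "measure lborel {y. same_cube k x (y::'a::euclidean_space)} = (1 / 2 ^ k) ^ DIM('a)"
  by (simp add: measure_def emeasure_cube)

lemma cube_volume: "(2 ^ k) ^ n * (1 / 2 ^ k) ^ n = (1::real)"
  by (simp add: power_mult_distrib[symmetric])

lemma integrable_cube:
  fixes f :: "'a::euclidean_space \<Rightarrow> real"
  assumes [measurable]: "f \<in> borel_measurable borel" and L: "\<And>x. \<bar>f x\<bar> \<le> L"
  shows "integrable lborel (\<lambda>y. indicator {y. same_cube k x y} y * f y)"
proof (rule Bochner_Integration.integrable_bound[where f = "\<lambda>y. L * indicator {y. same_cube k x y} y"])
  note [measurable] = cube_measurable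
  show "integrable lborel (\<lambda>y. L * indicator {y. same_cube k x y} y)"
    by (intro integrable_mult_right integrable_real_indicator) (auto simp: emeasure_cube)
  show "(\<lambda>y. indicator {y. same_cube k x y} y * f y) \<in> borel_measurable lborel" by measurable
  show "AE y in lborel. norm (indicator {y. same_cube k x y} y * f y) \<le> norm (L * indicator {y. same_cube k x y} y)"
    using L by (intro AE_I2) (auto simp: indicator_def intro: order_trans[OF _ abs_ge_self])
qed

lemma integral_cube_const: "(LINT y|lborel. indicator {y. same_cube k (x::'a::euclidean_space) y} y * c) = (1 / 2 ^ k) ^ DIM('a) * (c::real)"
  by (simp add: measure_cube)

text \<open>The integral over the cube of the squared deviation of \<open>f\<close> from its average
  is nonnegative; expanding the square gives the bound.\<close>

lemma cavg_jensen:
  fixes f :: "'a::euclidean_space \<Rightarrow> real"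
  assumes [measurable]: "f \<in> borel_measurable borel" and L: "\<And>x. \<bar>f x\<bar> \<le> L"
  shows "(cavg k f x)\<^sup>2 \<le> (2 ^ k) ^ DIM('a) * (LINT y|lborel. indicator {y. same_cube k x y} y * (f y)\<^sup>2)"
proof -
  define V :: real where "V = (2 ^ k) ^ DIM('a)"
  define a where "a = cavg k f x"
  define I where "I y = (indicator {y. same_cube k x y} y :: real)" for y
  have L2: "\<bar>(f x)\<^sup>2\<bar> \<le> L\<^sup>2" for x using power_mono[OF L abs_ge_zero, where n = 2] by simp
  have i1: "integrable lborel (\<lambda>y. I y * f y)" unfolding I_def by (rule integrable_cube) (use L in auto)
  have i2: "integrable lborel (\<lambda>y. I y * (f y)\<^sup>2)" unfolding I_def by (rule integrable_cube[OF _ L2]) auto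
  have i3: "integrable lborel (\<lambda>y. I y * a\<^sup>2)" unfolding I_def by (rule integrable_cube[where L = "a\<^sup>2"]) auto
  have 1: "(LINT y|lborel. I y * f y) = a / V" by (simp add: a_def cavg_def I_def V_def)
  have 2: "(LINT y|lborel. I y * a\<^sup>2) = a\<^sup>2 / V"
    unfolding I_def integral_cube_const V_def by (simp add: power_one_over)
  have V: "0 < V" by (simp add: V_def)
  have "0 \<le> (LINT y|lborel. I y * (f y - a)\<^sup>2)" by (intro integral_nonneg_AE AE_I2) (auto simp: I_def)
  also have "(\<lambda>y. I y * (f y - a)\<^sup>2) = (\<lambda>y. I y * (f y)\<^sup>2 - 2 * a * (I y * f y) + I y * a\<^sup>2)"
    by (auto simp: power2_diff algebra_simps)
  also have "(LINT y|lborel. I y * (f y)\<^sup>2 - 2 * a * (I y * f y) + I y * a\<^sup>2)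
      = (LINT y|lborel. I y * (f y)\<^sup>2) - 2 * a * (LINT y|lborel. I y * f y) + (LINT y|lborel. I y * a\<^sup>2)"
    using i1 i2 i3 by simp
  also have "\<dots> = (LINT y|lborel. I y * (f y)\<^sup>2) - a\<^sup>2 / V" unfolding 1 2 by (simp add: power2_eq_square)
  finally have "a\<^sup>2 \<le> V * (LINT y|lborel. I y * (f y)\<^sup>2)" using V by (simp add: field_simps)
  then show ?thesis by (simp add: a_def V_def I_def)
qed

lemma cavg_diff_const:
  fixes f :: "'a::euclidean_space \<Rightarrow> real"
  assumes [measurable]: "f \<in> borel_measurable borel" and L: "\<And>x. \<bar>f x\<bar> \<le> L"
  shows "cavg k (\<lambda>y. c - f y) x = c - cavg k f x"
proof -
  have i1: "integrable lborel (\<lambda>y. indicator {y. same_cube k x y} y * f y)" by (rule integrable_cube) (use L in auto)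
  have i2: "integrable lborel (\<lambda>y. indicator {y. same_cube k x y} y * c)" by (rule integrable_cube[where L = "\<bar>c\<bar>"]) auto
  have "(LINT y|lborel. indicator {y. same_cube k x y} y * (c - f y))
      = (LINT y|lborel. indicator {y. same_cube k x y} y * c) - (LINT y|lborel. indicator {y. same_cube k x y} y * f y)"
    unfolding right_diff_distrib by (rule Bochner_Integration.integral_diff[OF i2 i1])
  then show ?thesis
    using cube_volume[of k "DIM('a)"] unfolding cavg_def integral_cube_const
    by (simp add: right_diff_distrib mult.assoc[symmetric])
qed

lemma cavg_diff:
  fixes f :: "'a::euclidean_space \<Rightarrow> real"
  assumes "integrable lborel f" "integrable lborel g"
  shows "cavg k (\<lambda>y. f y - g y) x = cavg k f x - cavg k g x"
proof -
  note [measurable] = cube_measurable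
  have i: "integrable lborel (\<lambda>y. indicator {y. same_cube k x y} y * h y)" if "integrable lborel h" for h :: "'a \<Rightarrow> real"
    using integrable_mult_indicator[of "{y. same_cube k x y}" lborel h] that by simp
  show ?thesis
    using i[OF assms(1)] i[OF assms(2)] by (simp add: cavg_def right_diff_distrib)
qed

lemma cavg_measurable:
  fixes f :: "'a::euclidean_space \<Rightarrow> real"
  assumes [measurable]: "f \<in> borel_measurable borel"
  shows "cavg k f \<in> borel_measurable borel"
proof -
  note [measurable] = same_cube_measurable
  have "(\<lambda>(x, y). indicator {(x, y). same_cube k x y} (x, y) * f y) \<in> borel_measurable (borel \<Otimes>\<^sub>M lborel)"
    by measurable
  then have "(\<lambda>x. LINT y|lborel. indicator {(x, y). same_cube k x y} (x, y) * f y) \<in> borel_measurable borel"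
    by (rule lborel.borel_measurable_lebesgue_integral)
  moreover have "indicator {(x, y). same_cube k x y} (x, y) = (indicator {y. same_cube k x y} y :: real)" for x y :: 'a
    by (simp add: indicator_def)
  ultimately show ?thesis unfolding cavg_def[abs_def] by simp
qed

text \<open>Covers the average of \<phi>, with \<open>g x = \<phi>\<close>, and the error of the
  average, with \<open>g x y = \<phi> x - \<phi> y\<close>. Both are cube averages of a kernel that
  may depend on the base point; Jensen inside leaves a double integral to be estimated.\<close>

lemma cavg_L2_kernel:
  fixes g :: "'a::euclidean_space \<Rightarrow> 'a \<Rightarrow> real"
  assumes [measurable]: "case_prod g \<in> borel_measurable (borel \<Otimes>\<^sub>M borel)" "u \<in> borel_measurable borel"
    and L: "\<And>x y. \<bar>g x y\<bar> \<le> L" and u: "\<And>x. u x = cavg k (g x) x"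
    and B: "(\<integral>\<^sup>+x. \<integral>\<^sup>+y. ennreal ((2 ^ k) ^ DIM('a) * (indicator {y. same_cube k x y} y * (g x y)\<^sup>2)) \<partial>lborel \<partial>lborel) \<le> ennreal C"
    and C: "0 \<le> C"
  shows "pint 2 lborel u \<and> (pnorm 2 lborel u)\<^sup>2 \<le> C"
proof -
  have gm: "g x \<in> borel_measurable borel" for x by measurable
  have L2: "\<bar>(g x y)\<^sup>2\<bar> \<le> L\<^sup>2" for x y using power_mono[OF L abs_ge_zero, where n = 2] by simp
  have "ennreal ((norm (u x))\<^sup>2) \<le> (\<integral>\<^sup>+y. ennreal ((2 ^ k) ^ DIM('a) * (indicator {y. same_cube k x y} y * (g x y)\<^sup>2)) \<partial>lborel)" for x
  proof -
    have i: "integrable lborel (\<lambda>y. indicator {y. same_cube k x y} y * (g x y)\<^sup>2)"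
      by (rule integrable_cube[OF _ L2]) measurable
    have "ennreal ((norm (u x))\<^sup>2) \<le> ennreal (LINT y|lborel. (2 ^ k) ^ DIM('a) * (indicator {y. same_cube k x y} y * (g x y)\<^sup>2))"
      using cavg_jensen[OF gm L, of k x] by (intro ennreal_leI) (simp add: u)
    also have "\<dots> = (\<integral>\<^sup>+y. ennreal ((2 ^ k) ^ DIM('a) * (indicator {y. same_cube k x y} y * (g x y)\<^sup>2)) \<partial>lborel)"
      using i by (intro nn_integral_eq_integral[symmetric] integrable_mult_right) auto
    finally show ?thesis .
  qed
  then have "(\<integral>\<^sup>+x. ennreal ((norm (u x))\<^sup>2) \<partial>lborel) \<le>
      (\<integral>\<^sup>+x. \<integral>\<^sup>+y. ennreal ((2 ^ k) ^ DIM('a) * (indicator {y. same_cube k x y} y * (g x y)\<^sup>2)) \<partial>lborel \<partial>lborel)"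
    by (intro nn_integral_mono)
  then have le: "(\<integral>\<^sup>+x. ennreal ((norm (u x))\<^sup>2) \<partial>lborel) \<le> ennreal C" using B by (rule order_trans)
  have i: "integrable lborel (\<lambda>x. (norm (u x))\<^sup>2)"
    unfolding integrable_iff_bounded using le by (auto simp: le_less_trans top.extremum_strict)
  then have p: "pint 2 lborel u" by (simp add: pint_def)
  have "ennreal ((pnorm 2 lborel u)\<^sup>2) \<le> ennreal C"
    using le nn_integral_eq_integral[OF i] by (simp add: pnorm_power)
  then show ?thesis using p C by simp
qed

lemma test_pint:
  assumes \<phi>: "\<phi> \<in> test_functions \<Omega>" and p: "0 < p"
  shows "pint p lborel \<phi>" "pint p lborel (tgrad \<phi>)"
proof -
  obtain L where L: "L \<ge> 0" "\<And>x. \<bar>\<phi> x\<bar> \<le> L \<and> norm (tgrad \<phi> x) \<le> L" using test_bounded[OF \<phi>] by blast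
  obtain R where R: "R > 0" "\<And>x. R \<le> norm x \<Longrightarrow> \<phi> x = 0 \<and> tgrad \<phi> x = 0"
    using test_support_radius[OF \<phi>] by blast
  note [measurable] = test_measurable[OF \<phi>]
  have "integrable lborel (\<lambda>x. norm (\<phi> x) ^ p)" "integrable lborel (\<lambda>x. norm (tgrad \<phi> x) ^ p)"
    by (rule integrable_bounded_support[where L = "L ^ p" and R = R]; use L R p in \<open>auto simp: power_mono zero_power\<close>)+
  then show "pint p lborel \<phi>" "pint p lborel (tgrad \<phi>)" by (simp_all add: pint_def)
qed

text \<open>After exchanging the integrals, by symmetry of \<open>same_cube\<close>, each point is
  counted with the volume of its own cube, which cancels the prefactor.\<close>

lemma cavg_L2:
  fixes \<phi> :: "'a::euclidean_space \<Rightarrow> real"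
  assumes \<phi>: "\<phi> \<in> test_functions \<Omega>"
  shows "pint 2 lborel (cavg k \<phi>)" "pnorm 2 lborel (cavg k \<phi>) \<le> pnorm 2 lborel \<phi>"
proof -
  obtain L where L: "L \<ge> 0" "\<And>x. \<bar>\<phi> x\<bar> \<le> L" using test_bounded[OF \<phi>] by blast
  note [measurable] = test_measurable[OF \<phi>] same_cube_measurable cube_measurable
  have p: "pint 2 lborel \<phi>" by (rule test_pint[OF \<phi>]) simp
  let ?V = "(2 ^ k) ^ DIM('a) :: real"
  have ind: "indicator {y. same_cube k x y} y = (indicator {(x, y). same_cube k x y} (x, y) :: real)" for x y :: 'a
    by (simp add: indicator_def)
  have "(\<integral>\<^sup>+x. \<integral>\<^sup>+y. ennreal (?V * (indicator {y. same_cube k x y} y * (\<phi> y)\<^sup>2)) \<partial>lborel \<partial>lborel)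
     = (\<integral>\<^sup>+y. \<integral>\<^sup>+x. ennreal (?V * (indicator {y. same_cube k x y} y * (\<phi> y)\<^sup>2)) \<partial>lborel \<partial>lborel)"
    unfolding ind by (rule lborel_pair.Fubini'[symmetric]) measurable
  also have "\<dots> = (\<integral>\<^sup>+y. ennreal ((norm (\<phi> y))\<^sup>2) \<partial>lborel)"
  proof (rule nn_integral_cong)
    fix y
    have "(\<integral>\<^sup>+x. ennreal (?V * (indicator {y. same_cube k x y} y * (\<phi> y)\<^sup>2)) \<partial>lborel)
        = (\<integral>\<^sup>+x. ennreal (?V * (\<phi> y)\<^sup>2) * indicator {x. same_cube k y x} x \<partial>lborel)"
    proof (rule nn_integral_cong)
      fix x
      show "ennreal (?V * (indicator {y. same_cube k x y} y * (\<phi> y)\<^sup>2)) = ennreal (?V * (\<phi> y)\<^sup>2) * indicator {x. same_cube k y x} x"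
        using same_cube_sym[of k x y] same_cube_sym[of k y x] by (auto simp: indicator_def)
    qed
    also have "\<dots> = ennreal (?V * (\<phi> y)\<^sup>2) * ennreal ((1 / 2 ^ k) ^ DIM('a))"
      by (subst nn_integral_cmult_indicator) (auto simp: emeasure_cube)
    also have "\<dots> = ennreal ((\<phi> y)\<^sup>2 * (?V * (1 / 2 ^ k) ^ DIM('a)))"
      by (simp add: ennreal_mult[symmetric] mult_ac)
    finally show "(\<integral>\<^sup>+x. ennreal (?V * (indicator {y. same_cube k x y} y * (\<phi> y)\<^sup>2)) \<partial>lborel) = ennreal ((norm (\<phi> y))\<^sup>2)"
      unfolding cube_volume by simp
  qed
  also have "\<dots> = ennreal ((pnorm 2 lborel \<phi>)\<^sup>2)"
    unfolding pnorm_power[OF zero_less_numeral]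
    by (rule nn_integral_eq_integral[OF pint_integrable[OF p]]) simp
  finally have B: "(\<integral>\<^sup>+x. \<integral>\<^sup>+y. ennreal (?V * (indicator {y. same_cube k x y} y * (\<phi> y)\<^sup>2)) \<partial>lborel \<partial>lborel)
      \<le> ennreal ((pnorm 2 lborel \<phi>)\<^sup>2)" by simp
  have "pint 2 lborel (cavg k \<phi>) \<and> (pnorm 2 lborel (cavg k \<phi>))\<^sup>2 \<le> (pnorm 2 lborel \<phi>)\<^sup>2"
    by (rule cavg_L2_kernel[where g = "\<lambda>x. \<phi>" and L = L]) (use B L cavg_measurable[OF test_measurable(1)[OF \<phi>]] in auto)
  then show "pint 2 lborel (cavg k \<phi>)" "pnorm 2 lborel (cavg k \<phi>) \<le> pnorm 2 lborel \<phi>"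
    using power2_le_imp_le[OF _ pnorm_nonneg] by auto
qed

text \<open>Points of one cube differ by a vector of the box \<open>?B\<close>. Enlarging the cube
  to all \<open>y\<close> with \<open>y - x\<close> in this box makes the range of the shift
  independent of \<open>x\<close>, so Fubini reduces the claim to the translation estimate for each
  shift. In \<open>c0\<close> the factor \<open>2 ^ DIM('a)\<close> comes from the larger volume and
  \<open>DIM('a)\<close> from the squared length of the shifts.\<close>

lemma cavg_approx:
  fixes \<phi> :: "'a::euclidean_space \<Rightarrow> real"
  assumes \<phi>: "\<phi> \<in> test_functions \<Omega>"
  defines "c0 \<equiv> sqrt (2 ^ DIM('a) * DIM('a))"
  shows "pint 2 lborel (\<lambda>x. \<phi> x - cavg k \<phi> x)"
    "pnorm 2 lborel (\<lambda>x. \<phi> x - cavg k \<phi> x) \<le> c0 * pnorm 2 lborel (tgrad \<phi>) / 2 ^ k"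
proof -
  obtain L where L: "L \<ge> 0" "\<And>x. \<bar>\<phi> x\<bar> \<le> L" using test_bounded[OF \<phi>] by blast
  note [measurable] = test_measurable[OF \<phi>] same_cube_measurable cube_measurable
  let ?V = "(2 ^ k) ^ DIM('a) :: real"
  define s :: real where "s = 1 / 2 ^ k"
  define G where "G = pnorm 2 lborel (tgrad \<phi>)"
  let ?B = "cbox (- (s *\<^sub>R One)) (s *\<^sub>R (One::'a))"
  have s0: "0 < s" by (simp add: s_def)
  have eB: "emeasure lborel ?B = ennreal ((2 * s) ^ DIM('a))"
  proof (subst emeasure_lborel_cbox)
    have "(\<Prod>b\<in>Basis. (s *\<^sub>R One - - (s *\<^sub>R One)) \<bullet> (b::'a)) = (\<Prod>b\<in>(Basis::'a set). 2 * s)"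
      by (rule prod.cong) (auto simp: inner_add_left)
    then show "ennreal (\<Prod>b\<in>Basis. (s *\<^sub>R One - - (s *\<^sub>R One)) \<bullet> (b::'a)) = ennreal ((2 * s) ^ DIM('a))"
      by (simp only: prod_constant)
  qed (use s0 in auto)
  have diff_in: "y - x \<in> ?B" if xy: "same_cube k x y" for x y
  proof -
    have "\<bar>(y - x) \<bullet> b\<bar> \<le> s" if b: "b \<in> Basis" for b
    proof -
      have "cube_lo k x \<bullet> b \<le> y \<bullet> b \<and> y \<bullet> b < cube_hi k x \<bullet> b" "cube_lo k x \<bullet> b \<le> x \<bullet> b \<and> x \<bullet> b < cube_hi k x \<bullet> b"
        using xy same_cube_refl[of k x] b unfolding same_cube_iff by blast+
      moreover have "cube_hi k x \<bullet> b = cube_lo k x \<bullet> b + s" using b by (simp add: cube_hi_def inner_add_left s_def)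
      ultimately show ?thesis by (simp add: inner_diff_left abs_le_iff)
    qed
    then show ?thesis by (simp add: mem_box abs_le_iff) (metis minus_le_iff)
  qed
  have hB: "(norm h)\<^sup>2 \<le> DIM('a) * s\<^sup>2" if "h \<in> ?B" for h
  proof -
    have "(norm h)\<^sup>2 = (\<Sum>b\<in>Basis. (h \<bullet> b)\<^sup>2)"
      unfolding power2_norm_eq_inner by (subst euclidean_inner) (simp add: power2_eq_square)
    also have "\<dots> \<le> (\<Sum>b\<in>(Basis::'a set). s\<^sup>2)"
    proof (rule sum_mono)
      fix b :: 'a assume "b \<in> Basis"
      then have "\<bar>h \<bullet> b\<bar> \<le> s" using that by (auto simp: mem_box abs_le_iff)
      then show "(h \<bullet> b)\<^sup>2 \<le> s\<^sup>2" using power_mono[of "\<bar>h \<bullet> b\<bar>" s 2] by simp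
    qed
    finally show ?thesis by simp
  qed
  have tr: "(\<integral>\<^sup>+x. ennreal ((\<phi> x - \<phi> (x + h))\<^sup>2) \<partial>lborel) \<le> ennreal (DIM('a) * s\<^sup>2 * G\<^sup>2)" if "h \<in> ?B" for h
  proof -
    have i: "integrable lborel (\<lambda>x. (\<phi> x - \<phi> (x + h))\<^sup>2)"
    proof -
      obtain R where R: "R > 0" "\<And>x. R \<le> norm x \<Longrightarrow> \<phi> x = 0" using test_support_radius[OF \<phi>] by blast
      show ?thesis
      proof (rule integrable_bounded_support[where L = "(2 * L)\<^sup>2" and R = "R + norm h"])
        fix x
        have "\<bar>\<phi> x - \<phi> (x + h)\<bar> \<le> 2 * L" using L(2)[of x] L(2)[of "x + h"] by linarith
        then show "norm ((\<phi> x - \<phi> (x + h))\<^sup>2) \<le> (2 * L)\<^sup>2" using power_mono[of "\<bar>\<phi> x - \<phi> (x + h)\<bar>" "2 * L" 2] by simp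
        assume a: "R + norm h \<le> norm x"
        have "norm x - norm h \<le> norm (x + h)" using norm_triangle_ineq2[of x "- h"] by simp
        then have "R \<le> norm (x + h)" "R \<le> norm x" using a norm_ge_zero[of h] by linarith+
        then show "(\<phi> x - \<phi> (x + h))\<^sup>2 = 0" using R(2) by simp
      qed measurable
    qed
    have "(\<integral>\<^sup>+x. ennreal ((\<phi> x - \<phi> (x + h))\<^sup>2) \<partial>lborel) = ennreal (LINT x|lborel. (\<phi> (x + h) - \<phi> x)\<^sup>2)"
      using nn_integral_eq_integral[OF i] by (simp add: power2_commute)
    also have "\<dots> \<le> ennreal ((norm h)\<^sup>2 * G\<^sup>2)"
      using translation_estimate[OF \<phi>, of h] by (intro ennreal_leI) (simp add: G_def pnorm_power)
    also have "\<dots> \<le> ennreal (DIM('a) * s\<^sup>2 * G\<^sup>2)"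
      by (intro ennreal_leI mult_right_mono hB[OF that]) auto
    finally show ?thesis .
  qed
  have "(\<integral>\<^sup>+x. \<integral>\<^sup>+y. ennreal (?V * (indicator {y. same_cube k x y} y * (\<phi> x - \<phi> y)\<^sup>2)) \<partial>lborel \<partial>lborel)
    \<le> (\<integral>\<^sup>+x. \<integral>\<^sup>+y. ennreal (?V * (indicator ?B (y - x) * (\<phi> x - \<phi> y)\<^sup>2)) \<partial>lborel \<partial>lborel)"
    using diff_in by (intro nn_integral_mono ennreal_leI mult_left_mono mult_right_mono) (auto simp: indicator_def)
  also have "\<dots> = (\<integral>\<^sup>+x. \<integral>\<^sup>+h. ennreal (?V * (indicator ?B h * (\<phi> x - \<phi> (x + h))\<^sup>2)) \<partial>lborel \<partial>lborel)"
  proof (rule nn_integral_cong)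
    fix x
    have "(\<integral>\<^sup>+h. ennreal (?V * (indicator ?B ((h + x) - x) * (\<phi> x - \<phi> (h + x))\<^sup>2)) \<partial>lborel)
        = (\<integral>\<^sup>+y. ennreal (?V * (indicator ?B (y - x) * (\<phi> x - \<phi> y)\<^sup>2)) \<partial>lborel)"
      by (rule nn_integral_lborel_shift[where g = "\<lambda>y. ennreal (?V * (indicator ?B (y - x) * (\<phi> x - \<phi> y)\<^sup>2))"]) measurable
    then show "(\<integral>\<^sup>+y. ennreal (?V * (indicator ?B (y - x) * (\<phi> x - \<phi> y)\<^sup>2)) \<partial>lborel)
        = (\<integral>\<^sup>+h. ennreal (?V * (indicator ?B h * (\<phi> x - \<phi> (x + h))\<^sup>2)) \<partial>lborel)"
      by (simp add: add.commute)
  qed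
  also have "\<dots> = (\<integral>\<^sup>+h. \<integral>\<^sup>+x. ennreal (?V * (indicator ?B h * (\<phi> x - \<phi> (x + h))\<^sup>2)) \<partial>lborel \<partial>lborel)"
    by (rule lborel_pair.Fubini'[symmetric]) measurable
  also have "\<dots> \<le> (\<integral>\<^sup>+h. ennreal (?V * (DIM('a) * s\<^sup>2 * G\<^sup>2)) * indicator ?B h \<partial>lborel)"
  proof (rule nn_integral_mono)
    fix h
    have "(\<integral>\<^sup>+x. ennreal (?V * (\<phi> x - \<phi> (x + h))\<^sup>2) \<partial>lborel) \<le> ennreal (?V * (DIM('a) * s\<^sup>2 * G\<^sup>2))" if h: "h \<in> ?B"
    proof -
      have "(\<integral>\<^sup>+x. ennreal (?V * (\<phi> x - \<phi> (x + h))\<^sup>2) \<partial>lborel) = (\<integral>\<^sup>+x. ennreal ?V * ennreal ((\<phi> x - \<phi> (x + h))\<^sup>2) \<partial>lborel)"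
        by (simp add: ennreal_mult)
      also have "\<dots> = ennreal ?V * (\<integral>\<^sup>+x. ennreal ((\<phi> x - \<phi> (x + h))\<^sup>2) \<partial>lborel)"
        by (intro nn_integral_cmult) measurable
      also have "\<dots> \<le> ennreal ?V * ennreal (DIM('a) * s\<^sup>2 * G\<^sup>2)" by (rule mult_left_mono[OF tr[OF h]]) simp
      finally show ?thesis by (simp add: ennreal_mult)
    qed
    then show "(\<integral>\<^sup>+x. ennreal (?V * (indicator ?B h * (\<phi> x - \<phi> (x + h))\<^sup>2)) \<partial>lborel)
        \<le> ennreal (?V * (DIM('a) * s\<^sup>2 * G\<^sup>2)) * indicator ?B h"
      by (cases "h \<in> ?B") (simp_all only: indicator_simps mult_1 mult_1_right mult_zero_left mult_zero_right, simp_all)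
  qed
  also have "\<dots> = ennreal (?V * (DIM('a) * s\<^sup>2 * G\<^sup>2)) * ennreal ((2 * s) ^ DIM('a))"
    by (subst nn_integral_cmult_indicator) (auto simp: eB)
  also have "\<dots> = ennreal (?V * (DIM('a) * s\<^sup>2 * G\<^sup>2) * (2 * s) ^ DIM('a))"
    using s0 by (intro ennreal_mult[symmetric]) auto
  also have "?V * (DIM('a) * s\<^sup>2 * G\<^sup>2) * (2 * s) ^ DIM('a) = (2 ^ DIM('a) * DIM('a) * s\<^sup>2 * G\<^sup>2) * (?V * s ^ DIM('a))"
    by (simp add: power_mult_distrib)
  also have "?V * s ^ DIM('a) = 1" unfolding s_def by (rule cube_volume)
  finally have B: "(\<integral>\<^sup>+x. \<integral>\<^sup>+y. ennreal (?V * (indicator {y. same_cube k x y} y * (\<phi> x - \<phi> y)\<^sup>2)) \<partial>lborel \<partial>lborel)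
      \<le> ennreal (2 ^ DIM('a) * DIM('a) * s\<^sup>2 * G\<^sup>2)" by simp
  have "pint 2 lborel (\<lambda>x. \<phi> x - cavg k \<phi> x) \<and> (pnorm 2 lborel (\<lambda>x. \<phi> x - cavg k \<phi> x))\<^sup>2 \<le> 2 ^ DIM('a) * DIM('a) * s\<^sup>2 * G\<^sup>2"
  proof (rule cavg_L2_kernel[where g = "\<lambda>x y. \<phi> x - \<phi> y" and L = "2 * L"])
    show "(\<lambda>x. \<phi> x - cavg k \<phi> x) \<in> borel_measurable borel" using cavg_measurable[of \<phi> k] by measurable
    show "\<bar>\<phi> x - \<phi> y\<bar> \<le> 2 * L" for x y using L(2)[of x] L(2)[of y] by linarith
    show "\<phi> x - cavg k \<phi> x = cavg k (\<lambda>y. \<phi> x - \<phi> y) x" for x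
      by (rule cavg_diff_const[symmetric, OF test_measurable(1)[OF \<phi>] L(2)])
  qed (use B in \<open>auto simp: case_prod_beta'\<close>)
  moreover have "2 ^ DIM('a) * DIM('a) * s\<^sup>2 * G\<^sup>2 = (c0 * G / 2 ^ k)\<^sup>2"
    by (simp add: c0_def s_def power_mult_distrib power_divide)
  moreover have "0 \<le> c0 * G / 2 ^ k" by (simp add: c0_def G_def pnorm_nonneg)
  ultimately show "pint 2 lborel (\<lambda>x. \<phi> x - cavg k \<phi> x)"
    "pnorm 2 lborel (\<lambda>x. \<phi> x - cavg k \<phi> x) \<le> c0 * pnorm 2 lborel (tgrad \<phi>) / 2 ^ k"
    using power2_le_imp_le[of "pnorm 2 lborel (\<lambda>x. \<phi> x - cavg k \<phi> x)" "c0 * G / 2 ^ k"] G_def by auto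
qed

subsection \<open>Interpolation and compactness for test functions\<close>

lemma pint4_of_bounded:
  fixes u :: "'x \<Rightarrow> real"
  assumes u: "pint 2 M u" and B: "\<And>x. (u x)\<^sup>2 \<le> B"
  shows "pint 4 M u" "pnorm 4 M u ^ 4 \<le> B * (pnorm 2 M u)\<^sup>2"
proof -
  note [measurable] = pint_measurable[OF u]
  have i: "integrable M (\<lambda>x. B * (norm (u x))\<^sup>2)" using pint_integrable[OF u] by simp
  have pw: "norm (u x) ^ 4 \<le> B * (norm (u x))\<^sup>2" for x
    using mult_right_mono[OF B[of x], of "(u x)\<^sup>2"] by (simp add: power4_eq_xxxx power2_eq_square mult.assoc)
  have i4: "integrable M (\<lambda>x. norm (u x) ^ 4)"
  proof (rule Bochner_Integration.integrable_bound[OF i])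
    show "AE x in M. norm (norm (u x) ^ 4) \<le> norm (B * (norm (u x))\<^sup>2)"
      by (rule AE_I2) (use pw in \<open>simp add: order_trans[OF _ abs_ge_self]\<close>)
  qed measurable
  then show "pint 4 M u" by (simp add: pint_def)
  have "(LINT x|M. norm (u x) ^ 4) \<le> (LINT x|M. B * (norm (u x))\<^sup>2)"
    by (rule integral_mono[OF i4 i pw])
  then show "pnorm 4 M u ^ 4 \<le> B * (pnorm 2 M u)\<^sup>2" by (simp add: pnorm_power)
qed

text \<open>An inverse inequality: a value taken on a whole cube of volume 1/V contributes its
  square over V to the squared norm, so the function is bounded pointwise by its own
  \<open>L\<^sup>2\<close> norm.\<close>

lemma pint4_of_cube_constant:
  fixes u :: "'a::euclidean_space \<Rightarrow> real"
  assumes u: "pint 2 lborel u" and const: "\<And>x y. same_cube k x y \<Longrightarrow> u x = u y"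
  shows "pint 4 lborel u" "pnorm 4 lborel u \<le> root 4 ((2 ^ k) ^ DIM('a)) * pnorm 2 lborel u"
proof -
  note [measurable] = pint_measurable[OF u] cube_measurable
  let ?V = "(2 ^ k) ^ DIM('a) :: real"
  have B: "(u x)\<^sup>2 \<le> ?V * (pnorm 2 lborel u)\<^sup>2" for x
  proof -
    have "(1 / 2 ^ k) ^ DIM('a) * (u x)\<^sup>2 = (LINT y|lborel. indicator {y. same_cube k x y} y * (u x)\<^sup>2)"
      by (simp add: measure_cube)
    also have "\<dots> \<le> (LINT y|lborel. (norm (u y))\<^sup>2)"
    proof (rule integral_mono)
      show "integrable lborel (\<lambda>y. indicator {y. same_cube k x y} y * (u x)\<^sup>2)"
        by (rule integrable_cube[where L = "(u x)\<^sup>2"]) auto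
      show "integrable lborel (\<lambda>y. (norm (u y))\<^sup>2)" by (rule pint_integrable[OF u])
      show "indicator {y. same_cube k x y} y * (u x)\<^sup>2 \<le> (norm (u y))\<^sup>2" for y
        using const[of x y] by (auto simp: indicator_def)
    qed
    also have "\<dots> = (pnorm 2 lborel u)\<^sup>2" by (simp add: pnorm_power)
    finally have "?V * ((1 / 2 ^ k) ^ DIM('a) * (u x)\<^sup>2) \<le> ?V * (pnorm 2 lborel u)\<^sup>2"
      by (intro mult_left_mono) auto
    then show ?thesis using cube_volume[of k "DIM('a)"] by (simp add: mult.assoc[symmetric])
  qed
  note b = pint4_of_bounded[OF u B]
  show "pint 4 lborel u" by (rule b(1))
  have "pnorm 4 lborel u ^ 4 \<le> (root 4 ?V * pnorm 2 lborel u) ^ 4"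
    using b(2) by (simp add: power_mult_distrib mult.assoc flip: power_add)
  then show "pnorm 4 lborel u \<le> root 4 ?V * pnorm 2 lborel u"
    by (rule power_le_imp_le_base[of _ 3, simplified]) (simp add: pnorm_nonneg)
qed

lemma test_diff:
  "\<phi> \<in> test_functions \<Omega> \<Longrightarrow> \<psi> \<in> test_functions \<Omega> \<Longrightarrow> (\<lambda>x. \<phi> x - \<psi> x) \<in> test_functions \<Omega>"
  using test_functions_lincomb[of \<phi> \<Omega> \<psi> 1 "-1"] by simp

lemma tgrad_diff:
  "\<phi> \<in> test_functions \<Omega> \<Longrightarrow> \<psi> \<in> test_functions \<Omega> \<Longrightarrow> tgrad (\<lambda>x. \<phi> x - \<psi> x) x = tgrad \<phi> x - tgrad \<psi> x"
  using tgrad_lincomb[of \<phi> \<Omega> \<psi> 1 "-1" x] by simp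

text \<open>On functions that are constant on dyadic cubes the \<open>L\<^sup>4\<close> norm is controlled by the \<open>L\<^sup>2\<close> norm,
  with a loss that in dimension at most 3 is beaten by the gain \<open>2\<^sup>-\<^sup>k\<close> of the approximation. Telescoping
  over the scales therefore gives the Sobolev inequality together with its compactness.\<close>

lemma test_interpolation:
  fixes \<phi> :: "'a::euclidean_space \<Rightarrow> real"
  assumes \<phi>: "\<phi> \<in> test_functions \<Omega>" and dim: "DIM('a) \<le> 3"
  defines "c \<equiv> 4 * sqrt (2 ^ DIM('a) * DIM('a)) / (1 - root 4 (1/2))"
  shows "pnorm 4 lborel \<phi> \<le> root 4 ((2 ^ k) ^ DIM('a)) * pnorm 2 lborel \<phi> + c * root 4 (1/2) ^ k * pnorm 2 lborel (tgrad \<phi>)"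
proof -
  define c0 where "c0 = sqrt (2 ^ DIM('a) * real DIM('a))"
  define G where "G = pnorm 2 lborel (tgrad \<phi>)"
  \<comment> \<open>In dimension 3 the loss 2^(3k/4) and the gain 2^(-k) multiply to \<theta>^k,
    since \<theta>^4 = 1/2.\<close>
  define \<theta> :: real where "\<theta> = root 4 (1/2)"
  have c0: "0 \<le> c0" and G: "0 \<le> G" by (simp_all add: c0_def G_def pnorm_nonneg)
  have \<theta>: "0 < \<theta>" "\<theta> < 1" using real_root_less_mono[of 4 "1/2" 1] by (simp_all add: \<theta>_def)
  have even4: "even (4::nat)" "0 < (4::nat)" and even2: "even (2::nat)" "0 < (2::nat)" by simp_all
  have p\<phi>: "pint 2 lborel \<phi>" "pint 4 lborel \<phi>" using test_pint(1)[OF \<phi>] by auto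
  note avg2 = cavg_L2[OF \<phi>]
  have avg4: "pint 4 lborel (cavg j \<phi>)"
    "pnorm 4 lborel (cavg j \<phi>) \<le> root 4 ((2 ^ j) ^ DIM('a)) * pnorm 2 lborel (cavg j \<phi>)" for j
    by (rule pint4_of_cube_constant[OF avg2(1)], erule cavg_same_cube)+
  \<comment> \<open>The increment between consecutive scales is constant on the finer cubes, so the
    inverse inequality applies to it.\<close>
  define d where "d j x = cavg (Suc j) \<phi> x - cavg j \<phi> x" for j x
  have d2: "pint 2 lborel (d j)" for j unfolding d_def by (rule pint_diff(1)[OF even2 avg2(1) avg2(1)])
  have dc: "d j x = d j y" if "same_cube (Suc j) x y" for j x y
    using cavg_same_cube[OF that] cavg_same_cube[OF same_cube_Suc[OF that]] by (simp add: d_def)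
  have d4: "pint 4 lborel (d j)" "pnorm 4 lborel (d j) \<le> root 4 ((2 ^ Suc j) ^ DIM('a)) * pnorm 2 lborel (d j)" for j
    by (rule pint4_of_cube_constant[OF d2], erule dc)+
  have dn: "pnorm 4 lborel (d j) \<le> 4 * c0 * G * \<theta> ^ j" for j
  proof -
    have "pnorm 2 lborel (d j) \<le> pnorm 2 lborel (\<lambda>x. cavg (Suc j) \<phi> x - \<phi> x) + pnorm 2 lborel (\<lambda>x. \<phi> x - cavg j \<phi> x)"
      unfolding d_def by (rule pnorm_triangle[OF even2 avg2(1) p\<phi>(1) avg2(1)])
    also have "\<dots> \<le> c0 * G / 2 ^ Suc j + c0 * G / 2 ^ j"
    proof -
      have "pnorm 2 lborel (\<lambda>x. \<phi> x - cavg i \<phi> x) \<le> c0 * G / 2 ^ i" for i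
        using cavg_approx(2)[OF \<phi>, of i] by (simp add: c0_def G_def)
      then show ?thesis unfolding pnorm_minus_commute[of 2 lborel "cavg (Suc j) \<phi>"] by (intro add_mono)
    qed
    also have "\<dots> \<le> 2 * c0 * G / 2 ^ j"
      using c0 G by (simp add: field_simps)
    finally have 1: "pnorm 2 lborel (d j) \<le> 2 * c0 * G / 2 ^ j" .
    \<comment> \<open>The bound on the dimension enters here; the factor 2 reached below is a crude
      bound for 2^(3/4).\<close>
    have "root 4 ((2 ^ Suc j) ^ DIM('a)) \<le> root 4 ((2 ^ Suc j) ^ 3)"
      using dim one_le_power[of "2::real" "Suc j"]
      by (intro real_root_le_mono power_increasing) (auto simp del: one_le_power power_Suc)
    also have "\<dots> \<le> 2 * (2 ^ j * \<theta> ^ j)"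
    proof (rule power_le_imp_le_base[of _ 3, simplified])
      have "\<theta> ^ 4 = 1/2" by (simp add: \<theta>_def)
      have "(2 * (2 ^ j * \<theta> ^ j)) ^ 4 = 16 * (16 ^ j * (\<theta> ^ 4) ^ j)"
        by (simp add: power_mult_distrib power_mult[symmetric] mult.commute[of j] power_mult[of 2 4 j, simplified])
      also have "\<dots> = 16 * (16 * (1/2)) ^ j" unfolding \<open>\<theta> ^ 4 = 1/2\<close> power_mult_distrib by simp
      also have "\<dots> = 16 * 8 ^ j" by simp
      finally have e: "(2 * (2 ^ j * \<theta> ^ j)) ^ 4 = 16 * (8::real) ^ j" .
      have "(2 ^ Suc j) ^ 3 = 8 * (8::real) ^ j"
        by (simp add: power_mult_distrib power_mult[symmetric] mult.commute[of j] power_mult[of 2 3 j, simplified])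
      then show "root 4 ((2 ^ Suc j) ^ 3) ^ 4 \<le> (2 * (2 ^ j * \<theta> ^ j)) ^ 4"
        unfolding e by simp
      show "0 \<le> 2 * (2 ^ j * \<theta> ^ j)" using \<theta> by simp
    qed
    finally have 2: "root 4 ((2 ^ Suc j) ^ DIM('a)) \<le> 2 * (2 ^ j * \<theta> ^ j)" .
    have "pnorm 4 lborel (d j) \<le> root 4 ((2 ^ Suc j) ^ DIM('a)) * pnorm 2 lborel (d j)" by (rule d4(2))
    also have "\<dots> \<le> (2 * (2 ^ j * \<theta> ^ j)) * (2 * c0 * G / 2 ^ j)"
      using 1 2 \<theta> by (intro mult_mono) (auto simp: pnorm_nonneg)
    also have "\<dots> = 4 * c0 * G * \<theta> ^ j" by simp
    finally show ?thesis .
  qed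
  have tel: "pnorm 4 lborel (cavg (k + n) \<phi>) \<le> pnorm 4 lborel (cavg k \<phi>) + (\<Sum>j<n. 4 * c0 * G * \<theta> ^ (k + j))" for n
  proof (induction n)
    case (Suc n)
    have "pnorm 4 lborel (cavg (k + Suc n) \<phi>) \<le> pnorm 4 lborel (d (k + n)) + pnorm 4 lborel (cavg (k + n) \<phi>)"
      using pint_add(2)[OF even4 d4(1)[of "k + n"] avg4(1)[of "k + n"]] by (simp add: d_def)
    then show ?case using Suc dn[of "k + n"] by simp
  qed simp
  have geo: "(\<Sum>j<n. 4 * c0 * G * \<theta> ^ (k + j)) \<le> 4 * c0 * G * \<theta> ^ k / (1 - \<theta>)" for n
  proof -
    have "(\<Sum>j<n. \<theta> ^ j) \<le> 1 / (1 - \<theta>)"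
      using sum_le_suminf[of "\<lambda>j. \<theta> ^ j" "{..<n}"] suminf_geometric[of \<theta>] summable_geometric[of \<theta>] \<theta> by simp
    then have "(4 * c0 * G * \<theta> ^ k) * (\<Sum>j<n. \<theta> ^ j) \<le> (4 * c0 * G * \<theta> ^ k) * (1 / (1 - \<theta>))"
      using c0 G \<theta> by (intro mult_left_mono) auto
    then show ?thesis by (simp add: sum_distrib_left power_add mult.assoc)
  qed
  obtain L where L: "L \<ge> 0" "\<And>x. \<bar>\<phi> x\<bar> \<le> L" using test_bounded[OF \<phi>] by blast
  \<comment> \<open>The remainder is bounded by \<open>2 * L\<close> and small in
    \<open>L\<^sup>2\<close>, hence small in \<open>L\<^sup>4\<close>. Its bound depends on
    \<open>L\<close>, which is harmless because it disappears in the limit.\<close>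
  have rem: "pnorm 4 lborel (\<lambda>x. \<phi> x - cavg n \<phi> x) ^ 4 \<le> (2 * L)\<^sup>2 * (c0 * G / 2 ^ n)\<^sup>2" for n
  proof -
    have "\<bar>cavg n \<phi> x\<bar> \<le> L" for x
    proof -
      note [measurable] = test_measurable[OF \<phi>]
      have "(LINT y|lborel. indicator {y. same_cube n x y} y * (\<phi> y)\<^sup>2) \<le> (LINT y|lborel. indicator {y. same_cube n x y} y * L\<^sup>2)"
      proof (rule integral_mono)
        have L2: "\<bar>(\<phi> y)\<^sup>2\<bar> \<le> L\<^sup>2" for y using power_mono[OF L(2) abs_ge_zero, where n = 2] by simp
        show "integrable lborel (\<lambda>y. indicator {y. same_cube n x y} y * (\<phi> y)\<^sup>2)" by (rule integrable_cube[OF _ L2]) measurable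
        show "integrable lborel (\<lambda>y. indicator {y. same_cube n x y} y * L\<^sup>2)" by (rule integrable_cube[where L = "L\<^sup>2"]) auto
        show "indicator {y. same_cube n x y} y * (\<phi> y)\<^sup>2 \<le> indicator {y. same_cube n x y} y * L\<^sup>2" for y
          using L2[of y] by (auto simp: indicator_def)
      qed
      then have "(2 ^ n) ^ DIM('a) * (LINT y|lborel. indicator {y. same_cube n x y} y * (\<phi> y)\<^sup>2)
          \<le> (2 ^ n) ^ DIM('a) * ((1 / 2 ^ n) ^ DIM('a) * L\<^sup>2)"
        unfolding integral_cube_const by (intro mult_left_mono) auto
      with cavg_jensen[OF test_measurable(1)[OF \<phi>] L(2), of n x] have "(cavg n \<phi> x)\<^sup>2 \<le> L\<^sup>2"
        using cube_volume[of n "DIM('a)"] by (simp add: mult.assoc[symmetric])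
      then show ?thesis using L(1) abs_le_square_iff[of "cavg n \<phi> x" L] by simp
    qed
    then have "\<bar>\<phi> x - cavg n \<phi> x\<bar> \<le> 2 * L" for x using L(2)[of x] by (smt (verit))
    then have "(\<phi> x - cavg n \<phi> x)\<^sup>2 \<le> (2 * L)\<^sup>2" for x using power_mono[of "\<bar>\<phi> x - cavg n \<phi> x\<bar>" "2 * L" 2] by simp
    then have "pnorm 4 lborel (\<lambda>x. \<phi> x - cavg n \<phi> x) ^ 4 \<le> (2 * L)\<^sup>2 * (pnorm 2 lborel (\<lambda>x. \<phi> x - cavg n \<phi> x))\<^sup>2"
      by (rule pint4_of_bounded(2)[OF cavg_approx(1)[OF \<phi>]])
    also have "\<dots> \<le> (2 * L)\<^sup>2 * (c0 * G / 2 ^ n)\<^sup>2"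
      using cavg_approx(2)[OF \<phi>, of n] by (intro mult_left_mono power_mono) (auto simp: c0_def G_def pnorm_nonneg)
    finally show ?thesis .
  qed
  have "(\<lambda>n. 2 * L * (c0 * G / 2 ^ n)) \<longlonglongrightarrow> 2 * L * 0"
  proof (rule tendsto_mult_left)
    have "(\<lambda>n. c0 * G * (1/2) ^ n) \<longlonglongrightarrow> c0 * G * 0" by (intro tendsto_mult_left LIMSEQ_realpow_zero) auto
    then show "(\<lambda>n. c0 * G / 2 ^ n) \<longlonglongrightarrow> 0" by (simp add: power_one_over)
  qed
  then have "(\<lambda>n. root 4 ((2 * L * (c0 * G / 2 ^ n))\<^sup>2)) \<longlonglongrightarrow> root 4 (0\<^sup>2)"
    by (intro tendsto_real_root tendsto_power) simp
  then have "(\<lambda>n. root 4 ((2 * L * (c0 * G / 2 ^ n))\<^sup>2)) \<longlonglongrightarrow> 0" by simp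
  from LIMSEQ_ignore_initial_segment[OF this, of k]
  have "(\<lambda>n. pnorm 4 lborel (cavg k \<phi>) + 4 * c0 * G * \<theta> ^ k / (1 - \<theta>) + root 4 ((2 * L * (c0 * G / 2 ^ (n + k)))\<^sup>2))
     \<longlonglongrightarrow> pnorm 4 lborel (cavg k \<phi>) + 4 * c0 * G * \<theta> ^ k / (1 - \<theta>) + 0"
    by (intro tendsto_add tendsto_const)
  moreover have "pnorm 4 lborel \<phi> \<le> pnorm 4 lborel (cavg k \<phi>) + 4 * c0 * G * \<theta> ^ k / (1 - \<theta>) + root 4 ((2 * L * (c0 * G / 2 ^ (n + k)))\<^sup>2)" for n
  proof -
    have "pnorm 4 lborel \<phi> \<le> pnorm 4 lborel (\<lambda>x. \<phi> x - cavg (k + n) \<phi> x) + pnorm 4 lborel (cavg (k + n) \<phi>)"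
      using pint_add(2)[OF even4 pint_diff(1)[OF even4 p\<phi>(2) avg4(1)[of "k + n"]] avg4(1)[of "k + n"]] by simp
    moreover have "pnorm 4 lborel (\<lambda>x. \<phi> x - cavg (k + n) \<phi> x) \<le> root 4 ((2 * L * (c0 * G / 2 ^ (n + k)))\<^sup>2)"
    proof -
      have "(2 * L)\<^sup>2 * (c0 * G / 2 ^ (k + n))\<^sup>2 = (2 * L * (c0 * G / 2 ^ (n + k)))\<^sup>2"
        by (simp only: power_mult_distrib add.commute)
      then have "root 4 (pnorm 4 lborel (\<lambda>x. \<phi> x - cavg (k + n) \<phi> x) ^ 4) \<le> root 4 ((2 * L * (c0 * G / 2 ^ (n + k)))\<^sup>2)"
        using rem[of "k + n"] by (intro real_root_le_mono) (simp_all only: zero_less_numeral)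
      then show ?thesis by (simp only: real_root_power_cancel pnorm_nonneg zero_less_numeral)
    qed
    ultimately show ?thesis using tel[of n] geo[of n] by linarith
  qed
  ultimately have "pnorm 4 lborel \<phi> \<le> pnorm 4 lborel (cavg k \<phi>) + 4 * c0 * G * \<theta> ^ k / (1 - \<theta>) + 0"
    by (intro LIMSEQ_le_const) auto
  moreover have "pnorm 4 lborel (cavg k \<phi>) \<le> root 4 ((2 ^ k) ^ DIM('a)) * pnorm 2 lborel \<phi>"
    by (rule order_trans[OF avg4(2)[of k] mult_left_mono[OF avg2(2)[of k]]]) simp
  ultimately show ?thesis by (simp add: c_def c0_def G_def \<theta>_def mult_ac)
qed

text \<open>At a fixed scale the averages have bounded values and are constant on cubes; a diagonal
  subsequence makes them converge at all scales at once. The gradient bound keeps the functions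
  uniformly close to their averages, so one fine scale decides the Cauchy property.\<close>

lemma test_rellich:
  fixes f :: "nat \<Rightarrow> 'a::euclidean_space \<Rightarrow> real"
  assumes f: "\<And>n. f n \<in> test_functions \<Omega>" and R: "0 < R" "\<Omega> \<subseteq> ball 0 R"
    and M: "\<And>n. pnorm 2 lborel (f n) \<le> M" "\<And>n. pnorm 2 lborel (tgrad (f n)) \<le> M"
  shows "\<exists>r::nat\<Rightarrow>nat. strict_mono r \<and> (\<forall>e>0. \<exists>N. \<forall>n\<ge>N. \<forall>m\<ge>N. pnorm 2 lborel (\<lambda>x. f (r n) x - f (r m) x) < e)"
proof -
  have even2: "even (2::nat)" "0 < (2::nat)" by simp_all
  have M0: "0 \<le> M" using M(1)[of 0] pnorm_nonneg[of 2 lborel "f 0"] by simp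
  \<comment> \<open>Dividing by \<open>V k\<close> gives the averages at all scales the common bound
    \<open>M\<close> that the diagonal extraction asks for.\<close>
  define V where "V k = sqrt ((2 ^ k) ^ DIM('a))" for k :: nat
  have V: "0 < V k" for k by (simp add: V_def)
  have sup: "\<bar>cavg k (f n) x\<bar> \<le> V k * M" for k n x
  proof -
    obtain L where L: "\<And>x. \<bar>f n x\<bar> \<le> L" using test_bounded[OF f] by blast
    note [measurable] = test_measurable[OF f] cube_measurable
    have L2: "\<bar>(f n y)\<^sup>2\<bar> \<le> L\<^sup>2" for y using power_mono[OF L abs_ge_zero, where n = 2] by simp
    have "(LINT y|lborel. indicator {y. same_cube k x y} y * (f n y)\<^sup>2) \<le> (LINT y|lborel. (norm (f n y))\<^sup>2)"
    proof (rule integral_mono)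
      show "integrable lborel (\<lambda>y. indicator {y. same_cube k x y} y * (f n y)\<^sup>2)" by (rule integrable_cube[OF _ L2]) measurable
      show "integrable lborel (\<lambda>y. (norm (f n y))\<^sup>2)" by (rule pint_integrable[OF test_pint(1)[OF f even2(2)]])
    qed (auto simp: indicator_def)
    also have "\<dots> = (pnorm 2 lborel (f n))\<^sup>2" by (simp add: pnorm_power)
    also have "\<dots> \<le> M\<^sup>2" by (intro power_mono M pnorm_nonneg)
    finally have "(2 ^ k) ^ DIM('a) * (LINT y|lborel. indicator {y. same_cube k x y} y * (f n y)\<^sup>2) \<le> (2 ^ k) ^ DIM('a) * M\<^sup>2"
      by (intro mult_left_mono) auto
    with cavg_jensen[OF test_measurable(1)[OF f] L, of k x] have "(cavg k (f n) x)\<^sup>2 \<le> (2 ^ k) ^ DIM('a) * M\<^sup>2"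
      by (rule order_trans)
    then have "(cavg k (f n) x)\<^sup>2 \<le> (V k * M)\<^sup>2" by (simp add: V_def power_mult_distrib)
    then show ?thesis using abs_le_square_iff[of "cavg k (f n) x" "V k * M"] M0 V[of k] by (simp add: abs_mult)
  qed
  \<comment> \<open>Every cube meets the countable dense set \<open>D\<close>, so the values there
    determine the averages everywhere.\<close>
  obtain D :: "'a set" where D: "countable D" "\<And>X. open X \<Longrightarrow> X \<noteq> {} \<Longrightarrow> \<exists>d\<in>D. d \<in> X"
    using countable_dense_exists by blast
  have "\<exists>r::nat\<Rightarrow>nat. strict_mono r \<and>
      (\<forall>p\<in>(UNIV :: nat set) \<times> D. \<exists>l. (\<lambda>n. cavg (fst p) (f (r n)) (snd p) / V (fst p)) \<longlonglongrightarrow> l)"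
  proof (rule function_convergent_subsequence[where S = "(UNIV :: nat set) \<times> D" and M = M
      and f = "\<lambda>n p. cavg (fst p) (f n) (snd p) / V (fst p)"])
    show "countable ((UNIV :: nat set) \<times> D)" using D(1) by (intro countable_SIGMA) auto
    show "norm (cavg (fst p) (f n) (snd p) / V (fst p)) \<le> M" for n and p :: "nat \<times> 'a"
      using sup[of "fst p" n "snd p"] V[of "fst p"] by (simp add: divide_le_eq mult.commute)
    fix r :: "nat \<Rightarrow> nat"
    assume "strict_mono r"
      "\<And>p. p \<in> (UNIV :: nat set) \<times> D \<Longrightarrow> \<exists>l. (\<lambda>n. cavg (fst p) (f (r n)) (snd p) / V (fst p)) \<longlonglongrightarrow> l"
    then show "\<exists>r::nat\<Rightarrow>nat. strict_mono r \<and>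
      (\<forall>p\<in>(UNIV :: nat set) \<times> D. \<exists>l. (\<lambda>n. cavg (fst p) (f (r n)) (snd p) / V (fst p)) \<longlonglongrightarrow> l)"
      by (intro exI[of _ r] conjI ballI)
  qed
  then obtain r :: "nat \<Rightarrow> nat" where r: "strict_mono r"
    "\<forall>p\<in>(UNIV :: nat set) \<times> D. \<exists>l. (\<lambda>n. cavg (fst p) (f (r n)) (snd p) / V (fst p)) \<longlonglongrightarrow> l" by blast
  have conv: "convergent (\<lambda>n. cavg k (f (r n)) x)" for k x
  proof -
    have "(\<Sum>b\<in>Basis. ((cube_lo k x \<bullet> b + cube_hi k x \<bullet> b) / 2) *\<^sub>R b) \<in> box (cube_lo k x) (cube_hi k x)"
      by (simp add: mem_box cube_lo_inner cube_hi_inner field_simps)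
    then obtain x' where x': "x' \<in> D" "x' \<in> box (cube_lo k x) (cube_hi k x)"
      using D(2)[OF open_box] by blast
    then have "same_cube k x x'" using box_subset_cube by blast
    then have e: "cavg k (f (r n)) x = cavg k (f (r n)) x'" for n by (rule cavg_same_cube)
    obtain l where "(\<lambda>n. cavg k (f (r n)) x' / V k) \<longlonglongrightarrow> l" using bspec[OF r(2), of "(k, x')"] x'(1) by auto
    then have "(\<lambda>n. V k * (cavg k (f (r n)) x' / V k)) \<longlonglongrightarrow> V k * l" by (rule tendsto_mult_left)
    then show ?thesis unfolding e convergent_def using V[of k] by auto
  qed
  define P where "P k x = lim (\<lambda>n. cavg k (f (r n)) x)" for k x
  have Pl: "(\<lambda>n. cavg k (f (r n)) x) \<longlonglongrightarrow> P k x" for k x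
    unfolding P_def using conv by (simp add: convergent_LIMSEQ_iff)
  have cm: "cavg k (f n) \<in> borel_measurable borel" for k n by (rule cavg_measurable[OF test_measurable(1)[OF f]])
  have Pm: "P k \<in> borel_measurable borel" for k unfolding P_def by (rule borel_measurable_lim_metric[OF cm])
  have Pb: "\<bar>P k x\<bar> \<le> V k * M" for k x
    by (rule LIMSEQ_le_const2[OF tendsto_rabs[OF Pl]]) (use sup in auto)
  \<comment> \<open>Cubes have side at most 1, hence diameter at most \<open>DIM('a)\<close>; beyond
    this radius the averages vanish.\<close>
  define R' where "R' = R + DIM('a)"
  have cz: "cavg k (f n) x = 0" if x: "R' < norm x" for k n x
  proof -
    have "f n y = 0" if y: "same_cube k x y" for y
    proof (rule test_zero_outside(1)[OF f])
      have "\<bar>(x - y) \<bullet> b\<bar> \<le> 1" if b: "b \<in> Basis" for b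
      proof -
        have "cube_lo k x \<bullet> b \<le> y \<bullet> b \<and> y \<bullet> b < cube_hi k x \<bullet> b" "cube_lo k x \<bullet> b \<le> x \<bullet> b \<and> x \<bullet> b < cube_hi k x \<bullet> b"
          using y same_cube_refl[of k x] b unfolding same_cube_iff by blast+
        moreover have "cube_hi k x \<bullet> b \<le> cube_lo k x \<bullet> b + 1" using b by (simp add: cube_hi_def inner_add_left)
        ultimately show ?thesis by (simp add: inner_diff_left abs_le_iff)
      qed
      then have "norm (x - y) \<le> (\<Sum>b\<in>(Basis::'a set). 1)"
        by (intro order_trans[OF norm_le_l1] sum_mono)
      then have "norm (x - y) \<le> DIM('a)" by simp
      then have "R < norm y" using x norm_triangle_ineq2[of x "x - y"] norm_minus_commute[of x y] by (simp add: R'_def)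
      then show "y \<notin> \<Omega>" using R(2) by (force simp: subset_iff)
    qed
    then have "(\<lambda>y. indicator {y. same_cube k x y} y * f n y) = (\<lambda>y. 0)" by (auto simp: indicator_def fun_eq_iff)
    then show ?thesis by (simp add: cavg_def)
  qed
  have Pz: "P k x = 0" if "R' < norm x" for k x
    using Pl[of k x] cz[OF that] by (simp add: LIMSEQ_const_iff)
  have pn: "(\<lambda>n. pnorm 2 lborel (\<lambda>x. cavg k (f (r n)) x - P k x)) \<longlonglongrightarrow> 0" and Pp: "pint 2 lborel (P k)" for k
  proof -
    note [measurable] = cm Pm
    have "integrable lborel (\<lambda>x. (norm (P k x))\<^sup>2)"
    proof (rule integrable_bounded_support[where L = "(V k * M)\<^sup>2" and R = "R' + 1"])
      show "norm ((norm (P k x))\<^sup>2) \<le> (V k * M)\<^sup>2" for x using power_mono[OF Pb[of k x] abs_ge_zero, of 2] by simp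
    qed (use Pz in auto)
    then show "pint 2 lborel (P k)" by (simp add: pint_def)
    have "(\<lambda>n. LINT x|lborel. (cavg k (f (r n)) x - P k x)\<^sup>2) \<longlonglongrightarrow> (LINT x|(lborel::'a measure). 0)"
    proof (rule integral_dominated_convergence[where w = "\<lambda>x. (2 * (V k * M))\<^sup>2 * indicator (cball 0 R') x"])
      show "integrable lborel (\<lambda>x. (2 * (V k * M))\<^sup>2 * indicator (cball (0::'a) R') x)"
        using emeasure_lborel_cball_finite[of "0::'a" R'] by (intro integrable_mult_right integrable_real_indicator) auto
      show "AE x in lborel. (\<lambda>n. (cavg k (f (r n)) x - P k x)\<^sup>2) \<longlonglongrightarrow> 0"
      proof (rule AE_I2)
        fix x
        have "(\<lambda>n. (cavg k (f (r n)) x - P k x)\<^sup>2) \<longlonglongrightarrow> (P k x - P k x)\<^sup>2"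
          by (intro tendsto_power tendsto_diff Pl tendsto_const)
        then show "(\<lambda>n. (cavg k (f (r n)) x - P k x)\<^sup>2) \<longlonglongrightarrow> 0" by simp
      qed
      show "AE x in lborel. norm ((cavg k (f (r n)) x - P k x)\<^sup>2) \<le> (2 * (V k * M))\<^sup>2 * indicator (cball 0 R') x" for n
      proof (rule AE_I2)
        fix x
        have "\<bar>cavg k (f (r n)) x - P k x\<bar> \<le> 2 * (V k * M)" using sup[of k "r n" x] Pb[of k x] by linarith
        then have "(cavg k (f (r n)) x - P k x)\<^sup>2 \<le> (2 * (V k * M))\<^sup>2"
          using power_mono[of "\<bar>cavg k (f (r n)) x - P k x\<bar>" "2 * (V k * M)" 2] by simp
        then show "norm ((cavg k (f (r n)) x - P k x)\<^sup>2) \<le> (2 * (V k * M))\<^sup>2 * indicator (cball 0 R') x"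
          using cz[of x k "r n"] Pz[of x k] by (cases "norm x \<le> R'") (auto simp: indicator_def)
      qed
    qed auto
    then have "(\<lambda>n. sqrt (LINT x|lborel. (cavg k (f (r n)) x - P k x)\<^sup>2)) \<longlonglongrightarrow> sqrt 0"
      by (intro tendsto_real_sqrt) simp
    then show "(\<lambda>n. pnorm 2 lborel (\<lambda>x. cavg k (f (r n)) x - P k x)) \<longlonglongrightarrow> 0"
      by (simp add: pnorm_def sqrt_def)
  qed
  define c0 where "c0 = sqrt (2 ^ DIM('a) * real DIM('a))"
  show ?thesis
  proof (intro exI[of _ r] conjI r(1) allI impI)
    fix e :: real assume e: "e > 0"
    \<comment> \<open>The scale \<open>k\<close> is fixed first, uniformly in the sequence;
      \<open>N\<close> may depend on it.\<close>
    have "(\<lambda>k. (2 * c0 * M) * (1/2) ^ k) \<longlonglongrightarrow> (2 * c0 * M) * 0" by (intro tendsto_mult_left LIMSEQ_realpow_zero) auto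
    then have "\<forall>\<^sub>F k in sequentially. (2 * c0 * M) * (1/2) ^ k < e / 2"
      by (rule order_tendstoD(2)) (use e in simp)
    then obtain k where k: "(2 * c0 * M) * (1/2) ^ k < e / 2" by (auto simp: eventually_sequentially)
    have "\<forall>\<^sub>F n in sequentially. pnorm 2 lborel (\<lambda>x. cavg k (f (r n)) x - P k x) < e / 4"
      by (rule order_tendstoD(2)[OF pn]) (use e in simp)
    then obtain N where N: "\<And>n. n \<ge> N \<Longrightarrow> pnorm 2 lborel (\<lambda>x. cavg k (f (r n)) x - P k x) < e / 4"
      by (auto simp: eventually_sequentially)
    show "\<exists>N. \<forall>n\<ge>N. \<forall>m\<ge>N. pnorm 2 lborel (\<lambda>x. f (r n) x - f (r m) x) < e"
    proof (intro exI[of _ N] allI impI)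
      fix n m assume nm: "N \<le> n" "N \<le> m"
      define g where "g x = f (r n) x - f (r m) x" for x
      have g: "g \<in> test_functions \<Omega>" unfolding g_def by (rule test_diff[OF f f])
      have cg: "cavg k g x = cavg k (f (r n)) x - cavg k (f (r m)) x" for x
        unfolding g_def by (rule cavg_diff[OF test_integrable[OF f] test_integrable[OF f]])
      have tg: "tgrad g = (\<lambda>x. tgrad (f (r n)) x - tgrad (f (r m)) x)"
        by (rule ext) (simp add: g_def[abs_def] tgrad_diff[OF f f])
      have "pnorm 2 lborel (tgrad g) \<le> pnorm 2 lborel (tgrad (f (r n))) + pnorm 2 lborel (tgrad (f (r m)))"
        using pint_diff(2)[OF even2 test_pint(2)[OF f even2(2)] test_pint(2)[OF f even2(2)], of "r n" "r m"]
        unfolding tg .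
      then have G: "pnorm 2 lborel (tgrad g) \<le> 2 * M" using M(2)[of "r n"] M(2)[of "r m"] by linarith
      have "pnorm 2 lborel (\<lambda>x. g x - cavg k g x) \<le> c0 * pnorm 2 lborel (tgrad g) / 2 ^ k"
        using cavg_approx(2)[OF g, of k] by (simp add: c0_def)
      also have "\<dots> \<le> c0 * (2 * M) / 2 ^ k"
        using G by (intro divide_right_mono mult_left_mono) (auto simp: c0_def)
      also have "\<dots> = (2 * c0 * M) * (1/2) ^ k" by (simp add: power_one_over)
      finally have 1: "pnorm 2 lborel (\<lambda>x. g x - cavg k g x) < e / 2" using k by linarith
      have cg': "cavg k g = (\<lambda>x. cavg k (f (r n)) x - cavg k (f (r m)) x)" by (rule ext) (rule cg)
      have "pnorm 2 lborel (cavg k g) \<le> pnorm 2 lborel (\<lambda>x. cavg k (f (r n)) x - P k x) + pnorm 2 lborel (\<lambda>x. P k x - cavg k (f (r m)) x)"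
        unfolding cg' by (rule pnorm_triangle[OF even2 cavg_L2(1)[OF f] Pp cavg_L2(1)[OF f]])
      then have 2: "pnorm 2 lborel (cavg k g) < e / 2"
        using N[OF nm(1)] N[OF nm(2)] pnorm_minus_commute[of 2 lborel "P k" "cavg k (f (r m))"] by simp
      have "pnorm 2 lborel g \<le> pnorm 2 lborel (\<lambda>x. g x - cavg k g x) + pnorm 2 lborel (cavg k g)"
        using pint_add(2)[OF even2 cavg_approx(1)[OF g] cavg_L2(1)[OF g], of k k] by simp
      then show "pnorm 2 lborel (\<lambda>x. f (r n) x - f (r m) x) < e" using 1 2 by (simp add: g_def[abs_def])
    qed
  qed
qed

subsection \<open>Weak gradients\<close>

lemma Lp2_iff: "u \<in> Lp 2 \<Omega> \<longleftrightarrow> pint 2 (lebesgue_on \<Omega>) u"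
  by (simp add: Lp_def pint_def)

lemma Lp4_iff: "u \<in> Lp 4 \<Omega> \<longleftrightarrow> pint 4 (lebesgue_on \<Omega>) u"
  by (simp add: Lp_def pint_def)

lemma Lp_norm_4: "Lp_norm 4 \<Omega> u = pnorm 4 (lebesgue_on \<Omega>) u"
proof -
  have "root 4 y = y powr (1/4)" if "0 \<le> y" for y :: real
    using that root_powr_inverse[of 4 y] by (cases "y = 0") auto
  then show ?thesis by (simp add: Lp_norm_def pnorm_def)
qed

text \<open>Integrals of functions supported in the domain move to the whole space, where
  translations act.\<close>

lemma lborel_to_lebesgue_on:
  fixes g :: "'a::euclidean_space \<Rightarrow> real"
  assumes \<Omega>: "open \<Omega>" and g: "g \<in> borel_measurable borel" and z: "\<And>x. x \<notin> \<Omega> \<Longrightarrow> g x = 0"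
  shows "integrable (lebesgue_on \<Omega>) g \<longleftrightarrow> integrable lborel g"
    "(LINT x|lebesgue_on \<Omega>. g x) = (LINT x|lborel. g x)"
proof -
  have e: "(\<lambda>x. indicator \<Omega> x *\<^sub>R g x) = g" using z by (auto simp: fun_eq_iff indicator_def)
  have m: "g \<in> borel_measurable lborel" using g by simp
  have "\<Omega> \<inter> space lebesgue \<in> sets lebesgue" using \<Omega> by auto
  then show "integrable (lebesgue_on \<Omega>) g \<longleftrightarrow> integrable lborel g"
    "(LINT x|lebesgue_on \<Omega>. g x) = (LINT x|lborel. g x)"
    using integrable_restrict_space[of \<Omega> lebesgue g] integral_restrict_space[of \<Omega> lebesgue g]
      integrable_completion[OF m] integral_completion[OF m] by (simp_all only: e)
qed

lemma borel_measurable_lebesgue_on: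
  fixes f :: "'a::euclidean_space \<Rightarrow> 'b::topological_space"
  assumes "f \<in> borel_measurable borel"
  shows "f \<in> borel_measurable (lebesgue_on S)"
proof -
  have "f \<in> borel_measurable lborel" using assms by simp
  then have "f \<in> borel_measurable lebesgue" by (rule measurable_completion)
  then show ?thesis by (rule measurable_restrict_space1)
qed

lemma test_pnorm_lebesgue_on:
  assumes \<Omega>: "open \<Omega>" and \<phi>: "\<phi> \<in> test_functions \<Omega>" and p: "0 < p"
  shows "pint p (lebesgue_on \<Omega>) \<phi>" "pint p (lebesgue_on \<Omega>) (tgrad \<phi>)"
    "pnorm p (lebesgue_on \<Omega>) \<phi> = pnorm p lborel \<phi>"
    "pnorm p (lebesgue_on \<Omega>) (tgrad \<phi>) = pnorm p lborel (tgrad \<phi>)"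
proof -
  note [measurable] = test_measurable[OF \<phi>]
  have m: "(\<lambda>x. norm (\<phi> x) ^ p) \<in> borel_measurable borel" "(\<lambda>x. norm (tgrad \<phi> x) ^ p) \<in> borel_measurable borel"
    by measurable
  have z: "norm (\<phi> x) ^ p = 0" "norm (tgrad \<phi> x) ^ p = 0" if "x \<notin> \<Omega>" for x
    using test_zero_outside[OF \<phi> that] p by (simp_all add: zero_power)
  note l = lborel_to_lebesgue_on[OF \<Omega> m(1) z(1)] lborel_to_lebesgue_on[OF \<Omega> m(2) z(2)]
  show "pint p (lebesgue_on \<Omega>) \<phi>" "pint p (lebesgue_on \<Omega>) (tgrad \<phi>)"
    using l(1,3) test_pint[OF \<phi> p] test_measurable[OF \<phi>, THEN borel_measurable_lebesgue_on]
    by (simp_all add: pint_def)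
  show "pnorm p (lebesgue_on \<Omega>) \<phi> = pnorm p lborel \<phi>"
    "pnorm p (lebesgue_on \<Omega>) (tgrad \<phi>) = pnorm p lborel (tgrad \<phi>)"
    using l(2,4) by (simp_all add: pnorm_def)
qed

text \<open>On a compact set |f| is dominated by the integrable function 1 + |f|^2.\<close>

lemma L2_L1_loc:
  fixes f :: "'a::euclidean_space \<Rightarrow> 'b::euclidean_space"
  assumes \<Omega>: "open \<Omega>" and f: "pint 2 (lebesgue_on \<Omega>) f"
  shows "f \<in> L1_loc \<Omega>"
  unfolding L1_loc_def mem_Collect_eq
proof (intro allI impI, elim conjE)
  fix K assume K: "compact K" "K \<subseteq> \<Omega>"
  have Km: "K \<in> sets lebesgue" using K(1) by (simp add: lmeasurable_compact fmeasurableD)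
  have \<Omega>m: "\<Omega> \<inter> space lebesgue \<in> sets lebesgue" using \<Omega> by auto
  have i: "integrable lebesgue (\<lambda>x. indicator \<Omega> x *\<^sub>R (norm (f x))\<^sup>2)"
    using pint_integrable[OF f] integrable_restrict_space[OF \<Omega>m, of "\<lambda>x. (norm (f x))\<^sup>2"] by simp
  have m: "(\<lambda>x. indicator \<Omega> x *\<^sub>R f x) \<in> borel_measurable lebesgue"
    using pint_measurable[OF f] borel_measurable_restrict_space_iff[OF \<Omega>m, of f] by simp
  have "integrable lebesgue (\<lambda>x. indicator K x *\<^sub>R f x)"
  proof (rule Bochner_Integration.integrable_bound)
    show "integrable lebesgue (\<lambda>x. indicator K x + indicator \<Omega> x *\<^sub>R (norm (f x))\<^sup>2)"
      using K(1) i Km lmeasurable_compact[OF K(1)]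
      by (intro Bochner_Integration.integrable_add integrable_real_indicator) (auto simp: fmeasurable_def)
    have "(\<lambda>x. indicator K x *\<^sub>R (indicator \<Omega> x *\<^sub>R f x)) \<in> borel_measurable lebesgue"
      by (rule borel_measurable_scaleR[OF borel_measurable_indicator[OF Km] m])
    moreover have "(\<lambda>x. indicator K x *\<^sub>R (indicator \<Omega> x *\<^sub>R f x)) = (\<lambda>x. indicator K x *\<^sub>R f x)"
      using K(2) by (auto simp: indicator_def fun_eq_iff)
    ultimately show "(\<lambda>x. indicator K x *\<^sub>R f x) \<in> borel_measurable lebesgue" by simp
    show "AE x in lebesgue. norm (indicator K x *\<^sub>R f x) \<le> norm (indicator K x + indicator \<Omega> x *\<^sub>R (norm (f x))\<^sup>2)"
    proof (rule AE_I2)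
      fix x
      have "norm (f x) \<le> 1 + (norm (f x))\<^sup>2"
      proof -
        have "2 * norm (f x) \<le> (norm (f x))\<^sup>2 + 1" using sum_squares_bound[of "norm (f x)" 1] by simp
        then show ?thesis using norm_ge_zero[of "f x"] by linarith
      qed
      moreover have "0 \<le> indicator \<Omega> x *\<^sub>R (norm (f x))\<^sup>2" by simp
      ultimately show "norm (indicator K x *\<^sub>R f x) \<le> norm (indicator K x + indicator \<Omega> x *\<^sub>R (norm (f x))\<^sup>2)"
        using K(2) by (cases "x \<in> K") (auto simp: indicator_def)
    qed
  qed
  then show "integrable (lebesgue_on K) f" using Km integrable_restrict_space[of K lebesgue f] by simp
qed

text \<open>\<open>L1_loc\<close> speaks only of compact subsets; exhausting the open set by them
  recovers measurability as a pointwise limit. This matters for \<open>weak_grad\<close>, about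
  which the choice operator reveals only the properties in \<open>is_weak_grad\<close>.\<close>

lemma L1_loc_measurable:
  fixes f :: "'a::euclidean_space \<Rightarrow> 'b::euclidean_space"
  assumes \<Omega>: "open \<Omega>" and f: "f \<in> L1_loc \<Omega>"
  shows "f \<in> borel_measurable (lebesgue_on \<Omega>)"
proof -
  obtain C :: "nat \<Rightarrow> 'a set" where C: "\<And>n. compact (C n)" "\<And>n. C n \<subseteq> \<Omega>" "\<Union>(range C) = \<Omega>"
    "\<And>K. compact K \<Longrightarrow> K \<subseteq> \<Omega> \<Longrightarrow> \<exists>N. \<forall>n\<ge>N. K \<subseteq> C n"
    using open_Union_compact_subsets[OF \<Omega>] by metis
  have \<Omega>m: "\<Omega> \<inter> space lebesgue \<in> sets lebesgue" using \<Omega> by auto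
  have "(\<lambda>x. indicator \<Omega> x *\<^sub>R f x) \<in> borel_measurable lebesgue"
  proof (rule borel_measurable_LIMSEQ_metric)
    show "(\<lambda>x. indicator (C n) x *\<^sub>R f x) \<in> borel_measurable lebesgue" for n
      using integrable_lebesgue_on_compact_support[OF f C(1,2)] by (rule borel_measurable_integrable)
    show "(\<lambda>n. indicator (C n) x *\<^sub>R f x) \<longlonglongrightarrow> indicator \<Omega> x *\<^sub>R f x" for x
    proof (cases "x \<in> \<Omega>")
      case True
      then obtain N where N: "\<And>n. n \<ge> N \<Longrightarrow> x \<in> C n" using C(4)[of "{x}"] by auto
      then have "\<forall>\<^sub>F n in sequentially. indicator \<Omega> x *\<^sub>R f x = indicator (C n) x *\<^sub>R f x"
        using True by (intro eventually_sequentiallyI[of N]) (simp add: indicator_def)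
      then show ?thesis by (rule Lim_transform_eventually[OF tendsto_const])
    next
      case False
      then have "x \<notin> C n" for n using C(2) by blast
      then show ?thesis using False by simp
    qed
  qed
  then show ?thesis using borel_measurable_restrict_space_iff[OF \<Omega>m, of f] by simp
qed

lemma L1_loc_lincomb:
  fixes f g :: "'a::euclidean_space \<Rightarrow> 'b::euclidean_space"
  assumes "f \<in> L1_loc \<Omega>" "g \<in> L1_loc \<Omega>"
  shows "(\<lambda>x. a *\<^sub>R f x + b *\<^sub>R g x) \<in> L1_loc \<Omega>"
  using assms by (auto simp: L1_loc_def)

lemma L1_loc_inner:
  fixes f :: "'a::euclidean_space \<Rightarrow> 'b::euclidean_space"
  assumes "f \<in> L1_loc \<Omega>"
  shows "(\<lambda>x. f x \<bullet> b) \<in> L1_loc \<Omega>"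
  using assms by (auto simp: L1_loc_def)

lemma L1_loc_mult_integrable:
  fixes v g :: "'a::euclidean_space \<Rightarrow> real"
  assumes \<Omega>: "open \<Omega>" and v: "v \<in> L1_loc \<Omega>" and K: "compact K" "K \<subseteq> \<Omega>"
    and g: "g \<in> borel_measurable borel" "\<And>x. \<bar>g x\<bar> \<le> L" "\<And>x. x \<notin> K \<Longrightarrow> g x = 0"
  shows "integrable (lebesgue_on \<Omega>) (\<lambda>x. v x * g x)"
proof -
  have i: "integrable lebesgue (\<lambda>x. indicator K x *\<^sub>R v x)"
    by (rule integrable_lebesgue_on_compact_support[OF v K])
  have "g \<in> borel_measurable lborel" using g(1) by simp
  then have gm: "g \<in> borel_measurable lebesgue" by (rule measurable_completion)
  have "integrable lebesgue (\<lambda>x. indicator K x *\<^sub>R v x * g x)"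
  proof (rule Bochner_Integration.integrable_bound[where f = "\<lambda>x. L * \<bar>indicator K x *\<^sub>R v x\<bar>"])
    show "integrable lebesgue (\<lambda>x. L * \<bar>indicator K x *\<^sub>R v x\<bar>)" using i by (intro integrable_mult_right integrable_abs)
    show "(\<lambda>x. indicator K x *\<^sub>R v x * g x) \<in> borel_measurable lebesgue"
      using borel_measurable_integrable[OF i] gm by (rule borel_measurable_times)
    show "AE x in lebesgue. norm (indicator K x *\<^sub>R v x * g x) \<le> norm (L * \<bar>indicator K x *\<^sub>R v x\<bar>)"
    proof (rule AE_I2)
      fix x
      have "\<bar>g x\<bar> \<le> \<bar>L\<bar>" using g(2)[of x] by linarith
      then show "norm (indicator K x *\<^sub>R v x * g x) \<le> norm (L * \<bar>indicator K x *\<^sub>R v x\<bar>)"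
        by (simp add: abs_mult mult.commute mult_right_mono)
    qed
  qed
  moreover have "(\<lambda>x. indicator K x *\<^sub>R v x * g x) = (\<lambda>x. indicator \<Omega> x *\<^sub>R (v x * g x))"
    using g(3) K(2) by (auto simp: fun_eq_iff indicator_def)
  moreover have "\<Omega> \<inter> space lebesgue \<in> sets lebesgue" using \<Omega> by auto
  ultimately show ?thesis using integrable_restrict_space[of \<Omega> lebesgue "\<lambda>x. v x * g x"] by simp
qed

lemma L1_loc_test_integrable:
  fixes v :: "'a::euclidean_space \<Rightarrow> real"
  assumes \<Omega>: "open \<Omega>" and v: "v \<in> L1_loc \<Omega>" and \<phi>: "\<phi> \<in> test_functions \<Omega>"
  shows "integrable (lebesgue_on \<Omega>) (\<lambda>x. v x * \<phi> x)" "integrable (lebesgue_on \<Omega>) (\<lambda>x. v x * (tgrad \<phi> x \<bullet> b))"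
proof -
  let ?K = "closure {x. \<phi> x \<noteq> 0}"
  obtain L where L: "L \<ge> 0" "\<And>x. \<bar>\<phi> x\<bar> \<le> L \<and> norm (tgrad \<phi> x) \<le> L" using test_bounded[OF \<phi>] by blast
  note [measurable] = test_measurable[OF \<phi>]
  show "integrable (lebesgue_on \<Omega>) (\<lambda>x. v x * \<phi> x)"
  proof (rule L1_loc_mult_integrable[OF \<Omega> v test_functionsD(2,3)[OF \<phi>]])
    show "\<phi> x = 0" if "x \<notin> ?K" for x
      using subsetD[OF closure_subset[of "{x. \<phi> x \<noteq> 0}"], of x] that by auto
  qed (use L in auto)
  show "integrable (lebesgue_on \<Omega>) (\<lambda>x. v x * (tgrad \<phi> x \<bullet> b))"
  proof (rule L1_loc_mult_integrable[OF \<Omega> v test_functionsD(2,3)[OF \<phi>]])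
    show "\<bar>tgrad \<phi> x \<bullet> b\<bar> \<le> L * norm b" for x
      using Cauchy_Schwarz_ineq2[of "tgrad \<phi> x" b] mult_right_mono[of "norm (tgrad \<phi> x)" L "norm b"] L(2)[of x] by simp
    show "tgrad \<phi> x \<bullet> b = 0" if "x \<notin> ?K" for x using tgrad_zero_outside[OF \<phi> that] by simp
  qed measurable
qed

lemma is_weak_grad_iff:
  "is_weak_grad \<Omega> u w \<longleftrightarrow> u \<in> L1_loc \<Omega> \<and> w \<in> L1_loc \<Omega> \<and>
     (\<forall>\<phi>\<in>test_functions \<Omega>. \<forall>b\<in>Basis.
        (LINT x|lebesgue_on \<Omega>. u x * (tgrad \<phi> x \<bullet> b)) = - (LINT x|lebesgue_on \<Omega>. (w x \<bullet> b) * \<phi> x))"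
  unfolding is_weak_grad_def by (auto simp: frechet_eq_tgrad)

text \<open>Each component of the difference annihilates all test functions, so
  \<open>L1_loc_AE_zero\<close> applies.\<close>

lemma weak_grad_unique:
  fixes u :: "'a::euclidean_space \<Rightarrow> real"
  assumes \<Omega>: "open \<Omega>" and w: "is_weak_grad \<Omega> u w" and w': "is_weak_grad \<Omega> u w'"
  shows "AE x in lebesgue_on \<Omega>. w x = w' x"
proof -
  have L: "w \<in> L1_loc \<Omega>" "w' \<in> L1_loc \<Omega>" using w w' by (auto simp: is_weak_grad_iff)
  have "AE x in lebesgue_on \<Omega>. (w x - w' x) \<bullet> b = 0" if b: "b \<in> Basis" for b
  proof (rule L1_loc_AE_zero[OF \<Omega>])
    have "(\<lambda>x. 1 *\<^sub>R w x + (-1) *\<^sub>R w' x) \<in> L1_loc \<Omega>" by (rule L1_loc_lincomb[OF L])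
    from L1_loc_inner[OF this, of b] show "(\<lambda>x. (w x - w' x) \<bullet> b) \<in> L1_loc \<Omega>" by simp
    fix \<phi> assume \<phi>: "\<phi> \<in> test_functions \<Omega>"
    have "(LINT x|lebesgue_on \<Omega>. (w x - w' x) \<bullet> b * \<phi> x) =
        (LINT x|lebesgue_on \<Omega>. (w x \<bullet> b) * \<phi> x) - (LINT x|lebesgue_on \<Omega>. (w' x \<bullet> b) * \<phi> x)"
      unfolding inner_diff_left left_diff_distrib
      by (intro Bochner_Integration.integral_diff L1_loc_test_integrable[OF \<Omega> L1_loc_inner \<phi>] L)
    also have "\<dots> = 0"
    proof -
      have "(LINT x|lebesgue_on \<Omega>. u x * (tgrad \<phi> x \<bullet> b)) = - (LINT x|lebesgue_on \<Omega>. (w x \<bullet> b) * \<phi> x)"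
        "(LINT x|lebesgue_on \<Omega>. u x * (tgrad \<phi> x \<bullet> b)) = - (LINT x|lebesgue_on \<Omega>. (w' x \<bullet> b) * \<phi> x)"
        using w w' \<phi> b unfolding is_weak_grad_iff by blast+
      then show ?thesis by linarith
    qed
    finally show "(LINT x|lebesgue_on \<Omega>. (w x - w' x) \<bullet> b * \<phi> x) = 0" .
  qed
  then have "AE x in lebesgue_on \<Omega>. \<forall>b\<in>Basis. (w x - w' x) \<bullet> b = 0" by (intro AE_finite_allI) auto
  then show ?thesis by eventually_elim (simp add: euclidean_eq_iff[where 'a = 'a] inner_diff_left)
qed

lemma is_weak_grad_lincomb:
  fixes u v :: "'a::euclidean_space \<Rightarrow> real"
  assumes \<Omega>: "open \<Omega>" and u: "is_weak_grad \<Omega> u w" and v: "is_weak_grad \<Omega> v z"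
  shows "is_weak_grad \<Omega> (\<lambda>x. a * u x + b * v x) (\<lambda>x. a *\<^sub>R w x + b *\<^sub>R z x)"
proof -
  have L: "u \<in> L1_loc \<Omega>" "v \<in> L1_loc \<Omega>" "w \<in> L1_loc \<Omega>" "z \<in> L1_loc \<Omega>" using u v by (auto simp: is_weak_grad_iff)
  show ?thesis
    unfolding is_weak_grad_iff
  proof (intro conjI ballI)
    show "(\<lambda>x. a * u x + b * v x) \<in> L1_loc \<Omega>" using L1_loc_lincomb[OF L(1,2)] by simp
    show "(\<lambda>x. a *\<^sub>R w x + b *\<^sub>R z x) \<in> L1_loc \<Omega>" by (rule L1_loc_lincomb[OF L(3,4)])
    fix \<phi> e assume \<phi>: "\<phi> \<in> test_functions \<Omega>" and e: "(e::'a) \<in> Basis"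
    note i = L1_loc_test_integrable(2)[OF \<Omega> L(1) \<phi>, of e] L1_loc_test_integrable(2)[OF \<Omega> L(2) \<phi>, of e]
      L1_loc_test_integrable(1)[OF \<Omega> L1_loc_inner[OF L(3)] \<phi>, of e]
      L1_loc_test_integrable(1)[OF \<Omega> L1_loc_inner[OF L(4)] \<phi>, of e]
    have "(LINT x|lebesgue_on \<Omega>. (a * u x + b * v x) * (tgrad \<phi> x \<bullet> e))
      = a * (LINT x|lebesgue_on \<Omega>. u x * (tgrad \<phi> x \<bullet> e)) + b * (LINT x|lebesgue_on \<Omega>. v x * (tgrad \<phi> x \<bullet> e))"
      using i(1,2) by (simp add: distrib_right mult.assoc)
    also have "\<dots> = - (a * (LINT x|lebesgue_on \<Omega>. (w x \<bullet> e) * \<phi> x) + b * (LINT x|lebesgue_on \<Omega>. (z x \<bullet> e) * \<phi> x))"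
      using u v \<phi> e by (simp add: is_weak_grad_iff)
    also have "\<dots> = - (LINT x|lebesgue_on \<Omega>. ((a *\<^sub>R w x + b *\<^sub>R z x) \<bullet> e) * \<phi> x)"
      using i(3,4) by (simp add: inner_add_left distrib_right mult.assoc)
    finally show "(LINT x|lebesgue_on \<Omega>. (a * u x + b * v x) * (tgrad \<phi> x \<bullet> e))
      = - (LINT x|lebesgue_on \<Omega>. ((a *\<^sub>R w x + b *\<^sub>R z x) \<bullet> e) * \<phi> x)" .
  qed
qed

text \<open>The gradient of a product of test functions has integral 0, and the product rule splits
  it into the two sides.\<close>

lemma is_weak_grad_test:
  assumes \<Omega>: "open \<Omega>" and \<phi>: "\<phi> \<in> test_functions \<Omega>"
  shows "is_weak_grad \<Omega> \<phi> (tgrad \<phi>)"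
  unfolding is_weak_grad_iff
proof (intro conjI ballI)
  show L: "\<phi> \<in> L1_loc \<Omega>" "tgrad \<phi> \<in> L1_loc \<Omega>"
    using L2_L1_loc[OF \<Omega> test_pnorm_lebesgue_on(1)[OF \<Omega> \<phi>]] L2_L1_loc[OF \<Omega> test_pnorm_lebesgue_on(2)[OF \<Omega> \<phi>]] by auto
  fix \<psi> b assume \<psi>: "\<psi> \<in> test_functions \<Omega>"
  note i = L1_loc_test_integrable(2)[OF \<Omega> L(1) \<psi>, of b] L1_loc_test_integrable(1)[OF \<Omega> L1_loc_inner[OF L(2)] \<psi>, of b]
  note pr = test_functions_mult[OF \<phi> \<psi>]
  note [measurable] = test_measurable[OF pr]
  have "(LINT x|lebesgue_on \<Omega>. tgrad (\<lambda>x. \<phi> x * \<psi> x) x \<bullet> b) = (LINT x|lborel. tgrad (\<lambda>x. \<phi> x * \<psi> x) x \<bullet> b)"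
    by (rule lborel_to_lebesgue_on(2)[OF \<Omega>]) (use test_zero_outside(2)[OF pr] in auto)
  also have "\<dots> = 0" by (rule integral_tgrad_zero[OF pr])
  finally have "(LINT x|lebesgue_on \<Omega>. \<phi> x * (tgrad \<psi> x \<bullet> b) + (tgrad \<phi> x \<bullet> b) * \<psi> x) = 0"
    by (simp add: tgrad_mult[OF \<phi> \<psi>] inner_add_left mult.commute[of "\<psi> _"])
  then show "(LINT x|lebesgue_on \<Omega>. \<phi> x * (tgrad \<psi> x \<bullet> b)) = - (LINT x|lebesgue_on \<Omega>. (tgrad \<phi> x \<bullet> b) * \<psi> x)"
    using i by simp
qed

subsection \<open>The spaces \<open>H\<^sup>1\<close> and \<open>H\<^sub>0\<^sup>1\<close>\<close>

lemma is_weak_grad_weak_grad: "is_weak_grad \<Omega> u w \<Longrightarrow> is_weak_grad \<Omega> u (weak_grad \<Omega> u)"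
  unfolding weak_grad_def by (rule someI[where P = "is_weak_grad \<Omega> u"])

text \<open>The gradient picked by \<open>weak_grad\<close> need not be the square integrable
  witness, but agrees with it almost everywhere; its measurability comes from local
  integrability.\<close>

lemma H1_facts:
  assumes \<Omega>: "open \<Omega>" and u: "u \<in> H1 \<Omega>"
  shows "pint 2 (lebesgue_on \<Omega>) u" "is_weak_grad \<Omega> u (weak_grad \<Omega> u)" "pint 2 (lebesgue_on \<Omega>) (weak_grad \<Omega> u)"
proof -
  obtain w where w: "pint 2 (lebesgue_on \<Omega>) w" "is_weak_grad \<Omega> u w" using u by (auto simp: H1_def Lp2_iff)
  show "pint 2 (lebesgue_on \<Omega>) u" using u by (simp add: H1_def Lp2_iff)
  show 1: "is_weak_grad \<Omega> u (weak_grad \<Omega> u)" by (rule is_weak_grad_weak_grad[OF w(2)])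
  then have "weak_grad \<Omega> u \<in> borel_measurable (lebesgue_on \<Omega>)"
    by (intro L1_loc_measurable[OF \<Omega>]) (simp add: is_weak_grad_iff)
  then show "pint 2 (lebesgue_on \<Omega>) (weak_grad \<Omega> u)"
    using pint_cong_AE(1)[OF _ pint_measurable[OF w(1)] weak_grad_unique[OF \<Omega> 1 w(2)], of 2] w(1) by simp
qed

lemma H1I:
  assumes "pint 2 (lebesgue_on \<Omega>) u" "is_weak_grad \<Omega> u w" "pint 2 (lebesgue_on \<Omega>) w"
  shows "u \<in> H1 \<Omega>"
  using assms by (auto simp: H1_def Lp2_iff)

lemma weak_grad_AE:
  assumes \<Omega>: "open \<Omega>" and w: "is_weak_grad \<Omega> u w"
  shows "AE x in lebesgue_on \<Omega>. weak_grad \<Omega> u x = w x"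
  by (rule weak_grad_unique[OF \<Omega> is_weak_grad_weak_grad[OF w] w])

lemma even2: "even (2::nat)" "0 < (2::nat)" by simp_all

lemma even4: "even (4::nat)" "0 < (4::nat)" by simp_all

lemma H1_lincomb:
  assumes \<Omega>: "open \<Omega>" and u: "u \<in> H1 \<Omega>" and v: "v \<in> H1 \<Omega>"
  shows "(\<lambda>x. a * u x + b * v x) \<in> H1 \<Omega>"
    "AE x in lebesgue_on \<Omega>. weak_grad \<Omega> (\<lambda>x. a * u x + b * v x) x = a *\<^sub>R weak_grad \<Omega> u x + b *\<^sub>R weak_grad \<Omega> v x"
proof -
  note fu = H1_facts[OF \<Omega> u] and fv = H1_facts[OF \<Omega> v]
  note w = is_weak_grad_lincomb[OF \<Omega> fu(2) fv(2), of a b]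
  show "(\<lambda>x. a * u x + b * v x) \<in> H1 \<Omega>"
    using pint_add(1)[OF even2 pint_scale[OF fu(1), of a] pint_scale[OF fv(1), of b]]
      pint_add(1)[OF even2 pint_scale[OF fu(3), of a] pint_scale[OF fv(3), of b]]
    by (intro H1I[OF _ w]) simp_all
  show "AE x in lebesgue_on \<Omega>. weak_grad \<Omega> (\<lambda>x. a * u x + b * v x) x = a *\<^sub>R weak_grad \<Omega> u x + b *\<^sub>R weak_grad \<Omega> v x"
    by (rule weak_grad_AE[OF \<Omega> w])
qed

lemma test_H1:
  assumes \<Omega>: "open \<Omega>" and \<phi>: "\<phi> \<in> test_functions \<Omega>"
  shows "\<phi> \<in> H1 \<Omega>" "AE x in lebesgue_on \<Omega>. weak_grad \<Omega> \<phi> x = tgrad \<phi> x"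
  using test_pnorm_lebesgue_on(1,2)[OF \<Omega> \<phi> even2(2)] is_weak_grad_test[OF \<Omega> \<phi>]
  by (auto intro: H1I weak_grad_AE[OF \<Omega>])

lemma H1_norm_eq:
  "H1_norm \<Omega> u = sqrt ((pnorm 2 (lebesgue_on \<Omega>) u)\<^sup>2 + (pnorm 2 (lebesgue_on \<Omega>) (weak_grad \<Omega> u))\<^sup>2)"
  by (simp add: H1_norm_def pnorm_power)

lemma H1_diff_test:
  assumes \<Omega>: "open \<Omega>" and u: "u \<in> H1 \<Omega>" and \<phi>: "\<phi> \<in> test_functions \<Omega>"
  shows "pnorm 2 (lebesgue_on \<Omega>) (weak_grad \<Omega> (\<lambda>x. u x - \<phi> x)) = pnorm 2 (lebesgue_on \<Omega>) (\<lambda>x. weak_grad \<Omega> u x - tgrad \<phi> x)"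
proof (rule pint_cong_AE(2))
  have d: "(\<lambda>x. 1 * u x + (-1) * \<phi> x) \<in> H1 \<Omega>" by (rule H1_lincomb(1)[OF \<Omega> u test_H1(1)[OF \<Omega> \<phi>]])
  show "weak_grad \<Omega> (\<lambda>x. u x - \<phi> x) \<in> borel_measurable (lebesgue_on \<Omega>)"
    using pint_measurable[OF H1_facts(3)[OF \<Omega> d]] by simp
  show "(\<lambda>x. weak_grad \<Omega> u x - tgrad \<phi> x) \<in> borel_measurable (lebesgue_on \<Omega>)"
    by (rule pint_measurable[OF pint_diff(1)[OF even2 H1_facts(3)[OF \<Omega> u] test_pnorm_lebesgue_on(2)[OF \<Omega> \<phi> even2(2)]]])
  show "AE x in lebesgue_on \<Omega>. weak_grad \<Omega> (\<lambda>x. u x - \<phi> x) x = weak_grad \<Omega> u x - tgrad \<phi> x"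
    using H1_lincomb(2)[OF \<Omega> u test_H1(1)[OF \<Omega> \<phi>], of 1 "-1"] test_H1(2)[OF \<Omega> \<phi>]
    by eventually_elim simp
qed

text \<open>Separates the two parts of the norm and trades the weak gradient of a difference for a
  difference with a classical gradient, the form in which approximants are used below.\<close>

lemma H10_iff:
  assumes \<Omega>: "open \<Omega>"
  shows "u \<in> H10 \<Omega> \<longleftrightarrow> u \<in> H1 \<Omega> \<and> (\<forall>\<epsilon>>0. \<exists>\<phi>\<in>test_functions \<Omega>.
    pnorm 2 (lebesgue_on \<Omega>) (\<lambda>x. u x - \<phi> x) < \<epsilon> \<and> pnorm 2 (lebesgue_on \<Omega>) (\<lambda>x. weak_grad \<Omega> u x - tgrad \<phi> x) < \<epsilon>)"
proof (cases "u \<in> H1 \<Omega>")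
  case True
  have 1: "pnorm 2 (lebesgue_on \<Omega>) (\<lambda>x. u x - \<phi> x) < \<epsilon> \<and> pnorm 2 (lebesgue_on \<Omega>) (\<lambda>x. weak_grad \<Omega> u x - tgrad \<phi> x) < \<epsilon>"
    if "\<phi> \<in> test_functions \<Omega>" "H1_norm \<Omega> (\<lambda>x. u x - \<phi> x) < \<epsilon>" for \<phi> \<epsilon>
  proof -
    note X = that(2)[unfolded H1_norm_eq H1_diff_test[OF \<Omega> True that(1)]]
    show ?thesis
      by (rule conjI[OF le_less_trans[OF real_sqrt_sum_squares_ge1 X] le_less_trans[OF real_sqrt_sum_squares_ge2 X]])
  qed
  have 2: "H1_norm \<Omega> (\<lambda>x. u x - \<phi> x) < \<epsilon>"
    if "\<phi> \<in> test_functions \<Omega>" "pnorm 2 (lebesgue_on \<Omega>) (\<lambda>x. u x - \<phi> x) < \<epsilon> / 2"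
      "pnorm 2 (lebesgue_on \<Omega>) (\<lambda>x. weak_grad \<Omega> u x - tgrad \<phi> x) < \<epsilon> / 2" for \<phi> \<epsilon>
  proof -
    have "H1_norm \<Omega> (\<lambda>x. u x - \<phi> x) \<le> pnorm 2 (lebesgue_on \<Omega>) (\<lambda>x. u x - \<phi> x)
        + pnorm 2 (lebesgue_on \<Omega>) (\<lambda>x. weak_grad \<Omega> u x - tgrad \<phi> x)"
      unfolding H1_norm_eq H1_diff_test[OF \<Omega> True that(1)] by (intro sqrt_sum_squares_le_sum pnorm_nonneg)
    then show ?thesis using that by linarith
  qed
  show ?thesis
    unfolding H10_def mem_Collect_eq
  proof (intro iffI conjI allI impI; (elim conjE)?)
    fix \<epsilon> :: real assume "\<epsilon> > 0" and a: "\<forall>\<epsilon>>0. \<exists>\<phi>\<in>test_functions \<Omega>. H1_norm \<Omega> (\<lambda>x. u x - \<phi> x) < \<epsilon>"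
    then obtain \<phi> where "\<phi> \<in> test_functions \<Omega>" "H1_norm \<Omega> (\<lambda>x. u x - \<phi> x) < \<epsilon>" by blast
    then show "\<exists>\<phi>\<in>test_functions \<Omega>. pnorm 2 (lebesgue_on \<Omega>) (\<lambda>x. u x - \<phi> x) < \<epsilon>
        \<and> pnorm 2 (lebesgue_on \<Omega>) (\<lambda>x. weak_grad \<Omega> u x - tgrad \<phi> x) < \<epsilon>"
      using 1 by blast
  next
    fix \<epsilon> :: real assume "\<epsilon> > 0" and a: "\<forall>\<epsilon>>0. \<exists>\<phi>\<in>test_functions \<Omega>. pnorm 2 (lebesgue_on \<Omega>) (\<lambda>x. u x - \<phi> x) < \<epsilon>
        \<and> pnorm 2 (lebesgue_on \<Omega>) (\<lambda>x. weak_grad \<Omega> u x - tgrad \<phi> x) < \<epsilon>"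
    then have "0 < \<epsilon> / 2" by simp
    then obtain \<phi> where "\<phi> \<in> test_functions \<Omega>" "pnorm 2 (lebesgue_on \<Omega>) (\<lambda>x. u x - \<phi> x) < \<epsilon> / 2"
        "pnorm 2 (lebesgue_on \<Omega>) (\<lambda>x. weak_grad \<Omega> u x - tgrad \<phi> x) < \<epsilon> / 2" using a by blast
    then show "\<exists>\<phi>\<in>test_functions \<Omega>. H1_norm \<Omega> (\<lambda>x. u x - \<phi> x) < \<epsilon>" using 2 by blast
  qed (use True in auto)
qed (simp add: H10_def)

lemma pnorm_mono:
  assumes p: "0 < p" and g: "pint p M g" and f: "f \<in> borel_measurable M" and le: "\<And>x. norm (f x) \<le> norm (g x)"
  shows "pint p M f" "pnorm p M f \<le> pnorm p M g"
proof -
  have pw: "norm (f x) ^ p \<le> norm (g x) ^ p" for x by (intro power_mono le) simp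
  have i: "integrable M (\<lambda>x. norm (f x) ^ p)"
    by (rule Bochner_Integration.integrable_bound[OF pint_integrable[OF g]]) (use f pw in auto)
  then show "pint p M f" using f by (simp add: pint_def)
  show "pnorm p M f \<le> pnorm p M g"
    unfolding pnorm_def by (intro real_root_le_mono p integral_mono i pint_integrable[OF g] pw)
qed

lemma pnorm2_parallelogram:
  fixes f g :: "'x \<Rightarrow> 'b::euclidean_space"
  assumes f: "pint 2 M f" and g: "pint 2 M g"
  shows "(pnorm 2 M (\<lambda>x. f x - g x))\<^sup>2 + (pnorm 2 M (\<lambda>x. f x + g x))\<^sup>2 = 2 * (pnorm 2 M f)\<^sup>2 + 2 * (pnorm 2 M g)\<^sup>2"
proof -
  have "(LINT x|M. (norm (f x - g x))\<^sup>2) + (LINT x|M. (norm (f x + g x))\<^sup>2)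
      = (LINT x|M. (norm (f x - g x))\<^sup>2 + (norm (f x + g x))\<^sup>2)"
    by (rule Bochner_Integration.integral_add[symmetric])
      (rule pint_integrable[OF pint_diff(1)[OF even2 f g]] pint_integrable[OF pint_add(1)[OF even2 f g]])+
  also have "\<dots> = (LINT x|M. 2 * (norm (f x))\<^sup>2 + 2 * (norm (g x))\<^sup>2)"
    by (rule Bochner_Integration.integral_cong)
      (auto simp: power2_norm_eq_inner inner_add_left inner_add_right inner_diff_left inner_diff_right)
  also have "\<dots> = 2 * (LINT x|M. (norm (f x))\<^sup>2) + 2 * (LINT x|M. (norm (g x))\<^sup>2)"
    using pint_integrable[OF f] pint_integrable[OF g] by simp
  finally show ?thesis by (simp only: pnorm_power[OF even2(2)])
qed

lemma pint2_inner_limit: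
  fixes f :: "'x \<Rightarrow> 'b::euclidean_space"
  assumes s: "\<And>n. pint 2 M (s n)" and f: "pint 2 M f" and t: "pint 2 M t"
    and lim: "(\<lambda>n. pnorm 2 M (\<lambda>x. s n x - f x)) \<longlonglongrightarrow> 0"
  shows "(\<lambda>n. LINT x|M. s n x \<bullet> t x) \<longlonglongrightarrow> (LINT x|M. f x \<bullet> t x)"
proof -
  have "(\<lambda>n. (LINT x|M. s n x \<bullet> t x) - (LINT x|M. f x \<bullet> t x)) \<longlonglongrightarrow> 0"
  proof (rule Lim_null_comparison)
    show "\<forall>\<^sub>F n in sequentially. norm ((LINT x|M. s n x \<bullet> t x) - (LINT x|M. f x \<bullet> t x))
        \<le> pnorm 2 M (\<lambda>x. s n x - f x) * pnorm 2 M t"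
    proof (intro always_eventually allI)
      fix n
      have "(LINT x|M. s n x \<bullet> t x) - (LINT x|M. f x \<bullet> t x) = (LINT x|M. (s n x - f x) \<bullet> t x)"
        using pint2_inner(1)[OF s t] pint2_inner(1)[OF f t] by (simp add: inner_diff_left)
      then show "norm ((LINT x|M. s n x \<bullet> t x) - (LINT x|M. f x \<bullet> t x)) \<le> pnorm 2 M (\<lambda>x. s n x - f x) * pnorm 2 M t"
        using pint2_inner(2)[OF pint_diff(1)[OF even2 s f] t] by simp
    qed
    show "(\<lambda>n. pnorm 2 M (\<lambda>x. s n x - f x) * pnorm 2 M t) \<longlonglongrightarrow> 0"
      using tendsto_mult_right[OF lim, of "pnorm 2 M t"] by simp
  qed
  then show ?thesis by (simp add: LIM_zero_iff)
qed

section \<open>Elements of \<open>H10\<close> on a fixed open set\<close>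

locale open_set =
  fixes \<Omega> :: "'a::euclidean_space set"
  assumes open_dom: "open \<Omega>"
begin

abbreviation "MM \<equiv> lebesgue_on \<Omega>"
abbreviation "gr \<equiv> weak_grad \<Omega>"
abbreviation "nu u \<equiv> pnorm 2 MM u"
abbreviation "ng u \<equiv> pnorm 2 MM (weak_grad \<Omega> u)"

lemma H10_H1: "u \<in> H10 \<Omega> \<Longrightarrow> u \<in> H1 \<Omega>"
  by (simp add: H10_def)

lemma H10_pint: assumes "u \<in> H10 \<Omega>" shows "pint 2 MM u" "pint 2 MM (gr u)"
  using H1_facts[OF open_dom H10_H1[OF assms]] by auto

lemma ng_lincomb:
  assumes u: "u \<in> H1 \<Omega>" and v: "v \<in> H1 \<Omega>"
  shows "ng (\<lambda>x. a * u x + b * v x) = pnorm 2 MM (\<lambda>x. a *\<^sub>R gr u x + b *\<^sub>R gr v x)"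
proof (rule pint_cong_AE(2))
  show "gr (\<lambda>x. a * u x + b * v x) \<in> borel_measurable MM"
    by (rule pint_measurable[OF H1_facts(3)[OF open_dom H1_lincomb(1)[OF open_dom u v]]])
  show "(\<lambda>x. a *\<^sub>R gr u x + b *\<^sub>R gr v x) \<in> borel_measurable MM"
    by (rule pint_measurable[OF pint_add(1)[OF even2 pint_scale pint_scale]])
      (rule H1_facts(3)[OF open_dom u] H1_facts(3)[OF open_dom v])+
qed (rule H1_lincomb(2)[OF open_dom u v])

lemma ng_diff:
  assumes u: "u \<in> H1 \<Omega>" and v: "v \<in> H1 \<Omega>"
  shows "ng (\<lambda>x. u x - v x) = pnorm 2 MM (\<lambda>x. gr u x - gr v x)"
  using ng_lincomb[OF assms, of 1 "-1"] by simp

lemma ng_test: "\<phi> \<in> test_functions \<Omega> \<Longrightarrow> ng \<phi> = pnorm 2 MM (tgrad \<phi>)"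
  by (rule pint_cong_AE(2)[OF pint_measurable[OF H1_facts(3)[OF open_dom]] pint_measurable])
    (auto intro: test_H1[OF open_dom] test_pnorm_lebesgue_on(2)[OF open_dom _ even2(2)])

lemma H10_approx:
  assumes u: "u \<in> H10 \<Omega>" and e: "0 < e"
  shows "\<exists>\<phi>\<in>test_functions \<Omega>. nu (\<lambda>x. u x - \<phi> x) < e \<and> pnorm 2 MM (\<lambda>x. gr u x - tgrad \<phi> x) < e"
  using u e unfolding H10_iff[OF open_dom] by blast

lemma H10_approx_seq:
  assumes u: "u \<in> H10 \<Omega>" and e: "0 < e"
  shows "\<exists>\<phi>. (\<forall>n. \<phi> n \<in> test_functions \<Omega> \<and> nu (\<lambda>x. u x - \<phi> n x) < e / Suc n
    \<and> pnorm 2 MM (\<lambda>x. gr u x - tgrad (\<phi> n) x) < e / Suc n)"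
proof -
  have "\<exists>\<phi>\<in>test_functions \<Omega>. nu (\<lambda>x. u x - \<phi> x) < e / Suc n \<and> pnorm 2 MM (\<lambda>x. gr u x - tgrad \<phi> x) < e / Suc n" for n :: nat
    by (rule H10_approx[OF u]) (use e in simp)
  then show ?thesis by metis
qed

text \<open>Approximants from \<open>H10\<close> may replace test functions because they are
  approximable in turn.\<close>

lemma H10I:
  assumes u: "u \<in> H1 \<Omega>"
    and a: "\<And>e. 0 < e \<Longrightarrow> \<exists>v\<in>H10 \<Omega>. nu (\<lambda>x. u x - v x) < e \<and> pnorm 2 MM (\<lambda>x. gr u x - gr v x) < e"
  shows "u \<in> H10 \<Omega>"
  unfolding H10_iff[OF open_dom]
proof (intro conjI u allI impI)
  fix e :: real assume "0 < e"
  then have e2: "0 < e / 2" by simp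
  obtain v where v: "v \<in> H10 \<Omega>" "nu (\<lambda>x. u x - v x) < e / 2" "pnorm 2 MM (\<lambda>x. gr u x - gr v x) < e / 2"
    using a[OF e2] by blast
  obtain \<phi> where \<phi>: "\<phi> \<in> test_functions \<Omega>" "nu (\<lambda>x. v x - \<phi> x) < e / 2" "pnorm 2 MM (\<lambda>x. gr v x - tgrad \<phi> x) < e / 2"
    using H10_approx[OF v(1) e2] by blast
  note t = test_pnorm_lebesgue_on(1,2)[OF open_dom \<phi>(1) even2(2)]
  have "nu (\<lambda>x. u x - \<phi> x) < e"
    using pnorm_triangle[OF even2 H1_facts(1)[OF open_dom u] H10_pint(1)[OF v(1)] t(1)] v \<phi> by linarith
  moreover have "pnorm 2 MM (\<lambda>x. gr u x - tgrad \<phi> x) < e"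
    using pnorm_triangle[OF even2 H1_facts(3)[OF open_dom u] H10_pint(2)[OF v(1)] t(2)] v \<phi> by linarith
  ultimately show "\<exists>\<phi>\<in>test_functions \<Omega>. nu (\<lambda>x. u x - \<phi> x) < e \<and> pnorm 2 MM (\<lambda>x. gr u x - tgrad \<phi> x) < e"
    using \<phi>(1) by blast
qed

lemma test_H10:
  assumes \<phi>: "\<phi> \<in> test_functions \<Omega>" shows "\<phi> \<in> H10 \<Omega>"
  unfolding H10_def mem_Collect_eq
proof (intro conjI allI impI test_H1(1)[OF open_dom \<phi>])
  fix e :: real assume e: "0 < e"
  \<comment> \<open>The choice operator fixes the weak gradient of 0 only almost everywhere. Reading
    0 as a combination of test functions computes it by \<open>tgrad_lincomb\<close>.\<close>
  have z: "(\<lambda>x. 0 * \<phi> x + 0 * \<phi> x) \<in> test_functions \<Omega>" by (rule test_functions_lincomb[OF \<phi> \<phi>])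
  have "tgrad (\<lambda>x. 0 * \<phi> x + 0 * \<phi> x) = (\<lambda>x. 0)" using tgrad_lincomb[OF \<phi> \<phi>, of 0 0] by (simp add: fun_eq_iff)
  then have "ng (\<lambda>x. 0) = pnorm 2 MM (\<lambda>x. 0::'a)" using ng_test[OF z] by simp
  then have "H1_norm \<Omega> (\<lambda>x. \<phi> x - \<phi> x) = 0" by (simp add: H1_norm_eq pnorm_def)
  then show "\<exists>\<psi>\<in>test_functions \<Omega>. H1_norm \<Omega> (\<lambda>x. \<phi> x - \<psi> x) < e" using \<phi> e by (intro bexI[of _ \<phi>]) auto
qed

lemma H10_lincomb:
  assumes u: "u \<in> H10 \<Omega>" and v: "v \<in> H10 \<Omega>"
  shows "(\<lambda>x. a * u x + b * v x) \<in> H10 \<Omega>"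
proof (rule H10I)
  note u1 = H10_H1[OF u] and v1 = H10_H1[OF v]
  show L: "(\<lambda>x. a * u x + b * v x) \<in> H1 \<Omega>" by (rule H1_lincomb(1)[OF open_dom u1 v1])
  fix e :: real assume e: "0 < e"
  define d where "d = e / (\<bar>a\<bar> + \<bar>b\<bar> + 1)"
  have d: "0 < d" using e by (simp add: d_def add_nonneg_pos)
  have de: "\<bar>a\<bar> * d + \<bar>b\<bar> * d < e"
  proof -
    have "(\<bar>a\<bar> + \<bar>b\<bar> + 1) * d = e" using d e by (simp add: d_def)
    then show ?thesis using d by (simp add: algebra_simps)
  qed
  obtain \<phi> where \<phi>: "\<phi> \<in> test_functions \<Omega>" "nu (\<lambda>x. u x - \<phi> x) < d" "pnorm 2 MM (\<lambda>x. gr u x - tgrad \<phi> x) < d"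
    using H10_approx[OF u d] by blast
  obtain \<psi> where \<psi>: "\<psi> \<in> test_functions \<Omega>" "nu (\<lambda>x. v x - \<psi> x) < d" "pnorm 2 MM (\<lambda>x. gr v x - tgrad \<psi> x) < d"
    using H10_approx[OF v d] by blast
  note t\<phi> = test_pnorm_lebesgue_on(1,2)[OF open_dom \<phi>(1) even2(2)] and t\<psi> = test_pnorm_lebesgue_on(1,2)[OF open_dom \<psi>(1) even2(2)]
  let ?\<chi> = "\<lambda>x. a * \<phi> x + b * \<psi> x"
  have \<chi>: "?\<chi> \<in> test_functions \<Omega>" by (rule test_functions_lincomb[OF \<phi>(1) \<psi>(1)])
  note du = pint_diff(1)[OF even2 H10_pint(1)[OF u] t\<phi>(1)] and dv = pint_diff(1)[OF even2 H10_pint(1)[OF v] t\<psi>(1)]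
  note gu = pint_diff(1)[OF even2 H10_pint(2)[OF u] t\<phi>(2)] and gv = pint_diff(1)[OF even2 H10_pint(2)[OF v] t\<psi>(2)]
  have comb: "\<bar>a\<bar> * s + \<bar>b\<bar> * t < e" if "s < d" "t < d" for s t
    using that mult_left_mono[of s d "\<bar>a\<bar>"] mult_left_mono[of t d "\<bar>b\<bar>"] de by simp
  have "nu (\<lambda>x. (a * u x + b * v x) - ?\<chi> x) = nu (\<lambda>x. a *\<^sub>R (u x - \<phi> x) + b *\<^sub>R (v x - \<psi> x))"
    by (rule arg_cong[where f = nu]) (simp add: algebra_simps)
  also have "\<dots> \<le> \<bar>a\<bar> * nu (\<lambda>x. u x - \<phi> x) + \<bar>b\<bar> * nu (\<lambda>x. v x - \<psi> x)"
    using pint_add(2)[OF even2 pint_scale[OF du] pint_scale[OF dv], of a b] unfolding pnorm_scale[OF even2(2)] .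
  also have "\<dots> < e" by (rule comb[OF \<phi>(2) \<psi>(2)])
  finally have 1: "nu (\<lambda>x. (a * u x + b * v x) - ?\<chi> x) < e" .
  have "pnorm 2 MM (\<lambda>x. gr (\<lambda>x. a * u x + b * v x) x - gr ?\<chi> x) = ng (\<lambda>x. (a * u x + b * v x) - ?\<chi> x)"
    by (rule ng_diff[symmetric, OF L test_H1(1)[OF open_dom \<chi>]])
  also have "\<dots> = pnorm 2 MM (\<lambda>x. gr (\<lambda>x. a * u x + b * v x) x - tgrad ?\<chi> x)"
    by (rule H1_diff_test[OF open_dom L \<chi>])
  also have "\<dots> = pnorm 2 MM (\<lambda>x. a *\<^sub>R (gr u x - tgrad \<phi> x) + b *\<^sub>R (gr v x - tgrad \<psi> x))"
  proof (rule pint_cong_AE(2))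
    show "(\<lambda>x. gr (\<lambda>x. a * u x + b * v x) x - tgrad ?\<chi> x) \<in> borel_measurable MM"
      by (rule pint_measurable[OF pint_diff(1)[OF even2 H1_facts(3)[OF open_dom L] test_pnorm_lebesgue_on(2)[OF open_dom \<chi> even2(2)]]])
    show "(\<lambda>x. a *\<^sub>R (gr u x - tgrad \<phi> x) + b *\<^sub>R (gr v x - tgrad \<psi> x)) \<in> borel_measurable MM"
      by (rule pint_measurable[OF pint_add(1)[OF even2 pint_scale[OF gu] pint_scale[OF gv]]])
    show "AE x in MM. gr (\<lambda>x. a * u x + b * v x) x - tgrad ?\<chi> x = a *\<^sub>R (gr u x - tgrad \<phi> x) + b *\<^sub>R (gr v x - tgrad \<psi> x)"
      using H1_lincomb(2)[OF open_dom u1 v1, of a b]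
      by eventually_elim (simp add: tgrad_lincomb[OF \<phi>(1) \<psi>(1)] algebra_simps)
  qed
  also have "\<dots> \<le> \<bar>a\<bar> * pnorm 2 MM (\<lambda>x. gr u x - tgrad \<phi> x) + \<bar>b\<bar> * pnorm 2 MM (\<lambda>x. gr v x - tgrad \<psi> x)"
    using pint_add(2)[OF even2 pint_scale[OF gu] pint_scale[OF gv], of a b] unfolding pnorm_scale[OF even2(2)] .
  also have "\<dots> < e" by (rule comb[OF \<phi>(3) \<psi>(3)])
  finally show "\<exists>w\<in>H10 \<Omega>. nu (\<lambda>x. (a * u x + b * v x) - w x) < e \<and> pnorm 2 MM (\<lambda>x. gr (\<lambda>x. a * u x + b * v x) x - gr w x) < e"
    using 1 test_H10[OF \<chi>] by (intro bexI[of _ ?\<chi>] conjI)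
qed

lemma H10_diff: "u \<in> H10 \<Omega> \<Longrightarrow> v \<in> H10 \<Omega> \<Longrightarrow> (\<lambda>x. u x - v x) \<in> H10 \<Omega>"
  using H10_lincomb[of u v 1 "-1"] by simp

text \<open>Both functions have the same weak gradients, so the choice operator returns literally
  the same function.\<close>

lemma weak_grad_cong_AE:
  assumes u: "pint 2 MM u" and v: "pint 2 MM v" and ae: "AE x in MM. u x = v x"
  shows "gr u = gr v"
proof -
  have "is_weak_grad \<Omega> u w = is_weak_grad \<Omega> v w" for w
  proof -
    have "(LINT x|MM. u x * (tgrad \<phi> x \<bullet> b)) = (LINT x|MM. v x * (tgrad \<phi> x \<bullet> b))"
      if \<phi>: "\<phi> \<in> test_functions \<Omega>" for \<phi> b
    proof (rule integral_cong_AE)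
      show "(\<lambda>x. u x * (tgrad \<phi> x \<bullet> b)) \<in> borel_measurable MM" "(\<lambda>x. v x * (tgrad \<phi> x \<bullet> b)) \<in> borel_measurable MM"
        using pint_measurable[OF u] pint_measurable[OF v] borel_measurable_lebesgue_on[OF test_measurable(2)[OF \<phi>]]
        by measurable
      show "AE x in MM. u x * (tgrad \<phi> x \<bullet> b) = v x * (tgrad \<phi> x \<bullet> b)" using ae by eventually_elim simp
    qed
    then show ?thesis
      unfolding is_weak_grad_iff using L2_L1_loc[OF open_dom u] L2_L1_loc[OF open_dom v] by auto
  qed
  then have "is_weak_grad \<Omega> u = is_weak_grad \<Omega> v" by blast
  then show ?thesis by (simp add: weak_grad_def fun_eq_iff)
qed

lemma H10_cong_AE:
  assumes u: "u \<in> H10 \<Omega>" and v: "v \<in> borel_measurable MM" and ae: "AE x in MM. u x = v x"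
  shows "v \<in> H10 \<Omega>" "gr v = gr u"
proof -
  note up = H10_pint[OF u]
  have vp: "pint 2 MM v" using pint_cong_AE(1)[OF pint_measurable[OF up(1)] v ae, of 2] up(1) by simp
  show g: "gr v = gr u" using weak_grad_cong_AE[OF up(1) vp ae] by simp
  have L: "u \<in> L1_loc \<Omega>" "v \<in> L1_loc \<Omega>" using L2_L1_loc[OF open_dom up(1)] L2_L1_loc[OF open_dom vp] by auto
  have "is_weak_grad \<Omega> v (gr u)"
    unfolding is_weak_grad_iff
  proof (intro conjI ballI L(2))
    have iw: "is_weak_grad \<Omega> u (gr u)" by (rule H1_facts(2)[OF open_dom H10_H1[OF u]])
    then show "gr u \<in> L1_loc \<Omega>" by (simp add: is_weak_grad_iff)
    fix \<phi> b assume \<phi>: "\<phi> \<in> test_functions \<Omega>" and b: "(b::'a) \<in> Basis"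
    have "(LINT x|MM. v x * (tgrad \<phi> x \<bullet> b)) = (LINT x|MM. u x * (tgrad \<phi> x \<bullet> b))"
    proof (rule integral_cong_AE)
      show "(\<lambda>x. v x * (tgrad \<phi> x \<bullet> b)) \<in> borel_measurable MM" "(\<lambda>x. u x * (tgrad \<phi> x \<bullet> b)) \<in> borel_measurable MM"
        using pint_measurable[OF up(1)] v borel_measurable_lebesgue_on[OF test_measurable(2)[OF \<phi>]]
        by measurable
      show "AE x in MM. v x * (tgrad \<phi> x \<bullet> b) = u x * (tgrad \<phi> x \<bullet> b)" using ae by eventually_elim simp
    qed
    then show "(LINT x|MM. v x * (tgrad \<phi> x \<bullet> b)) = - (LINT x|MM. (gr u x \<bullet> b) * \<phi> x)"
      using iw \<phi> b by (simp add: is_weak_grad_iff)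
  qed
  then have v1: "v \<in> H1 \<Omega>" by (rule H1I[OF vp _ up(2)])
  show "v \<in> H10 \<Omega>"
  proof (rule H10I[OF v1])
    fix e :: real assume e: "0 < e"
    have "nu (\<lambda>x. v x - u x) = nu (\<lambda>x. 0::real)"
      using ae by (intro pint_cong_AE(2) pint_measurable[OF pint_diff(1)[OF even2 vp up(1)]]) (auto elim!: eventually_mono)
    then have "nu (\<lambda>x. v x - u x) < e" "pnorm 2 MM (\<lambda>x. gr v x - gr u x) < e" using e g by (auto simp: pnorm_def)
    then show "\<exists>w\<in>H10 \<Omega>. nu (\<lambda>x. v x - w x) < e \<and> pnorm 2 MM (\<lambda>x. gr v x - gr w x) < e" using u by blast
  qed
qed

text \<open>Functions and gradients converge separately in \<open>L\<^sup>2\<close>. Against a fixed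
  test function the integration by parts identity passes to the limit, so the limit of the gradients
  is a weak gradient of the limit.\<close>

lemma H10_complete:
  assumes s: "\<And>n. s n \<in> H10 \<Omega>"
    and c1: "\<And>e. e > 0 \<Longrightarrow> \<exists>N. \<forall>n\<ge>N. \<forall>m\<ge>N. nu (\<lambda>x. s n x - s m x) < e"
    and c2: "\<And>e. e > 0 \<Longrightarrow> \<exists>N. \<forall>n\<ge>N. \<forall>m\<ge>N. pnorm 2 MM (\<lambda>x. gr (s n) x - gr (s m) x) < e"
  shows "\<exists>f\<in>H10 \<Omega>. (\<lambda>n. nu (\<lambda>x. s n x - f x)) \<longlonglongrightarrow> 0 \<and> (\<lambda>n. pnorm 2 MM (\<lambda>x. gr (s n) x - gr f x)) \<longlonglongrightarrow> 0"
proof -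
  note sp = H10_pint[OF s]
  obtain f where f: "pint 2 MM f" "(\<lambda>n. nu (\<lambda>x. s n x - f x)) \<longlonglongrightarrow> 0"
    using pint_complete[of 2 MM s, OF even2 sp(1) c1] by blast
  obtain g where g: "pint 2 MM g" "(\<lambda>n. pnorm 2 MM (\<lambda>x. gr (s n) x - g x)) \<longlonglongrightarrow> 0"
    using pint_complete[of 2 MM "\<lambda>n. gr (s n)", OF even2 sp(2) c2] by blast
  have wg: "is_weak_grad \<Omega> f g"
    unfolding is_weak_grad_iff
  proof (intro conjI ballI L2_L1_loc[OF open_dom] f(1) g(1))
    fix \<phi> b assume \<phi>: "\<phi> \<in> test_functions \<Omega>" and b: "(b::'a) \<in> Basis"
    note t = test_pnorm_lebesgue_on(1,2)[OF open_dom \<phi> even2(2)]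
    have tb: "pint 2 MM (\<lambda>x. tgrad \<phi> x \<bullet> b)"
      by (rule pnorm_mono(1)[OF even2(2) t(2)])
        (use pint_measurable[OF t(2)] b in \<open>auto intro: Basis_le_norm\<close>)
    \<comment> \<open>The component of the gradient times \<phi> is read as an inner product with
      the vector field \<phi> b, to match the convergence of gradients as vectors.\<close>
    have pb: "pint 2 MM (\<lambda>x. \<phi> x *\<^sub>R b)"
      by (rule pnorm_mono(1)[OF even2(2) t(1)]) (use pint_measurable[OF t(1)] b in auto)
    have "(\<lambda>n. LINT x|MM. s n x \<bullet> (tgrad \<phi> x \<bullet> b)) \<longlonglongrightarrow> (LINT x|MM. f x \<bullet> (tgrad \<phi> x \<bullet> b))"
      by (rule pint2_inner_limit[OF sp(1) f(1) tb f(2)])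
    moreover have "(\<lambda>n. LINT x|MM. gr (s n) x \<bullet> (\<phi> x *\<^sub>R b)) \<longlonglongrightarrow> (LINT x|MM. g x \<bullet> (\<phi> x *\<^sub>R b))"
      by (rule pint2_inner_limit[OF sp(2) g(1) pb g(2)])
    moreover have "(LINT x|MM. s n x \<bullet> (tgrad \<phi> x \<bullet> b)) = - (LINT x|MM. gr (s n) x \<bullet> (\<phi> x *\<^sub>R b))" for n
      using H1_facts(2)[OF open_dom H10_H1[OF s[of n]]] \<phi> b by (simp add: is_weak_grad_iff mult.commute)
    ultimately have "(\<lambda>n. LINT x|MM. gr (s n) x \<bullet> (\<phi> x *\<^sub>R b)) \<longlonglongrightarrow> - (LINT x|MM. f x \<bullet> (tgrad \<phi> x \<bullet> b))"
      "(\<lambda>n. LINT x|MM. gr (s n) x \<bullet> (\<phi> x *\<^sub>R b)) \<longlonglongrightarrow> (LINT x|MM. g x \<bullet> (\<phi> x *\<^sub>R b))"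
      using tendsto_minus_cancel_left by auto
    then have "- (LINT x|MM. f x \<bullet> (tgrad \<phi> x \<bullet> b)) = (LINT x|MM. g x \<bullet> (\<phi> x *\<^sub>R b))"
      by (rule LIMSEQ_unique)
    then show "(LINT x|MM. f x * (tgrad \<phi> x \<bullet> b)) = - (LINT x|MM. (g x \<bullet> b) * \<phi> x)"
      by (simp add: mult.commute)
  qed
  have f1: "f \<in> H1 \<Omega>" by (rule H1I[OF f(1) wg g(1)])
  have "pnorm 2 MM (\<lambda>x. gr (s n) x - gr f x) = pnorm 2 MM (\<lambda>x. gr (s n) x - g x)" for n
    using weak_grad_AE[OF open_dom wg]
    by (intro pint_cong_AE(2) pint_measurable[OF pint_diff(1)[OF even2 sp(2) g(1)]]
        pint_measurable[OF pint_diff(1)[OF even2 sp(2) H1_facts(3)[OF open_dom f1]]]) (auto elim!: eventually_mono)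
  then have gl: "(\<lambda>n. pnorm 2 MM (\<lambda>x. gr (s n) x - gr f x)) \<longlonglongrightarrow> 0" using g(2) by simp
  have "f \<in> H10 \<Omega>"
  proof (rule H10I[OF f1])
    fix e :: real assume e: "0 < e"
    have "\<forall>\<^sub>F n in sequentially. nu (\<lambda>x. s n x - f x) < e \<and> pnorm 2 MM (\<lambda>x. gr (s n) x - gr f x) < e"
      using order_tendstoD(2)[OF f(2) e] order_tendstoD(2)[OF gl e] by (rule eventually_conj)
    then obtain n where "nu (\<lambda>x. s n x - f x) < e" "pnorm 2 MM (\<lambda>x. gr (s n) x - gr f x) < e"
      by (auto simp: eventually_sequentially)
    then show "\<exists>v\<in>H10 \<Omega>. nu (\<lambda>x. f x - v x) < e \<and> pnorm 2 MM (\<lambda>x. gr f x - gr v x) < e"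
      using s[of n] pnorm_minus_commute[of 2 MM f "s n"] pnorm_minus_commute[of 2 MM "gr f" "gr (s n)"]
      by (intro bexI[of _ "s n"]) auto
  qed
  then show ?thesis using f(2) gl by blast
qed

end

context open_set
begin

subsection \<open>Closure properties of \<open>H\<^sub>0\<^sup>1\<close>\<close>

text \<open>Approximating test functions converge almost everywhere along a subsequence, and the
  assumed estimate bounds their \<open>L\<^sup>4\<close> norms. Fatou delivers integrability and the
  bound together, up to the slack \<open>e\<close>.\<close>

lemma H10_L4_bound:
  assumes A: "0 \<le> A" and B: "0 \<le> B"
    and test: "\<And>\<phi>. \<phi> \<in> test_functions \<Omega> \<Longrightarrow> pnorm 4 lborel \<phi> \<le> A * pnorm 2 lborel \<phi> + B * pnorm 2 lborel (tgrad \<phi>)"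
    and u: "u \<in> H10 \<Omega>"
  shows "pint 4 MM u" "pnorm 4 MM u \<le> A * nu u + B * ng u"
proof -
  note up = H10_pint[OF u]
  have *: "pint 4 MM u \<and> pnorm 4 MM u \<le> A * (nu u + e) + B * (ng u + e)" if e: "0 < e" for e
  proof -
    obtain \<phi> where \<phi>: "\<And>n. \<phi> n \<in> test_functions \<Omega>" "\<And>n. nu (\<lambda>x. u x - \<phi> n x) < e / Suc n"
      "\<And>n. pnorm 2 MM (\<lambda>x. gr u x - tgrad (\<phi> n) x) < e / Suc n"
      using H10_approx_seq[OF u e] by blast
    note t2 = test_pnorm_lebesgue_on[OF open_dom \<phi>(1) even2(2)]
    note t4 = test_pnorm_lebesgue_on[OF open_dom \<phi>(1) even4(2)]
    have en: "e / Suc n \<le> e" for n using e by (simp add: divide_le_eq mult_le_cancel_left1)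
    have "(\<lambda>n. e * (1 / Suc n)) \<longlonglongrightarrow> e * 0" by (intro tendsto_mult_left LIMSEQ_Suc[OF lim_1_over_n])
    then have en0: "(\<lambda>n. e / Suc n) \<longlonglongrightarrow> 0" by simp
    have "(\<lambda>n. nu (\<lambda>x. \<phi> n x - u x)) \<longlonglongrightarrow> 0"
      by (rule tendsto_sandwich[OF _ _ tendsto_const en0])
        (use \<phi>(2) in \<open>auto simp: pnorm_nonneg pnorm_minus_commute[of 2 MM _ u] intro!: always_eventually less_imp_le\<close>)
    then obtain r where r: "strict_mono r" "AE x in MM. (\<lambda>n. \<phi> (r n) x) \<longlonglongrightarrow> u x"
      using pnorm_tendsto_AE_subseq[of 2 MM \<phi> u, OF even2 t2(1) up(1)] by blast
    have b: "pnorm 4 MM (\<phi> n) \<le> A * (nu u + e) + B * (ng u + e)" for n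
    proof -
      have "nu (\<phi> n) \<le> nu u + e"
        using pnorm_triangle_rev[OF even2 up(1) t2(1)[of n]] \<phi>(2)[of n] en[of n] by linarith
      moreover have "pnorm 2 MM (tgrad (\<phi> n)) \<le> ng u + e"
        using pnorm_triangle_rev[OF even2 up(2) t2(2)[of n]] \<phi>(3)[of n] en[of n] by linarith
      ultimately have "A * nu (\<phi> n) + B * pnorm 2 MM (tgrad (\<phi> n)) \<le> A * (nu u + e) + B * (ng u + e)"
        using A B by (intro add_mono mult_left_mono)
      then show ?thesis using test[OF \<phi>(1), of n] unfolding t4(3) t2(3,4) by linarith
    qed
    show ?thesis
      using pnorm_fatou[of 4 u MM "\<lambda>n. \<phi> (r n)", OF even4(2) pint_measurable[OF up(1)] t4(1) r(2) b] by blast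
  qed
  show "pint 4 MM u" using *[of 1] by simp
  show "pnorm 4 MM u \<le> A * nu u + B * ng u"
  proof (rule field_le_epsilon)
    fix e :: real assume e: "0 < e"
    define d where "d = e / (A + B + 1)"
    have d: "0 < d" using e A B by (simp add: d_def)
    have "(A + B + 1) * d = e" using A B by (simp add: d_def)
    then have "A * d + B * d \<le> e" using d by (simp add: algebra_simps)
    then show "pnorm 4 MM u \<le> A * nu u + B * ng u + e" using *[OF d] by (simp add: algebra_simps)
  qed
qed

lemma H10_poincare:
  assumes R: "0 < R" "\<Omega> \<subseteq> ball 0 R" and u: "u \<in> H10 \<Omega>"
  shows "nu u \<le> sqrt 2 * R * ng u"
proof (rule field_le_epsilon)
  fix e :: real assume e: "0 < e"
  define P where "P = sqrt 2 * R"
  have P: "0 < P" using R by (simp add: P_def)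
  define d where "d = e / (P + 1)"
  have d: "0 < d" using e P by (simp add: d_def)
  obtain \<phi> where \<phi>: "\<phi> \<in> test_functions \<Omega>" "nu (\<lambda>x. u x - \<phi> x) < d" "pnorm 2 MM (\<lambda>x. gr u x - tgrad \<phi> x) < d"
    using H10_approx[OF u d] by blast
  note t = test_pnorm_lebesgue_on[OF open_dom \<phi>(1) even2(2)]
  have "(pnorm 2 lborel \<phi>)\<^sup>2 \<le> (P * pnorm 2 lborel (tgrad \<phi>))\<^sup>2"
    using test_poincare[OF \<phi>(1) R] by (simp add: pnorm_power power_mult_distrib P_def)
  then have "nu \<phi> \<le> P * pnorm 2 MM (tgrad \<phi>)"
    unfolding t(3,4) by (rule power2_le_imp_le) (use P in \<open>simp add: pnorm_nonneg\<close>)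
  also have "\<dots> \<le> P * (ng u + d)"
    using pnorm_triangle_rev[OF even2 H10_pint(2)[OF u] t(2)] \<phi>(3) P by (intro mult_left_mono) linarith+
  finally have "nu u \<le> P * (ng u + d) + d"
    using pnorm_triangle_rev[OF even2 H10_pint(1)[OF u] t(1)] \<phi>(2) by linarith
  also have "\<dots> = P * ng u + (P + 1) * d" by (simp add: algebra_simps)
  also have "(P + 1) * d = e" using P by (simp add: d_def)
  finally show "nu u \<le> sqrt 2 * R * ng u + e" by (simp add: P_def)
qed

text \<open>Elements of minimal gradient norm in shrinking \<open>L\<^sup>2\<close> balls around the limit form a Cauchy sequence,
  which replaces a weak compactness argument.\<close>

lemma H10_closed_L2:
  assumes z: "\<And>n. z n \<in> H10 \<Omega>" and v: "pint 2 MM v"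
    and lim: "(\<lambda>n. nu (\<lambda>x. z n x - v x)) \<longlonglongrightarrow> 0" and K: "\<And>n. ng (z n) \<le> K"
  shows "v \<in> H10 \<Omega>" "ng v \<le> K"
proof -
  \<comment> \<open>These sets decrease, so the infima \<open>d n\<close> increase; each set
    contains some \<open>z j\<close>, which keeps \<open>d n\<close> below \<open>K\<close>.\<close>
  define S where "S n = {w \<in> H10 \<Omega>. nu (\<lambda>x. w x - v x) \<le> 1 / Suc n}" for n :: nat
  define d where "d n = Inf (ng ` S n)" for n
  have bdd: "bdd_below (ng ` S n)" for n by (rule bdd_belowI[of _ 0]) (auto simp: pnorm_nonneg)
  have "\<exists>w\<in>S n. ng w \<le> K" for n
  proof -
    have "\<forall>\<^sub>F j in sequentially. nu (\<lambda>x. z j x - v x) < 1 / Suc n" by (rule order_tendstoD(2)[OF lim]) simp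
    then obtain j where "nu (\<lambda>x. z j x - v x) < 1 / Suc n" by (auto simp: eventually_sequentially)
    then show ?thesis using z[of j] K[of j] by (intro bexI[of _ "z j"]) (auto simp: S_def)
  qed
  then obtain w0 where w0: "\<And>n. w0 n \<in> S n" "\<And>n. ng (w0 n) \<le> K" by metis
  have d_le: "d n \<le> ng w" if "w \<in> S n" for n w
    unfolding d_def by (rule cInf_lower[OF imageI[OF that] bdd])
  have dK: "d n \<le> K" for n using d_le[OF w0(1)] w0(2) order_trans by blast
  have d0: "0 \<le> d n" for n
    unfolding d_def by (rule cInf_greatest) (use w0(1)[of n] in \<open>auto simp: pnorm_nonneg\<close>)
  have S_mono: "S n \<subseteq> S m" if "m \<le> n" for m n
  proof -
    have "1 / real (Suc n) \<le> 1 / real (Suc m)" using that by (simp add: frac_le)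
    then show ?thesis by (auto simp: S_def)
  qed
  have dm: "d m \<le> d n" if "m \<le> n" for m n
    unfolding d_def using S_mono[OF that] w0(1)[of n] by (intro cInf_superset_mono bdd image_mono) auto
  have "convergent d"
    by (intro Bseq_monoseq_convergent BseqI'[of _ K]) (use d0 dK dm in \<open>auto simp: monoseq_def\<close>)
  then obtain D where D: "d \<longlonglongrightarrow> D" by (auto simp: convergent_def)
  have dD: "d n \<le> D" for n by (rule LIMSEQ_le_const[OF D]) (use dm in blast)
  have "\<exists>w\<in>S n. ng w < d n + 1 / Suc n" for n
  proof -
    have "Inf (ng ` S n) < d n + 1 / Suc n" by (simp add: d_def)
    then show ?thesis using cInf_lessD[of "ng ` S n" "d n + 1 / Suc n"] w0(1)[of n] by auto
  qed
  then obtain y where y: "\<And>n. y n \<in> S n" "\<And>n. ng (y n) < d n + 1 / Suc n" by metis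
  have yH: "y n \<in> H10 \<Omega>" and yv: "nu (\<lambda>x. y n x - v x) \<le> 1 / Suc n" for n using y(1)[of n] by (auto simp: S_def)
  note yp = H10_pint[OF yH]
  have inv0: "(\<lambda>n. 1 / real (Suc n)) \<longlonglongrightarrow> 0" by (rule LIMSEQ_Suc[OF lim_1_over_n])
  have yl: "(\<lambda>n. nu (\<lambda>x. y n x - v x)) \<longlonglongrightarrow> 0"
    by (rule tendsto_sandwich[OF _ _ tendsto_const inv0]) (use yv in \<open>auto simp: pnorm_nonneg\<close>)
  \<comment> \<open>By the parallelogram law this bounds the squared gradient distance of two
    near-minimisers with index at least \<open>N\<close>, because their midpoint lies in
    \<open>S N\<close>. It tends to \<open>4 * D\<^sup>2 - 4 * D\<^sup>2\<close>.\<close>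
  define \<delta> where "\<delta> N = 4 * (D + 1 / Suc N)\<^sup>2 - 4 * (d N)\<^sup>2" for N :: nat
  have "\<delta> \<longlonglongrightarrow> 4 * (D + 0)\<^sup>2 - 4 * D\<^sup>2" unfolding \<delta>_def by (intro tendsto_intros inv0 D)
  then have \<delta>0: "\<delta> \<longlonglongrightarrow> 0" by simp
  have est: "(pnorm 2 MM (\<lambda>x. gr (y n) x - gr (y m) x))\<^sup>2 \<le> \<delta> N" if nm: "N \<le> n" "N \<le> m" for n m N
  proof -
    let ?w = "\<lambda>x. (1/2) * y n x + (1/2) * y m x"
    have wH: "?w \<in> H10 \<Omega>" by (rule H10_lincomb[OF yH yH])
    have dn: "pint 2 MM (\<lambda>x. y k x - v x)" for k by (rule pint_diff(1)[OF even2 yp(1) v])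
    have "nu (\<lambda>x. ?w x - v x) = nu (\<lambda>x. (1/2) *\<^sub>R (y n x - v x) + (1/2) *\<^sub>R (y m x - v x))"
      by (rule arg_cong[where f = nu]) (simp add: fun_eq_iff field_simps)
    also have "\<dots> \<le> (1/2) * nu (\<lambda>x. y n x - v x) + (1/2) * nu (\<lambda>x. y m x - v x)"
      using pint_add(2)[OF even2 pint_scale[OF dn[of n]] pint_scale[OF dn[of m]], of "1/2" "1/2"]
      unfolding pnorm_scale[OF even2(2)] by simp
    also have "\<dots> \<le> (1/2) * (1 / Suc N) + (1/2) * (1 / Suc N)"
    proof -
      have "nu (\<lambda>x. y k x - v x) \<le> 1 / Suc N" if "N \<le> k" for k
        using S_mono[OF that] y(1)[of k] by (auto simp: S_def)
      then show ?thesis using nm by (intro add_mono mult_left_mono) auto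
    qed
    also have "(1/2) * (1 / Suc N) + (1/2) * (1 / Suc N) = 1 / real (Suc N)" by (simp only: distrib_right[symmetric]) simp
    finally have "?w \<in> S N" using wH unfolding S_def by blast
    then have "d N \<le> ng ?w" by (rule d_le)
    also have "ng ?w = pnorm 2 MM (\<lambda>x. (1/2) *\<^sub>R (gr (y n) x + gr (y m) x))"
      using ng_lincomb[OF H10_H1[OF yH] H10_H1[OF yH], of "1/2" n "1/2" m] by (simp add: scaleR_add_right)
    also have "\<dots> = (1/2) * pnorm 2 MM (\<lambda>x. gr (y n) x + gr (y m) x)" by (simp add: pnorm_scale)
    finally have "2 * d N \<le> pnorm 2 MM (\<lambda>x. gr (y n) x + gr (y m) x)" by simp
    then have 1: "4 * (d N)\<^sup>2 \<le> (pnorm 2 MM (\<lambda>x. gr (y n) x + gr (y m) x))\<^sup>2"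
      using power_mono[of "2 * d N" _ 2] d0[of N] by (simp add: power_mult_distrib)
    have 2: "(ng (y k))\<^sup>2 \<le> (D + 1 / Suc N)\<^sup>2" if "N \<le> k" for k
    proof (rule power_mono[OF _ pnorm_nonneg])
      have "1 / real (Suc k) \<le> 1 / real (Suc N)" using that by (simp add: frac_le)
      then show "ng (y k) \<le> D + 1 / Suc N" using y(2)[of k] dD[of k] by linarith
    qed
    show ?thesis
      using pnorm2_parallelogram[OF yp(2)[of n] yp(2)[of m]] 1 2[OF nm(1)] 2[OF nm(2)] by (simp add: \<delta>_def)
  qed
  have "\<exists>N. \<forall>n\<ge>N. \<forall>m\<ge>N. pnorm 2 MM (\<lambda>x. gr (y n) x - gr (y m) x) < e" if e: "0 < e" for e
  proof -
    have "\<forall>\<^sub>F N in sequentially. \<delta> N < e\<^sup>2" by (rule order_tendstoD(2)[OF \<delta>0]) (use e in simp)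
    then obtain N where N: "\<delta> N < e\<^sup>2" by (auto simp: eventually_sequentially)
    show ?thesis
    proof (intro exI[of _ N] allI impI)
      fix n m assume "N \<le> n" "N \<le> m"
      from le_less_trans[OF est[OF this] N] show "pnorm 2 MM (\<lambda>x. gr (y n) x - gr (y m) x) < e"
        by (rule power_less_imp_less_base) (use e in simp)
    qed
  qed
  moreover have "\<exists>N. \<forall>n\<ge>N. \<forall>m\<ge>N. nu (\<lambda>x. y n x - y m x) < e" if e: "0 < e" for e
  proof -
    have "\<forall>\<^sub>F n in sequentially. nu (\<lambda>x. y n x - v x) < e / 2" by (rule order_tendstoD(2)[OF yl]) (use e in simp)
    then obtain N where N: "\<And>n. n \<ge> N \<Longrightarrow> nu (\<lambda>x. y n x - v x) < e / 2" by (auto simp: eventually_sequentially)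
    show ?thesis
    proof (intro exI[of _ N] allI impI)
      fix n m assume nm: "N \<le> n" "N \<le> m"
      show "nu (\<lambda>x. y n x - y m x) < e"
        using pnorm_triangle[OF even2 yp(1) v yp(1), of n m] N[OF nm(1)] N[OF nm(2)]
          pnorm_minus_commute[of 2 MM v "y m"] by linarith
    qed
  qed
  ultimately obtain f where f: "f \<in> H10 \<Omega>" "(\<lambda>n. nu (\<lambda>x. y n x - f x)) \<longlonglongrightarrow> 0"
    "(\<lambda>n. pnorm 2 MM (\<lambda>x. gr (y n) x - gr f x)) \<longlonglongrightarrow> 0"
    using H10_complete[of y, OF yH] by blast
  note fp = H10_pint[OF f(1)]
  \<comment> \<open>Both \<open>f\<close> and \<open>v\<close> are \<open>L\<^sup>2\<close> limits
    of \<open>y\<close>, so they agree almost everywhere and membership passes from \<open>f\<close>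
    to \<open>v\<close>.\<close>
  have "nu (\<lambda>x. f x - v x) \<le> 0"
  proof (rule LIMSEQ_le_const[OF tendsto_add_zero[OF f(2) yl]])
    show "\<exists>N. \<forall>n\<ge>N. nu (\<lambda>x. f x - v x) \<le> nu (\<lambda>x. y n x - f x) + nu (\<lambda>x. y n x - v x)"
      using pnorm_triangle[OF even2 fp(1) yp(1) v] pnorm_minus_commute[of 2 MM f] by simp
  qed
  then have "AE x in MM. f x - v x = 0"
    using pnorm_nonneg[of 2 MM "\<lambda>x. f x - v x"] by (intro pnorm_zero_AE[OF even2(2) pint_diff(1)[OF even2 fp(1) v]]) simp
  then have ae: "AE x in MM. f x = v x" by eventually_elim simp
  note cong = H10_cong_AE[OF f(1) pint_measurable[OF v] ae]
  show "v \<in> H10 \<Omega>" by (rule cong(1))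
  have "ng f \<le> K"
  proof (rule LIMSEQ_le_const)
    show "(\<lambda>n. pnorm 2 MM (\<lambda>x. gr (y n) x - gr f x) + (K + 1 / Suc n)) \<longlonglongrightarrow> K"
      using tendsto_add[OF f(3) tendsto_add[OF tendsto_const[of K] inv0]] by simp
    show "\<exists>N. \<forall>n\<ge>N. ng f \<le> pnorm 2 MM (\<lambda>x. gr (y n) x - gr f x) + (K + 1 / Suc n)"
    proof (intro exI allI impI)
      fix n
      show "ng f \<le> pnorm 2 MM (\<lambda>x. gr (y n) x - gr f x) + (K + 1 / Suc n)"
        using pnorm_triangle_rev[OF even2 yp(2)[of n] fp(2)] y(2)[of n] dK[of n] by linarith
    qed
  qed
  then show "ng v \<le> K" using cong(2) by simp
qed

end

subsection \<open>Absolute values\<close>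

text \<open>Stays within \<open>e\<close> of |\<phi>|. Subtracting \<open>e\<close> makes it vanish
  where \<phi> does, which preserves compact support; the root is a \<open>powr\<close> to match
  \<open>Ck_powr\<close>.\<close>

definition smooth_abs :: "real \<Rightarrow> ('a \<Rightarrow> real) \<Rightarrow> 'a \<Rightarrow> real" where
  "smooth_abs e \<phi> x = ((\<phi> x)\<^sup>2 + e\<^sup>2) powr (1/2) - e"

lemma smooth_abs_bounds:
  assumes e: "0 < e"
  shows "\<bar>smooth_abs e \<phi> x - \<bar>\<phi> x\<bar>\<bar> \<le> e"
proof -
  have s: "((\<phi> x)\<^sup>2 + e\<^sup>2) powr (1/2) = sqrt ((\<phi> x)\<^sup>2 + e\<^sup>2)" by (simp add: powr_half_sqrt)
  have "\<bar>\<phi> x\<bar> \<le> sqrt ((\<phi> x)\<^sup>2 + e\<^sup>2)" using real_sqrt_sum_squares_ge1[of "\<bar>\<phi> x\<bar>" e] by simp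
  moreover have "sqrt ((\<phi> x)\<^sup>2 + e\<^sup>2) \<le> \<bar>\<phi> x\<bar> + e" using sqrt_sum_squares_le_sum[of "\<bar>\<phi> x\<bar>" e] e by simp
  ultimately show ?thesis unfolding smooth_abs_def s by simp
qed

lemma smooth_abs_test:
  assumes \<phi>: "\<phi> \<in> test_functions \<Omega>" and e: "0 < e"
  shows "smooth_abs e \<phi> \<in> test_functions \<Omega>" "norm (tgrad (smooth_abs e \<phi>) x) \<le> norm (tgrad \<phi> x)"
proof -
  have p: "0 < (\<phi> x)\<^sup>2 + e\<^sup>2" for x using e by (simp add: add_nonneg_pos)
  show t: "smooth_abs e \<phi> \<in> test_functions \<Omega>"
  proof (rule test_functionsI[OF _ _ test_functionsD(2,3)[OF \<phi>]])
    have ck: "Ck k (\<lambda>x. 1 * (\<phi> x)\<^sup>2 + e\<^sup>2 * 1)" for k by (intro Ck_lincomb Ck_power Ck_const test_functionsD(1)[OF \<phi>])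
    have "Ck k (\<lambda>x. 1 * ((\<phi> x)\<^sup>2 + e\<^sup>2) powr (1/2) + (- e) * 1)" for k
      using ck by (intro Ck_lincomb Ck_const Ck_powr p) simp
    then show "Ck k (smooth_abs e \<phi>)" for k by (simp add: smooth_abs_def[abs_def])
    have "smooth_abs e \<phi> x = 0" if "\<phi> x = 0" for x
      using that e by (simp add: smooth_abs_def powr_half_sqrt)
    then have "{x. smooth_abs e \<phi> x \<noteq> 0} \<subseteq> {x. \<phi> x \<noteq> 0}" by auto
    then show "{x. smooth_abs e \<phi> x \<noteq> 0} \<subseteq> closure {x. \<phi> x \<noteq> 0}" using closure_subset by (rule subset_trans)
  qed
  \<comment> \<open>By the chain rule the gradient is multiplied by \<open>q\<close>, and |q| =
    |\<phi>| / sqrt(\<phi>^2 + e^2) is at most 1.\<close>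
  define q where "q = \<phi> x * ((\<phi> x)\<^sup>2 + e\<^sup>2) powr (-1/2)"
  have d: "((\<lambda>x. (\<phi> x)\<^sup>2 + e\<^sup>2) has_derivative (\<lambda>h. 2 * \<phi> x * (tgrad \<phi> x \<bullet> h))) (at x)"
    by (auto intro!: derivative_eq_intros tgrad_derivative[OF \<phi>])
  have "((\<lambda>x. ((\<phi> x)\<^sup>2 + e\<^sup>2) powr (1/2)) has_derivative
      (\<lambda>h. (2 * \<phi> x * (tgrad \<phi> x \<bullet> h)) * ((1/2) * ((\<phi> x)\<^sup>2 + e\<^sup>2) powr (1/2 - 1)))) (at x)"
    by (rule DERIV_compose_FDERIV[OF _ d]) (rule has_real_derivative_powr[OF p])
  then have "(smooth_abs e \<phi> has_derivative (\<lambda>h. (2 * \<phi> x * (tgrad \<phi> x \<bullet> h)) * ((1/2) * ((\<phi> x)\<^sup>2 + e\<^sup>2) powr (1/2 - 1)) - 0)) (at x)"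
    unfolding smooth_abs_def[abs_def] by (rule has_derivative_diff) simp
  then have "(smooth_abs e \<phi> has_derivative (\<lambda>h. (q *\<^sub>R tgrad \<phi> x) \<bullet> h)) (at x)"
    by (rule has_derivative_eq_rhs) (simp add: fun_eq_iff q_def mult_ac)
  then have g: "tgrad (smooth_abs e \<phi>) x = q *\<^sub>R tgrad \<phi> x" by (rule tgrad_unique[OF t])
  have "\<bar>q\<bar> \<le> 1"
  proof -
    have "((\<phi> x)\<^sup>2 + e\<^sup>2) powr (-1/2) = 1 / sqrt ((\<phi> x)\<^sup>2 + e\<^sup>2)"
      using p[of x] by (simp add: powr_minus_divide powr_half_sqrt[symmetric])
    moreover have "\<bar>\<phi> x\<bar> \<le> sqrt ((\<phi> x)\<^sup>2 + e\<^sup>2)" using real_sqrt_sum_squares_ge1[of "\<bar>\<phi> x\<bar>" e] by simp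
    ultimately show ?thesis using p[of x] by (simp add: q_def abs_mult)
  qed
  then show "norm (tgrad (smooth_abs e \<phi>) x) \<le> norm (tgrad \<phi> x)"
    unfolding g by (simp add: mult_left_le_one_le)
qed

context open_set
begin

lemma pint_const:
  assumes bd: "bounded \<Omega>"
  shows "pint p MM (\<lambda>x. c::real)"
proof -
  have "emeasure MM (space MM) < \<infinity>"
    using emeasure_bounded_finite[OF bd] open_dom
    by (simp add: emeasure_restrict_space space_restrict_space)
  then have "integrable MM (\<lambda>x. norm c ^ p)"
    by (intro finite_measure.integrable_const finite_measureI) (simp add: less_top[symmetric])
  then show ?thesis by (simp add: pint_def)
qed

text \<open>Smoothed absolute values of the approximants converge to |u| in \<open>L\<^sup>2\<close>
  and have no larger gradients. \<open>H10_closed_L2\<close> gives membership and norm bound at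
  once, which bypasses a chain rule for |u|.\<close>

lemma H10_abs:
  assumes bd: "bounded \<Omega>" and u: "u \<in> H10 \<Omega>"
  shows "(\<lambda>x. \<bar>u x\<bar>) \<in> H10 \<Omega>" "ng (\<lambda>x. \<bar>u x\<bar>) \<le> ng u"
proof -
  note up = H10_pint[OF u]
  have ap: "pint 2 MM (\<lambda>x. \<bar>u x\<bar>)"
    by (rule pnorm_mono(1)[OF even2(2) up(1)]) (use pint_measurable[OF up(1)] in auto)
  have one: "pint 2 MM (\<lambda>x. c)" for c :: real by (rule pint_const[OF bd])
  define m where "m = pnorm 2 MM (\<lambda>x. 1::real)"
  have *: "(\<lambda>x. \<bar>u x\<bar>) \<in> H10 \<Omega> \<and> ng (\<lambda>x. \<bar>u x\<bar>) \<le> ng u + e" if e: "0 < e" for e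
  proof -
    obtain \<phi> where \<phi>: "\<And>n. \<phi> n \<in> test_functions \<Omega>" "\<And>n. nu (\<lambda>x. u x - \<phi> n x) < e / Suc n"
      "\<And>n. pnorm 2 MM (\<lambda>x. gr u x - tgrad (\<phi> n) x) < e / Suc n"
      using H10_approx_seq[OF u e] by blast
    note t = test_pnorm_lebesgue_on[OF open_dom \<phi>(1) even2(2)]
    have en: "e / Suc n \<le> e" for n using e by (simp add: divide_le_eq mult_le_cancel_left1)
    have en0: "0 < e / Suc n" for n using e by simp
    define \<psi> where "\<psi> n = smooth_abs (e / Suc n) (\<phi> n)" for n
    have \<psi>: "\<psi> n \<in> test_functions \<Omega>" "\<And>x. norm (tgrad (\<psi> n) x) \<le> norm (tgrad (\<phi> n) x)" for n
      unfolding \<psi>_def using smooth_abs_test[OF \<phi>(1) en0] by auto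
    note t\<psi> = test_pnorm_lebesgue_on[OF open_dom \<psi>(1) even2(2)]
    \<comment> \<open>The first summand is the smoothing error on a domain of finite measure, the
      second the approximation error.\<close>
    have le: "nu (\<lambda>x. \<psi> n x - \<bar>u x\<bar>) \<le> e / Suc n * m + e / Suc n" for n
    proof -
      have ab: "pint 2 MM (\<lambda>x. \<bar>\<phi> n x\<bar>)"
        by (rule pnorm_mono(1)[OF even2(2) t(1)]) (use pint_measurable[OF t(1)] in auto)
      have "nu (\<lambda>x. \<psi> n x - \<bar>\<phi> n x\<bar>) \<le> pnorm 2 MM (\<lambda>x. (e / Suc n) *\<^sub>R (1::real))"
        by (rule pnorm_mono(2)[OF even2(2) _ pint_measurable[OF pint_diff(1)[OF even2 t\<psi>(1) ab]]])
          (use one smooth_abs_bounds[OF en0, of n "\<phi> n"] e in \<open>auto simp: \<psi>_def\<close>)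
      also have "\<dots> = e / Suc n * m" unfolding m_def pnorm_scale[OF even2(2)] using e by simp
      finally have 1: "nu (\<lambda>x. \<psi> n x - \<bar>\<phi> n x\<bar>) \<le> e / Suc n * m" .
      have "nu (\<lambda>x. \<bar>\<phi> n x\<bar> - \<bar>u x\<bar>) \<le> nu (\<lambda>x. \<phi> n x - u x)"
        by (rule pnorm_mono(2)[OF even2(2) pint_diff(1)[OF even2 t(1) up(1)] pint_measurable[OF pint_diff(1)[OF even2 ab ap]]]) auto
      then have "nu (\<lambda>x. \<bar>\<phi> n x\<bar> - \<bar>u x\<bar>) \<le> e / Suc n"
        using \<phi>(2)[of n] pnorm_minus_commute[of 2 MM u "\<phi> n"] by linarith
      then show ?thesis using 1 pnorm_triangle[OF even2 t\<psi>(1)[of n] ab ap] by linarith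
    qed
    have "(\<lambda>n. e * (1 / Suc n) * m + e * (1 / Suc n)) \<longlonglongrightarrow> e * 0 * m + e * 0"
      by (intro tendsto_intros LIMSEQ_Suc[OF lim_1_over_n])
    then have lim: "(\<lambda>n. e / Suc n * m + e / Suc n) \<longlonglongrightarrow> 0" by simp
    have l: "(\<lambda>n. nu (\<lambda>x. \<psi> n x - \<bar>u x\<bar>)) \<longlonglongrightarrow> 0"
      by (rule tendsto_sandwich[OF _ _ tendsto_const lim])
        (intro always_eventually allI pnorm_nonneg le)+
    have b: "ng (\<psi> n) \<le> ng u + e" for n
    proof -
      have "ng (\<psi> n) = pnorm 2 MM (tgrad (\<psi> n))" by (rule ng_test[OF \<psi>(1)])
      also have "\<dots> \<le> pnorm 2 MM (tgrad (\<phi> n))" by (rule pnorm_mono(2)[OF even2(2) t(2) pint_measurable[OF t\<psi>(2)] \<psi>(2)])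
      also have "\<dots> \<le> ng u + e"
        using pnorm_triangle_rev[OF even2 up(2) t(2)[of n]] \<phi>(3)[of n] en[of n] by linarith
      finally show ?thesis .
    qed
    show ?thesis using H10_closed_L2[of \<psi>, OF test_H10[OF \<psi>(1)] ap l b] by blast
  qed
  show "(\<lambda>x. \<bar>u x\<bar>) \<in> H10 \<Omega>" using *[of 1] by simp
  show "ng (\<lambda>x. \<bar>u x\<bar>) \<le> ng u" by (rule field_le_epsilon) (use * in blast)
qed

end

subsection \<open>Sobolev inequality and compactness\<close>

lemma pnorm2_sqrt: "sqrt (LINT x|M. (norm (f x))\<^sup>2) = pnorm 2 M f"
  by (simp add: pnorm_def sqrt_def)

locale small_dim_domain = open_set \<Omega> for \<Omega> :: "'a::euclidean_space set" +
  assumes bounded_dom: "bounded \<Omega>" and nonempty_dom: "\<Omega> \<noteq> {}" and dim3: "DIM('a) \<le> 3"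
begin

definition "c_int = 4 * sqrt (2 ^ DIM('a) * real DIM('a)) / (1 - root 4 (1/2))"

lemma root4_half: "0 < root 4 (1/2::real)" "root 4 (1/2::real) < 1"
  using real_root_less_mono[of 4 "1/2" 1] by simp_all

lemma c_int_nonneg: "0 \<le> c_int"
  using root4_half by (simp add: c_int_def)

text \<open>The free scale \<open>k\<close> balances the two norms: \<open>k = 0\<close> leads to
  the Sobolev inequality, large \<open>k\<close> suppresses the gradient term for
  compactness.\<close>

lemma H10_interpolation:
  assumes u: "u \<in> H10 \<Omega>"
  shows "pint 4 MM u" "pnorm 4 MM u \<le> root 4 ((2 ^ k) ^ DIM('a)) * nu u + c_int * root 4 (1/2) ^ k * ng u"
proof -
  have A: "0 \<le> root 4 ((2 ^ k) ^ DIM('a) :: real)" by simp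
  have B: "0 \<le> c_int * root 4 (1/2) ^ k" using c_int_nonneg root4_half by simp
  have T: "pnorm 4 lborel \<phi> \<le> root 4 ((2 ^ k) ^ DIM('a)) * pnorm 2 lborel \<phi> + c_int * root 4 (1/2) ^ k * pnorm 2 lborel (tgrad \<phi>)"
    if "\<phi> \<in> test_functions \<Omega>" for \<phi>
    unfolding c_int_def using test_interpolation[OF that dim3] by simp
  show "pint 4 MM u" "pnorm 4 MM u \<le> root 4 ((2 ^ k) ^ DIM('a)) * nu u + c_int * root 4 (1/2) ^ k * ng u"
    by (rule H10_L4_bound[OF A B T u], assumption)+
qed

lemma dom_radius: "\<exists>R>0. \<Omega> \<subseteq> ball 0 R"
proof -
  obtain R where "0 < R" "\<forall>x\<in>\<Omega>. norm x < R" using bounded_dom unfolding bounded_pos_less by blast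
  then show ?thesis by (intro exI[of _ R]) auto
qed

lemma H10_sobolev: "\<exists>C. \<forall>u\<in>H10 \<Omega>. pint 4 MM u \<and> pnorm 4 MM u \<le> C * ng u"
proof -
  obtain R where R: "0 < R" "\<Omega> \<subseteq> ball 0 R" using dom_radius by blast
  have "pnorm 4 MM u \<le> (sqrt 2 * R + c_int) * ng u" if u: "u \<in> H10 \<Omega>" for u
    using H10_interpolation(2)[OF u, of 0] H10_poincare[OF R u] by (simp add: distrib_right)
  then show ?thesis using H10_interpolation(1) by (intro exI[of _ "sqrt 2 * R + c_int"]) blast
qed

lemma H10_nonzero: "\<exists>u\<in>H10 \<Omega>. pint 4 MM u \<and> 0 < pnorm 4 MM u"
proof -
  obtain x where x: "x \<in> \<Omega>" using nonempty_dom by blast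
  obtain a c where ac: "x \<in> box a c" "cbox a c \<subseteq> \<Omega>"
    using open_contains_cbox[of \<Omega> x] open_dom x by metis
  let ?u = "box_approx a c 1"
  have t: "?u \<in> test_functions \<Omega>" by (rule box_approx_test_function[OF ac(2)])
  have p: "pint 4 MM ?u" by (rule test_pnorm_lebesgue_on(1)[OF open_dom t even4(2)])
  have "pnorm 4 MM ?u \<noteq> 0"
  proof
    assume "pnorm 4 MM ?u = 0"
    then have "AE x in MM. ?u x = 0" by (rule pnorm_zero_AE[OF even4(2) p])
    then have "AE x in lebesgue. x \<in> \<Omega> \<longrightarrow> ?u x = 0" using open_dom by (simp add: AE_restrict_space_iff)
    then have "AE x in lebesgue. x \<notin> box a c"
    proof eventually_elim
      case (elim y)
      show ?case
      proof
        assume y: "y \<in> box a c"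
        then have "y \<in> \<Omega>" using ac(2) box_subset_cbox[of a c] by blast
        then show False using elim bump_pos[OF y] by (simp add: box_approx_def)
      qed
    qed
    then have "box a c \<in> null_sets lebesgue" by (simp add: AE_iff_null_sets)
    then have "negligible (box a c)" by (simp add: negligible_iff_null_sets)
    then have "box a c = {}" by (simp only: negligible_interval)
    then show False using ac(1) by simp
  qed
  then have "0 < pnorm 4 MM ?u" using pnorm_nonneg[of 4 MM ?u] by simp
  then show ?thesis using test_H10[OF t] p by blast
qed

text \<open>\<open>LEAST\<close> on the reals has meaning only when the minimum is attained. The
  admissible constants are a nonempty set by \<open>H10_sobolev\<close>, bounded below by the
  quotient of one nonzero function, and contain their infimum because every quotient is a lower
  bound.\<close>

lemma S4_facts:
  shows "0 < S4 \<Omega>" "u \<in> H10 \<Omega> \<Longrightarrow> pnorm 4 MM u \<le> S4 \<Omega> * ng u"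
proof -
  define X where "X = {C. \<forall>u\<in>H10 \<Omega>. pint 4 MM u \<and> pnorm 4 MM u \<le> C * ng u}"
  have S4: "S4 \<Omega> = (LEAST C. C \<in> X)"
    unfolding S4_def X_def Lp4_iff Lp_norm_4 pnorm2_sqrt by simp
  have ne: "X \<noteq> {}" using H10_sobolev by (auto simp: X_def)
  obtain u0 where u0: "u0 \<in> H10 \<Omega>" "0 < pnorm 4 MM u0" using H10_nonzero by blast
  have lb: "0 < ng u0 \<and> pnorm 4 MM u0 / ng u0 \<le> C" if "C \<in> X" for C
  proof -
    have le: "pnorm 4 MM u0 \<le> C * ng u0" using that u0(1) by (auto simp: X_def)
    then have "ng u0 \<noteq> 0" using u0(2) by auto
    then have "0 < ng u0" using pnorm_nonneg[of 2 MM "gr u0"] by simp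
    then show ?thesis using le by (simp add: divide_le_eq)
  qed
  have bdd: "bdd_below X" using lb by (intro bdd_belowI[of _ "pnorm 4 MM u0 / ng u0"]) blast
  have "Inf X \<in> X"
    unfolding X_def mem_Collect_eq
  proof (intro ballI conjI)
    fix u assume u: "u \<in> H10 \<Omega>"
    show "pint 4 MM u" by (rule H10_interpolation(1)[OF u])
    obtain C where "C \<in> X" using ne by blast
    then have C: "pnorm 4 MM u \<le> C * ng u" using u by (auto simp: X_def)
    show "pnorm 4 MM u \<le> Inf {C. \<forall>u\<in>H10 \<Omega>. pint 4 MM u \<and> pnorm 4 MM u \<le> C * ng u} * ng u"
    \<comment> \<open>A vanishing gradient leaves no quotient; an admissible constant then already
      forces the \<open>L\<^sup>4\<close> norm to be 0.\<close>
    proof (cases "ng u = 0")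
      case True
      then show ?thesis using C by simp
    next
      case False
      then have p: "0 < ng u" using pnorm_nonneg[of 2 MM "gr u"] by simp
      have "pnorm 4 MM u / ng u \<le> Inf X"
      proof (rule cInf_greatest[OF ne])
        fix C assume "C \<in> X"
        then have "pnorm 4 MM u \<le> C * ng u" using u by (auto simp: X_def)
        then show "pnorm 4 MM u / ng u \<le> C" using p by (simp add: divide_le_eq)
      qed
      then show ?thesis using p by (simp add: divide_le_eq X_def)
    qed
  qed
  then have S: "S4 \<Omega> \<in> X" unfolding S4 by (rule LeastI2_order[where P = "\<lambda>C. C \<in> X"]) (auto intro: cInf_lower[OF _ bdd])
  then show "u \<in> H10 \<Omega> \<Longrightarrow> pnorm 4 MM u \<le> S4 \<Omega> * ng u" by (auto simp: X_def)
  show "0 < S4 \<Omega>" using lb[OF S] u0(2) by (auto intro: less_le_trans[OF divide_pos_pos])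
qed

text \<open>Test functions close to the sequence inherit its bounds, so \<open>test_rellich\<close>
  yields a subsequence that is Cauchy in \<open>L\<^sup>2\<close>; interpolation lifts this to
  \<open>L\<^sup>4\<close>.\<close>

lemma H10_rellich:
  assumes s: "\<And>n. s n \<in> H10 \<Omega>" and K: "\<And>n. nu (s n) \<le> K" "\<And>n. ng (s n) \<le> K"
  shows "\<exists>r::nat\<Rightarrow>nat. strict_mono r \<and> (\<forall>e>0. \<exists>N. \<forall>n\<ge>N. \<forall>m\<ge>N. pnorm 4 MM (\<lambda>x. s (r n) x - s (r m) x) < e)"
proof -
  obtain R where R: "0 < R" "\<Omega> \<subseteq> ball 0 R" using dom_radius by blast
  have "\<exists>\<phi>\<in>test_functions \<Omega>. nu (\<lambda>x. s n x - \<phi> x) < 1 / Suc n \<and> pnorm 2 MM (\<lambda>x. gr (s n) x - tgrad \<phi> x) < 1 / Suc n" for n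
    by (rule H10_approx[OF s]) simp
  then obtain \<phi> where \<phi>: "\<And>n. \<phi> n \<in> test_functions \<Omega>" "\<And>n. nu (\<lambda>x. s n x - \<phi> n x) < 1 / Suc n"
    "\<And>n. pnorm 2 MM (\<lambda>x. gr (s n) x - tgrad (\<phi> n) x) < 1 / Suc n" by metis
  note sp = H10_pint[OF s]
  note t = test_pnorm_lebesgue_on[OF open_dom \<phi>(1) even2(2)]
  have le1: "1 / real (Suc n) \<le> 1" for n by simp
  have b: "pnorm 2 lborel (\<phi> n) \<le> K + 1" "pnorm 2 lborel (tgrad (\<phi> n)) \<le> K + 1" for n
    unfolding t(3,4)[symmetric]
    using pnorm_triangle_rev[OF even2 sp(1)[of n] t(1)[of n]] \<phi>(2)[of n] K(1)[of n] le1[of n]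
      pnorm_triangle_rev[OF even2 sp(2)[of n] t(2)[of n]] \<phi>(3)[of n] K(2)[of n] by linarith+
  obtain r :: "nat \<Rightarrow> nat" where r: "strict_mono r"
    "\<forall>e>0. \<exists>N. \<forall>n\<ge>N. \<forall>m\<ge>N. pnorm 2 lborel (\<lambda>x. \<phi> (r n) x - \<phi> (r m) x) < e"
    using test_rellich[of \<phi> \<Omega> R "K + 1", OF \<phi>(1) R b] by (elim exE conjE)
  have c2: "\<exists>N. \<forall>n\<ge>N. \<forall>m\<ge>N. nu (\<lambda>x. s (r n) x - s (r m) x) < e" if e: "0 < e" for e
  proof -
    have e3: "0 < e / 3" using e by simp
    obtain N1 where N1: "\<forall>n\<ge>N1. \<forall>m\<ge>N1. pnorm 2 lborel (\<lambda>x. \<phi> (r n) x - \<phi> (r m) x) < e / 3"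
      using r(2) e3 by blast
    have "\<forall>\<^sub>F n in sequentially. 1 / real (Suc n) < e / 3"
      by (rule order_tendstoD(2)[OF LIMSEQ_Suc[OF lim_1_over_n] e3])
    then obtain N2 where N2: "\<And>n. n \<ge> N2 \<Longrightarrow> 1 / real (Suc n) < e / 3" by (auto simp: eventually_sequentially)
    have N2': "nu (\<lambda>x. s (r n) x - \<phi> (r n) x) < e / 3" if "N2 \<le> n" for n
    proof -
      have "N2 \<le> r n" using seq_suble[OF r(1), of n] that by linarith
      then show ?thesis using \<phi>(2)[of "r n"] N2[of "r n"] by linarith
    qed
    show ?thesis
    proof (intro exI[of _ "max N1 N2"] allI impI)
      fix n m assume "max N1 N2 \<le> n" "max N1 N2 \<le> m"
      then have nm: "N1 \<le> n" "N1 \<le> m" "N2 \<le> n" "N2 \<le> m" by auto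
      have d: "nu (\<lambda>x. \<phi> (r n) x - \<phi> (r m) x) < e / 3"
        using N1 nm test_pnorm_lebesgue_on(3)[OF open_dom test_diff[OF \<phi>(1) \<phi>(1)] even2(2), of "r n" "r m"] by simp
      show "nu (\<lambda>x. s (r n) x - s (r m) x) < e"
        using pnorm_triangle[OF even2 sp(1)[of "r n"] t(1)[of "r n"] sp(1)[of "r m"]]
          pnorm_triangle[OF even2 t(1)[of "r n"] t(1)[of "r m"] sp(1)[of "r m"]] d N2'[OF nm(3)] N2'[OF nm(4)]
          pnorm_minus_commute[of 2 MM "\<phi> (r m)" "s (r m)"] by linarith
    qed
  qed
  show ?thesis
  proof (intro exI[of _ r] conjI r(1) allI impI)
    fix e :: real assume e: "0 < e"
    \<comment> \<open>\<open>k\<close> comes before \<open>N\<close>: it makes the gradient term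
      small uniformly, and \<open>N\<close> then compensates the factor \<open>V\<close>, which
      grows with \<open>k\<close>.\<close>
    have "(\<lambda>k. (c_int * (2 * K)) * root 4 (1/2) ^ k) \<longlonglongrightarrow> (c_int * (2 * K)) * 0"
      using root4_half by (intro tendsto_mult_left LIMSEQ_realpow_zero) auto
    then have "\<forall>\<^sub>F k in sequentially. (c_int * (2 * K)) * root 4 (1/2) ^ k < e / 2"
      by (rule order_tendstoD(2)) (use e in simp)
    then obtain k where k: "(c_int * (2 * K)) * root 4 (1/2) ^ k < e / 2" by (auto simp: eventually_sequentially)
    define V where "V = root 4 ((2 ^ k) ^ DIM('a) :: real)"
    have V: "0 < V" by (simp add: V_def)
    obtain N where N: "\<forall>n\<ge>N. \<forall>m\<ge>N. nu (\<lambda>x. s (r n) x - s (r m) x) < e / (2 * V)"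
      using c2[of "e / (2 * V)"] e V by auto
    show "\<exists>N. \<forall>n\<ge>N. \<forall>m\<ge>N. pnorm 4 MM (\<lambda>x. s (r n) x - s (r m) x) < e"
    proof (intro exI[of _ N] allI impI)
      fix n m assume nm: "N \<le> n" "N \<le> m"
      let ?d = "\<lambda>x. s (r n) x - s (r m) x"
      have dH: "?d \<in> H10 \<Omega>" by (rule H10_diff[OF s s])
      have "ng ?d \<le> 2 * K"
        using ng_diff[OF H10_H1[OF s] H10_H1[OF s], of "r n" "r m"]
          pint_diff(2)[OF even2 sp(2)[of "r n"] sp(2)[of "r m"]] K(2)[of "r n"] K(2)[of "r m"] by linarith
      then have "c_int * root 4 (1/2) ^ k * ng ?d \<le> c_int * root 4 (1/2) ^ k * (2 * K)"
        using c_int_nonneg root4_half by (intro mult_left_mono) auto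
      also have "\<dots> < e / 2" using k by (simp add: mult_ac)
      finally have 1: "c_int * root 4 (1/2) ^ k * ng ?d < e / 2" .
      have "V * nu ?d < V * (e / (2 * V))" using N nm V by (intro mult_strict_left_mono) auto
      also have "\<dots> = e / 2" using V by simp
      finally show "pnorm 4 MM ?d < e" using 1 H10_interpolation(2)[OF dH, of k] unfolding V_def by linarith
    qed
  qed
qed

end

subsection \<open>The quartic form\<close>

text \<open>The arithmetic-geometric mean inequality, first on the two pairs and then on the
  squares; the crude constants are enough for domination.\<close>

lemma abs_prod4_le: "\<bar>a * b * c * d\<bar> \<le> a ^ 4 + b ^ 4 + c ^ 4 + d ^ (4::nat)" for a b c d :: real
proof -
  have sq: "2 * \<bar>s * t\<bar> \<le> s\<^sup>2 + t\<^sup>2" for s t :: real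
    using sum_squares_bound[of "\<bar>s\<bar>" "\<bar>t\<bar>"] by (simp add: abs_mult)
  have "2 * \<bar>(a * b) * (c * d)\<bar> \<le> (a * b)\<^sup>2 + (c * d)\<^sup>2" by (rule sq)
  moreover have "2 * \<bar>a\<^sup>2 * b\<^sup>2\<bar> \<le> (a\<^sup>2)\<^sup>2 + (b\<^sup>2)\<^sup>2" "2 * \<bar>c\<^sup>2 * d\<^sup>2\<bar> \<le> (c\<^sup>2)\<^sup>2 + (d\<^sup>2)\<^sup>2" by (rule sq)+
  moreover have "0 \<le> a ^ 4" "0 \<le> b ^ 4" "0 \<le> c ^ 4" "0 \<le> d ^ 4" by simp_all
  ultimately show ?thesis by (simp add: power_mult_distrib mult.assoc)
qed

lemma pint4_prod_integrable:
  fixes a b c d :: "'x \<Rightarrow> real"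
  assumes "pint 4 M a" "pint 4 M b" "pint 4 M c" "pint 4 M d"
  shows "integrable M (\<lambda>x. a x * b x * c x * d x)"
proof (rule Bochner_Integration.integrable_bound[where f = "\<lambda>x. a x ^ 4 + b x ^ 4 + c x ^ 4 + d x ^ 4"])
  have "integrable M (\<lambda>x. e x ^ 4)" if "pint 4 M e" for e :: "'x \<Rightarrow> real" using pint_integrable[OF that] by simp
  then show "integrable M (\<lambda>x. a x ^ 4 + b x ^ 4 + c x ^ 4 + d x ^ 4)"
    using assms by (intro Bochner_Integration.integrable_add) auto
  show "(\<lambda>x. a x * b x * c x * d x) \<in> borel_measurable M"
    using assms[THEN pint_measurable] by (intro borel_measurable_times)
  show "AE x in M. norm (a x * b x * c x * d x) \<le> norm (a x ^ 4 + b x ^ 4 + c x ^ 4 + d x ^ 4)"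
    using abs_prod4_le by (intro AE_I2) (auto intro: order_trans[OF _ abs_ge_self])
qed

text \<open>All terms are products of four factors, so that \<open>pint4_prod_integrable\<close>
  covers pure and mixed ones alike and expansions are ring normalisation.\<close>

definition quartic :: "'x measure \<Rightarrow> real \<Rightarrow> real \<Rightarrow> real \<Rightarrow> ('x \<Rightarrow> real) \<Rightarrow> ('x \<Rightarrow> real) \<Rightarrow> real" where
  "quartic M \<mu>1 \<mu>2 \<beta> u v = (LINT x|M. \<mu>1 * (u x * u x * u x * u x) + \<mu>2 * (v x * v x * v x * v x)
     + 2 * \<beta> * (u x * u x * v x * v x))"

definition dquartic :: "'x measure \<Rightarrow> real \<Rightarrow> real \<Rightarrow> real \<Rightarrow> ('x \<Rightarrow> real) \<Rightarrow> ('x \<Rightarrow> real) \<Rightarrow> ('x \<Rightarrow> real) \<Rightarrow> ('x \<Rightarrow> real) \<Rightarrow> real" where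
  "dquartic M \<mu>1 \<mu>2 \<beta> u v \<phi> \<psi> = (LINT x|M. 4 * (\<mu>1 * (u x * u x * u x * \<phi> x) + \<mu>2 * (v x * v x * v x * \<psi> x)
     + \<beta> * (u x * v x * v x * \<phi> x) + \<beta> * (u x * u x * v x * \<psi> x)))"

lemma pnorm4_power: "pnorm 4 M u ^ 4 = (LINT x|M. u x * u x * u x * u x)" for u :: "'x \<Rightarrow> real"
proof -
  have "norm y ^ 4 = y * y * y * y" for y :: real
  proof -
    have "norm y ^ 4 = y ^ 4" by simp
    also have "\<dots> = y * y * y * y" by (rule power4_eq_xxxx)
    finally show ?thesis .
  qed
  then show ?thesis by (simp only: pnorm_power[OF even4(2)])
qed

text \<open>By (u + v)^4 + (u - v)^4 = 2 u^4 + 12 u^2 v^2 + 2 v^4 the mixed term is a combination of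
  pure fourth powers. Continuity of the form thereby reduces to the triangle inequality in
  \<open>L\<^sup>4\<close>.\<close>

lemma quartic_pnorm:
  assumes u: "pint 4 M u" and v: "pint 4 M v"
  shows "quartic M \<mu>1 \<mu>2 \<beta> u v = (\<mu>1 - \<beta> / 3) * pnorm 4 M u ^ 4 + (\<mu>2 - \<beta> / 3) * pnorm 4 M v ^ 4
    + \<beta> / 6 * pnorm 4 M (\<lambda>x. u x + v x) ^ 4 + \<beta> / 6 * pnorm 4 M (\<lambda>x. u x - v x) ^ 4"
proof -
  note s = pint_add(1)[OF even4 u v] and d = pint_diff(1)[OF even4 u v]
  have i: "integrable M (\<lambda>x. w x * w x * w x * w x)" if "pint 4 M w" for w :: "'a \<Rightarrow> real"
    by (rule pint4_prod_integrable[OF that that that that])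
  have "quartic M \<mu>1 \<mu>2 \<beta> u v = (LINT x|M. (\<mu>1 - \<beta> / 3) * (u x * u x * u x * u x) + (\<mu>2 - \<beta> / 3) * (v x * v x * v x * v x)
     + \<beta> / 6 * ((u x + v x) * (u x + v x) * (u x + v x) * (u x + v x))
     + \<beta> / 6 * ((u x - v x) * (u x - v x) * (u x - v x) * (u x - v x)))"
    unfolding quartic_def by (rule Bochner_Integration.integral_cong) (auto simp: field_simps)
  also have "\<dots> = (\<mu>1 - \<beta> / 3) * pnorm 4 M u ^ 4 + (\<mu>2 - \<beta> / 3) * pnorm 4 M v ^ 4
    + \<beta> / 6 * pnorm 4 M (\<lambda>x. u x + v x) ^ 4 + \<beta> / 6 * pnorm 4 M (\<lambda>x. u x - v x) ^ 4"
    unfolding pnorm4_power using i[OF u] i[OF v] i[OF s] i[OF d] by simp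
  finally show ?thesis .
qed

lemma power4_diff_le:
  fixes a b R :: real
  assumes "0 \<le> a" "a \<le> R" "0 \<le> b" "b \<le> R"
  shows "\<bar>a ^ 4 - b ^ 4\<bar> \<le> 4 * R ^ 3 * \<bar>a - b\<bar>"
proof -
  have "a ^ 4 - b ^ 4 = (a ^ 3 + a\<^sup>2 * b + a * b\<^sup>2 + b ^ 3) * (a - b)"
    by (simp add: power2_eq_square power3_eq_cube power4_eq_xxxx algebra_simps)
  moreover have "a ^ 3 + a\<^sup>2 * b + a * b\<^sup>2 + b ^ 3 \<le> R ^ 3 + R\<^sup>2 * R + R * R\<^sup>2 + R ^ 3"
    using assms by (intro add_mono mult_mono power_mono) auto
  then have "a ^ 3 + a\<^sup>2 * b + a * b\<^sup>2 + b ^ 3 \<le> 4 * R ^ 3"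
    by (simp add: power2_eq_square power3_eq_cube)
  moreover have "0 \<le> a ^ 3 + a\<^sup>2 * b + a * b\<^sup>2 + b ^ 3" using assms by simp
  ultimately show ?thesis by (simp add: abs_mult mult_right_mono)
qed

text \<open>Each norm in \<open>quartic_pnorm\<close> is Lipschitz and fourth powers are Lipschitz
  on bounded intervals; for sum and difference of the components the bound is
  \<open>2 * K\<close>.\<close>

lemma quartic_lipschitz:
  fixes u v u' v' :: "'x \<Rightarrow> real"
  assumes "pint 4 M u" "pint 4 M v" "pint 4 M u'" "pint 4 M v'"
    and K: "pnorm 4 M u \<le> K" "pnorm 4 M v \<le> K" "pnorm 4 M u' \<le> K" "pnorm 4 M v' \<le> K"
  shows "\<bar>quartic M \<mu>1 \<mu>2 \<beta> u v - quartic M \<mu>1 \<mu>2 \<beta> u' v'\<bar> \<le>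
    ((\<bar>\<mu>1 - \<beta> / 3\<bar> + \<bar>\<mu>2 - \<beta> / 3\<bar>) * (4 * K ^ 3) + \<bar>\<beta>\<bar> / 3 * (4 * (2 * K) ^ 3)) *
      (pnorm 4 M (\<lambda>x. u x - u' x) + pnorm 4 M (\<lambda>x. v x - v' x))"
proof -
  note p = assms(1-4)
  define du where "du = pnorm 4 M (\<lambda>x. u x - u' x)"
  define dv where "dv = pnorm 4 M (\<lambda>x. v x - v' x)"
  have d0: "0 \<le> du" "0 \<le> dv" by (simp_all add: du_def dv_def pnorm_nonneg)
  have K0: "0 \<le> K" using K(1) pnorm_nonneg[of 4 M u] by linarith
  have 1: "\<bar>pnorm 4 M u ^ 4 - pnorm 4 M u' ^ 4\<bar> \<le> 4 * K ^ 3 * (du + dv)"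
    using power4_diff_le[OF pnorm_nonneg K(1) pnorm_nonneg K(3)]
      mult_left_mono[of "\<bar>pnorm 4 M u - pnorm 4 M u'\<bar>" "du + dv" "4 * K ^ 3"]
      pnorm_triangle_rev[OF even4 p(1,3)] d0 K0 by (simp add: du_def)
  have 2: "\<bar>pnorm 4 M v ^ 4 - pnorm 4 M v' ^ 4\<bar> \<le> 4 * K ^ 3 * (du + dv)"
    using power4_diff_le[OF pnorm_nonneg K(2) pnorm_nonneg K(4)]
      mult_left_mono[of "\<bar>pnorm 4 M v - pnorm 4 M v'\<bar>" "du + dv" "4 * K ^ 3"]
      pnorm_triangle_rev[OF even4 p(2,4)] d0 K0 by (simp add: dv_def)
  have du': "pint 4 M (\<lambda>x. u x - u' x)" and dv': "pint 4 M (\<lambda>x. v x - v' x)"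
    by (rule pint_diff(1)[OF even4 p(1,3)], rule pint_diff(1)[OF even4 p(2,4)])
  have 3: "\<bar>pnorm 4 M (\<lambda>x. u x + v x) ^ 4 - pnorm 4 M (\<lambda>x. u' x + v' x) ^ 4\<bar> \<le> 4 * (2 * K) ^ 3 * (du + dv)"
  proof -
    have a: "pnorm 4 M (\<lambda>x. u x + v x) \<le> 2 * K" "pnorm 4 M (\<lambda>x. u' x + v' x) \<le> 2 * K"
      using pint_add(2)[OF even4 p(1,2)] pint_add(2)[OF even4 p(3,4)] K by linarith+
    have "\<bar>pnorm 4 M (\<lambda>x. u x + v x) - pnorm 4 M (\<lambda>x. u' x + v' x)\<bar> \<le> pnorm 4 M (\<lambda>x. (u x + v x) - (u' x + v' x))"
      by (rule pnorm_triangle_rev[OF even4 pint_add(1)[OF even4 p(1,2)] pint_add(1)[OF even4 p(3,4)]])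
    also have "(\<lambda>x. (u x + v x) - (u' x + v' x)) = (\<lambda>x. (u x - u' x) + (v x - v' x))" by (simp add: fun_eq_iff)
    also have "pnorm 4 M \<dots> \<le> du + dv" unfolding du_def dv_def by (rule pint_add(2)[OF even4 du' dv'])
    finally have "4 * (2 * K) ^ 3 * \<bar>pnorm 4 M (\<lambda>x. u x + v x) - pnorm 4 M (\<lambda>x. u' x + v' x)\<bar> \<le> 4 * (2 * K) ^ 3 * (du + dv)"
      using K0 by (intro mult_left_mono) auto
    with power4_diff_le[OF pnorm_nonneg a(1) pnorm_nonneg a(2)] show ?thesis by (rule order_trans)
  qed
  have 4: "\<bar>pnorm 4 M (\<lambda>x. u x - v x) ^ 4 - pnorm 4 M (\<lambda>x. u' x - v' x) ^ 4\<bar> \<le> 4 * (2 * K) ^ 3 * (du + dv)"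
  proof -
    have a: "pnorm 4 M (\<lambda>x. u x - v x) \<le> 2 * K" "pnorm 4 M (\<lambda>x. u' x - v' x) \<le> 2 * K"
      using pint_diff(2)[OF even4 p(1,2)] pint_diff(2)[OF even4 p(3,4)] K by linarith+
    have "\<bar>pnorm 4 M (\<lambda>x. u x - v x) - pnorm 4 M (\<lambda>x. u' x - v' x)\<bar> \<le> pnorm 4 M (\<lambda>x. (u x - v x) - (u' x - v' x))"
      by (rule pnorm_triangle_rev[OF even4 pint_diff(1)[OF even4 p(1,2)] pint_diff(1)[OF even4 p(3,4)]])
    also have "(\<lambda>x. (u x - v x) - (u' x - v' x)) = (\<lambda>x. (u x - u' x) - (v x - v' x))" by (simp add: fun_eq_iff)
    also have "pnorm 4 M \<dots> \<le> du + dv" unfolding du_def dv_def by (rule pint_diff(2)[OF even4 du' dv'])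
    finally have "4 * (2 * K) ^ 3 * \<bar>pnorm 4 M (\<lambda>x. u x - v x) - pnorm 4 M (\<lambda>x. u' x - v' x)\<bar> \<le> 4 * (2 * K) ^ 3 * (du + dv)"
      using K0 by (intro mult_left_mono) auto
    with power4_diff_le[OF pnorm_nonneg a(1) pnorm_nonneg a(2)] show ?thesis by (rule order_trans)
  qed
  have m: "\<bar>c * s - c * t\<bar> \<le> \<bar>c\<bar> * X" if "\<bar>s - t\<bar> \<le> X" for c s t X :: real
    using mult_left_mono[OF that, of "\<bar>c\<bar>"] by (simp add: abs_mult[symmetric] right_diff_distrib)
  have tri: "\<bar>(a1 + a2 + a3 + a4) - (b1 + b2 + b3 + b4)\<bar> \<le> X1 + X2 + X3 + X4"
    if "\<bar>a1 - b1\<bar> \<le> X1" "\<bar>a2 - b2\<bar> \<le> X2" "\<bar>a3 - b3\<bar> \<le> X3" "\<bar>a4 - b4\<bar> \<le> X4" for a1 a2 a3 a4 b1 b2 b3 b4 X1 X2 X3 X4 :: real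
    using that by linarith
  have "\<bar>quartic M \<mu>1 \<mu>2 \<beta> u v - quartic M \<mu>1 \<mu>2 \<beta> u' v'\<bar> \<le>
     \<bar>\<mu>1 - \<beta> / 3\<bar> * (4 * K ^ 3 * (du + dv)) + \<bar>\<mu>2 - \<beta> / 3\<bar> * (4 * K ^ 3 * (du + dv))
     + \<bar>\<beta> / 6\<bar> * (4 * (2 * K) ^ 3 * (du + dv)) + \<bar>\<beta> / 6\<bar> * (4 * (2 * K) ^ 3 * (du + dv))"
    unfolding quartic_pnorm[OF p(1,2)] quartic_pnorm[OF p(3,4)] by (rule tri[OF m[OF 1] m[OF 2] m[OF 3] m[OF 4]])
  also have "\<dots> = ((\<bar>\<mu>1 - \<beta> / 3\<bar> + \<bar>\<mu>2 - \<beta> / 3\<bar>) * (4 * K ^ 3) + \<bar>\<beta>\<bar> / 3 * (4 * (2 * K) ^ 3)) * (du + dv)"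
    by (simp add: field_simps)
  finally show ?thesis by (simp only: du_def dv_def)
qed

text \<open>Pointwise, with s = sqrt(\<mu>1) u^2 and t = sqrt(\<mu>2) v^2, the lower bound on
  \<beta> makes the mixed term at least -2 s t, and s^2 + t^2 - 2 s t is a square.\<close>

lemma quartic_nonneg:
  assumes \<mu>: "0 < \<mu>1" "0 < \<mu>2" and \<beta>: "- sqrt (\<mu>1 * \<mu>2) < \<beta>"
  shows "0 \<le> quartic M \<mu>1 \<mu>2 \<beta> u v"
  unfolding quartic_def
proof (rule integral_nonneg_AE, rule AE_I2)
  fix x
  define s where "s = sqrt \<mu>1 * (u x)\<^sup>2"
  define t where "t = sqrt \<mu>2 * (v x)\<^sup>2"
  have "2 * s * t \<le> s\<^sup>2 + t\<^sup>2" by (rule sum_squares_bound)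
  moreover have "s\<^sup>2 = \<mu>1 * (u x * u x * u x * u x)" "t\<^sup>2 = \<mu>2 * (v x * v x * v x * v x)"
    using \<mu> by (simp_all add: s_def t_def power_mult_distrib power2_eq_square)
  moreover have "- (2 * s * t) \<le> 2 * \<beta> * (u x * u x * v x * v x)"
  proof -
    have "- (sqrt (\<mu>1 * \<mu>2)) * ((u x)\<^sup>2 * (v x)\<^sup>2) \<le> \<beta> * ((u x)\<^sup>2 * (v x)\<^sup>2)"
      using \<beta> by (intro mult_right_mono) auto
    then show ?thesis by (simp add: s_def t_def real_sqrt_mult power2_eq_square mult_ac)
  qed
  ultimately show "0 \<le> \<mu>1 * (u x * u x * u x * u x) + \<mu>2 * (v x * v x * v x * v x) + 2 * \<beta> * (u x * u x * v x * v x)"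
    by linarith
qed

lemma quartic_le:
  assumes u: "pint 4 M u" and v: "pint 4 M v" and \<mu>: "0 < \<mu>1" "0 < \<mu>2"
  shows "quartic M \<mu>1 \<mu>2 \<beta> u v \<le> (\<mu>1 + \<mu>2 + \<bar>\<beta>\<bar>) * (pnorm 4 M u ^ 4 + pnorm 4 M v ^ 4)"
proof -
  note i = pint4_prod_integrable[OF u u u u] pint4_prod_integrable[OF v v v v] pint4_prod_integrable[OF u u v v]
  have "quartic M \<mu>1 \<mu>2 \<beta> u v \<le> (LINT x|M. (\<mu>1 + \<mu>2 + \<bar>\<beta>\<bar>) * (u x * u x * u x * u x + v x * v x * v x * v x))"
    unfolding quartic_def
  proof (rule integral_mono)
    show "integrable M (\<lambda>x. \<mu>1 * (u x * u x * u x * u x) + \<mu>2 * (v x * v x * v x * v x) + 2 * \<beta> * (u x * u x * v x * v x))"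
      using i by simp
    show "integrable M (\<lambda>x. (\<mu>1 + \<mu>2 + \<bar>\<beta>\<bar>) * (u x * u x * u x * u x + v x * v x * v x * v x))"
      using i by simp
    fix x
    define s where "s = (u x)\<^sup>2"
    define t where "t = (v x)\<^sup>2"
    have e: "u x * u x * u x * u x = s\<^sup>2" "v x * v x * v x * v x = t\<^sup>2" "u x * u x * v x * v x = s * t"
      by (simp_all add: s_def t_def power2_eq_square)
    have st: "0 \<le> s * t" "2 * (s * t) \<le> s\<^sup>2 + t\<^sup>2" using sum_squares_bound[of s t] by (simp_all add: s_def t_def)
    have "2 * \<beta> * (s * t) \<le> \<bar>\<beta>\<bar> * (2 * (s * t))" using mult_right_mono[OF abs_ge_self[of \<beta>] st(1)] by simp
    also have "\<dots> \<le> \<bar>\<beta>\<bar> * (s\<^sup>2 + t\<^sup>2)" by (intro mult_left_mono st) simp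
    finally have "2 * \<beta> * (s * t) \<le> \<bar>\<beta>\<bar> * (s\<^sup>2 + t\<^sup>2)" .
    moreover have "0 \<le> \<mu>1 * t\<^sup>2" "0 \<le> \<mu>2 * s\<^sup>2" using \<mu> by simp_all
    ultimately show "\<mu>1 * (u x * u x * u x * u x) + \<mu>2 * (v x * v x * v x * v x) + 2 * \<beta> * (u x * u x * v x * v x)
      \<le> (\<mu>1 + \<mu>2 + \<bar>\<beta>\<bar>) * (u x * u x * u x * u x + v x * v x * v x * v x)"
      unfolding e by (simp add: distrib_left distrib_right)
  qed
  also have "\<dots> = (\<mu>1 + \<mu>2 + \<bar>\<beta>\<bar>) * (pnorm 4 M u ^ 4 + pnorm 4 M v ^ 4)"
    unfolding pnorm4_power using i by simp
  finally show ?thesis .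
qed

lemma quartic_scale: "quartic M \<mu>1 \<mu>2 \<beta> (\<lambda>x. s * u x) (\<lambda>x. s * v x) = s ^ 4 * quartic M \<mu>1 \<mu>2 \<beta> u v"
proof -
  have "quartic M \<mu>1 \<mu>2 \<beta> (\<lambda>x. s * u x) (\<lambda>x. s * v x) = (LINT x|M. s ^ 4 * (\<mu>1 * (u x * u x * u x * u x) + \<mu>2 * (v x * v x * v x * v x)
     + 2 * \<beta> * (u x * u x * v x * v x)))"
    unfolding quartic_def by (rule Bochner_Integration.integral_cong) (auto simp: power4_eq_xxxx algebra_simps)
  then show ?thesis by (simp add: quartic_def)
qed

lemma dquartic_self: "dquartic M \<mu>1 \<mu>2 \<beta> u v u v = 4 * quartic M \<mu>1 \<mu>2 \<beta> u v"
proof -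
  have "dquartic M \<mu>1 \<mu>2 \<beta> u v u v = (LINT x|M. 4 * (\<mu>1 * (u x * u x * u x * u x) + \<mu>2 * (v x * v x * v x * v x)
     + 2 * \<beta> * (u x * u x * v x * v x)))"
    unfolding dquartic_def by (rule Bochner_Integration.integral_cong) (auto simp: algebra_simps)
  then show ?thesis by (simp only: quartic_def integral_mult_right_zero)
qed

lemma dquartic_integrable:
  fixes u v \<phi> \<psi> :: "'x \<Rightarrow> real"
  assumes "pint 4 M u" "pint 4 M v" "pint 4 M \<phi>" "pint 4 M \<psi>"
  shows "integrable M (\<lambda>x. 4 * (\<mu>1 * (u x * u x * u x * \<phi> x) + \<mu>2 * (v x * v x * v x * \<psi> x)
     + \<beta> * (u x * v x * v x * \<phi> x) + \<beta> * (u x * u x * v x * \<psi> x)))"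
  by (intro integrable_mult_right Bochner_Integration.integrable_add pint4_prod_integrable assms)

lemma dquartic_lin:
  assumes p: "pint 4 M u" "pint 4 M v" and q: "pint 4 M \<phi>" "pint 4 M \<psi>" "pint 4 M \<phi>'" "pint 4 M \<psi>'"
  shows "dquartic M \<mu>1 \<mu>2 \<beta> u v (\<lambda>x. a * \<phi> x + b * \<phi>' x) (\<lambda>x. a * \<psi> x + b * \<psi>' x)
    = a * dquartic M \<mu>1 \<mu>2 \<beta> u v \<phi> \<psi> + b * dquartic M \<mu>1 \<mu>2 \<beta> u v \<phi>' \<psi>'"
proof -
  note i = dquartic_integrable[OF p q(1,2), of \<mu>1 \<mu>2 \<beta>] dquartic_integrable[OF p q(3,4), of \<mu>1 \<mu>2 \<beta>]
  have "dquartic M \<mu>1 \<mu>2 \<beta> u v (\<lambda>x. a * \<phi> x + b * \<phi>' x) (\<lambda>x. a * \<psi> x + b * \<psi>' x) =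
    (LINT x|M. a * (4 * (\<mu>1 * (u x * u x * u x * \<phi> x) + \<mu>2 * (v x * v x * v x * \<psi> x)
     + \<beta> * (u x * v x * v x * \<phi> x) + \<beta> * (u x * u x * v x * \<psi> x)))
     + b * (4 * (\<mu>1 * (u x * u x * u x * \<phi>' x) + \<mu>2 * (v x * v x * v x * \<psi>' x)
     + \<beta> * (u x * v x * v x * \<phi>' x) + \<beta> * (u x * u x * v x * \<psi>' x))))"
    unfolding dquartic_def by (rule Bochner_Integration.integral_cong) (auto simp: algebra_simps)
  also have "\<dots> = a * dquartic M \<mu>1 \<mu>2 \<beta> u v \<phi> \<psi> + b * dquartic M \<mu>1 \<mu>2 \<beta> u v \<phi>' \<psi>'"
    unfolding dquartic_def
    by (subst Bochner_Integration.integral_add[OF integrable_mult_right[OF i(1)] integrable_mult_right[OF i(2)]])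
      (simp only: integral_mult_right_zero)
  finally show ?thesis .
qed

text \<open>The integrand is a polynomial in \<open>s\<close> with integrable coefficients
  \<open>q0\<close> to \<open>q4\<close>; for \<open>\<bar>s\<bar> \<le> 1\<close> the cubic and
  quartic terms join the quadratic error.\<close>

lemma quartic_expansion:
  assumes p: "pint 4 M u" "pint 4 M v" "pint 4 M \<phi>" "pint 4 M \<psi>"
  shows "\<exists>K. \<forall>s. \<bar>s\<bar> \<le> 1 \<longrightarrow> \<bar>quartic M \<mu>1 \<mu>2 \<beta> (\<lambda>x. 1 * u x + s * \<phi> x) (\<lambda>x. 1 * v x + s * \<psi> x)
     - quartic M \<mu>1 \<mu>2 \<beta> u v - s * dquartic M \<mu>1 \<mu>2 \<beta> u v \<phi> \<psi>\<bar> \<le> K * s\<^sup>2"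
proof -
  define q0 where "q0 x = \<mu>1 * (u x * u x * u x * u x) + \<mu>2 * (v x * v x * v x * v x) + 2 * \<beta> * (u x * u x * v x * v x)" for x
  define q1 where "q1 x = 4 * (\<mu>1 * (u x * u x * u x * \<phi> x) + \<mu>2 * (v x * v x * v x * \<psi> x)
     + \<beta> * (u x * v x * v x * \<phi> x) + \<beta> * (u x * u x * v x * \<psi> x))" for x
  define q2 where "q2 x = 6 * \<mu>1 * (u x * u x * \<phi> x * \<phi> x) + 6 * \<mu>2 * (v x * v x * \<psi> x * \<psi> x)
     + 2 * \<beta> * (u x * u x * \<psi> x * \<psi> x) + 8 * \<beta> * (u x * v x * \<phi> x * \<psi> x) + 2 * \<beta> * (v x * v x * \<phi> x * \<phi> x)" for x
  define q3 where "q3 x = 4 * \<mu>1 * (u x * \<phi> x * \<phi> x * \<phi> x) + 4 * \<mu>2 * (v x * \<psi> x * \<psi> x * \<psi> x)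
     + 4 * \<beta> * (u x * \<phi> x * \<psi> x * \<psi> x) + 4 * \<beta> * (v x * \<psi> x * \<phi> x * \<phi> x)" for x
  define q4 where "q4 x = \<mu>1 * (\<phi> x * \<phi> x * \<phi> x * \<phi> x) + \<mu>2 * (\<psi> x * \<psi> x * \<psi> x * \<psi> x) + 2 * \<beta> * (\<phi> x * \<phi> x * \<psi> x * \<psi> x)" for x
  have i: "integrable M q0" "integrable M q1" "integrable M q2" "integrable M q3" "integrable M q4"
    unfolding q0_def q1_def q2_def q3_def q4_def
    by (intro integrable_mult_right Bochner_Integration.integrable_add pint4_prod_integrable p)+
  define K where "K = \<bar>LINT x|M. q2 x\<bar> + \<bar>LINT x|M. q3 x\<bar> + \<bar>LINT x|M. q4 x\<bar>"
  have "\<bar>quartic M \<mu>1 \<mu>2 \<beta> (\<lambda>x. 1 * u x + s * \<phi> x) (\<lambda>x. 1 * v x + s * \<psi> x)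
     - quartic M \<mu>1 \<mu>2 \<beta> u v - s * dquartic M \<mu>1 \<mu>2 \<beta> u v \<phi> \<psi>\<bar> \<le> K * s\<^sup>2" if s: "\<bar>s\<bar> \<le> 1" for s
  proof -
    have "quartic M \<mu>1 \<mu>2 \<beta> (\<lambda>x. 1 * u x + s * \<phi> x) (\<lambda>x. 1 * v x + s * \<psi> x)
      = (LINT x|M. q0 x + s * q1 x + s\<^sup>2 * q2 x + s ^ 3 * q3 x + s ^ 4 * q4 x)"
      unfolding quartic_def q0_def q1_def q2_def q3_def q4_def
      by (rule Bochner_Integration.integral_cong)
        (auto simp: power2_eq_square power3_eq_cube power4_eq_xxxx algebra_simps)
    also have "\<dots> = (LINT x|M. q0 x) + s * (LINT x|M. q1 x) + s\<^sup>2 * (LINT x|M. q2 x) + s ^ 3 * (LINT x|M. q3 x) + s ^ 4 * (LINT x|M. q4 x)"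
      using i by simp
    also have "(LINT x|M. q0 x) = quartic M \<mu>1 \<mu>2 \<beta> u v" by (simp add: quartic_def q0_def)
    also have "(LINT x|M. q1 x) = dquartic M \<mu>1 \<mu>2 \<beta> u v \<phi> \<psi>" by (simp add: dquartic_def q1_def)
    finally have "quartic M \<mu>1 \<mu>2 \<beta> (\<lambda>x. 1 * u x + s * \<phi> x) (\<lambda>x. 1 * v x + s * \<psi> x)
      - quartic M \<mu>1 \<mu>2 \<beta> u v - s * dquartic M \<mu>1 \<mu>2 \<beta> u v \<phi> \<psi>
      = s\<^sup>2 * ((LINT x|M. q2 x) + s * (LINT x|M. q3 x) + s\<^sup>2 * (LINT x|M. q4 x))"
      by (simp add: power2_eq_square power3_eq_cube power4_eq_xxxx algebra_simps)
    also have "\<bar>\<dots>\<bar> \<le> s\<^sup>2 * K"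
      unfolding abs_mult abs_power2
    proof (rule mult_left_mono)
      have "\<bar>s * (LINT x|M. q3 x)\<bar> \<le> \<bar>LINT x|M. q3 x\<bar>" using s by (simp add: abs_mult mult_left_le_one_le)
      moreover have "\<bar>s\<^sup>2 * (LINT x|M. q4 x)\<bar> \<le> \<bar>LINT x|M. q4 x\<bar>"
        using s power_le_one[of "\<bar>s\<bar>" 2] by (simp add: abs_mult mult_left_le_one_le)
      ultimately show "\<bar>(LINT x|M. q2 x) + s * (LINT x|M. q3 x) + s\<^sup>2 * (LINT x|M. q4 x)\<bar> \<le> K"
        unfolding K_def by linarith
    qed simp
    finally show ?thesis by (simp only: mult.commute)
  qed
  then show ?thesis by blast
qed

subsection \<open>The linear term\<close>

text \<open>Young's inequality with the conjugate exponents 4/3 and 4, scaled by numbers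
  \<open>a\<close>, \<open>b\<close> above the two norms that finally decrease to them.\<close>

lemma holder_4_3_4:
  fixes f u :: "'a::euclidean_space \<Rightarrow> real"
  assumes f: "f \<in> Lp (4/3) \<Omega>" and u: "pint 4 (lebesgue_on \<Omega>) u"
  shows "integrable (lebesgue_on \<Omega>) (\<lambda>x. f x * u x)"
    "\<bar>LINT x|lebesgue_on \<Omega>. f x * u x\<bar> \<le> Lp_norm (4/3) \<Omega> f * pnorm 4 (lebesgue_on \<Omega>) u"
proof -
  let ?M = "lebesgue_on \<Omega>"
  have fm: "f \<in> borel_measurable ?M" and fi: "integrable ?M (\<lambda>x. \<bar>f x\<bar> powr (4/3))" using f by (auto simp: Lp_def)
  have ui: "integrable ?M (\<lambda>x. \<bar>u x\<bar> ^ 4)" using pint_integrable[OF u] by simp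
  have pw: "\<bar>f x * u x\<bar> \<le> a * b * (3/4 * (\<bar>f x\<bar> powr (4/3) / a powr (4/3)) + 1/4 * (\<bar>u x\<bar> ^ 4 / b ^ 4))"
    if "0 < a" "0 < b" for a b x
  proof -
    have "(\<bar>f x\<bar> / a) * (\<bar>u x\<bar> / b) \<le> (\<bar>f x\<bar> / a) powr (4/3) / (4/3) + (\<bar>u x\<bar> / b) powr 4 / 4"
      using that by (intro Youngs_inequality) auto
    also have "\<dots> = 3/4 * (\<bar>f x\<bar> powr (4/3) / a powr (4/3)) + 1/4 * (\<bar>u x\<bar> ^ 4 / b ^ 4)"
      using that by (simp add: powr_divide power_divide)
    finally have "a * b * ((\<bar>f x\<bar> / a) * (\<bar>u x\<bar> / b)) \<le> a * b * (3/4 * (\<bar>f x\<bar> powr (4/3) / a powr (4/3)) + 1/4 * (\<bar>u x\<bar> ^ 4 / b ^ 4))"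
      using that by (intro mult_left_mono) auto
    moreover have "a * b * ((\<bar>f x\<bar> / a) * (\<bar>u x\<bar> / b)) = \<bar>f x * u x\<bar>" using that by (simp add: abs_mult)
    ultimately show ?thesis by simp
  qed
  have bi: "integrable ?M (\<lambda>x. a * b * (3/4 * (\<bar>f x\<bar> powr (4/3) / a powr (4/3)) + 1/4 * (\<bar>u x\<bar> ^ 4 / b ^ 4)))" for a b :: real
    using fi ui by (intro integrable_mult_right Bochner_Integration.integrable_add integrable_divide)
  show i: "integrable ?M (\<lambda>x. f x * u x)"
  proof (rule Bochner_Integration.integrable_bound[OF bi[of 1 1]])
    show "(\<lambda>x. f x * u x) \<in> borel_measurable ?M" using fm pint_measurable[OF u] by (rule borel_measurable_times)
    show "AE x in ?M. norm (f x * u x) \<le> norm (1 * 1 * (3/4 * (\<bar>f x\<bar> powr (4/3) / 1 powr (4/3)) + 1/4 * (\<bar>u x\<bar> ^ 4 / 1 ^ 4)) :: real)"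
      using pw[of 1 1] by (intro AE_I2) (auto intro: order_trans[OF _ abs_ge_self])
  qed
  have *: "\<bar>LINT x|?M. f x * u x\<bar> \<le> a * b" if a: "Lp_norm (4/3) \<Omega> f < a" and b: "pnorm 4 ?M u < b" for a b
  proof -
    define If where "If = (LINT x|?M. \<bar>f x\<bar> powr (4/3))"
    have If0: "0 \<le> If" unfolding If_def by (rule integral_nonneg_AE) simp
    have nf: "Lp_norm (4/3) \<Omega> f = If powr (3/4)" by (simp add: Lp_norm_def If_def)
    have ab: "0 < a" "0 < b" using a b pnorm_nonneg[of 4 ?M u] powr_ge_zero[of If "3/4"] unfolding nf by linarith+
    have "(If powr (3/4)) powr (4/3) \<le> a powr (4/3)" using a unfolding nf by (intro powr_mono2) auto
    then have fa: "If / a powr (4/3) \<le> 1" using If0 ab by (simp add: powr_powr divide_le_eq)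
    have ub: "(LINT x|?M. \<bar>u x\<bar> ^ 4) / b ^ 4 \<le> 1"
      using power_mono[OF less_imp_le[OF b] pnorm_nonneg, of 4] pnorm_power[of 4 ?M u] ab by (simp add: divide_le_eq)
    have "\<bar>LINT x|?M. f x * u x\<bar> \<le> (LINT x|?M. \<bar>f x * u x\<bar>)" by (rule integral_abs_bound)
    also have "\<dots> \<le> (LINT x|?M. a * b * (3/4 * (\<bar>f x\<bar> powr (4/3) / a powr (4/3)) + 1/4 * (\<bar>u x\<bar> ^ 4 / b ^ 4)))"
      by (rule integral_mono[OF integrable_abs[OF i] bi pw[OF ab]])
    also have "\<dots> = a * b * (3/4 * (If / a powr (4/3)) + 1/4 * ((LINT x|?M. \<bar>u x\<bar> ^ 4) / b ^ 4))"
      unfolding If_def using fi ui by simp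
    also have "\<dots> \<le> a * b * (3/4 * 1 + 1/4 * 1)"
      using ab fa ub by (intro mult_left_mono add_mono) auto
    finally show ?thesis by simp
  qed
  have "((\<lambda>e. (Lp_norm (4/3) \<Omega> f + e) * (pnorm 4 ?M u + e)) \<longlongrightarrow> (Lp_norm (4/3) \<Omega> f + 0) * (pnorm 4 ?M u + 0)) (at_right 0)"
    by (intro tendsto_intros)
  then show "\<bar>LINT x|?M. f x * u x\<bar> \<le> Lp_norm (4/3) \<Omega> f * pnorm 4 ?M u"
    by (intro tendsto_lowerbound[where F = "at_right 0"])
      (auto intro!: * eventually_mono[OF eventually_at_right_less[of 0]])
qed

subsection \<open>The system as an abstract quartic problem\<close>

context open_set
begin

definition b1 :: "real \<Rightarrow> ('a \<Rightarrow> real) \<Rightarrow> ('a \<Rightarrow> real) \<Rightarrow> real" where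
  "b1 l u v = (LINT x|MM. gr u x \<bullet> gr v x) + l * (LINT x|MM. u x * v x)"

lemma L2_mult_integrable: "pint 2 MM u \<Longrightarrow> pint 2 MM v \<Longrightarrow> integrable MM (\<lambda>x. u x * v x)" for u v :: "'a \<Rightarrow> real"
  using pint2_inner(1)[of MM u v] by simp

lemma b1_sym: "b1 l u v = b1 l v u"
  by (simp add: b1_def inner_commute mult.commute)

lemma b1_self: "b1 l u u = (ng u)\<^sup>2 + l * (nu u)\<^sup>2"
  by (simp only: b1_def pnorm_power[OF even2(2)] power2_norm_eq_inner inner_real_def)

lemma b1_lin:
  assumes u: "u \<in> H10 \<Omega>" and v: "v \<in> H10 \<Omega>" and w: "w \<in> H10 \<Omega>"
  shows "b1 l (\<lambda>x. a * u x + b * v x) w = a * b1 l u w + b * b1 l v w"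
proof -
  note up = H10_pint[OF u] and vp = H10_pint[OF v] and wp = H10_pint[OF w]
  note lp = H10_pint[OF H10_lincomb[OF u v, of a b]]
  have "(LINT x|MM. gr (\<lambda>x. a * u x + b * v x) x \<bullet> gr w x) = (LINT x|MM. a * (gr u x \<bullet> gr w x) + b * (gr v x \<bullet> gr w x))"
  proof (rule integral_cong_AE)
    show "(\<lambda>x. gr (\<lambda>x. a * u x + b * v x) x \<bullet> gr w x) \<in> borel_measurable MM"
      by (rule borel_measurable_integrable[OF pint2_inner(1)[OF lp(2) wp(2)]])
    show "(\<lambda>x. a * (gr u x \<bullet> gr w x) + b * (gr v x \<bullet> gr w x)) \<in> borel_measurable MM"
      using pint2_inner(1)[OF up(2) wp(2)] pint2_inner(1)[OF vp(2) wp(2)]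
      by (intro borel_measurable_integrable Bochner_Integration.integrable_add integrable_mult_right)
    show "AE x in MM. gr (\<lambda>x. a * u x + b * v x) x \<bullet> gr w x = a * (gr u x \<bullet> gr w x) + b * (gr v x \<bullet> gr w x)"
      using H1_lincomb(2)[OF open_dom H10_H1[OF u] H10_H1[OF v], of a b]
      by eventually_elim (simp add: inner_add_left)
  qed
  also have "\<dots> = a * (LINT x|MM. gr u x \<bullet> gr w x) + b * (LINT x|MM. gr v x \<bullet> gr w x)"
    using pint2_inner(1)[OF up(2) wp(2)] pint2_inner(1)[OF vp(2) wp(2)] by simp
  finally have 1: "(LINT x|MM. gr (\<lambda>x. a * u x + b * v x) x \<bullet> gr w x)
    = a * (LINT x|MM. gr u x \<bullet> gr w x) + b * (LINT x|MM. gr v x \<bullet> gr w x)" .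
  have "(LINT x|MM. (a * u x + b * v x) * w x) = (LINT x|MM. a * (u x * w x) + b * (v x * w x))"
    by (rule Bochner_Integration.integral_cong) (auto simp: algebra_simps)
  also have "\<dots> = a * (LINT x|MM. u x * w x) + b * (LINT x|MM. v x * w x)"
    using L2_mult_integrable[OF up(1) wp(1)] L2_mult_integrable[OF vp(1) wp(1)] by simp
  finally show ?thesis unfolding b1_def 1 by (simp add: algebra_simps)
qed

end

text \<open>Solves \<open>1 / (3 * \<rho>\<^sup>2) = (\<mu>1 + \<mu>2 + \<bar>\<beta>\<bar>) * S ^
  4\<close>, the right-hand side being the constant that \<open>quartic_le\<close> and the Sobolev
  inequality produce.\<close>

definition radius_of :: "real \<Rightarrow> real \<Rightarrow> real \<Rightarrow> real \<Rightarrow> real" where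
  "radius_of \<mu>1 \<mu>2 \<beta> S = 1 / sqrt (3 * ((\<mu>1 + \<mu>2 + \<bar>\<beta>\<bar>) * S ^ 4))"

text \<open>Each of the two summands of the linear term is at most the norm of its datum times
  \<open>S\<close> times the norm on pairs. A share of \<rho>/16 for each makes up the \<rho>/8 of
  the abstract problem.\<close>

definition threshold :: "real \<Rightarrow> real \<Rightarrow> real \<Rightarrow> real \<Rightarrow> real" where
  "threshold \<mu>1 \<mu>2 \<beta> S = radius_of \<mu>1 \<mu>2 \<beta> S / (16 * S)"

locale coupled_system = small_dim_domain \<Omega> for \<Omega> :: "'a::euclidean_space set" +
  fixes lam1 lam2 \<mu>1 \<mu>2 \<beta> :: real and f g :: "'a \<Rightarrow> real"
  assumes lam: "0 < lam1" "0 < lam2" and \<mu>: "0 < \<mu>1" "0 < \<mu>2" and \<beta>: "- sqrt (\<mu>1 * \<mu>2) < \<beta>"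
    and f: "f \<in> Lp (4/3) \<Omega>" and g: "g \<in> Lp (4/3) \<Omega>"
    and small: "Lp_norm (4/3) \<Omega> f < threshold \<mu>1 \<mu>2 \<beta> (S4 \<Omega>)" "Lp_norm (4/3) \<Omega> g < threshold \<mu>1 \<mu>2 \<beta> (S4 \<Omega>)"
begin

definition "\<rho> = radius_of \<mu>1 \<mu>2 \<beta> (S4 \<Omega>)"

definition "HH = {w. fst w \<in> H10 \<Omega> \<and> snd w \<in> H10 \<Omega>}"

definition lin :: "real \<Rightarrow> ('a \<Rightarrow> real) \<times> ('a \<Rightarrow> real) \<Rightarrow> real \<Rightarrow> ('a \<Rightarrow> real) \<times> ('a \<Rightarrow> real) \<Rightarrow> ('a \<Rightarrow> real) \<times> ('a \<Rightarrow> real)"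
  where "lin a w b z = (\<lambda>x. a * fst w x + b * fst z x, \<lambda>x. a * snd w x + b * snd z x)"

definition BB :: "('a \<Rightarrow> real) \<times> ('a \<Rightarrow> real) \<Rightarrow> ('a \<Rightarrow> real) \<times> ('a \<Rightarrow> real) \<Rightarrow> real" where
  "BB w z = b1 lam1 (fst w) (fst z) + b1 lam2 (snd w) (snd z)"

definition QQ :: "('a \<Rightarrow> real) \<times> ('a \<Rightarrow> real) \<Rightarrow> real" where
  "QQ w = quartic MM \<mu>1 \<mu>2 \<beta> (fst w) (snd w)"

definition DQ :: "('a \<Rightarrow> real) \<times> ('a \<Rightarrow> real) \<Rightarrow> ('a \<Rightarrow> real) \<times> ('a \<Rightarrow> real) \<Rightarrow> real" where
  "DQ w z = dquartic MM \<mu>1 \<mu>2 \<beta> (fst w) (snd w) (fst z) (snd z)"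

definition FF :: "('a \<Rightarrow> real) \<times> ('a \<Rightarrow> real) \<Rightarrow> real" where
  "FF w = (LINT x|MM. f x * fst w x) + (LINT x|MM. g x * snd w x)"

section \<open>Verification of the assumptions of the abstract problem\<close>

lemma S_pos: "0 < S4 \<Omega>" by (rule S4_facts(1))

lemma rho_gt_0: "0 < \<rho>"
proof -
  have "0 < \<mu>1 + \<mu>2 + \<bar>\<beta>\<bar>" using \<mu> by simp
  then show ?thesis using S_pos by (simp add: \<rho>_def radius_of_def)
qed

lemma rho_sq: "1 / (3 * \<rho>\<^sup>2) = (\<mu>1 + \<mu>2 + \<bar>\<beta>\<bar>) * S4 \<Omega> ^ 4"
proof -
  have p: "0 < (\<mu>1 + \<mu>2 + \<bar>\<beta>\<bar>) * S4 \<Omega> ^ 4" using \<mu> S_pos by simp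
  then have "\<rho>\<^sup>2 = 1 / (3 * ((\<mu>1 + \<mu>2 + \<bar>\<beta>\<bar>) * S4 \<Omega> ^ 4))"
    unfolding \<rho>_def radius_of_def power_divide by (subst real_sqrt_pow2) auto
  then show ?thesis by simp
qed

lemma HH_D: assumes "w \<in> HH" shows "fst w \<in> H10 \<Omega>" "snd w \<in> H10 \<Omega>" "pint 4 MM (fst w)" "pint 4 MM (snd w)"
  using assms H10_interpolation(1) by (auto simp: HH_def)

lemma lin_HH: "w \<in> HH \<Longrightarrow> z \<in> HH \<Longrightarrow> lin a w b z \<in> HH"
  by (auto simp: HH_def lin_def intro: H10_lincomb)

lemma BB_self: "BB w w = (ng (fst w))\<^sup>2 + lam1 * (nu (fst w))\<^sup>2 + (ng (snd w))\<^sup>2 + lam2 * (nu (snd w))\<^sup>2"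
  by (simp add: BB_def b1_self)

lemma BB_nonneg: "0 \<le> BB w w"
  using lam by (simp add: BB_self)

lemma BB_bounds:
  shows "ng (fst w) \<le> sqrt (BB w w)" "ng (snd w) \<le> sqrt (BB w w)"
    "nu (fst w) \<le> sqrt (BB w w / lam1)" "nu (snd w) \<le> sqrt (BB w w / lam2)"
proof -
  have p: "0 \<le> lam1 * (nu (fst w))\<^sup>2" "0 \<le> lam2 * (nu (snd w))\<^sup>2" "0 \<le> (ng (fst w))\<^sup>2" "0 \<le> (ng (snd w))\<^sup>2"
    using lam by simp_all
  show "ng (fst w) \<le> sqrt (BB w w)" "ng (snd w) \<le> sqrt (BB w w)"
    using p by (auto intro!: real_le_rsqrt simp: BB_self)
  have "lam1 * (nu (fst w))\<^sup>2 \<le> BB w w" "lam2 * (nu (snd w))\<^sup>2 \<le> BB w w" using p by (auto simp: BB_self)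
  then show "nu (fst w) \<le> sqrt (BB w w / lam1)" "nu (snd w) \<le> sqrt (BB w w / lam2)"
    using lam by (auto intro!: real_le_rsqrt simp: le_divide_eq mult.commute)
qed

lemma HH_L4:
  assumes "w \<in> HH"
  shows "pnorm 4 MM (fst w) \<le> S4 \<Omega> * sqrt (BB w w)" "pnorm 4 MM (snd w) \<le> S4 \<Omega> * sqrt (BB w w)"
  using S4_facts(2)[OF HH_D(1)[OF assms]] S4_facts(2)[OF HH_D(2)[OF assms]]
    mult_left_mono[OF BB_bounds(1)[of w] less_imp_le[OF S_pos]] mult_left_mono[OF BB_bounds(2)[of w] less_imp_le[OF S_pos]]
  by linarith+

lemma fst_lin_diff: "fst (lin 1 w (-1) z) = (\<lambda>x. fst w x - fst z x)" "snd (lin 1 w (-1) z) = (\<lambda>x. snd w x - snd z x)"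
  by (simp_all add: lin_def)

lemma FF_lin:
  assumes w: "w \<in> HH" and z: "z \<in> HH"
  shows "FF (lin a w b z) = a * FF w + b * FF z"
proof -
  have *: "(LINT x|MM. h x * (a * u x + b * v x)) = a * (LINT x|MM. h x * u x) + b * (LINT x|MM. h x * v x)"
    if h: "h \<in> Lp (4/3) \<Omega>" and u: "pint 4 MM u" and v: "pint 4 MM v" for h u v :: "'a \<Rightarrow> real"
  proof -
    have "(LINT x|MM. h x * (a * u x + b * v x)) = (LINT x|MM. a * (h x * u x) + b * (h x * v x))"
      by (rule Bochner_Integration.integral_cong) (auto simp: algebra_simps)
    then show ?thesis using holder_4_3_4(1)[OF h u] holder_4_3_4(1)[OF h v] by simp
  qed
  show ?thesis
    unfolding FF_def lin_def fst_conv snd_conv *[OF f HH_D(3)[OF w] HH_D(3)[OF z]] *[OF g HH_D(4)[OF w] HH_D(4)[OF z]]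
    by (simp add: algebra_simps)
qed

lemma FF_bound:
  assumes w: "w \<in> HH"
  shows "\<bar>FF w\<bar> \<le> \<rho> / 8 * sqrt (BB w w)"
proof -
  define \<Lambda> where "\<Lambda> = threshold \<mu>1 \<mu>2 \<beta> (S4 \<Omega>)"
  have \<Lambda>: "\<Lambda> * S4 \<Omega> = \<rho> / 16" using S_pos by (simp add: \<Lambda>_def threshold_def \<rho>_def)
  have *: "\<bar>LINT x|MM. h x * u x\<bar> \<le> \<rho> / 16 * sqrt (BB w w)"
    if h: "h \<in> Lp (4/3) \<Omega>" "Lp_norm (4/3) \<Omega> h < \<Lambda>" and u: "pint 4 MM u" "pnorm 4 MM u \<le> S4 \<Omega> * sqrt (BB w w)" for h u :: "'a \<Rightarrow> real"
  proof -
    have "0 \<le> Lp_norm (4/3) \<Omega> h" by (simp add: Lp_norm_def)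
    then have "Lp_norm (4/3) \<Omega> h * pnorm 4 MM u \<le> \<Lambda> * (S4 \<Omega> * sqrt (BB w w))"
      using h(2) u(2) by (intro mult_mono pnorm_nonneg) auto
    also have "\<dots> = \<rho> / 16 * sqrt (BB w w)" by (simp only: mult.assoc[symmetric] \<Lambda>)
    finally show ?thesis using holder_4_3_4(2)[OF h(1) u(1)] by linarith
  qed
  have "\<bar>LINT x|MM. f x * fst w x\<bar> \<le> \<rho> / 16 * sqrt (BB w w)" "\<bar>LINT x|MM. g x * snd w x\<bar> \<le> \<rho> / 16 * sqrt (BB w w)"
    using *[OF f _ HH_D(3)[OF w] HH_L4(1)[OF w]] *[OF g _ HH_D(4)[OF w] HH_L4(2)[OF w]] small by (auto simp: \<Lambda>_def)
  then show ?thesis unfolding FF_def by linarith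
qed

text \<open>With \<open>a\<close>, \<open>b\<close> the squared gradient norms, Sobolev leaves
  \<open>a\<^sup>2 + b\<^sup>2\<close>, which is at most \<open>(a + b)\<^sup>2\<close> and hence at
  most \<open>(BB w w)\<^sup>2\<close>.\<close>

lemma QQ_bound:
  assumes w: "w \<in> HH"
  shows "QQ w \<le> (BB w w)\<^sup>2 / (3 * \<rho>\<^sup>2)"
proof -
  define a where "a = (ng (fst w))\<^sup>2"
  define b where "b = (ng (snd w))\<^sup>2"
  have ab: "0 \<le> a" "0 \<le> b" by (simp_all add: a_def b_def)
  have pw: "pnorm 4 MM u ^ 4 \<le> S4 \<Omega> ^ 4 * ((ng u)\<^sup>2)\<^sup>2" if "u \<in> H10 \<Omega>" for u
    using power_mono[OF S4_facts(2)[OF that] pnorm_nonneg, of 4] by (simp add: power_mult_distrib)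
  have "QQ w \<le> (\<mu>1 + \<mu>2 + \<bar>\<beta>\<bar>) * (pnorm 4 MM (fst w) ^ 4 + pnorm 4 MM (snd w) ^ 4)"
    unfolding QQ_def by (rule quartic_le[OF HH_D(3,4)[OF w] \<mu>])
  also have "\<dots> \<le> (\<mu>1 + \<mu>2 + \<bar>\<beta>\<bar>) * (S4 \<Omega> ^ 4 * a\<^sup>2 + S4 \<Omega> ^ 4 * b\<^sup>2)"
    using \<mu> pw[OF HH_D(1)[OF w]] pw[OF HH_D(2)[OF w]] unfolding a_def b_def by (intro mult_left_mono add_mono) auto
  also have "\<dots> = ((\<mu>1 + \<mu>2 + \<bar>\<beta>\<bar>) * S4 \<Omega> ^ 4) * (a\<^sup>2 + b\<^sup>2)" by (simp add: algebra_simps)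
  also have "\<dots> \<le> ((\<mu>1 + \<mu>2 + \<bar>\<beta>\<bar>) * S4 \<Omega> ^ 4) * (BB w w)\<^sup>2"
  proof (rule mult_left_mono)
    have "a\<^sup>2 + b\<^sup>2 \<le> (a + b)\<^sup>2" using ab by (simp add: power2_sum)
    also have "\<dots> \<le> (BB w w)\<^sup>2" using ab lam by (intro power_mono) (auto simp: BB_self a_def b_def)
    finally show "a\<^sup>2 + b\<^sup>2 \<le> (BB w w)\<^sup>2" .
    show "0 \<le> (\<mu>1 + \<mu>2 + \<bar>\<beta>\<bar>) * S4 \<Omega> ^ 4" using \<mu> by simp
  qed
  finally show ?thesis unfolding rho_sq[symmetric] by simp
qed

lemma QQ_lipschitz:
  assumes w: "w \<in> HH" and z: "z \<in> HH" and K: "S4 \<Omega> * sqrt (BB w w) \<le> K" "S4 \<Omega> * sqrt (BB z z) \<le> K"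
  defines "L \<equiv> (\<bar>\<mu>1 - \<beta> / 3\<bar> + \<bar>\<mu>2 - \<beta> / 3\<bar>) * (4 * K ^ 3) + \<bar>\<beta>\<bar> / 3 * (4 * (2 * K) ^ 3)"
  shows "\<bar>QQ w - QQ z\<bar> \<le> L * (pnorm 4 MM (\<lambda>x. fst w x - fst z x) + pnorm 4 MM (\<lambda>x. snd w x - snd z x))"
  unfolding QQ_def L_def
  by (rule quartic_lipschitz[OF HH_D(3,4)[OF w] HH_D(3,4)[OF z]])
    (use HH_L4[OF w] HH_L4[OF z] K in linarith)+

text \<open>Rellich for one component after the other gives a subsequence that is Cauchy in
  \<open>L\<^sup>4\<close>. A midpoint is half the distance of the ends away from each end, and
  \<open>QQ\<close> is Lipschitz on bounded sets.\<close>

lemma QQ_compact: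
  assumes x: "\<And>n. x n \<in> HH" and M: "\<And>n. BB (x n) (x n) \<le> M"
  shows "\<exists>r::nat\<Rightarrow>nat. strict_mono r \<and> (\<forall>e>0. \<exists>N. \<forall>n\<ge>N. \<forall>m\<ge>N.
     \<bar>QQ (lin (1/2) (x (r n)) (1/2) (x (r m))) - QQ (x (r n))\<bar> < e)"
proof -
  have M0: "0 \<le> M" using M[of 0] BB_nonneg[of "x 0"] by linarith
  define K where "K = sqrt M + sqrt (M / lam1) + sqrt (M / lam2)"
  have s0: "0 \<le> sqrt M" "0 \<le> sqrt (M / lam1)" "0 \<le> sqrt (M / lam2)" using M0 lam by simp_all
  have sM: "sqrt (BB (x n) (x n)) \<le> sqrt M" "sqrt (BB (x n) (x n) / lam1) \<le> sqrt (M / lam1)"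
    "sqrt (BB (x n) (x n) / lam2) \<le> sqrt (M / lam2)" for n
    using M[of n] lam by (auto intro: divide_right_mono)
  have b: "nu (fst (x n)) \<le> K" "ng (fst (x n)) \<le> K" "nu (snd (x n)) \<le> K" "ng (snd (x n)) \<le> K" for n
    using BB_bounds[of "x n"] sM[of n] s0 unfolding K_def by linarith+
  obtain r1 :: "nat \<Rightarrow> nat" where r1: "strict_mono r1"
    "\<forall>e>0. \<exists>N. \<forall>n\<ge>N. \<forall>m\<ge>N. pnorm 4 MM (\<lambda>y. fst (x (r1 n)) y - fst (x (r1 m)) y) < e"
    using H10_rellich[of "\<lambda>n. fst (x n)" K, OF HH_D(1)[OF x] b(1,2)] by (elim exE conjE)
  obtain r2 :: "nat \<Rightarrow> nat" where r2: "strict_mono r2"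
    "\<forall>e>0. \<exists>N. \<forall>n\<ge>N. \<forall>m\<ge>N. pnorm 4 MM (\<lambda>y. snd (x (r1 (r2 n))) y - snd (x (r1 (r2 m))) y) < e"
    using H10_rellich[of "\<lambda>n. snd (x (r1 n))" K, OF HH_D(2)[OF x] b(3,4)] by (elim exE conjE)
  define r where "r n = r1 (r2 n)" for n
  have r: "strict_mono r" using r1(1) r2(1) by (simp add: r_def strict_mono_def)
  define L where "L = (\<bar>\<mu>1 - \<beta> / 3\<bar> + \<bar>\<mu>2 - \<beta> / 3\<bar>) * (4 * (S4 \<Omega> * sqrt M) ^ 3) + \<bar>\<beta>\<bar> / 3 * (4 * (2 * (S4 \<Omega> * sqrt M)) ^ 3)"
  have L0: "0 \<le> L" using M0 S_pos by (simp add: L_def)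
  have SM: "S4 \<Omega> * sqrt (BB w w) \<le> S4 \<Omega> * sqrt M" if "BB w w \<le> M" for w
    using that S_pos by (intro mult_left_mono) auto
  have est: "\<bar>QQ (lin (1/2) (x (r n)) (1/2) (x (r m))) - QQ (x (r n))\<bar> \<le>
      L * (1/2 * pnorm 4 MM (\<lambda>y. fst (x (r m)) y - fst (x (r n)) y) + 1/2 * pnorm 4 MM (\<lambda>y. snd (x (r m)) y - snd (x (r n)) y))" for n m
  proof -
    let ?w = "lin (1/2) (x (r n)) (1/2) (x (r m))"
    have wH: "?w \<in> HH" by (rule lin_HH[OF x x])
    have h: "fst (x k) \<in> H10 \<Omega>" "snd (x k) \<in> H10 \<Omega>" for k using HH_D[OF x] by auto
    \<comment> \<open>Convexity of the squared norm, from its nonnegativity on the difference, keeps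
      midpoints below the bound \<open>M\<close>, so one Lipschitz constant serves all of
      them.\<close>
    have par: "b1 l ((\<lambda>y. 1/2 * u y + 1/2 * v y)) ((\<lambda>y. 1/2 * u y + 1/2 * v y)) \<le> 1/2 * b1 l u u + 1/2 * b1 l v v"
      if u: "u \<in> H10 \<Omega>" and v: "v \<in> H10 \<Omega>" and l: "0 < l" for u v l
    proof -
      let ?s = "\<lambda>y. 1/2 * u y + 1/2 * v y"
      let ?d = "\<lambda>y. 1 * u y + (-1) * v y"
      have sH: "?s \<in> H10 \<Omega>" and dH: "?d \<in> H10 \<Omega>" by (rule H10_lincomb[OF u v])+
      have "b1 l ?s ?s = 1/2 * b1 l ?s u + 1/2 * b1 l ?s v"
        by (subst b1_lin[OF u v sH]) (simp only: b1_sym)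
      also have "b1 l ?s u = 1/2 * b1 l u u + 1/2 * b1 l v u" by (rule b1_lin[OF u v u])
      also have "b1 l ?s v = 1/2 * b1 l u v + 1/2 * b1 l v v" by (rule b1_lin[OF u v v])
      finally have s: "b1 l ?s ?s = 1/4 * b1 l u u + 1/2 * b1 l u v + 1/4 * b1 l v v" using b1_sym[of l v u] by (simp add: field_simps)
      have "b1 l ?d ?d = 1 * b1 l u ?d + (-1) * b1 l v ?d" by (rule b1_lin[OF u v dH])
      also have "b1 l u ?d = 1 * b1 l u u + (-1) * b1 l v u" by (subst b1_sym) (rule b1_lin[OF u v u])
      also have "b1 l v ?d = 1 * b1 l u v + (-1) * b1 l v v" by (subst b1_sym) (rule b1_lin[OF u v v])
      finally have d: "b1 l ?d ?d = b1 l u u - 2 * b1 l u v + b1 l v v" using b1_sym[of l v u] by simp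
      have "0 \<le> b1 l ?d ?d" using l by (simp only: b1_self) simp
      then have "0 \<le> b1 l u u - 2 * b1 l u v + b1 l v v" unfolding d .
      then show ?thesis unfolding s by linarith
    qed
    have "BB ?w ?w \<le> 1/2 * BB (x (r n)) (x (r n)) + 1/2 * BB (x (r m)) (x (r m))"
      unfolding BB_def lin_def fst_conv snd_conv
      by (rule order_trans[OF add_mono[OF par[OF h(1)[of "r n"] h(1)[of "r m"] lam(1)] par[OF h(2)[of "r n"] h(2)[of "r m"] lam(2)]]])
        (simp add: field_simps)
    then have "BB ?w ?w \<le> M" using M[of "r n"] M[of "r m"] by linarith
    from QQ_lipschitz[OF wH x SM[OF this] SM[OF M], of "r n"]
    have "\<bar>QQ ?w - QQ (x (r n))\<bar> \<le> L * (pnorm 4 MM (\<lambda>y. fst ?w y - fst (x (r n)) y) + pnorm 4 MM (\<lambda>y. snd ?w y - snd (x (r n)) y))"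
      unfolding L_def .
    also have "pnorm 4 MM (\<lambda>y. fst ?w y - fst (x (r n)) y) = pnorm 4 MM (\<lambda>y. (1/2) *\<^sub>R (fst (x (r m)) y - fst (x (r n)) y))"
      by (rule arg_cong[where f = "pnorm 4 MM"]) (simp add: lin_def fun_eq_iff field_simps)
    also have "\<dots> = 1/2 * pnorm 4 MM (\<lambda>y. fst (x (r m)) y - fst (x (r n)) y)" by (subst pnorm_scale[OF even4(2)]) simp
    also have "pnorm 4 MM (\<lambda>y. snd ?w y - snd (x (r n)) y) = pnorm 4 MM (\<lambda>y. (1/2) *\<^sub>R (snd (x (r m)) y - snd (x (r n)) y))"
      by (rule arg_cong[where f = "pnorm 4 MM"]) (simp add: lin_def fun_eq_iff field_simps)
    also have "\<dots> = 1/2 * pnorm 4 MM (\<lambda>y. snd (x (r m)) y - snd (x (r n)) y)" by (subst pnorm_scale[OF even4(2)]) simp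
    finally show ?thesis .
  qed
  show ?thesis
  proof (intro exI[of _ r] conjI r allI impI)
    fix e :: real assume e: "0 < e"
    define d where "d = e / (L + 1)"
    have d: "0 < d" using e L0 by (simp add: d_def)
    obtain N1 where N1: "\<forall>n\<ge>N1. \<forall>m\<ge>N1. pnorm 4 MM (\<lambda>y. fst (x (r1 n)) y - fst (x (r1 m)) y) < d" using r1(2) d by blast
    obtain N2 where N2: "\<forall>n\<ge>N2. \<forall>m\<ge>N2. pnorm 4 MM (\<lambda>y. snd (x (r1 (r2 n))) y - snd (x (r1 (r2 m))) y) < d" using r2(2) d by blast
    show "\<exists>N. \<forall>n\<ge>N. \<forall>m\<ge>N. \<bar>QQ (lin (1/2) (x (r n)) (1/2) (x (r m))) - QQ (x (r n))\<bar> < e"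
    proof (intro exI[of _ "max N1 N2"] allI impI)
      fix n m assume "max N1 N2 \<le> n" "max N1 N2 \<le> m"
      \<comment> \<open>The rate for the first component refers to \<open>r1\<close> and is used at
        \<open>r2 n\<close>, which is at least \<open>n\<close>.\<close>
      then have nm: "N1 \<le> r2 n" "N1 \<le> r2 m" "N2 \<le> n" "N2 \<le> m"
        using seq_suble[OF r2(1), of n] seq_suble[OF r2(1), of m] by auto
      have "pnorm 4 MM (\<lambda>y. fst (x (r m)) y - fst (x (r n)) y) < d" "pnorm 4 MM (\<lambda>y. snd (x (r m)) y - snd (x (r n)) y) < d"
        using N1 N2 nm by (simp_all add: r_def)
      then have "1/2 * pnorm 4 MM (\<lambda>y. fst (x (r m)) y - fst (x (r n)) y) + 1/2 * pnorm 4 MM (\<lambda>y. snd (x (r m)) y - snd (x (r n)) y) \<le> d"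
        by linarith
      then have "\<bar>QQ (lin (1/2) (x (r n)) (1/2) (x (r m))) - QQ (x (r n))\<bar> \<le> L * d"
        using order_trans[OF est mult_left_mono[OF _ L0]] by blast
      also have "L * d < (L + 1) * d" using d by (simp add: algebra_simps)
      also have "(L + 1) * d = e" using L0 by (simp add: d_def)
      finally show "\<bar>QQ (lin (1/2) (x (r n)) (1/2) (x (r m))) - QQ (x (r n))\<bar> < e" .
    qed
  qed
qed

text \<open>Convergence in \<open>BB\<close> controls the \<open>L\<^sup>4\<close> distance through
  \<open>S4\<close>; eventually all norms are within 1 of those of the limit, so one Lipschitz
  constant suffices.\<close>

lemma QQ_continuous:
  assumes x: "\<And>n. x n \<in> HH" and w: "w \<in> HH"
    and lim: "(\<lambda>n. BB (lin 1 (x n) (-1) w) (lin 1 (x n) (-1) w)) \<longlonglongrightarrow> 0"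
  shows "(\<lambda>n. QQ (x n)) \<longlonglongrightarrow> QQ w"
proof -
  define \<delta> where "\<delta> n = S4 \<Omega> * sqrt (BB (lin 1 (x n) (-1) w) (lin 1 (x n) (-1) w))" for n
  have \<delta>0: "\<delta> \<longlonglongrightarrow> 0"
    unfolding \<delta>_def using tendsto_mult_left[OF tendsto_real_sqrt[OF lim], of "S4 \<Omega>"] by simp
  have dH: "lin 1 (x n) (-1) w \<in> HH" for n by (rule lin_HH[OF x w])
  have d: "pnorm 4 MM (\<lambda>y. fst (x n) y - fst w y) \<le> \<delta> n" "pnorm 4 MM (\<lambda>y. snd (x n) y - snd w y) \<le> \<delta> n" for n
    using HH_L4[OF dH[of n]] unfolding fst_lin_diff \<delta>_def by auto
  define K where "K = max (pnorm 4 MM (fst w)) (pnorm 4 MM (snd w)) + 1"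
  define L where "L = (\<bar>\<mu>1 - \<beta> / 3\<bar> + \<bar>\<mu>2 - \<beta> / 3\<bar>) * (4 * K ^ 3) + \<bar>\<beta>\<bar> / 3 * (4 * (2 * K) ^ 3)"
  have K0: "0 \<le> K" using pnorm_nonneg[of 4 MM "fst w"] by (simp add: K_def)
  have L0: "0 \<le> L" using K0 by (simp add: L_def)
  have "(\<lambda>n. QQ (x n) - QQ w) \<longlonglongrightarrow> 0"
  proof (rule Lim_null_comparison)
    have "\<forall>\<^sub>F n in sequentially. \<delta> n < 1" by (rule order_tendstoD(2)[OF \<delta>0]) simp
    then show "\<forall>\<^sub>F n in sequentially. norm (QQ (x n) - QQ w) \<le> L * (\<delta> n + \<delta> n)"
    proof eventually_elim
      case (elim n)
      have K1: "pnorm 4 MM (fst (x n)) \<le> K" "pnorm 4 MM (snd (x n)) \<le> K"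
        using pnorm_triangle_rev[OF even4 HH_D(3)[OF x] HH_D(3)[OF w], of n]
          pnorm_triangle_rev[OF even4 HH_D(4)[OF x] HH_D(4)[OF w], of n] d[of n] elim unfolding K_def by linarith+
      have K2: "pnorm 4 MM (fst w) \<le> K" "pnorm 4 MM (snd w) \<le> K" unfolding K_def by linarith+
      have "\<bar>QQ (x n) - QQ w\<bar> \<le> L * (pnorm 4 MM (\<lambda>y. fst (x n) y - fst w y) + pnorm 4 MM (\<lambda>y. snd (x n) y - snd w y))"
        unfolding QQ_def L_def by (rule quartic_lipschitz[OF HH_D(3,4)[OF x] HH_D(3,4)[OF w] K1 K2])
      also have "\<dots> \<le> L * (\<delta> n + \<delta> n)" using d[of n] L0 by (intro mult_left_mono add_mono)
      finally show ?case by simp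
    qed
    show "(\<lambda>n. L * (\<delta> n + \<delta> n)) \<longlonglongrightarrow> 0"
      using tendsto_mult_left[OF tendsto_add[OF \<delta>0 \<delta>0], of L] by simp
  qed
  then show ?thesis by (simp add: LIM_zero_iff)
qed

lemma HH_complete:
  assumes x: "\<And>n. x n \<in> HH"
    and c: "\<forall>e>0. \<exists>N. \<forall>n\<ge>N. \<forall>m\<ge>N. BB (lin 1 (x n) (-1) (x m)) (lin 1 (x n) (-1) (x m)) < e"
  shows "\<exists>w\<in>HH. (\<lambda>n. BB (lin 1 (x n) (-1) w) (lin 1 (x n) (-1) w)) \<longlonglongrightarrow> 0"
proof -
  let ?D = "\<lambda>n m. BB (lin 1 (x n) (-1) (x m)) (lin 1 (x n) (-1) (x m))"
  \<comment> \<open>Each of the four seminorms is at most \<open>sqrt (BB / l)\<close> with its own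
    weight \<open>l\<close>, so one argument makes all of them Cauchy.\<close>
  have c': "\<exists>N. \<forall>n\<ge>N. \<forall>m\<ge>N. p n m < e" if e: "0 < e" and l: "0 < l" and p: "\<And>n m. p n m \<le> sqrt (?D n m / l)" for e l and p :: "nat \<Rightarrow> nat \<Rightarrow> real"
  proof -
    have "0 < l * e\<^sup>2" using e l by simp
    then obtain N where N: "\<forall>n\<ge>N. \<forall>m\<ge>N. ?D n m < l * e\<^sup>2" using c by blast
    show ?thesis
    proof (intro exI[of _ N] allI impI)
      fix n m assume "N \<le> n" "N \<le> m"
      then have "?D n m < l * e\<^sup>2" using N by blast
      then have "?D n m / l < e\<^sup>2" using l by (simp add: divide_less_eq mult.commute)
      then have "sqrt (?D n m / l) < e" using e by (simp add: real_less_lsqrt)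
      then show "p n m < e" using p[of n m] by linarith
    qed
  qed
  have h: "fst (x n) \<in> H10 \<Omega>" "snd (x n) \<in> H10 \<Omega>" for n using HH_D[OF x] by auto
  have b1: "nu (\<lambda>y. fst (x n) y - fst (x m) y) \<le> sqrt (?D n m / lam1)" "nu (\<lambda>y. snd (x n) y - snd (x m) y) \<le> sqrt (?D n m / lam2)" for n m
    using BB_bounds(3,4)[of "lin 1 (x n) (-1) (x m)"] unfolding fst_lin_diff by auto
  have b2: "pnorm 2 MM (\<lambda>y. gr (fst (x n)) y - gr (fst (x m)) y) \<le> sqrt (?D n m / 1)"
    "pnorm 2 MM (\<lambda>y. gr (snd (x n)) y - gr (snd (x m)) y) \<le> sqrt (?D n m / 1)" for n m
    using BB_bounds(1,2)[of "lin 1 (x n) (-1) (x m)"]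
    unfolding fst_lin_diff ng_diff[OF H10_H1[OF h(1)] H10_H1[OF h(1)]] ng_diff[OF H10_H1[OF h(2)] H10_H1[OF h(2)]] by auto
  obtain u where u: "u \<in> H10 \<Omega>" "(\<lambda>n. nu (\<lambda>y. fst (x n) y - u y)) \<longlonglongrightarrow> 0"
    "(\<lambda>n. pnorm 2 MM (\<lambda>y. gr (fst (x n)) y - gr u y)) \<longlonglongrightarrow> 0"
    using H10_complete[of "\<lambda>n. fst (x n)", OF h(1) c'[OF _ lam(1) b1(1)] c'[OF _ zero_less_one b2(1)]] by blast
  obtain v where v: "v \<in> H10 \<Omega>" "(\<lambda>n. nu (\<lambda>y. snd (x n) y - v y)) \<longlonglongrightarrow> 0"
    "(\<lambda>n. pnorm 2 MM (\<lambda>y. gr (snd (x n)) y - gr v y)) \<longlonglongrightarrow> 0"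
    using H10_complete[of "\<lambda>n. snd (x n)", OF h(2) c'[OF _ lam(2) b1(2)] c'[OF _ zero_less_one b2(2)]] by blast
  have "BB (lin 1 (x n) (-1) (u, v)) (lin 1 (x n) (-1) (u, v)) =
     (pnorm 2 MM (\<lambda>y. gr (fst (x n)) y - gr u y))\<^sup>2 + lam1 * (nu (\<lambda>y. fst (x n) y - u y))\<^sup>2
     + (pnorm 2 MM (\<lambda>y. gr (snd (x n)) y - gr v y))\<^sup>2 + lam2 * (nu (\<lambda>y. snd (x n) y - v y))\<^sup>2" for n
    unfolding BB_self fst_lin_diff fst_conv snd_conv ng_diff[OF H10_H1[OF h(1)] H10_H1[OF u(1)]] ng_diff[OF H10_H1[OF h(2)] H10_H1[OF v(1)]] ..
  moreover have "(\<lambda>n. (pnorm 2 MM (\<lambda>y. gr (fst (x n)) y - gr u y))\<^sup>2 + lam1 * (nu (\<lambda>y. fst (x n) y - u y))\<^sup>2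
     + (pnorm 2 MM (\<lambda>y. gr (snd (x n)) y - gr v y))\<^sup>2 + lam2 * (nu (\<lambda>y. snd (x n) y - v y))\<^sup>2) \<longlonglongrightarrow> 0\<^sup>2 + lam1 * 0\<^sup>2 + 0\<^sup>2 + lam2 * 0\<^sup>2"
    by (intro tendsto_intros u v)
  ultimately have "(\<lambda>n. BB (lin 1 (x n) (-1) (u, v)) (lin 1 (x n) (-1) (u, v))) \<longlonglongrightarrow> 0" by simp
  then show ?thesis using u(1) v(1) by (intro bexI[of _ "(u, v)"]) (auto simp: HH_def)
qed

sublocale qp: quartic_problem HH lin BB QQ FF DQ \<rho>
proof
  show "\<exists>w\<in>HH. 0 < QQ w"
  proof -
    obtain u where u: "u \<in> H10 \<Omega>" "0 < pnorm 4 MM u" using H10_nonzero by blast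
    \<comment> \<open>A vanishing second component removes the mixed term, so the sign of \<beta>
      does not matter.\<close>
    let ?w = "(u, \<lambda>x. 0 * u x + 0 * u x)"
    have "?w \<in> HH" using u(1) H10_lincomb[OF u(1) u(1), of 0 0] by (simp add: HH_def)
    moreover have "QQ ?w = \<mu>1 * pnorm 4 MM u ^ 4" by (simp add: QQ_def quartic_def pnorm4_power)
    ultimately show ?thesis using u(2) \<mu> by (intro bexI[of _ ?w]) simp_all
  qed
  show "lin a w b z \<in> HH" if "w \<in> HH" "z \<in> HH" for a w b z by (rule lin_HH[OF that])
  show "lin a w b z = lin b z a w" for a w b z by (simp add: lin_def add.commute)
  show "BB w z = BB z w" for w z by (simp add: BB_def b1_sym)
  show "BB (lin a w b z) y = a * BB w y + b * BB z y" if "w \<in> HH" "z \<in> HH" "y \<in> HH" for a w b z y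
    unfolding BB_def lin_def fst_conv snd_conv
      b1_lin[OF HH_D(1)[OF that(1)] HH_D(1)[OF that(2)] HH_D(1)[OF that(3)]]
      b1_lin[OF HH_D(2)[OF that(1)] HH_D(2)[OF that(2)] HH_D(2)[OF that(3)]] by (simp add: algebra_simps)
  show "0 \<le> BB w w" for w by (rule BB_nonneg)
  show "FF (lin a w b z) = a * FF w + b * FF z" if "w \<in> HH" "z \<in> HH" for a w b z by (rule FF_lin[OF that])
  show "0 < \<rho>" by (rule rho_gt_0)
  show "\<bar>FF w\<bar> \<le> \<rho> / 8 * sqrt (BB w w)" if "w \<in> HH" for w by (rule FF_bound[OF that])
  show "0 \<le> QQ w" for w unfolding QQ_def by (rule quartic_nonneg[OF \<mu> \<beta>])
  show "QQ w \<le> (BB w w)\<^sup>2 / (3 * \<rho>\<^sup>2)" if "w \<in> HH" for w by (rule QQ_bound[OF that])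
  show "QQ (lin s w 0 w) = s ^ 4 * QQ w" for s w by (simp add: QQ_def lin_def quartic_scale)
  show "DQ w w = 4 * QQ w" for w unfolding DQ_def QQ_def by (rule dquartic_self)
  show "DQ w (lin a \<phi> b \<psi>) = a * DQ w \<phi> + b * DQ w \<psi>" if "w \<in> HH" "\<phi> \<in> HH" "\<psi> \<in> HH" for w a \<phi> b \<psi>
    unfolding DQ_def lin_def fst_conv snd_conv
    by (rule dquartic_lin[OF HH_D(3,4)[OF that(1)] HH_D(3,4)[OF that(2)] HH_D(3,4)[OF that(3)]])
  show "\<exists>K. \<forall>s. \<bar>s\<bar> \<le> 1 \<longrightarrow> \<bar>QQ (lin 1 w s \<phi>) - QQ w - s * DQ w \<phi>\<bar> \<le> K * s\<^sup>2" if "w \<in> HH" "\<phi> \<in> HH" for w \<phi>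
    unfolding DQ_def QQ_def lin_def fst_conv snd_conv
    by (rule quartic_expansion[OF HH_D(3,4)[OF that(1)] HH_D(3,4)[OF that(2)]])
qed (rule QQ_compact QQ_continuous HH_complete; assumption)+

end

subsection \<open>Solutions of the system\<close>

context coupled_system
begin

text \<open>Splitting the integral requires every piece to be integrable; the four cubic terms are
  grouped into a quarter of the integrand of \<open>dquartic\<close>.\<close>

lemma weak_form:
  assumes w: "(u, v) \<in> HH" and z: "(\<phi>, \<psi>) \<in> HH"
  shows "(LINT x|MM. gr u x \<bullet> gr \<phi> x + gr v x \<bullet> gr \<psi> x + lam1 * u x * \<phi> x + lam2 * v x * \<psi> x
      - \<mu>1 * u x ^ 3 * \<phi> x - \<mu>2 * v x ^ 3 * \<psi> x - \<beta> * u x * (v x)\<^sup>2 * \<phi> x - \<beta> * (u x)\<^sup>2 * v x * \<psi> x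
      - f x * \<phi> x - g x * \<psi> x) = BB (u, v) (\<phi>, \<psi>) - DQ (u, v) (\<phi>, \<psi>) / 4 - FF (\<phi>, \<psi>)"
proof -
  note hw = HH_D[OF w, unfolded fst_conv snd_conv] and hz = HH_D[OF z, unfolded fst_conv snd_conv]
  define q where "q x = 4 * (\<mu>1 * (u x * u x * u x * \<phi> x) + \<mu>2 * (v x * v x * v x * \<psi> x)
     + \<beta> * (u x * v x * v x * \<phi> x) + \<beta> * (u x * u x * v x * \<psi> x))" for x
  have iq: "integrable MM q" unfolding q_def by (rule dquartic_integrable[OF hw(3,4) hz(3,4)])
  note i = pint2_inner(1)[OF H10_pint(2)[OF hw(1)] H10_pint(2)[OF hz(1)]]
    pint2_inner(1)[OF H10_pint(2)[OF hw(2)] H10_pint(2)[OF hz(2)]]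
    L2_mult_integrable[OF H10_pint(1)[OF hw(1)] H10_pint(1)[OF hz(1)]]
    L2_mult_integrable[OF H10_pint(1)[OF hw(2)] H10_pint(1)[OF hz(2)]]
    holder_4_3_4(1)[OF f hz(3)] holder_4_3_4(1)[OF g hz(4)] iq
  have "(LINT x|MM. gr u x \<bullet> gr \<phi> x + gr v x \<bullet> gr \<psi> x + lam1 * u x * \<phi> x + lam2 * v x * \<psi> x
      - \<mu>1 * u x ^ 3 * \<phi> x - \<mu>2 * v x ^ 3 * \<psi> x - \<beta> * u x * (v x)\<^sup>2 * \<phi> x - \<beta> * (u x)\<^sup>2 * v x * \<psi> x
      - f x * \<phi> x - g x * \<psi> x)
    = (LINT x|MM. gr u x \<bullet> gr \<phi> x + gr v x \<bullet> gr \<psi> x + lam1 * (u x * \<phi> x) + lam2 * (v x * \<psi> x)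
      - (1/4) * q x - f x * \<phi> x - g x * \<psi> x)"
    unfolding q_def by (rule Bochner_Integration.integral_cong) (auto simp: power2_eq_square power3_eq_cube algebra_simps)
  also have "\<dots> = (LINT x|MM. gr u x \<bullet> gr \<phi> x) + (LINT x|MM. gr v x \<bullet> gr \<psi> x) + lam1 * (LINT x|MM. u x * \<phi> x)
      + lam2 * (LINT x|MM. v x * \<psi> x) - (1/4) * (LINT x|MM. q x) - (LINT x|MM. f x * \<phi> x) - (LINT x|MM. g x * \<psi> x)"
    using i by simp
  also have "(LINT x|MM. q x) = DQ (u, v) (\<phi>, \<psi>)" by (simp add: DQ_def dquartic_def q_def)
  finally show ?thesis by (simp add: BB_def b1_def FF_def)
qed

lemma weak_solution_iff:
  "weak_solution \<Omega> lam1 lam2 \<mu>1 \<mu>2 \<beta> f g u v \<longleftrightarrow> qp.critical (u, v)"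
proof -
  have HH_iff: "(u, v) \<in> HH \<longleftrightarrow> u \<in> H10 \<Omega> \<and> v \<in> H10 \<Omega>" for u v by (simp add: HH_def)
  have all: "(\<forall>z\<in>HH. P z) \<longleftrightarrow> (\<forall>\<phi>\<in>H10 \<Omega>. \<forall>\<psi>\<in>H10 \<Omega>. P (\<phi>, \<psi>))" for P
    by (auto simp: HH_def)
  have "(\<forall>\<phi>\<in>H10 \<Omega>. \<forall>\<psi>\<in>H10 \<Omega>.
        (LINT x|MM. gr u x \<bullet> gr \<phi> x + gr v x \<bullet> gr \<psi> x + lam1 * u x * \<phi> x + lam2 * v x * \<psi> x
      - \<mu>1 * u x ^ 3 * \<phi> x - \<mu>2 * v x ^ 3 * \<psi> x - \<beta> * u x * (v x)\<^sup>2 * \<phi> x - \<beta> * (u x)\<^sup>2 * v x * \<psi> x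
      - f x * \<phi> x - g x * \<psi> x) = 0) \<longleftrightarrow> (\<forall>\<phi>\<in>H10 \<Omega>. \<forall>\<psi>\<in>H10 \<Omega>. BB (u, v) (\<phi>, \<psi>) - DQ (u, v) (\<phi>, \<psi>) / 4 - FF (\<phi>, \<psi>) = 0)"
    if w: "(u, v) \<in> HH"
    by (intro ball_cong refl) (subst weak_form[OF w], simp_all add: HH_iff)
  then show ?thesis unfolding weak_solution_def qp.critical_def all conj_assoc[symmetric] HH_iff[symmetric]
    by (rule conj_cong[OF refl])
qed

lemma quartic_split:
  assumes "(u, v) \<in> HH"
  shows "QQ (u, v) = \<mu>1 * Lp_norm 4 \<Omega> u ^ 4 + \<mu>2 * Lp_norm 4 \<Omega> v ^ 4 + 2 * \<beta> * (LINT x|MM. (u x)\<^sup>2 * (v x)\<^sup>2)"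
    "integrable MM (\<lambda>x. (u x)\<^sup>2 * (v x)\<^sup>2)"
proof -
  note p = HH_D(3,4)[OF assms, unfolded fst_conv snd_conv]
  have e: "(\<lambda>x. (u x)\<^sup>2 * (v x)\<^sup>2) = (\<lambda>x. u x * u x * v x * v x)" by (simp add: fun_eq_iff power2_eq_square)
  note i = pint4_prod_integrable[OF p(1) p(1) p(1) p(1)] pint4_prod_integrable[OF p(2) p(2) p(2) p(2)]
    pint4_prod_integrable[OF p(1) p(1) p(2) p(2)]
  show "integrable MM (\<lambda>x. (u x)\<^sup>2 * (v x)\<^sup>2)" unfolding e by (rule i(3))
  show "QQ (u, v) = \<mu>1 * Lp_norm 4 \<Omega> u ^ 4 + \<mu>2 * Lp_norm 4 \<Omega> v ^ 4 + 2 * \<beta> * (LINT x|MM. (u x)\<^sup>2 * (v x)\<^sup>2)"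
    unfolding Lp_norm_4 pnorm4_power e using i by (simp add: QQ_def quartic_def)
qed

lemma energy_eq:
  assumes w: "(u, v) \<in> HH"
  shows "energy \<Omega> lam1 lam2 \<mu>1 \<mu>2 \<beta> f g u v = qp.J (u, v)"
proof -
  note h = HH_D[OF w, unfolded fst_conv snd_conv]
  have *: "(LINT x|MM. (norm (gr u x))\<^sup>2 + l * (u x)\<^sup>2) = (ng u)\<^sup>2 + l * (nu u)\<^sup>2" if "u \<in> H10 \<Omega>" for u l
    using pint_integrable[OF H10_pint(1)[OF that]] pint_integrable[OF H10_pint(2)[OF that]] by (simp add: pnorm_power)
  have "(H_norm \<Omega> lam1 lam2 u v)\<^sup>2 = BB (u, v) (u, v)"
    unfolding H_norm_def *[OF h(1)] *[OF h(2)] using BB_nonneg[of "(u, v)"] by (simp add: BB_self add.assoc)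
  moreover have "(LINT x|MM. f x * u x + g x * v x) = FF (u, v)"
    using holder_4_3_4(1)[OF f h(3)] holder_4_3_4(1)[OF g h(4)] by (simp add: FF_def)
  ultimately show ?thesis unfolding energy_def qp.J_def quartic_split(1)[OF w] by simp
qed

lemma finite_energy_HH:
  assumes w: "(u, v) \<in> HH"
  shows "finite_energy \<Omega> f g u v"
proof -
  note h = HH_D[OF w, unfolded fst_conv snd_conv]
  show ?thesis
    unfolding finite_energy_def Lp2_iff Lp4_iff
    using H10_pint[OF h(1)] H10_pint[OF h(2)] h quartic_split(2)[OF w]
      holder_4_3_4(1)[OF f h(3)] holder_4_3_4(1)[OF g h(4)] by auto
qed

section \<open>Almost everywhere equality, distinctness and nonvanishing components\<close>

lemma BB_cong_AE:
  assumes w: "w \<in> HH" and z: "z \<in> HH" and ae: "AE x in MM. fst w x = fst z x \<and> snd w x = snd z x"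
  shows "BB w w = BB z z"
proof -
  have *: "ng u = ng v \<and> nu u = nu v" if u: "u \<in> H10 \<Omega>" and v: "v \<in> H10 \<Omega>" and ae: "AE x in MM. u x = v x" for u v
    using weak_grad_cong_AE[OF H10_pint(1)[OF u] H10_pint(1)[OF v] ae]
      pint_cong_AE(2)[OF pint_measurable[OF H10_pint(1)[OF u]] pint_measurable[OF H10_pint(1)[OF v]] ae] by simp
  have "AE x in MM. fst w x = fst z x" "AE x in MM. snd w x = snd z x" using ae by (auto elim: eventually_mono)
  then show ?thesis
    using *[OF HH_D(1)[OF w] HH_D(1)[OF z]] *[OF HH_D(2)[OF w] HH_D(2)[OF z]] by (simp add: BB_self)
qed

lemma AE_zero_b1:
  assumes u: "u \<in> H10 \<Omega>" and \<phi>: "\<phi> \<in> H10 \<Omega>" and ae: "AE x in MM. u x = 0"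
  shows "b1 l u \<phi> = 0"
proof -
  let ?z = "\<lambda>x. 0 * u x + 0 * u x"
  have z: "?z \<in> H10 \<Omega>" by (rule H10_lincomb[OF u u])
  have aez: "AE x in MM. u x = ?z x" using ae by eventually_elim simp
  have "gr u = gr ?z" by (rule weak_grad_cong_AE[OF H10_pint(1)[OF u] H10_pint(1)[OF z] aez])
  moreover have "AE x in MM. gr ?z x = 0" using H1_lincomb(2)[OF open_dom H10_H1[OF u] H10_H1[OF u], of 0 0] by eventually_elim simp
  ultimately have "AE x in MM. gr u x = 0" by simp
  then have "AE x in MM. gr u x \<bullet> gr \<phi> x = 0" by eventually_elim simp
  then have 1: "(LINT x|MM. gr u x \<bullet> gr \<phi> x) = 0" by (rule integral_eq_zero_AE)
  have "AE x in MM. u x * \<phi> x = 0" using ae by eventually_elim simp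
  then have 2: "(LINT x|MM. u x * \<phi> x) = 0" by (rule integral_eq_zero_AE)
  show ?thesis by (simp add: b1_def 1 2)
qed

text \<open>Hoelder against the constant 1, which lies in \<open>L\<^sup>4\<close> because the
  domain is bounded.\<close>

lemma Lp43_L1_loc:
  fixes h :: "'a \<Rightarrow> real"
  assumes h: "h \<in> Lp (4/3) \<Omega>"
  shows "h \<in> L1_loc \<Omega>"
  unfolding L1_loc_def mem_Collect_eq
proof (intro allI impI, elim conjE)
  fix K assume K: "compact K" "K \<subseteq> \<Omega>"
  have Km: "K \<in> sets lebesgue" using K(1) by (simp add: lmeasurable_compact fmeasurableD)
  have \<Omega>m: "\<Omega> \<inter> space lebesgue \<in> sets lebesgue" using open_dom by auto
  have "integrable MM (\<lambda>x. h x * 1)" by (rule holder_4_3_4(1)[OF h pint_const[OF bounded_dom]])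
  then have "integrable lebesgue (\<lambda>x. indicator \<Omega> x *\<^sub>R h x)"
    using integrable_restrict_space[OF \<Omega>m, of h] by simp
  from integrable_mult_indicator[OF Km this]
  have "integrable lebesgue (\<lambda>x. indicator K x *\<^sub>R (indicator \<Omega> x *\<^sub>R h x))" .
  moreover have "(\<lambda>x. indicator K x *\<^sub>R (indicator \<Omega> x *\<^sub>R h x)) = (\<lambda>x. indicator K x *\<^sub>R h x)"
    using K(2) by (auto simp: fun_eq_iff indicator_def)
  ultimately show "integrable (lebesgue_on K) h" using Km integrable_restrict_space[of K lebesgue h] by simp
qed

text \<open>A test pair with one zero component isolates one equation. If its unknown vanished
  almost everywhere, so would every term except the datum, which would then annihilate all test
  functions.\<close>

lemma critical_nonzero:
  assumes c: "qp.critical (u, v)" and nz: "nonzero_on \<Omega> f" "nonzero_on \<Omega> g"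
  shows "nonzero_on \<Omega> u" "nonzero_on \<Omega> v"
proof -
  have w: "(u, v) \<in> HH" and eq: "\<And>z. z \<in> HH \<Longrightarrow> BB (u, v) z - DQ (u, v) z / 4 - FF z = 0"
    using c by (auto simp: qp.critical_def)
  note h = HH_D[OF w, unfolded fst_conv snd_conv]
  show "nonzero_on \<Omega> u"
    unfolding nonzero_on_def
  proof
    assume ae: "AE x in MM. u x = 0"
    have "AE x in MM. f x = 0"
    proof (rule L1_loc_AE_zero[OF open_dom Lp43_L1_loc[OF f]])
      fix \<phi> assume \<phi>: "\<phi> \<in> test_functions \<Omega>"
      \<comment> \<open>The zero function in a form whose membership in \<open>H10\<close> is
        immediate.\<close>
      let ?o = "\<lambda>x. 0 * \<phi> x + 0 * \<phi> x"
      have \<phi>H: "\<phi> \<in> H10 \<Omega>" by (rule test_H10[OF \<phi>])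
      have oH: "?o \<in> H10 \<Omega>" by (rule H10_lincomb[OF \<phi>H \<phi>H])
      have z: "(\<phi>, ?o) \<in> HH" using \<phi>H oH by (simp add: HH_def)
      have "b1 lam2 ?o v = 0" by (rule AE_zero_b1[OF oH h(2)]) simp
      then have "BB (u, v) (\<phi>, ?o) = 0" using AE_zero_b1[OF h(1) \<phi>H ae] b1_sym[of lam2 v ?o] by (simp add: BB_def)
      moreover have "DQ (u, v) (\<phi>, ?o) = 0"
        unfolding DQ_def dquartic_def by (rule integral_eq_zero_AE) (use ae in eventually_elim, simp)
      ultimately show "(LINT x|MM. f x * \<phi> x) = 0" using eq[OF z] by (simp add: FF_def)
    qed
    then show False using nz(1) by (simp add: nonzero_on_def)
  qed
  show "nonzero_on \<Omega> v"
    unfolding nonzero_on_def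
  proof
    assume ae: "AE x in MM. v x = 0"
    have "AE x in MM. g x = 0"
    proof (rule L1_loc_AE_zero[OF open_dom Lp43_L1_loc[OF g]])
      fix \<phi> assume \<phi>: "\<phi> \<in> test_functions \<Omega>"
      let ?o = "\<lambda>x. 0 * \<phi> x + 0 * \<phi> x"
      have \<phi>H: "\<phi> \<in> H10 \<Omega>" by (rule test_H10[OF \<phi>])
      have oH: "?o \<in> H10 \<Omega>" by (rule H10_lincomb[OF \<phi>H \<phi>H])
      have z: "(?o, \<phi>) \<in> HH" using \<phi>H oH by (simp add: HH_def)
      have "b1 lam1 ?o u = 0" by (rule AE_zero_b1[OF oH h(1)]) simp
      then have "BB (u, v) (?o, \<phi>) = 0" using AE_zero_b1[OF h(2) \<phi>H ae] b1_sym[of lam1 u ?o] by (simp add: BB_def)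
      moreover have "DQ (u, v) (?o, \<phi>) = 0"
        unfolding DQ_def dquartic_def by (rule integral_eq_zero_AE) (use ae in eventually_elim, simp)
      ultimately show "(LINT x|MM. g x * \<phi> x) = 0" using eq[OF z] by (simp add: FF_def)
    qed
    then show False using nz(2) by (simp add: nonzero_on_def)
  qed
qed

text \<open>Critical points become weak solutions and \<open>J\<close> becomes the energy. Lying on
  different sides of the sphere of radius \<rho> becomes distinctness, because \<open>BB\<close>
  depends only on classes of almost everywhere equal functions.\<close>

lemma two_solutions:
  assumes nz: "nonzero_on \<Omega> f" "nonzero_on \<Omega> g"
    and p: "\<And>w. w \<in> HH \<Longrightarrow> p w \<in> HH \<and> BB (p w) (p w) \<le> BB w w \<and> QQ (p w) = QQ w \<and> FF w \<le> FF (p w)"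
  shows "\<exists>w\<^sub>1\<in>HH. \<exists>w\<^sub>2\<in>HH.
    nontrivial_solution \<Omega> lam1 lam2 \<mu>1 \<mu>2 \<beta> f g (fst (p w\<^sub>1)) (snd (p w\<^sub>1)) \<and>
    nontrivial_solution \<Omega> lam1 lam2 \<mu>1 \<mu>2 \<beta> f g (fst (p w\<^sub>2)) (snd (p w\<^sub>2)) \<and>
    distinct_pairs \<Omega> (fst (p w\<^sub>1)) (snd (p w\<^sub>1)) (fst (p w\<^sub>2)) (snd (p w\<^sub>2)) \<and>
    (\<forall>u v. weak_solution \<Omega> lam1 lam2 \<mu>1 \<mu>2 \<beta> f g u v \<longrightarrow>
       energy \<Omega> lam1 lam2 \<mu>1 \<mu>2 \<beta> f g (fst (p w\<^sub>1)) (snd (p w\<^sub>1)) \<le> energy \<Omega> lam1 lam2 \<mu>1 \<mu>2 \<beta> f g u v)"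
proof -
  have "\<exists>w\<^sub>1\<in>HH. \<exists>w\<^sub>2\<in>HH. qp.critical (p w\<^sub>1) \<and> qp.critical (p w\<^sub>2) \<and>
    BB (p w\<^sub>1) (p w\<^sub>1) < \<rho>\<^sup>2 \<and> \<rho>\<^sup>2 < BB (p w\<^sub>2) (p w\<^sub>2) \<and> (\<forall>w. qp.critical w \<longrightarrow> qp.J (p w\<^sub>1) \<le> qp.J w)"
    by (rule qp.two_critical_points) (rule p)
  then obtain w1 w2 where w: "w1 \<in> HH" "w2 \<in> HH" "qp.critical (p w1)" "qp.critical (p w2)"
    "BB (p w1) (p w1) < \<rho>\<^sup>2" "\<rho>\<^sup>2 < BB (p w2) (p w2)" "\<forall>w. qp.critical w \<longrightarrow> qp.J (p w1) \<le> qp.J w"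
    by (elim bexE conjE)
  have H: "p w1 \<in> HH" "p w2 \<in> HH" using w(3,4) by (auto simp: qp.critical_def)
  have sol: "nontrivial_solution \<Omega> lam1 lam2 \<mu>1 \<mu>2 \<beta> f g (fst z) (snd z)" if "qp.critical z" for z
  proof -
    have "qp.critical (fst z, snd z)" using that by simp
    then show ?thesis unfolding nontrivial_solution_def weak_solution_iff using critical_nonzero[OF _ nz] by blast
  qed
  have dist: "distinct_pairs \<Omega> (fst (p w1)) (snd (p w1)) (fst (p w2)) (snd (p w2))"
    unfolding distinct_pairs_def using BB_cong_AE[OF H] w(5,6) by auto
  have gs: "energy \<Omega> lam1 lam2 \<mu>1 \<mu>2 \<beta> f g (fst (p w1)) (snd (p w1)) \<le> energy \<Omega> lam1 lam2 \<mu>1 \<mu>2 \<beta> f g u v"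
    if "weak_solution \<Omega> lam1 lam2 \<mu>1 \<mu>2 \<beta> f g u v" for u v
  proof -
    have c: "qp.critical (u, v)" using that by (simp add: weak_solution_iff)
    then have "(u, v) \<in> HH" by (simp add: qp.critical_def)
    then show ?thesis using w(7) c energy_eq[of "fst (p w1)" "snd (p w1)"] H(1) energy_eq[of u v] by simp
  qed
  show ?thesis
    using w(1,2) sol[OF w(3)] sol[OF w(4)] dist gs by (intro bexI[of _ w1] bexI[of _ w2] conjI allI impI)
qed

text \<open>\<open>BB\<close> does not grow by \<open>H10_abs\<close>, \<open>QQ\<close> contains
  each component only in even degree, and \<open>FF\<close> does not decrease because the data are
  nonnegative.\<close>

lemma abs_pair:
  assumes pos: "positive_on \<Omega> f" "positive_on \<Omega> g" and w: "w \<in> HH"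
  defines "a \<equiv> (\<lambda>x. \<bar>fst w x\<bar>, \<lambda>x. \<bar>snd w x\<bar>)"
  shows "a \<in> HH \<and> BB a a \<le> BB w w \<and> QQ a = QQ w \<and> FF w \<le> FF a"
proof (intro conjI)
  note h = HH_D[OF w]
  note A = H10_abs[OF bounded_dom h(1)] H10_abs[OF bounded_dom h(2)]
  show aH: "a \<in> HH" using A by (simp add: HH_def a_def)
  have nu: "nu (\<lambda>x. \<bar>u x\<bar>) = nu u" for u :: "'a \<Rightarrow> real" by (simp add: pnorm_def)
  have "(ng (fst a))\<^sup>2 \<le> (ng (fst w))\<^sup>2" "(ng (snd a))\<^sup>2 \<le> (ng (snd w))\<^sup>2"
    unfolding a_def fst_conv snd_conv by (intro power_mono A pnorm_nonneg)+
  then show "BB a a \<le> BB w w" by (simp add: BB_self a_def nu)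
  have e: "\<bar>s\<bar> * \<bar>s\<bar> * \<bar>t\<bar> * \<bar>t\<bar> = s * s * t * t" for s t :: real
    by (simp add: mult.assoc)
  show "QQ a = QQ w" unfolding QQ_def quartic_def a_def fst_conv snd_conv e ..
  have *: "(LINT x|MM. k x * u x) \<le> (LINT x|MM. k x * \<bar>u x\<bar>)"
    if k: "k \<in> Lp (4/3) \<Omega>" "positive_on \<Omega> k" and u: "pint 4 MM u" "pint 4 MM (\<lambda>x. \<bar>u x\<bar>)" for k u :: "'a \<Rightarrow> real"
  proof (rule integral_mono_AE)
    show "integrable MM (\<lambda>x. k x * u x)" "integrable MM (\<lambda>x. k x * \<bar>u x\<bar>)"
      using holder_4_3_4(1)[OF k(1) u(1)] holder_4_3_4(1)[OF k(1) u(2)] by auto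
    have "AE x in MM. 0 \<le> k x" using k(2) by (simp add: positive_on_def)
    then show "AE x in MM. k x * u x \<le> k x * \<bar>u x\<bar>" by eventually_elim (simp add: mult_left_mono)
  qed
  show "FF w \<le> FF a"
    unfolding FF_def using *[OF f pos(1) h(3)] *[OF g pos(2) h(4)] HH_D(3,4)[OF aH] by (auto simp: a_def)
qed

lemma existence:
  assumes nz: "nonzero_on \<Omega> f" "nonzero_on \<Omega> g"
  shows "(\<exists>u\<^sub>1 v\<^sub>1 u\<^sub>2 v\<^sub>2.
           nontrivial_solution \<Omega> lam1 lam2 \<mu>1 \<mu>2 \<beta> f g u\<^sub>1 v\<^sub>1 \<and>
           nontrivial_solution \<Omega> lam1 lam2 \<mu>1 \<mu>2 \<beta> f g u\<^sub>2 v\<^sub>2 \<and>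
           distinct_pairs \<Omega> u\<^sub>1 v\<^sub>1 u\<^sub>2 v\<^sub>2)"
    "positive_on \<Omega> f \<Longrightarrow> positive_on \<Omega> g \<Longrightarrow> (\<exists>u\<^sub>1 v\<^sub>1 u\<^sub>2 v\<^sub>2.
             positive_ground_state \<Omega> lam1 lam2 \<mu>1 \<mu>2 \<beta> f g u\<^sub>1 v\<^sub>1 \<and>
             positive_bound_state \<Omega> lam1 lam2 \<mu>1 \<mu>2 \<beta> f g u\<^sub>2 v\<^sub>2 \<and>
             distinct_pairs \<Omega> u\<^sub>1 v\<^sub>1 u\<^sub>2 v\<^sub>2)"
proof -
  show "\<exists>u\<^sub>1 v\<^sub>1 u\<^sub>2 v\<^sub>2.
           nontrivial_solution \<Omega> lam1 lam2 \<mu>1 \<mu>2 \<beta> f g u\<^sub>1 v\<^sub>1 \<and>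
           nontrivial_solution \<Omega> lam1 lam2 \<mu>1 \<mu>2 \<beta> f g u\<^sub>2 v\<^sub>2 \<and>
           distinct_pairs \<Omega> u\<^sub>1 v\<^sub>1 u\<^sub>2 v\<^sub>2"
  proof -
    have "w \<in> HH \<and> BB w w \<le> BB w w \<and> QQ w = QQ w \<and> FF w \<le> FF w" if "w \<in> HH" for w using that by simp
    from two_solutions[OF nz this] show ?thesis by blast
  qed
  assume pos: "positive_on \<Omega> f" "positive_on \<Omega> g"
  define a where "a w = (\<lambda>x. \<bar>fst w x\<bar>, \<lambda>x. \<bar>snd w x\<bar>)" for w :: "('a \<Rightarrow> real) \<times> ('a \<Rightarrow> real)"
  have ap: "a w \<in> HH \<and> BB (a w) (a w) \<le> BB w w \<and> QQ (a w) = QQ w \<and> FF w \<le> FF (a w)" if "w \<in> HH" for w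
    unfolding a_def by (rule abs_pair[OF pos that])
  \<comment> \<open>Nonnegativity is built into \<open>a\<close>; that the components are nonzero
    comes from the solution being nontrivial.\<close>
  have posI: "positive_on \<Omega> (fst (a w)) \<and> positive_on \<Omega> (snd (a w))"
    if "nontrivial_solution \<Omega> lam1 lam2 \<mu>1 \<mu>2 \<beta> f g (fst (a w)) (snd (a w))" for w
    using that by (auto simp: nontrivial_solution_def positive_on_def a_def)
  have "\<exists>w\<^sub>1\<in>HH. \<exists>w\<^sub>2\<in>HH.
    nontrivial_solution \<Omega> lam1 lam2 \<mu>1 \<mu>2 \<beta> f g (fst (a w\<^sub>1)) (snd (a w\<^sub>1)) \<and>
    nontrivial_solution \<Omega> lam1 lam2 \<mu>1 \<mu>2 \<beta> f g (fst (a w\<^sub>2)) (snd (a w\<^sub>2)) \<and>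
    distinct_pairs \<Omega> (fst (a w\<^sub>1)) (snd (a w\<^sub>1)) (fst (a w\<^sub>2)) (snd (a w\<^sub>2)) \<and>
    (\<forall>u v. weak_solution \<Omega> lam1 lam2 \<mu>1 \<mu>2 \<beta> f g u v \<longrightarrow>
       energy \<Omega> lam1 lam2 \<mu>1 \<mu>2 \<beta> f g (fst (a w\<^sub>1)) (snd (a w\<^sub>1)) \<le> energy \<Omega> lam1 lam2 \<mu>1 \<mu>2 \<beta> f g u v)"
    by (rule two_solutions[OF nz]) (rule ap)
  then obtain w1 w2 where w: "w1 \<in> HH" "w2 \<in> HH"
    "nontrivial_solution \<Omega> lam1 lam2 \<mu>1 \<mu>2 \<beta> f g (fst (a w1)) (snd (a w1))"
    "nontrivial_solution \<Omega> lam1 lam2 \<mu>1 \<mu>2 \<beta> f g (fst (a w2)) (snd (a w2))"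
    "distinct_pairs \<Omega> (fst (a w1)) (snd (a w1)) (fst (a w2)) (snd (a w2))"
    "\<forall>u v. weak_solution \<Omega> lam1 lam2 \<mu>1 \<mu>2 \<beta> f g u v \<longrightarrow>
       energy \<Omega> lam1 lam2 \<mu>1 \<mu>2 \<beta> f g (fst (a w1)) (snd (a w1)) \<le> energy \<Omega> lam1 lam2 \<mu>1 \<mu>2 \<beta> f g u v"
    by (elim bexE conjE)
  have "positive_ground_state \<Omega> lam1 lam2 \<mu>1 \<mu>2 \<beta> f g (fst (a w1)) (snd (a w1))"
    unfolding positive_ground_state_def using w(3,6) posI[OF w(3)] by (simp add: nontrivial_solution_def)
  moreover have "positive_bound_state \<Omega> lam1 lam2 \<mu>1 \<mu>2 \<beta> f g (fst (a w2)) (snd (a w2))"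
    unfolding positive_bound_state_def using w(4) posI[OF w(4)] ap[OF w(2)] finite_energy_HH[of "fst (a w2)" "snd (a w2)"]
    by (simp add: nontrivial_solution_def)
  ultimately show "\<exists>u\<^sub>1 v\<^sub>1 u\<^sub>2 v\<^sub>2.
             positive_ground_state \<Omega> lam1 lam2 \<mu>1 \<mu>2 \<beta> f g u\<^sub>1 v\<^sub>1 \<and>
             positive_bound_state \<Omega> lam1 lam2 \<mu>1 \<mu>2 \<beta> f g u\<^sub>2 v\<^sub>2 \<and>
             distinct_pairs \<Omega> u\<^sub>1 v\<^sub>1 u\<^sub>2 v\<^sub>2"
    using w(5) by blast
qed

end

lemma solvable_below_threshold:
  fixes \<Omega> :: "'a::euclidean_space set"
  assumes dim: "DIM('a) \<le> 3" and \<Omega>: "domain_set \<Omega>" "bounded \<Omega>"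
    and par: "0 < lam1" "0 < lam2" "0 < \<mu>1" "0 < \<mu>2" "- sqrt (\<mu>1 * \<mu>2) < \<beta>"
  shows "0 < threshold \<mu>1 \<mu>2 \<beta> (S4 \<Omega>)"
    "solvable_below (threshold \<mu>1 \<mu>2 \<beta> (S4 \<Omega>)) \<Omega> lam1 lam2 \<mu>1 \<mu>2 \<beta>"
proof -
  interpret small_dim_domain \<Omega>
    by unfold_locales (use dim \<Omega> in \<open>auto simp: domain_set_def\<close>)
  have "0 < 3 * ((\<mu>1 + \<mu>2 + \<bar>\<beta>\<bar>) * S4 \<Omega> ^ 4)" using par S4_facts(1) by simp
  then show "0 < threshold \<mu>1 \<mu>2 \<beta> (S4 \<Omega>)" using S4_facts(1) by (simp add: threshold_def radius_of_def)
  show "solvable_below (threshold \<mu>1 \<mu>2 \<beta> (S4 \<Omega>)) \<Omega> lam1 lam2 \<mu>1 \<mu>2 \<beta>"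
    unfolding solvable_below_def
  proof (intro ballI impI, elim conjE)
    fix f g assume fg: "f \<in> Lp (4/3) \<Omega>" "g \<in> Lp (4/3) \<Omega>" and nz: "nonzero_on \<Omega> f" "nonzero_on \<Omega> g"
      and small: "max (Lp_norm (4/3) \<Omega> f) (Lp_norm (4/3) \<Omega> g) < threshold \<mu>1 \<mu>2 \<beta> (S4 \<Omega>)"
    interpret coupled_system \<Omega> lam1 lam2 \<mu>1 \<mu>2 \<beta> f g
      by unfold_locales (use par fg small in auto)
    show "(\<exists>u\<^sub>1 v\<^sub>1 u\<^sub>2 v\<^sub>2.
           nontrivial_solution \<Omega> lam1 lam2 \<mu>1 \<mu>2 \<beta> f g u\<^sub>1 v\<^sub>1 \<and>
           nontrivial_solution \<Omega> lam1 lam2 \<mu>1 \<mu>2 \<beta> f g u\<^sub>2 v\<^sub>2 \<and>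
           distinct_pairs \<Omega> u\<^sub>1 v\<^sub>1 u\<^sub>2 v\<^sub>2) \<and>
        (positive_on \<Omega> f \<and> positive_on \<Omega> g \<longrightarrow>
          (\<exists>u\<^sub>1 v\<^sub>1 u\<^sub>2 v\<^sub>2.
             positive_ground_state \<Omega> lam1 lam2 \<mu>1 \<mu>2 \<beta> f g u\<^sub>1 v\<^sub>1 \<and>
             positive_bound_state \<Omega> lam1 lam2 \<mu>1 \<mu>2 \<beta> f g u\<^sub>2 v\<^sub>2 \<and>
             distinct_pairs \<Omega> u\<^sub>1 v\<^sub>1 u\<^sub>2 v\<^sub>2))"
      using existence[OF nz] by blast
  qed
qed

theorem mainTheorem2:
  "\<exists>\<Lambda> :: real \<Rightarrow> real \<Rightarrow> real \<Rightarrow> real \<Rightarrow> real \<Rightarrow> real \<Rightarrow> real.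
     \<forall>lam1 lam2 \<mu>1 \<mu>2 \<beta>.
       0 < lam1 \<and> 0 < lam2 \<and> 0 < \<mu>1 \<and> 0 < \<mu>2 \<and> - sqrt (\<mu>1 * \<mu>2) < \<beta> \<longrightarrow>
       (\<forall>\<Omega> :: (real ^ 1) set. domain_set \<Omega> \<and> bounded \<Omega> \<longrightarrow>
          0 < \<Lambda> lam1 lam2 \<mu>1 \<mu>2 \<beta> (S4 \<Omega>) \<and>
          solvable_below (\<Lambda> lam1 lam2 \<mu>1 \<mu>2 \<beta> (S4 \<Omega>)) \<Omega> lam1 lam2 \<mu>1 \<mu>2 \<beta>) \<and>
       (\<forall>\<Omega> :: (real ^ 2) set. domain_set \<Omega> \<and> bounded \<Omega> \<longrightarrow>
          0 < \<Lambda> lam1 lam2 \<mu>1 \<mu>2 \<beta> (S4 \<Omega>) \<and>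
          solvable_below (\<Lambda> lam1 lam2 \<mu>1 \<mu>2 \<beta> (S4 \<Omega>)) \<Omega> lam1 lam2 \<mu>1 \<mu>2 \<beta>) \<and>
       (\<forall>\<Omega> :: (real ^ 3) set. domain_set \<Omega> \<and> bounded \<Omega> \<longrightarrow>
          0 < \<Lambda> lam1 lam2 \<mu>1 \<mu>2 \<beta> (S4 \<Omega>) \<and>
          solvable_below (\<Lambda> lam1 lam2 \<mu>1 \<mu>2 \<beta> (S4 \<Omega>)) \<Omega> lam1 lam2 \<mu>1 \<mu>2 \<beta>)"
\<comment> \<open>One formula serves all three dimensions; the domain enters only through its
  Sobolev constant.\<close>
proof (intro exI[of _ "\<lambda>lam1 lam2 \<mu>1 \<mu>2 \<beta> S. threshold \<mu>1 \<mu>2 \<beta> S"] allI impI conjI; elim conjE)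
qed (rule solvable_below_threshold; simp)+

end
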